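(* Let $M$ be a compact path-connected real-analytic Riemannian manifold without boundary (with real-analytic metric), and let $N\subset M$ be a closed, path-connected, analytic embedded submanifold with cut locus $\operatorname{Cut}N\subset M$. Then $$\operatorname{cat}M\leq \operatorname{cat}_M(N)+\operatorname{cat}_M(\operatorname{Cut}N)+1.$$
   Context: L-S category (normalized): for a subspace $A$ of a topological space $X$, $\operatorname{cat}_X A$ is the minimum integer $k\geq 0$ such that there is a covering $U_0\cup\dots\cup U_k=A$ with each $U_j$ open in $A$ and each inclusion $U_j\hookrightarrow X$ homotopic to a constant map; it is $\infty$ if no such covering exists. One writes $\operatorname{cat}X=\operatorname{cat}_X X$. Cut locus: for $y\in M$, the distance $d(y,N)$ is the infimum of the lengths of all piecewise smooth curves joining $y$ to some point of $N$. A unit speed geodesic $\gamma\colon[0,t_0]\to M$ ($t_0>0$) with $\gamma(0)\in N$ is an $N$-segment if $d(\gamma(t),N)=t$ for all $t\in[0,t_0]$. The endpoint $\gamma(t_0)$ of an $N$-segment is a cut point of $N$ if there is no $N$-segment properly containing $\gamma([0,t_0])$ (that is, extending $\gamma$ beyond $t_0$). The cut locus $\operatorname{Cut}N$ is the set of all cut points of $N$. *)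

theory Defs
  imports "HOL-Analysis.Analysis" "HOL-Library.Extended_Nat"
begin

section \<open>Lusternik--Schnirelmann category\<close>

definition ls_cat :: "'a topology \<Rightarrow> 'a set \<Rightarrow> enat" where
  "ls_cat X A = Inf (enat ` {k. \<exists>U. (\<Union>j\<le>k. U j) = A \<and>
      (\<forall>j\<le>k. openin (subtopology X A) (U j) \<and>
         (\<exists>c\<in>topspace X.
            homotopic_with (\<lambda>_. True) (subtopology X (U j)) X (\<lambda>x. x) (\<lambda>_. c)))})"


section \<open>Real-analytic manifolds\<close>

text \<open>
  Local expansion in a power series of several variables: a multi-index is a function
  \<open>Basis \<Rightarrow> nat\<close>, extended by 0. The set \<open>S\<close> is meant to be open in the model
  space.
\<close>

definition real_analytic_on ::
    "'e set \<Rightarrow> ('e::euclidean_space \<Rightarrow> 'f::real_normed_vector) \<Rightarrow> bool" where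
  "real_analytic_on S f \<longleftrightarrow>
     (\<forall>a\<in>S. \<exists>r>0. \<exists>c :: ('e \<Rightarrow> nat) \<Rightarrow> 'f. \<forall>x \<in> S \<inter> ball a r.
        ((\<lambda>\<alpha>. (\<Prod>b\<in>Basis. ((x - a) \<bullet> b) ^ \<alpha> b) *\<^sub>R c \<alpha>) has_sum f x)
          {\<alpha>. \<forall>b. b \<notin> Basis \<longrightarrow> \<alpha> b = 0})"

definition dir_deriv ::
    "('e::real_normed_vector \<Rightarrow> 'f::real_normed_vector) \<Rightarrow> 'e \<Rightarrow> 'e \<Rightarrow> 'f" where
  "dir_deriv f x u = vector_derivative (\<lambda>t::real. f (x + t *\<^sub>R u)) (at 0)"

type_synonym ('a, 'e) chart = "'a set \<times> ('a \<Rightarrow> 'e)"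

definition is_chart ::
    "'a topology \<Rightarrow> 'e::euclidean_space set \<Rightarrow> ('a, 'e) chart \<Rightarrow> bool" where
  "is_chart X E = (\<lambda>(U, \<phi>). openin X U \<and> openin (top_of_set E) (\<phi> ` U) \<and>
     homeomorphic_map (subtopology X U) (top_of_set (\<phi> ` U)) \<phi>)"

definition transition ::
    "('a, 'e) chart \<Rightarrow> ('a, 'e) chart \<Rightarrow> 'e \<Rightarrow> 'e" where
  "transition = (\<lambda>(U, \<phi>) (V, \<psi>). \<psi> \<circ> inv_into U \<phi>)"

definition analytically_compatible ::
    "('a, 'e::euclidean_space) chart \<Rightarrow> ('a, 'e) chart \<Rightarrow> bool" where
  "analytically_compatible = (\<lambda>(U, \<phi>) (V, \<psi>).
     real_analytic_on (\<phi> ` (U \<inter> V)) (transition (U, \<phi>) (V, \<psi>)) \<and>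
     real_analytic_on (\<psi> ` (U \<inter> V)) (transition (V, \<psi>) (U, \<phi>)))"

text \<open>
  Since \<open>DIM('e) > 0\<close>, the model space \<open>E\<close> is carried explicitly:
  \<open>E = UNIV\<close> gives the manifolds of dimension \<open>DIM('e)\<close>, and \<open>E = {0}\<close>
  those of dimension 0.
\<close>

definition analytic_manifold ::
    "'a topology \<Rightarrow> 'e::euclidean_space set \<Rightarrow> ('a, 'e) chart set \<Rightarrow> bool" where
  "analytic_manifold X E \<A> \<longleftrightarrow>
     (E = UNIV \<or> E = {0}) \<and>
     Hausdorff_space X \<and> second_countable X \<and>
     (\<forall>C\<in>\<A>. is_chart X E C) \<and>
     (\<Union>(U, \<phi>)\<in>\<A>. U) = topspace X \<and>
     (\<forall>C\<in>\<A>. \<forall>D\<in>\<A>. analytically_compatible C D)"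

text \<open>
  Embedded submanifolds are described by slice charts, taken from the maximal analytic atlas
  generated by \<open>\<A>\<close>.
\<close>

definition analytic_submanifold ::
    "'a topology \<Rightarrow> 'e::euclidean_space set \<Rightarrow> ('a, 'e) chart set \<Rightarrow> 'a set \<Rightarrow> bool" where
  "analytic_submanifold X E \<A> N \<longleftrightarrow> N \<subseteq> topspace X \<and>
     (\<exists>k. \<forall>p\<in>N. \<exists>U \<phi> S. p \<in> U \<and> is_chart X E (U, \<phi>) \<and>
        (\<forall>C\<in>\<A>. analytically_compatible (U, \<phi>) C) \<and>
        subspace S \<and> S \<subseteq> E \<and> dim S = k \<and> \<phi> ` (U \<inter> N) = \<phi> ` U \<inter> S)"


section \<open>Riemannian metrics\<close>

text \<open>
  A metric is given by its coordinate representations: \<open>g (U, \<phi>) x u v\<close> is the inner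
  product at \<open>x \<in> \<phi> ` U\<close> of the tangent vectors with coordinates \<open>u, v \<in> E\<close>.
  The last clause says that the representations transform as a covariant 2-tensor.
\<close>

type_synonym ('a, 'e) metric = "('a, 'e) chart \<Rightarrow> 'e \<Rightarrow> 'e \<Rightarrow> 'e \<Rightarrow> real"

definition analytic_riemannian_metric ::
    "'e::euclidean_space set \<Rightarrow> ('a, 'e) chart set \<Rightarrow> ('a, 'e) metric \<Rightarrow> bool" where
  "analytic_riemannian_metric E \<A> g \<longleftrightarrow>
     (\<forall>(U, \<phi>)\<in>\<A>. \<forall>x\<in>\<phi> ` U. bilinear (g (U, \<phi>) x) \<and>
        (\<forall>u\<in>E. \<forall>v\<in>E. g (U, \<phi>) x u v = g (U, \<phi>) x v u) \<and>
        (\<forall>u\<in>E. u \<noteq> 0 \<longrightarrow> g (U, \<phi>) x u u > 0)) \<and>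
     (\<forall>(U, \<phi>)\<in>\<A>. \<forall>u\<in>E. \<forall>v\<in>E. real_analytic_on (\<phi> ` U) (\<lambda>x. g (U, \<phi>) x u v)) \<and>
     (\<forall>(U, \<phi>)\<in>\<A>. \<forall>(V, \<psi>)\<in>\<A>. \<forall>p \<in> U \<inter> V. \<forall>u\<in>E. \<forall>v\<in>E.
        g (U, \<phi>) (\<phi> p) u v =
        g (V, \<psi>) (\<psi> p)
          (dir_deriv (transition (U, \<phi>) (V, \<psi>)) (\<phi> p) u)
          (dir_deriv (transition (U, \<phi>) (V, \<psi>)) (\<phi> p) v))"

text \<open>
  Christoffel symbols of the Levi-Civita connection in a chart, \<open>h = g (U, \<phi>)\<close>,
  in the form \<open>\<Gamma>\<^sub>x(u, v) = \<Sum> \<Gamma>\<^sup>k\<^sub>i\<^sub>j u\<^sup>i v\<^sup>j e\<^sub>k\<close>; the equation is the Koszul formula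
  for coordinate vector fields.
\<close>

definition christoffel ::
    "'e::euclidean_space set \<Rightarrow> ('e \<Rightarrow> 'e \<Rightarrow> 'e \<Rightarrow> real) \<Rightarrow> 'e \<Rightarrow> 'e \<Rightarrow> 'e \<Rightarrow> 'e" where
  "christoffel E h x u v = (THE z. z \<in> E \<and> (\<forall>w\<in>E. 2 * h x z w =
     dir_deriv (\<lambda>y. h y v w) x u + dir_deriv (\<lambda>y. h y u w) x v
     - dir_deriv (\<lambda>y. h y u v) x w))"


section \<open>Curves, length and distance\<close>

text \<open>
  \<open>C\<^sup>\<infinity>\<close>-functions on a subset of the line without isolated points, with one-sided derivatives
  at boundary points: \<open>D k\<close> is the \<open>k\<close>-th derivative.
\<close>

definition smooth_fun_on :: "real set \<Rightarrow> (real \<Rightarrow> 'e::real_normed_vector) \<Rightarrow> bool" where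
  "smooth_fun_on T f \<longleftrightarrow> (\<exists>D. (\<forall>t\<in>T. D 0 t = f t) \<and>
     (\<forall>k::nat. \<forall>t\<in>T. (D k has_vector_derivative D (Suc k) t) (at t within T)))"

definition smooth_curve ::
    "'a topology \<Rightarrow> ('a, 'e::euclidean_space) chart set \<Rightarrow> real \<Rightarrow> real \<Rightarrow> (real \<Rightarrow> 'a) \<Rightarrow> bool" where
  "smooth_curve X \<A> a b \<gamma> \<longleftrightarrow> continuous_map (top_of_set {a..b}) X \<gamma> \<and>
     (\<forall>(U, \<phi>)\<in>\<A>. smooth_fun_on {t \<in> {a..b}. \<gamma> t \<in> U} (\<phi> \<circ> \<gamma>))"

definition piecewise_smooth_curve ::
    "'a topology \<Rightarrow> ('a, 'e::euclidean_space) chart set \<Rightarrow> real \<Rightarrow> real \<Rightarrow> (real \<Rightarrow> 'a) \<Rightarrow> bool" where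
  "piecewise_smooth_curve X \<A> a b \<gamma> \<longleftrightarrow> a \<le> b \<and>
     continuous_map (top_of_set {a..b}) X \<gamma> \<and>
     (\<exists>F. finite F \<and> a \<in> F \<and> b \<in> F \<and> F \<subseteq> {a..b} \<and>
        (\<forall>s\<in>F. \<forall>t\<in>F. s < t \<and> {s<..<t} \<inter> F = {} \<longrightarrow> smooth_curve X \<A> s t \<gamma>))"

definition velocity ::
    "('a, 'e::euclidean_space) chart \<Rightarrow> real set \<Rightarrow> (real \<Rightarrow> 'a) \<Rightarrow> real \<Rightarrow> 'e" where
  "velocity = (\<lambda>(U, \<phi>) I \<gamma> t. vector_derivative (\<phi> \<circ> \<gamma>) (at t within I))"

text \<open>
  Wherever \<open>\<gamma>\<close> is differentiable (as a curve on the interval \<open>I\<close>), the value below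
  does not depend on the chart. For a piecewise smooth curve this leaves out finitely many
  parameters, which do not affect the length.
\<close>

definition speed ::
    "('a, 'e::euclidean_space) chart set \<Rightarrow> ('a, 'e) metric \<Rightarrow> real set \<Rightarrow> (real \<Rightarrow> 'a) \<Rightarrow> real \<Rightarrow> real" where
  "speed \<A> g I \<gamma> t = (THE s. \<forall>(U, \<phi>)\<in>\<A>. \<gamma> t \<in> U \<longrightarrow>
     s = sqrt (g (U, \<phi>) (\<phi> (\<gamma> t)) (velocity (U, \<phi>) I \<gamma> t) (velocity (U, \<phi>) I \<gamma> t)))"

definition curve_length ::
    "('a, 'e::euclidean_space) chart set \<Rightarrow> ('a, 'e) metric \<Rightarrow> real \<Rightarrow> real \<Rightarrow> (real \<Rightarrow> 'a) \<Rightarrow> real" where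
  "curve_length \<A> g a b \<gamma> = integral {a..b} (speed \<A> g {a..b} \<gamma>)"

text \<open>
  The infimum is over a nonempty set when \<open>X\<close> is a path-connected manifold containing
  \<open>y\<close> and \<open>N \<noteq> {}\<close>.
\<close>

definition dist_to ::
    "'a topology \<Rightarrow> ('a, 'e::euclidean_space) chart set \<Rightarrow> ('a, 'e) metric \<Rightarrow> 'a set \<Rightarrow> 'a \<Rightarrow> real" where
  "dist_to X \<A> g N y = Inf {curve_length \<A> g a b \<gamma> | a b \<gamma>.
     piecewise_smooth_curve X \<A> a b \<gamma> \<and> \<gamma> a = y \<and> \<gamma> b \<in> N}"


section \<open>Geodesics and the cut locus\<close>

definition geodesic ::
    "'a topology \<Rightarrow> 'e::euclidean_space set \<Rightarrow> ('a, 'e) chart set \<Rightarrow> ('a, 'e) metric \<Rightarrow>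
      real \<Rightarrow> real \<Rightarrow> (real \<Rightarrow> 'a) \<Rightarrow> bool" where
  "geodesic X E \<A> g a b \<gamma> \<longleftrightarrow> smooth_curve X \<A> a b \<gamma> \<and>
     (\<forall>(U, \<phi>)\<in>\<A>. \<forall>t\<in>{a..b}. \<gamma> t \<in> U \<longrightarrow>
        vector_derivative (velocity (U, \<phi>) {a..b} \<gamma>) (at t within {a..b}) +
        christoffel E (g (U, \<phi>)) (\<phi> (\<gamma> t))
          (velocity (U, \<phi>) {a..b} \<gamma> t) (velocity (U, \<phi>) {a..b} \<gamma> t) = 0)"

definition N_segment ::
    "'a topology \<Rightarrow> 'e::euclidean_space set \<Rightarrow> ('a, 'e) chart set \<Rightarrow> ('a, 'e) metric \<Rightarrow>
      'a set \<Rightarrow> real \<Rightarrow> (real \<Rightarrow> 'a) \<Rightarrow> bool" where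
  "N_segment X E \<A> g N t0 \<gamma> \<longleftrightarrow> t0 > 0 \<and> geodesic X E \<A> g 0 t0 \<gamma> \<and>
     (\<forall>t\<in>{0..t0}. speed \<A> g {0..t0} \<gamma> t = 1) \<and> \<gamma> 0 \<in> N \<and>
     (\<forall>t\<in>{0..t0}. dist_to X \<A> g N (\<gamma> t) = t)"

definition cut_locus ::
    "'a topology \<Rightarrow> 'e::euclidean_space set \<Rightarrow> ('a, 'e) chart set \<Rightarrow> ('a, 'e) metric \<Rightarrow>
      'a set \<Rightarrow> 'a set" where
  "cut_locus X E \<A> g N = {\<gamma> t0 | \<gamma> t0. N_segment X E \<A> g N t0 \<gamma> \<and>
     \<not> (\<exists>t1>t0. \<exists>\<gamma>'. N_segment X E \<A> g N t1 \<gamma>' \<and> (\<forall>t\<in>{0..t0}. \<gamma>' t = \<gamma> t))}"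

end

theory Submission
  imports Defs
begin

text \<open>
  Outside the cut locus every point is joined to \<open>N\<close> by a unique minimal geodesic: if two of them
  ended at \<open>x \<notin> Cut N\<close>, one could be extended beyond \<open>x\<close> as an \<open>N\<close>-segment, the other one
  followed by this extension would again be minimal, hence a geodesic, and geodesics do not branch.
  Moving along these geodesics deforms \<open>M - Cut N\<close> inside \<open>M\<close> into \<open>N\<close>; the deformation is
  continuous since its graph is closed and \<open>M\<close> is compact. So a categorical cover of \<open>N\<close> pulls back
  to one of \<open>M - Cut N\<close>, and together with one of \<open>Cut N\<close> it covers \<open>M\<close>. As \<open>M\<close> is an absolute
  neighbourhood extensor, these arbitrary subsets can be enlarged to open categorical ones.

  Neither the exponential map nor the existence theorem for geodesics is needed. Minimal paths come
  from a compactness argument, and their regularity is shown directly: in a chart a path that is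
  isometric for a metric \<open>d(x, y) = |x - y|\<^sub>x + O(|x - y|\<^sup>2)\<close> has slopes that form a Cauchy
  family, so it is \<open>C\<^sup>1\<close>; the du Bois-Reymond lemma gives the Euler-Lagrange equation, which is
  then bootstrapped to smoothness.
\<close>

section \<open>Real-analytic functions\<close>

text \<open>The cut locus is defined through smooth geodesics, whereas concatenation and compactness
  only yield continuous paths. Everything therefore turns on \<open>N_segment_iff\<close>: an
  N-segment is the same as a path that is isometric for the distance \<open>rd\<close>, starts in
  \<open>N\<close> and satisfies \<open>dN (f t) = t\<close>. After that, no smoothness has to be
  checked where two paths are joined: a 1-Lipschitz path on \<open>{0..T}\<close> from
  \<open>N\<close> to a point at distance \<open>T\<close> is automatically isometric
  (\<open>lip_imp_isopath\<close>), hence smooth. The regularity proof has to cope with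
  \<open>rd\<close> being an infimum over piecewise smooth curves while the competitors in the first
  variation are only C1. So it works with the triangle inequality, the second-order agreement of
  \<open>rd\<close> with the chart norm and a Euclidean lower bound
  (\<open>local_metric_dist\<close>). The complement of the cut locus is not shown to be open, and
  sets pulled back to it may be neither open nor closed in \<open>M\<close>. The extension theorem,
  however, starts from closed sets. This is resolved by removing the points outside \<open>V\<close>
  from the bottom of \<open>M\<close> times the unit interval, which makes the bottom copy of
  \<open>V\<close> closed.\<close>

definition mono_at :: "'e::euclidean_space \<Rightarrow> ('e \<Rightarrow> nat) \<Rightarrow> real" where
  "mono_at y \<alpha> = (\<Prod>b\<in>Basis. (y \<bullet> b) ^ \<alpha> b)"

definition multi_idx :: "('e::euclidean_space \<Rightarrow> nat) set" where
  "multi_idx = {\<alpha>. \<forall>b. b \<notin> Basis \<longrightarrow> \<alpha> b = 0}"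

definition mi_deg :: "('e::euclidean_space \<Rightarrow> nat) \<Rightarrow> nat" where
  "mi_deg \<alpha> = sum \<alpha> Basis"

text \<open>Together with \<open>infinite_multi_idx\<close> this gives a bijection from the natural
  numbers onto the multi-indices. It turns the unordered sums of \<open>real_analytic_on\<close>
  into ordinary series, to which \<open>has_derivative_series\<close> applies.\<close>

lemma countable_multi_idx: "countable (multi_idx :: ('e::euclidean_space \<Rightarrow> nat) set)"
proof -
  let ?P = "PiE (Basis::'e set) (\<lambda>_. UNIV :: nat set)"
  have "countable ?P" by (rule countable_PiE) auto
  moreover have "multi_idx \<subseteq> (\<lambda>f b. if b \<in> Basis then f b else 0) ` ?P"
  proof
    fix \<alpha> :: "'e \<Rightarrow> nat" assume "\<alpha> \<in> multi_idx"
    then have "\<alpha> = (\<lambda>b. if b \<in> Basis then restrict \<alpha> Basis b else 0)"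
      by (auto simp: multi_idx_def)
    moreover have "restrict \<alpha> Basis \<in> ?P" by auto
    ultimately show "\<alpha> \<in> (\<lambda>f b. if b \<in> Basis then f b else 0) ` ?P" by blast
  qed
  ultimately show ?thesis by (meson countable_image countable_subset)
qed

lemma infinite_multi_idx: "infinite (multi_idx :: ('e::euclidean_space \<Rightarrow> nat) set)"
proof -
  obtain b :: 'e where b: "b \<in> Basis" using nonempty_Basis by blast
  have "inj (\<lambda>n c. if c = b then n else (0::nat))"
    by (rule injI) (metis)
  then have "infinite (range (\<lambda>n c. if c = b then n else (0::nat)))"
    using finite_imageD infinite_UNIV_nat by blast
  moreover have "range (\<lambda>n c. if c = b then n else (0::nat)) \<subseteq> multi_idx"
    using b by (auto simp: multi_idx_def)
  ultimately show ?thesis using finite_subset by blast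
qed

lemma mono_at_upd:
  assumes "b \<in> Basis"
  shows "mono_at y (\<alpha>(b := n)) = (y \<bullet> b) ^ n * (\<Prod>c\<in>Basis - {b}. (y \<bullet> c) ^ \<alpha> c)"
  unfolding mono_at_def by (subst prod.remove[OF _ assms]) (auto intro!: prod.cong)

text \<open>For \<open>\<alpha> b = 0\<close> the truncated exponent \<open>\<alpha> b - 1\<close>
  is again 0; the term is harmless because of the factor \<open>real (\<alpha> b)\<close>.\<close>

lemma mono_at_has_derivative:
  "((\<lambda>y. mono_at y \<alpha>) has_derivative
     (\<lambda>h. \<Sum>b\<in>Basis. (h \<bullet> b) * (real (\<alpha> b) * mono_at y (\<alpha>(b := \<alpha> b - 1))))) (at y within S)"
  unfolding mono_at_def[of _ \<alpha>]
  by (rule has_derivative_eq_rhs, rule has_derivative_prod, rule derivative_eq_intros,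
      rule derivative_eq_intros, rule derivative_eq_intros, rule refl, rule refl)
     (auto simp: mono_at_upd fun_eq_iff ac_simps intro!: sum.cong)

lemma mi_deg_upd:
  fixes \<alpha> :: "'e::euclidean_space \<Rightarrow> nat"
  assumes "b \<in> Basis" shows "mi_deg (\<alpha>(b := n)) + \<alpha> b = mi_deg \<alpha> + n"
  unfolding mi_deg_def by (simp add: sum.remove[OF _ assms] cong: sum.cong_simp)

lemma abs_mono_at_le:
  assumes "\<And>b. b \<in> Basis \<Longrightarrow> \<bar>y \<bullet> b\<bar> \<le> s"
  shows "\<bar>mono_at y \<alpha>\<bar> \<le> s ^ mi_deg \<alpha>"
proof -
  have "\<bar>mono_at y \<alpha>\<bar> = (\<Prod>b\<in>Basis. \<bar>y \<bullet> b\<bar> ^ \<alpha> b)"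
    by (simp add: mono_at_def abs_prod power_abs)
  also have "\<dots> \<le> (\<Prod>b\<in>Basis. s ^ \<alpha> b)"
    using assms by (intro prod_mono) (auto intro: power_mono)
  also have "\<dots> = s ^ mi_deg \<alpha>" by (simp add: mi_deg_def power_sum)
  finally show ?thesis .
qed

text \<open>Differentiation costs a factor \<open>n\<close>, which the passage from radius
  \<open>r\<close> to \<open>s < r\<close> absorbs: with \<open>r / s = 1 + x\<close>, Bernoulli's
  inequality bounds \<open>n * x\<close> by \<open>(1 + x) ^ n\<close>.\<close>

lemma derivative_coeff_bound:
  fixes s r :: real assumes "0 < s" "s < r"
  obtains K where "K > 0" "\<And>n::nat. real n * s ^ (n - 1) \<le> K * r ^ n"
proof
  define x where "x = r / s - 1"
  have x: "x > 0" "r = s * (1 + x)" using assms by (auto simp: x_def field_simps)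
  show "1 / (x * s) > 0" using x assms by simp
  fix n :: nat
  show "real n * s ^ (n - 1) \<le> 1 / (x * s) * r ^ n"
  proof (cases n)
    case (Suc m)
    have "real n * x \<le> (1 + x) ^ n" using Bernoulli_inequality[of x n] x by simp
    then have "real n * x * s ^ n \<le> r ^ n"
      using assms x by (simp add: power_mult_distrib mult.commute mult_left_mono)
    moreover have "real n * s ^ (n - 1) = 1 / (x * s) * (real n * x * s ^ n)"
      using x assms Suc by simp
    ultimately show ?thesis
      using x(1) assms mult_left_mono[of "real n * x * s ^ n" "r ^ n" "1 / (x * s)"] by simp
  qed (use x assms in simp)
qed

text \<open>The coefficients of the formal partial derivative of the power series in the direction
  \<open>b\<close>.\<close>

definition pd_coeff :: "'e \<Rightarrow> (('e::euclidean_space \<Rightarrow> nat) \<Rightarrow> real) \<Rightarrow> ('e \<Rightarrow> nat) \<Rightarrow> real" where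
  "pd_coeff b c \<alpha> = real (\<alpha> b + 1) * c (\<alpha>(b := \<alpha> b + 1))"

text \<open>Termwise differentiation leaves the terms indexed by the old exponents. Raising the
  exponent of \<open>b\<close> is injective, and the multi-indices that it misses have
  \<open>\<alpha> b = 0\<close>, so their terms vanish; reindexing along it restores the standard
  form. The weight \<open>w\<close> will be a monomial.\<close>

lemma has_sum_shift:
  fixes c :: "('e::euclidean_space \<Rightarrow> nat) \<Rightarrow> real"
  assumes b: "b \<in> Basis"
    and l: "((\<lambda>\<alpha>. real (\<alpha> b) * w (\<alpha>(b := \<alpha> b - 1)) * c \<alpha>) has_sum l) multi_idx"
  shows "((\<lambda>\<alpha>. w \<alpha> * pd_coeff b c \<alpha>) has_sum l) multi_idx"
proof -
  let ?S = "\<lambda>\<alpha>::'e \<Rightarrow> nat. \<alpha>(b := \<alpha> b + 1)"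
  have "((\<lambda>\<alpha>. real (\<alpha> b) * w (\<alpha>(b := \<alpha> b - 1)) * c \<alpha>) has_sum l) (?S ` multi_idx)"
  proof (rule has_sum_cong_neutral[THEN iffD1, OF _ _ _ l])
    fix \<alpha> assume "\<alpha> \<in> multi_idx - ?S ` multi_idx"
    have "\<alpha> b = 0"
    proof (rule ccontr)
      assume "\<alpha> b \<noteq> 0"
      then have "\<alpha> = ?S (\<alpha>(b := \<alpha> b - 1))" by auto
      moreover have "\<alpha>(b := \<alpha> b - 1) \<in> multi_idx"
        using \<open>\<alpha> \<in> _\<close> b by (auto simp: multi_idx_def)
      ultimately show False using \<open>\<alpha> \<in> _\<close> by blast
    qed
    then show "real (\<alpha> b) * w (\<alpha>(b := \<alpha> b - 1)) * c \<alpha> = 0" by simp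
  next
    have "?S ` multi_idx \<subseteq> multi_idx" using b by (auto simp: multi_idx_def)
    then show "\<And>x. x \<in> ?S ` multi_idx - multi_idx \<Longrightarrow> real (x b) * w (x(b := x b - 1)) * c x = 0" by blast
  qed simp
  moreover have "inj_on ?S multi_idx"
  proof (rule inj_onI)
    fix x y :: "'e \<Rightarrow> nat" assume *: "?S x = ?S y"
    show "x = y"
    proof
      fix c show "x c = y c" using fun_cong[OF *, of c] by (auto split: if_splits)
    qed
  qed
  ultimately have "(((\<lambda>\<alpha>. real (\<alpha> b) * w (\<alpha>(b := \<alpha> b - 1)) * c \<alpha>) \<circ> ?S) has_sum l) multi_idx"
    by (simp add: has_sum_reindex)
  then show ?thesis
    by (simp add: o_def pd_coeff_def algebra_simps)
qed

text \<open>Absolute convergence at the corner \<open>(r, ..., r)\<close> dominates the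
  differentiated series on the smaller open box of half side \<open>s\<close>. A box fits the
  estimate of a monomial by a power of its degree. The second conclusion says that the partial
  derivatives are power series again, which keeps the class of analytic functions closed under
  differentiation.\<close>

lemma power_series_has_derivative:
  fixes c :: "('e::euclidean_space \<Rightarrow> nat) \<Rightarrow> real"
  assumes sm: "(\<lambda>\<alpha>. r ^ mi_deg \<alpha> * \<bar>c \<alpha>\<bar>) summable_on multi_idx"
    and s: "0 < s" "s < r"
    and f: "\<And>y. (\<forall>b\<in>Basis. \<bar>y \<bullet> b\<bar> < s) \<Longrightarrow> ((\<lambda>\<alpha>. mono_at y \<alpha> * c \<alpha>) has_sum f y) multi_idx"
  shows "\<exists>G. \<forall>y. (\<forall>b\<in>Basis. \<bar>y \<bullet> b\<bar> < s) \<longrightarrow>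
    (f has_derivative (\<lambda>h. \<Sum>b\<in>Basis. (h \<bullet> b) * G b y)) (at y) \<and>
    (\<forall>b\<in>Basis. ((\<lambda>\<alpha>. mono_at y \<alpha> * pd_coeff b c \<alpha>) has_sum G b y) multi_idx)"
proof -
  obtain K where K: "K > 0" "\<And>n::nat. real n * s ^ (n - 1) \<le> K * r ^ n"
    using derivative_coeff_bound[OF s] by metis
  define S where "S = {y::'e. \<forall>b\<in>Basis. \<bar>y \<bullet> b\<bar> < s}"
  have S_box: "S = box (- (s *\<^sub>R One)) (s *\<^sub>R One)"
    by (auto simp: S_def box_def abs_less_iff algebra_simps)
  have S: "open S" "convex S" "0 \<in> S" unfolding S_box
    by (simp_all add: open_box convex_box) (use s in \<open>simp add: box_def\<close>)
  define e where "e = (from_nat_into multi_idx :: nat \<Rightarrow> 'e \<Rightarrow> nat)"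
  have e: "bij_betw e UNIV multi_idx"
    unfolding e_def by (rule bij_betw_from_nat_into[OF countable_multi_idx infinite_multi_idx])
  define t where "t = (\<lambda>b \<alpha> y. real (\<alpha> b) * mono_at y (\<alpha>(b := \<alpha> b - 1)) * c \<alpha>)"
  \<comment> \<open>The Weierstrass majorant: with \<open>n\<close> the degree,
    \<open>n * s ^ (n - 1)\<close> is traded for \<open>K * r ^ n\<close>.\<close>
  define M where "M = (\<lambda>\<alpha>. K * (r ^ mi_deg \<alpha> * \<bar>c \<alpha>\<bar>))"
  have M_sum: "M summable_on multi_idx"
    unfolding M_def by (rule summable_on_cmult_right[OF sm])
  have tM: "\<bar>t b \<alpha> y\<bar> \<le> M \<alpha>" if "y \<in> S" "b \<in> Basis" for b \<alpha> y
  proof (cases "\<alpha> b = 0")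
    case True then show ?thesis using K s by (simp add: t_def M_def)
  next
    case False
    have d: "mi_deg (\<alpha>(b := \<alpha> b - 1)) = mi_deg \<alpha> - 1" "\<alpha> b \<le> mi_deg \<alpha>"
      using mi_deg_upd[OF that(2), of \<alpha> "\<alpha> b - 1"] mi_deg_upd[OF that(2), of \<alpha> 0] False by auto
    have "\<bar>t b \<alpha> y\<bar> = real (\<alpha> b) * \<bar>mono_at y (\<alpha>(b := \<alpha> b - 1))\<bar> * \<bar>c \<alpha>\<bar>"
      by (simp add: t_def abs_mult)
    also have "\<dots> \<le> real (mi_deg \<alpha>) * s ^ (mi_deg \<alpha> - 1) * \<bar>c \<alpha>\<bar>"
      using abs_mono_at_le[of y s "\<alpha>(b := \<alpha> b - 1)"] that d s
      by (intro mult_right_mono mult_mono) (auto simp: S_def less_imp_le)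
    also have "\<dots> \<le> K * r ^ mi_deg \<alpha> * \<bar>c \<alpha>\<bar>"
      using K by (intro mult_right_mono) auto
    finally show ?thesis by (simp add: M_def mult.assoc)
  qed
  have Me: "summable (\<lambda>i. M (e i))"
    using M_sum summable_on_reindex_bij_betw[OF e, of M] by (simp add: summable_on_UNIV_nonneg_real_iff[symmetric] summable_on_imp_summable)
  define G where "G = (\<lambda>b y. \<Sum>\<^sub>\<infinity>\<alpha>\<in>multi_idx. t b \<alpha> y)"
  have tsum: "((\<lambda>\<alpha>. t b \<alpha> y) has_sum G b y) multi_idx" if "y \<in> S" "b \<in> Basis" for b y
  proof -
    have "(\<lambda>\<alpha>. t b \<alpha> y) summable_on multi_idx"
      by (rule abs_summable_summable, rule summable_on_comparison_test[OF M_sum])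
         (use tM[OF that] in auto)
    then show ?thesis unfolding G_def by (rule has_sum_infsum)
  qed
  have tG: "(\<lambda>i. t b (e i) y) sums G b y" if "y \<in> S" "b \<in> Basis" for b y
    using tsum[OF that] has_sum_reindex_bij_betw[OF e, of "\<lambda>\<alpha>. t b \<alpha> y" "G b y"]
    by (auto intro: has_sum_imp_sums)
  have ul: "uniform_limit S (\<lambda>n y. \<Sum>i<n. t b (e i) y) (G b) sequentially" if "b \<in> Basis" for b
  proof -
    have "uniform_limit S (\<lambda>n y. \<Sum>i<n. t b (e i) y) (\<lambda>y. suminf (\<lambda>i. t b (e i) y)) sequentially"
      by (rule Weierstrass_m_test[OF _ Me]) (use tM that in auto)
    then show ?thesis
      by (rule uniform_limit_cong'[THEN iffD1, rotated 2]) (use tG that in \<open>auto simp: sums_iff\<close>)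
  qed
  have "\<exists>g. \<forall>y\<in>S. (\<lambda>n. mono_at y (e n) * c (e n)) sums g y \<and>
          (g has_derivative (\<lambda>h. \<Sum>b\<in>Basis. (h \<bullet> b) * G b y)) (at y within S)"
  proof (rule has_derivative_series[OF S(2) _ _ S(3), where f'="\<lambda>n y h. \<Sum>b\<in>Basis. (h \<bullet> b) * t b (e n) y"])
    fix n y assume "y \<in> S"
    show "((\<lambda>y. mono_at y (e n) * c (e n)) has_derivative (\<lambda>h. \<Sum>b\<in>Basis. (h \<bullet> b) * t b (e n) y)) (at y within S)"
      by (rule has_derivative_eq_rhs, rule has_derivative_mult_left, rule mono_at_has_derivative)
         (simp add: t_def sum_distrib_right sum_distrib_left mult_ac)
  next
    \<comment> \<open>\<open>has_derivative_series\<close> asks for convergence that is uniform in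
      the operator norm; the tolerance is shared equally among the \<open>DIM('e)\<close> partial
      derivatives.\<close>
    fix \<epsilon> :: real assume "\<epsilon> > 0"
    then have "\<forall>\<^sub>F n in sequentially. \<forall>b\<in>Basis. \<forall>y\<in>S. dist (\<Sum>i<n. t b (e i) y) (G b y) < \<epsilon> / DIM('e)"
      using ul by (intro eventually_ball_finite) (auto simp: uniform_limit_iff)
    then show "\<forall>\<^sub>F n in sequentially. \<forall>y\<in>S. \<forall>h. norm ((\<Sum>i<n. \<Sum>b\<in>Basis. (h \<bullet> b) * t b (e i) y) -
        (\<Sum>b\<in>Basis. (h \<bullet> b) * G b y)) \<le> \<epsilon> * norm h"
    proof (eventually_elim, intro ballI allI)
      fix n y and h :: 'e assume *: "\<forall>b\<in>Basis. \<forall>y\<in>S. dist (\<Sum>i<n. t b (e i) y) (G b y) < \<epsilon> / DIM('e)" "y \<in> S"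
      have "(\<Sum>i<n. \<Sum>b\<in>Basis. (h \<bullet> b) * t b (e i) y) - (\<Sum>b\<in>Basis. (h \<bullet> b) * G b y)
          = (\<Sum>b\<in>Basis. (h \<bullet> b) * ((\<Sum>i<n. t b (e i) y) - G b y))"
        by (subst sum.swap) (simp add: sum_subtractf right_diff_distrib sum_distrib_left)
      also have "norm \<dots> \<le> (\<Sum>b\<in>(Basis::'e set). norm h * (\<epsilon> / DIM('e)))"
      proof (rule sum_norm_le)
        fix b :: 'e assume b: "b \<in> Basis"
        have "\<bar>(\<Sum>i<n. t b (e i) y) - G b y\<bar> \<le> \<epsilon> / DIM('e)"
          using * b by (force simp: dist_real_def)
        then show "norm ((h \<bullet> b) * ((\<Sum>i<n. t b (e i) y) - G b y)) \<le> norm h * (\<epsilon> / DIM('e))"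
          using Basis_le_norm[OF b, of h] unfolding real_norm_def abs_mult by (intro mult_mono) auto
      qed
      also have "\<dots> = \<epsilon> * norm h" by simp
      finally show "norm ((\<Sum>i<n. \<Sum>b\<in>Basis. (h \<bullet> b) * t b (e i) y) - (\<Sum>b\<in>Basis. (h \<bullet> b) * G b y)) \<le> \<epsilon> * norm h" .
    qed
  next
    show "(\<lambda>n. mono_at 0 (e n) * c (e n)) sums f 0"
      using f[of 0] s has_sum_reindex_bij_betw[OF e, of "\<lambda>\<alpha>. mono_at 0 \<alpha> * c \<alpha>" "f 0"]
      by (auto intro: has_sum_imp_sums)
  qed
  then obtain gg where gg: "\<And>y. y \<in> S \<Longrightarrow> (\<lambda>n. mono_at y (e n) * c (e n)) sums gg y"
    "\<And>y. y \<in> S \<Longrightarrow> (gg has_derivative (\<lambda>h. \<Sum>b\<in>Basis. (h \<bullet> b) * G b y)) (at y within S)" by blast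
  have fgg: "f y = gg y" if "y \<in> S" for y
  proof -
    have "(\<lambda>n. mono_at y (e n) * c (e n)) sums f y"
      using f[of y] that has_sum_reindex_bij_betw[OF e, of "\<lambda>\<alpha>. mono_at y \<alpha> * c \<alpha>" "f y"]
      by (auto intro: has_sum_imp_sums simp: S_def)
    then show ?thesis using gg(1)[OF that] sums_unique2 by blast
  qed
  show ?thesis
  proof (intro exI allI impI conjI ballI)
    fix y :: 'e assume "\<forall>b\<in>Basis. \<bar>y \<bullet> b\<bar> < s"
    then have y: "y \<in> S" by (auto simp: S_def)
    show "(f has_derivative (\<lambda>h. \<Sum>b\<in>Basis. (h \<bullet> b) * G b y)) (at y)"
      using has_derivative_transform[OF y _ gg(2)[OF y]] fgg at_within_open[OF y S(1)] by metis
    fix b :: 'e assume "b \<in> Basis"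
    then show "((\<lambda>\<alpha>. mono_at y \<alpha> * pd_coeff b c \<alpha>) has_sum G b y) multi_idx"
      using has_sum_shift tsum[OF y] unfolding t_def by blast
  qed
qed

lemma real_analytic_on_real_def:
  fixes f :: "'e::euclidean_space \<Rightarrow> real"
  shows "real_analytic_on S f \<longleftrightarrow> (\<forall>a\<in>S. \<exists>r>0. \<exists>c. \<forall>x \<in> S \<inter> ball a r.
     ((\<lambda>\<alpha>. mono_at (x - a) \<alpha> * c \<alpha>) has_sum f x) multi_idx)"
  unfolding real_analytic_on_def mono_at_def multi_idx_def by simp

lemma norm_le_DIM_mult:
  fixes y :: "'e::euclidean_space" and s :: real
  assumes "\<And>b. b \<in> Basis \<Longrightarrow> \<bar>y \<bullet> b\<bar> \<le> s"
  shows "norm y \<le> DIM('e) * s"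
proof -
  have "norm y \<le> (\<Sum>b\<in>Basis. \<bar>y \<bullet> b\<bar>)" by (rule norm_le_l1)
  also have "\<dots> \<le> (\<Sum>b\<in>(Basis::'e set). s)" using assms by (intro sum_mono) auto
  finally show ?thesis by simp
qed

proposition real_analytic_on_has_derivative:
  fixes f :: "'e::euclidean_space \<Rightarrow> real"
  assumes S: "open S" and f: "real_analytic_on S f"
  obtains G where
    "\<And>x. x \<in> S \<Longrightarrow> (f has_derivative (\<lambda>h. \<Sum>b\<in>Basis. (h \<bullet> b) * G b x)) (at x)"
    "\<And>b. b \<in> Basis \<Longrightarrow> real_analytic_on S (G b)"
proof
  \<comment> \<open>Defined globally through the Frechet derivative, so that the partial derivatives
    obtained from expansions at different centres fit together.\<close>
  define G where "G = (\<lambda>b x. frechet_derivative f (at x) b)"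
  have loc: "\<exists>\<sigma>>0. \<exists>c. \<forall>y. (\<forall>b\<in>Basis. \<bar>y \<bullet> b\<bar> < \<sigma>) \<longrightarrow>
      (f has_derivative (\<lambda>h. \<Sum>b\<in>Basis. (h \<bullet> b) * G b (a + y))) (at (a + y)) \<and>
      (\<forall>b\<in>Basis. ((\<lambda>\<alpha>. mono_at y \<alpha> * pd_coeff b c \<alpha>) has_sum G b (a + y)) multi_idx)"
    if a: "a \<in> S" for a
  proof -
    obtain r0 c where r0: "r0 > 0"
      "\<And>x. x \<in> S \<inter> ball a r0 \<Longrightarrow> ((\<lambda>\<alpha>. mono_at (x - a) \<alpha> * c \<alpha>) has_sum f x) multi_idx"
      using f a unfolding real_analytic_on_real_def by blast
    obtain r1 where r1: "r1 > 0" "ball a r1 \<subseteq> S" using S a openE by blast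
    \<comment> \<open>By \<open>norm_le_DIM_mult\<close>, every point of the closed box of half side
      \<open>r\<close>, in particular its corner, has norm at most \<open>min r0 r1 / 2\<close>, so
      the expansion at \<open>a\<close> is valid there.\<close>
    define r where "r = min r0 r1 / (2 * DIM('e))"
    have r: "r > 0" unfolding r_def using r0 r1 by simp
    have hs: "((\<lambda>\<alpha>. mono_at y \<alpha> * c \<alpha>) has_sum f (a + y)) multi_idx"
      if "\<And>b. b \<in> Basis \<Longrightarrow> \<bar>y \<bullet> b\<bar> \<le> r" for y
    proof -
      have "norm y \<le> DIM('e) * r" using norm_le_DIM_mult that by blast
      also have "\<dots> = min r0 r1 / 2" by (simp add: r_def)
      also have "\<dots> < min r0 r1" using r0(1) r1(1) by (simp add: min_def)
      finally have "a + y \<in> S \<inter> ball a r0" using r1 by (auto simp: dist_norm)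
      from r0(2)[OF this] show ?thesis by simp
    qed
    \<comment> \<open>At the corner every monomial equals \<open>r ^ mi_deg \<alpha>\<close>.
      Unordered summability of real terms is absolute, which gives the majorant.\<close>
    have "(\<lambda>\<alpha>. mono_at (r *\<^sub>R One) \<alpha> * c \<alpha>) summable_on multi_idx"
      using hs[of "r *\<^sub>R One"] r by (auto simp: summable_on_def)
    then have "(\<lambda>\<alpha>. \<bar>mono_at (r *\<^sub>R One) \<alpha> * c \<alpha>\<bar>) summable_on multi_idx"
      using summable_on_iff_abs_summable_on_real[THEN iffD1] by (simp only: real_norm_def)
    moreover have "mono_at (r *\<^sub>R One) \<alpha> = r ^ mi_deg \<alpha>" for \<alpha> :: "'e \<Rightarrow> nat"
      by (simp add: mono_at_def mi_deg_def power_sum)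
    ultimately have sm: "(\<lambda>\<alpha>. r ^ mi_deg \<alpha> * \<bar>c \<alpha>\<bar>) summable_on multi_idx"
      using r by (simp add: abs_mult)
    have A: "((\<lambda>\<alpha>. mono_at y \<alpha> * c \<alpha>) has_sum f (a + y)) multi_idx"
      if y: "\<forall>b\<in>Basis. \<bar>y \<bullet> b\<bar> < r / 2" for y
    proof (rule hs)
      fix b :: 'e assume "b \<in> Basis"
      from bspec[OF y this] r show "\<bar>y \<bullet> b\<bar> \<le> r" by linarith
    qed
    have r2: "0 < r / 2" "r / 2 < r" using r by auto
    from power_series_has_derivative[OF sm r2, of "\<lambda>y. f (a + y)", OF A]
    obtain G' where "\<forall>y. (\<forall>b\<in>Basis. \<bar>y \<bullet> b\<bar> < r / 2) \<longrightarrow>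
         ((\<lambda>y. f (a + y)) has_derivative (\<lambda>h. \<Sum>b\<in>Basis. (h \<bullet> b) * G' b y)) (at y) \<and>
         (\<forall>b\<in>Basis. ((\<lambda>\<alpha>. mono_at y \<alpha> * pd_coeff b c \<alpha>) has_sum G' b y) multi_idx)" ..
    then have G': "\<And>y. (\<forall>b\<in>Basis. \<bar>y \<bullet> b\<bar> < r / 2) \<Longrightarrow>
         ((\<lambda>y. f (a + y)) has_derivative (\<lambda>h. \<Sum>b\<in>Basis. (h \<bullet> b) * G' b y)) (at y)"
      "\<And>y b. (\<forall>b\<in>Basis. \<bar>y \<bullet> b\<bar> < r / 2) \<Longrightarrow> b \<in> Basis \<Longrightarrow>
         ((\<lambda>\<alpha>. mono_at y \<alpha> * pd_coeff b c \<alpha>) has_sum G' b y) multi_idx" by auto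
    show ?thesis
    proof (intro exI conjI allI impI)
      show "r / 2 > 0" using r by simp
      fix y :: 'e assume y: "\<forall>b\<in>Basis. \<bar>y \<bullet> b\<bar> < r / 2"
      have D: "(f has_derivative (\<lambda>h. \<Sum>b\<in>Basis. (h \<bullet> b) * G' b y)) (at (a + y))"
      proof -
        have "((\<lambda>x. f (a + (x - a))) has_derivative (\<lambda>h. \<Sum>b\<in>Basis. (h \<bullet> b) * G' b y)) (at (a + y))"
          by (rule has_derivative_compose[where g="\<lambda>y. f (a + y)" and f="\<lambda>x. x - a" and f'="\<lambda>h. h"])
             (use G'(1)[of y] y in \<open>auto intro!: derivative_eq_intros\<close>)
        then show ?thesis by simp
      qed
      have GG: "G b (a + y) = G' b y" if "b \<in> Basis" for b
      proof -
        have "G b (a + y) = (\<Sum>c\<in>Basis. (b \<bullet> c) * G' c y)"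
          using frechet_derivative_at[OF D] unfolding G_def by metis
        also have "\<dots> = (\<Sum>c\<in>Basis. if c = b then G' c y else 0)"
          using that by (intro sum.cong) (auto simp: inner_Basis)
        finally show ?thesis using that by simp
      qed
      show "(f has_derivative (\<lambda>h. \<Sum>b\<in>Basis. (h \<bullet> b) * G b (a + y))) (at (a + y))"
        using D GG by (simp cong: sum.cong)
      show "\<forall>b\<in>Basis. ((\<lambda>\<alpha>. mono_at y \<alpha> * pd_coeff b c \<alpha>) has_sum G b (a + y)) multi_idx"
        using G'(2)[of y] y GG by auto
    qed
  qed
  show "(f has_derivative (\<lambda>h. \<Sum>b\<in>Basis. (h \<bullet> b) * G b x)) (at x)" if x: "x \<in> S" for x
  proof -
    obtain \<sigma> where "\<sigma> > 0" "(\<forall>b\<in>Basis. \<bar>(0::'e) \<bullet> b\<bar> < \<sigma>) \<longrightarrow>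
      (f has_derivative (\<lambda>h. \<Sum>b\<in>Basis. (h \<bullet> b) * G b (x + 0))) (at (x + 0))"
      using loc[OF x] by meson
    then show ?thesis by simp
  qed
  fix b :: 'e assume b: "b \<in> Basis"
  show "real_analytic_on S (G b)" unfolding real_analytic_on_real_def
  proof
    fix a assume a: "a \<in> S"
    obtain \<sigma> c where \<sigma>: "\<sigma> > 0" "\<And>y. (\<forall>b\<in>Basis. \<bar>y \<bullet> b\<bar> < \<sigma>) \<Longrightarrow>
      (\<forall>b\<in>Basis. ((\<lambda>\<alpha>. mono_at y \<alpha> * pd_coeff b c \<alpha>) has_sum G b (a + y)) multi_idx)"
      using loc[OF a] by meson
    have "((\<lambda>\<alpha>. mono_at (x - a) \<alpha> * pd_coeff b c \<alpha>) has_sum G b x) multi_idx"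
      if "x \<in> S \<inter> ball a \<sigma>" for x
    proof -
      have "\<bar>(x - a) \<bullet> b\<bar> < \<sigma>" if "b \<in> Basis" for b
        using Basis_le_norm[OF that, of "x - a"] \<open>x \<in> _\<close> by (auto simp: dist_norm norm_minus_commute)
      then show ?thesis using \<sigma>(2)[of "x - a"] b by simp
    qed
    then show "\<exists>r>0. \<exists>c. \<forall>x\<in>S \<inter> ball a r. ((\<lambda>\<alpha>. mono_at (x - a) \<alpha> * c \<alpha>) has_sum G b x) multi_idx"
      using \<sigma>(1) by blast
  qed
qed

lemma real_analytic_on_inner:
  fixes f :: "'e::euclidean_space \<Rightarrow> 'f::real_inner"
  assumes "real_analytic_on S f"
  shows "real_analytic_on S (\<lambda>x. f x \<bullet> v)"
  unfolding real_analytic_on_real_def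
proof
  fix a assume "a \<in> S"
  then obtain r c where r: "r > 0" "\<forall>x \<in> S \<inter> ball a r.
        ((\<lambda>\<alpha>. (\<Prod>b\<in>Basis. ((x - a) \<bullet> b) ^ \<alpha> b) *\<^sub>R c \<alpha>) has_sum f x)
          {\<alpha>. \<forall>b. b \<notin> Basis \<longrightarrow> \<alpha> b = 0}"
    using assms unfolding real_analytic_on_def by blast
  have "((\<lambda>\<alpha>. mono_at (x - a) \<alpha> * (c \<alpha> \<bullet> v)) has_sum (f x \<bullet> v)) multi_idx" if "x \<in> S \<inter> ball a r" for x
    using has_sum_bounded_linear[OF bounded_linear_inner_left, OF bspec[OF r(2) that], of v]
    unfolding mono_at_def multi_idx_def by simp
  then show "\<exists>r>0. \<exists>c. \<forall>x\<in>S \<inter> ball a r. ((\<lambda>\<alpha>. mono_at (x - a) \<alpha> * c \<alpha>) has_sum (f x \<bullet> v)) multi_idx"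
    using r(1) by (intro exI[of _ r] conjI exI[of _ "\<lambda>\<alpha>. c \<alpha> \<bullet> v"] ballI)
qed

section \<open>Differentiability classes of curves\<close>

lemma has_vector_derivative_iff_quotient:
  fixes f :: "real \<Rightarrow> 'f::real_normed_vector"
  shows "(f has_vector_derivative D) (at t within S) \<longleftrightarrow>
    ((\<lambda>s. (f s - f t) /\<^sub>R (s - t)) \<longlongrightarrow> D) (at t within S)"
proof -
  have "(f has_vector_derivative D) (at t within S) \<longleftrightarrow>
    ((\<lambda>y. (1 / norm (y - t)) *\<^sub>R (f y - (f t + (y - t) *\<^sub>R D))) \<longlongrightarrow> 0) (at t within S)"
    unfolding has_vector_derivative_def has_derivative_within
    by (simp add: bounded_linear_scaleR_left)
  also have "\<dots> \<longleftrightarrow> ((\<lambda>y. norm ((1 / norm (y - t)) *\<^sub>R (f y - (f t + (y - t) *\<^sub>R D)))) \<longlongrightarrow> 0) (at t within S)"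
    by (rule tendsto_norm_zero_iff[symmetric])
  also have "\<dots> \<longleftrightarrow> ((\<lambda>s. norm ((f s - f t) /\<^sub>R (s - t) - D)) \<longlongrightarrow> 0) (at t within S)"
  proof (rule tendsto_cong)
    have "norm ((1 / norm (s - t)) *\<^sub>R (f s - (f t + (s - t) *\<^sub>R D))) = norm ((f s - f t) /\<^sub>R (s - t) - D)"
      if "s \<noteq> t" for s
    proof -
      have "f s - (f t + (s - t) *\<^sub>R D) = (s - t) *\<^sub>R ((f s - f t) /\<^sub>R (s - t) - D)"
        using that by (simp add: scaleR_diff_right)
      then have "norm (f s - (f t + (s - t) *\<^sub>R D)) = \<bar>s - t\<bar> * norm ((f s - f t) /\<^sub>R (s - t) - D)"
        by simp
      then show ?thesis using that by simp
    qed
    then show "\<forall>\<^sub>F s in at t within S. norm ((1 / norm (s - t)) *\<^sub>R (f s - (f t + (s - t) *\<^sub>R D))) =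
        norm ((f s - f t) /\<^sub>R (s - t) - D)"
      by (auto simp: eventually_at_filter)
  qed
  also have "\<dots> \<longleftrightarrow> ((\<lambda>s. (f s - f t) /\<^sub>R (s - t) - D) \<longlongrightarrow> 0) (at t within S)"
    by (rule tendsto_norm_zero_iff)
  finally show ?thesis by (simp add: LIM_zero_iff)
qed

text \<open>Finite differentiability classes, with derivatives taken within \<open>J\<close>. The
  bootstrap of the Euler-Lagrange equation gains one order at a time, which
  \<open>smooth_fun_on\<close> cannot express.\<close>

primrec Ck :: "nat \<Rightarrow> real set \<Rightarrow> (real \<Rightarrow> 'f::real_normed_vector) \<Rightarrow> bool" where
  "Ck 0 J f = continuous_on J f"
| "Ck (Suc k) J f = (\<exists>f'. (\<forall>t\<in>J. (f has_vector_derivative f' t) (at t within J)) \<and> Ck k J f')"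

lemma Ck_cong: "Ck k J f \<Longrightarrow> (\<And>t. t \<in> J \<Longrightarrow> f t = g t) \<Longrightarrow> Ck k J g"
proof (induction k arbitrary: f g)
  case 0 then show ?case using continuous_on_eq by (auto)
next
  case (Suc k)
  then obtain f' where f': "\<forall>t\<in>J. (f has_vector_derivative f' t) (at t within J)" "Ck k J f'" by auto
  then have "\<forall>t\<in>J. (g has_vector_derivative f' t) (at t within J)"
    using Suc.prems(2) has_vector_derivative_transform by metis
  then show ?case using f' by auto
qed

lemma Ck_imp_continuous_on: "Ck k J f \<Longrightarrow> continuous_on J f"
  by (cases k) (auto simp: continuous_on_eq_continuous_within intro: has_vector_derivative_continuous)

lemma Ck_Suc_imp: "Ck (Suc k) J f \<Longrightarrow> Ck k J f"
proof (induction k arbitrary: f)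
  case 0 then show ?case by (metis Ck_imp_continuous_on Ck.simps(1))
next
  case (Suc k) then show ?case by (metis Ck.simps(2))
qed

lemma Ck_const [simp]: "Ck k J (\<lambda>_. c)"
  by (induction k arbitrary: c) (auto intro!: exI[of _ "\<lambda>_. 0"])

lemma Ck_bounded_linear: "bounded_linear L \<Longrightarrow> Ck k J f \<Longrightarrow> Ck k J (\<lambda>t. L (f t))"
proof (induction k arbitrary: f)
  case 0 then show ?case by (simp add: bounded_linear.continuous_on)
next
  case (Suc k)
  then obtain f' where f': "\<forall>t\<in>J. (f has_vector_derivative f' t) (at t within J)" "Ck k J f'" by auto
  then show ?case using Suc bounded_linear.has_vector_derivative[OF Suc.prems(1)]
    by (auto intro!: exI[of _ "\<lambda>t. L (f' t)"])
qed

lemma Ck_add: "Ck k J f \<Longrightarrow> Ck k J g \<Longrightarrow> Ck k J (\<lambda>t. f t + g t)"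
proof (induction k arbitrary: f g)
  case 0 then show ?case by (auto intro: continuous_intros)
next
  case (Suc k)
  then obtain f' g' where "\<forall>t\<in>J. (f has_vector_derivative f' t) (at t within J)" "Ck k J f'"
    "\<forall>t\<in>J. (g has_vector_derivative g' t) (at t within J)" "Ck k J g'" by auto
  then show ?case using Suc.IH by (auto intro!: exI[of _ "\<lambda>t. f' t + g' t"] has_vector_derivative_add)
qed

lemma Ck_sum: "(\<And>i. i \<in> I \<Longrightarrow> Ck k J (f i)) \<Longrightarrow> Ck k J (\<lambda>t. \<Sum>i\<in>I. f i t)"
  by (induction I rule: infinite_finite_induct) (auto intro: Ck_add)

lemma Ck_mult:
  fixes f g :: "real \<Rightarrow> real"
  shows "Ck k J f \<Longrightarrow> Ck k J g \<Longrightarrow> Ck k J (\<lambda>t. f t * g t)"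
proof (induction k arbitrary: f g)
  case 0 then show ?case by (auto intro: continuous_intros)
next
  case (Suc k)
  from Suc.prems have k: "Ck k J f" "Ck k J g" using Ck_Suc_imp by blast+
  from Suc.prems obtain f' g' where d: "\<forall>t\<in>J. (f has_vector_derivative f' t) (at t within J)" "Ck k J f'"
    "\<forall>t\<in>J. (g has_vector_derivative g' t) (at t within J)" "Ck k J g'" by auto
  have "Ck k J (\<lambda>t. f t * g' t + f' t * g t)"
    using Suc.IH d k by (intro Ck_add) auto
  moreover have "\<forall>t\<in>J. ((\<lambda>t. f t * g t) has_vector_derivative f t * g' t + f' t * g t) (at t within J)"
    using d by (auto intro: has_vector_derivative_mult)
  ultimately show ?case by auto
qed

lemma Ck_inner: "Ck k J f \<Longrightarrow> Ck k J (\<lambda>t. f t \<bullet> v)"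
  by (rule Ck_bounded_linear[OF bounded_linear_inner_left])

lemma Ck_componentwise:
  fixes f :: "real \<Rightarrow> 'f::euclidean_space"
  assumes "\<And>b. b \<in> Basis \<Longrightarrow> Ck k J (\<lambda>t. f t \<bullet> b)"
  shows "Ck k J f"
proof -
  have "Ck k J (\<lambda>t. \<Sum>b\<in>Basis. (f t \<bullet> b) *\<^sub>R b)"
    using assms by (intro Ck_sum Ck_bounded_linear[OF bounded_linear_scaleR_left])
  then show ?thesis by (simp add: euclidean_representation)
qed

lemma real_analytic_on_cong:
  assumes f: "real_analytic_on S f" and eq: "\<And>x. x \<in> S \<Longrightarrow> f x = g x"
  shows "real_analytic_on S g"
  unfolding real_analytic_on_def
proof
  let ?P = "\<lambda>f a x c. ((\<lambda>\<alpha>. (\<Prod>b\<in>Basis. ((x - a) \<bullet> b) ^ \<alpha> b) *\<^sub>R c \<alpha>) has_sum f x)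
    {\<alpha>. \<forall>b. b \<notin> Basis \<longrightarrow> \<alpha> b = 0}"
  fix a assume a: "a \<in> S"
  obtain r c where r: "r > 0" "\<forall>x \<in> S \<inter> ball a r. ?P f a x c"
    using bspec[OF f[unfolded real_analytic_on_def] a] by (elim exE conjE) (rule that)
  have "\<forall>x \<in> S \<inter> ball a r. ?P g a x c"
  proof
    fix x assume x: "x \<in> S \<inter> ball a r"
    show "?P g a x c" using bspec[OF r(2) x] unfolding eq[OF IntD1[OF x]] .
  qed
  with r(1) show "\<exists>r>0. \<exists>c. \<forall>x \<in> S \<inter> ball a r. ?P g a x c"
    by (intro exI conjI)
qed

lemma real_analytic_frechet_derivative:
  fixes f :: "'e::euclidean_space \<Rightarrow> real"
  assumes "open S" "real_analytic_on S f"
  shows "\<And>x. x \<in> S \<Longrightarrow> (f has_derivative frechet_derivative f (at x)) (at x)"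
    and "\<And>b. b \<in> Basis \<Longrightarrow> real_analytic_on S (\<lambda>x. frechet_derivative f (at x) b)"
proof -
  obtain G where G:
    "\<And>x. x \<in> S \<Longrightarrow> (f has_derivative (\<lambda>h. \<Sum>b\<in>Basis. (h \<bullet> b) * G b x)) (at x)"
    "\<And>b. b \<in> Basis \<Longrightarrow> real_analytic_on S (G b)"
    by (rule real_analytic_on_has_derivative[OF assms]) (rule that)
  have eq: "frechet_derivative f (at x) = (\<lambda>h. \<Sum>b\<in>Basis. (h \<bullet> b) * G b x)" if "x \<in> S" for x
    using frechet_derivative_at[OF G(1)[OF that]] by (rule sym)
  show fd: "(f has_derivative frechet_derivative f (at x)) (at x)" if "x \<in> S" for x
    unfolding eq[OF that] by (rule G(1)[OF that])
  fix b :: 'e assume b: "b \<in> Basis"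
  have "frechet_derivative f (at x) b = G b x" if "x \<in> S" for x
  proof -
    have "frechet_derivative f (at x) b = (\<Sum>c\<in>Basis. (b \<bullet> c) * G c x)"
      unfolding eq[OF that] ..
    also have "\<dots> = (\<Sum>c\<in>Basis. if c = b then G c x else 0)"
      using b by (intro sum.cong) (auto simp: inner_Basis)
    finally show ?thesis using b by simp
  qed
  from real_analytic_on_cong[OF G(2)[OF b] this[symmetric]]
  show "real_analytic_on S (\<lambda>x. frechet_derivative f (at x) b)" .
qed

lemma real_analytic_continuous_on:
  fixes f :: "'e::euclidean_space \<Rightarrow> real"
  assumes "open S" "real_analytic_on S f"
  shows "continuous_on S f"
  using real_analytic_frechet_derivative(1)[OF assms]
  by (meson continuous_at_imp_continuous_on has_derivative_continuous)

lemma frechet_derivative_expand: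
  fixes f :: "'e::euclidean_space \<Rightarrow> real"
  assumes "f differentiable (at x)"
  shows "frechet_derivative f (at x) w = (\<Sum>b\<in>Basis. (w \<bullet> b) * frechet_derivative f (at x) b)"
proof -
  interpret linear "frechet_derivative f (at x)"
    using assms by (rule linear_frechet_derivative)
  have "frechet_derivative f (at x) w = frechet_derivative f (at x) (\<Sum>b\<in>Basis. (w \<bullet> b) *\<^sub>R b)"
    by (simp add: euclidean_representation)
  then show ?thesis by (simp only: sum scale real_scaleR_def)
qed

text \<open>The chain rule trades \<open>F\<close> for its partial derivatives, which are analytic
  again; hence \<open>F\<close> is general in the induction.\<close>

lemma Ck_compose_analytic:
  fixes F :: "'e::euclidean_space \<Rightarrow> real"
  assumes S: "open S" and u: "\<And>t. t \<in> J \<Longrightarrow> u t \<in> S"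
  shows "real_analytic_on S F \<Longrightarrow> Ck k J u \<Longrightarrow> Ck k J (\<lambda>t. F (u t))"
proof (induction k arbitrary: F)
  case 0
  then have "continuous_on S F" using real_analytic_continuous_on S by blast
  then show ?case using 0 u by (auto intro: continuous_on_compose2)
next
  case (Suc k)
  note fd = real_analytic_frechet_derivative[OF S Suc.prems(1)]
  from Suc.prems(2) obtain u' where u': "\<forall>t\<in>J. (u has_vector_derivative u' t) (at t within J)" "Ck k J u'" by auto
  have "((\<lambda>t. F (u t)) has_vector_derivative (\<Sum>b\<in>Basis. (u' t \<bullet> b) * frechet_derivative F (at (u t)) b)) (at t within J)"
    if t: "t \<in> J" for t
  proof -
    have "((\<lambda>t. F (u t)) has_derivative (\<lambda>x. frechet_derivative F (at (u t)) (x *\<^sub>R u' t))) (at t within J)"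
      by (rule has_derivative_compose[where f=u and g=F, OF u'(1)[rule_format, OF t, unfolded has_vector_derivative_def] fd(1)[OF u[OF t]]])
    moreover have "frechet_derivative F (at (u t)) (x *\<^sub>R u' t) = x *\<^sub>R (\<Sum>b\<in>Basis. (u' t \<bullet> b) * frechet_derivative F (at (u t)) b)" for x
      using frechet_derivative_expand[of F "u t" "x *\<^sub>R u' t"] fd(1)[OF u[OF t]]
      by (simp add: sum_distrib_left differentiableI mult.assoc)
    ultimately show ?thesis by (simp add: has_vector_derivative_def)
  qed
  moreover have "Ck k J (\<lambda>t. \<Sum>b\<in>Basis. (u' t \<bullet> b) * frechet_derivative F (at (u t)) b)"
    using Suc.IH fd(2) u'(2) Ck_Suc_imp[OF Suc.prems(2)]
    by (intro Ck_sum Ck_mult Ck_inner) auto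
  ultimately show ?case unfolding Ck.simps by (intro exI conjI ballI)
qed

text \<open>The derivatives found on the pieces have to be glued. As no point of \<open>J\<close> is
  isolated, each of them equals \<open>vector_derivative\<close> within \<open>J\<close>, which is
  defined globally.\<close>

lemma Ck_locally:
  assumes nb: "\<And>t. t \<in> J \<Longrightarrow> at t within J \<noteq> bot"
    and loc: "\<And>t. t \<in> J \<Longrightarrow> \<exists>O'. open O' \<and> t \<in> O' \<and> Ck k (J \<inter> O') f"
  shows "Ck k J f"
  using loc
proof (induction k arbitrary: f)
  case 0
  show ?case unfolding Ck.simps continuous_on_eq_continuous_within
  proof
    fix t assume t: "t \<in> J"
    obtain O' where O': "open O'" "t \<in> O'" "continuous_on (J \<inter> O') f" using 0[OF t] by auto
    then have "continuous (at t within J \<inter> O') f"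
      using t by (auto simp: continuous_on_eq_continuous_within)
    moreover have "at t within J \<inter> O' = at t within J"
      using at_within_nhd[OF O'(2,1), of "J \<inter> O'" J] by auto
    ultimately show "continuous (at t within J) f" by simp
  qed
next
  case (Suc k)
  define f' where "f' = (\<lambda>t. vector_derivative f (at t within J))"
  have *: "\<exists>O'. open O' \<and> t \<in> O' \<and> (\<forall>s\<in>J \<inter> O'. (f has_vector_derivative f' s) (at s within J)) \<and> Ck k (J \<inter> O') f'"
    if t: "t \<in> J" for t
  proof -
    obtain O' d where O': "open O'" "t \<in> O'" and
      d: "\<forall>s\<in>J \<inter> O'. (f has_vector_derivative d s) (at s within J \<inter> O')" "Ck k (J \<inter> O') d"
      using Suc.prems[OF t] by auto
    have eq: "at s within J \<inter> O' = at s within J" if "s \<in> O'" for s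
      using at_within_nhd[OF that O'(1), of "J \<inter> O'" J] by auto
    have "(f has_vector_derivative d s) (at s within J)" if "s \<in> J \<inter> O'" for s
      using d(1) that eq by auto
    moreover from this have "f' s = d s" if "s \<in> J \<inter> O'" for s
      unfolding f'_def using that nb by (intro vector_derivative_within) auto
    ultimately show ?thesis using O' d(2) Ck_cong[of k "J \<inter> O'" d f'] by (intro exI[of _ O']) auto
  qed
  have "\<forall>t\<in>J. (f has_vector_derivative f' t) (at t within J)" using * by blast
  moreover have "Ck k J f'" by (rule Suc.IH) (use * in blast)
  ultimately show ?case by auto
qed

text \<open>\<open>smooth_fun_on\<close> wants one sequence of derivatives for all orders, while
  \<open>Ck\<close> provides separate witnesses for each order. Uniqueness of derivatives within
  \<open>J\<close> identifies all of them with the iterates of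
  \<open>vector_derivative\<close>.\<close>

lemma Ck_imp_smooth_fun_on:
  assumes nb: "\<And>t. t \<in> J \<Longrightarrow> at t within J \<noteq> bot" and f: "\<And>k. Ck k J f"
  shows "smooth_fun_on J f"
proof -
  define D where "D = (\<lambda>k. ((\<lambda>f t. vector_derivative f (at t within J)) ^^ k) f)"
  have D: "\<forall>j. Ck j J (D k)" for k
  proof (induction k)
    case 0 then show ?case using f by (simp add: D_def)
  next
    case (Suc k)
    show ?case
    proof
      fix j
      obtain f' where f': "\<forall>t\<in>J. (D k has_vector_derivative f' t) (at t within J)" "Ck j J f'"
        using Suc[rule_format, of "Suc j"] by auto
      then have "f' t = D (Suc k) t" if "t \<in> J" for t
        using vector_derivative_within[OF nb] that by (metis D_def comp_apply funpow.simps(2))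
      then show "Ck j J (D (Suc k))" using f'(2) Ck_cong by blast
    qed
  qed
  have "(D k has_vector_derivative D (Suc k) t) (at t within J)" if t: "t \<in> J" for k t
  proof -
    obtain f' where f': "\<forall>t\<in>J. (D k has_vector_derivative f' t) (at t within J)"
      using D[rule_format, where j="Suc 0"] by auto
    then show ?thesis
      using vector_derivative_within[OF nb] t by (metis D_def comp_apply funpow.simps(2))
  qed
  moreover have "D 0 = f" by (simp add: D_def)
  ultimately show ?thesis unfolding smooth_fun_on_def by metis
qed

lemma smooth_fun_on_imp_Ck:
  assumes "smooth_fun_on J f" shows "Ck k J f"
proof -
  obtain D where D: "\<forall>t\<in>J. D 0 t = f t"
     "\<forall>k::nat. \<forall>t\<in>J. (D k has_vector_derivative D (Suc k) t) (at t within J)"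
    using assms unfolding smooth_fun_on_def by blast
  have "Ck k J (D n)" for n
  proof (induction k arbitrary: n)
    case 0 then show ?case using D(2)
      by (auto simp: continuous_on_eq_continuous_within intro: has_vector_derivative_continuous)
  next
    case (Suc k) then show ?case using D(2) by auto
  qed
  then show ?thesis using D(1) Ck_cong by blast
qed

section \<open>Positive definite forms and linear systems depending on a parameter\<close>

lemma posdef_lower_bound:
  fixes B :: "'e::euclidean_space \<Rightarrow> 'e \<Rightarrow> real"
  assumes B: "bilinear B" and pos: "\<And>z. z \<noteq> 0 \<Longrightarrow> B z z > 0"
  obtains m where "m > 0" "\<And>z. m * (norm z)\<^sup>2 \<le> B z z"
proof -
  have "continuous_on (sphere 0 1) (\<lambda>z. B z z)"
    using bilinear_continuous_on_compose[OF continuous_on_id continuous_on_id B] by (simp add: id_def)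
  moreover have "sphere (0::'e) 1 \<noteq> {}" by simp
  ultimately have "\<exists>z0\<in>sphere 0 1. \<forall>z\<in>sphere 0 1. B z0 z0 \<le> B z z"
    by (intro continuous_attains_inf) auto
  then obtain z0 where z0: "z0 \<in> sphere 0 1" "\<And>z. z \<in> sphere 0 1 \<Longrightarrow> B z0 z0 \<le> B z z"
    by blast
  show ?thesis
  proof
    show "B z0 z0 > 0" using z0(1) by (intro pos) auto
    fix z :: 'e
    show "B z0 z0 * (norm z)\<^sup>2 \<le> B z z"
    proof (cases "z = 0")
      case False
      have z: "norm z *\<^sub>R sgn z = z" using False by (simp add: sgn_div_norm)
      have "B (norm z *\<^sub>R sgn z) (norm z *\<^sub>R sgn z) = (norm z)\<^sup>2 * B (sgn z) (sgn z)"
        by (simp only: bilinear_lmul[OF B] bilinear_rmul[OF B] power2_eq_square mult.assoc real_scaleR_def)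
      then have "B z z = (norm z)\<^sup>2 * B (sgn z) (sgn z)" unfolding z .
      moreover have "B z0 z0 \<le> B (sgn z) (sgn z)"
        using False by (intro z0(2)) (simp add: norm_sgn)
      ultimately show ?thesis by (simp add: mult.commute mult_left_mono mult_right_mono)
    qed (simp add: bilinear_lzero[OF B])
  qed
qed

lemma bilinear_expand_right:
  fixes B :: "'e::euclidean_space \<Rightarrow> 'e \<Rightarrow> real"
  assumes B: "bilinear B" shows "B v w = (\<Sum>e\<in>Basis. (w \<bullet> e) * B v e)"
proof -
  interpret linear "B v" using B by (simp add: bilinear_def)
  have "B v w = B v (\<Sum>e\<in>Basis. (w \<bullet> e) *\<^sub>R e)" by (simp add: euclidean_representation)
  then show ?thesis by (simp only: sum scale real_scaleR_def)
qed

lemma bilinear_expand: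
  fixes B :: "'e::euclidean_space \<Rightarrow> 'e \<Rightarrow> real"
  assumes B: "bilinear B" shows "B v w = (\<Sum>b\<in>Basis. \<Sum>e\<in>Basis. (v \<bullet> b) * (w \<bullet> e) * B b e)"
proof -
  have *: "bilinear (\<lambda>x y. B y x)" using B by (simp add: bilinear_def)
  have "B v e = (\<Sum>b\<in>Basis. (v \<bullet> b) * B b e)" for e
    using bilinear_expand_right[OF *, where v=e and w=v] by simp
  then show ?thesis
    by (subst bilinear_expand_right[OF B]) (simp add: sum_distrib_left sum_distrib_right mult_ac, subst sum.swap, simp add: mult_ac)
qed

text \<open>Coercivity makes testing against the basis quantitative: for \<open>w = q s - z\<close>
  the bound \<open>m * (norm w)\<^sup>2 \<le> B w w\<close> and the expansion of the second argument
  control \<open>norm w\<close> by the sum of the tested differences.\<close>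

lemma posdef_tendsto:
  fixes B :: "'e::euclidean_space \<Rightarrow> 'e \<Rightarrow> real"
  assumes B: "bilinear B" and pos: "\<And>z. z \<noteq> 0 \<Longrightarrow> B z z > 0"
    and lim: "\<And>e. e \<in> Basis \<Longrightarrow> ((\<lambda>s. B (q s) e) \<longlongrightarrow> B z e) F"
  shows "(q \<longlongrightarrow> z) F"
proof -
  obtain m where m: "m > 0" "\<And>z. m * (norm z)\<^sup>2 \<le> B z z" using posdef_lower_bound[OF B pos] by metis
  have bd: "norm (q s - z) \<le> (\<Sum>e\<in>Basis. \<bar>B (q s) e - B z e\<bar>) / m" for s
  proof (cases "q s = z")
    case True then show ?thesis by simp
  next
    case False
    let ?w = "q s - z"
    have "m * (norm ?w)\<^sup>2 \<le> (\<Sum>e\<in>Basis. (?w \<bullet> e) * B ?w e)"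
      using m(2)[of ?w] bilinear_expand_right[OF B, of ?w ?w] by simp
    also have "\<dots> \<le> (\<Sum>e\<in>Basis. norm ?w * \<bar>B (q s) e - B z e\<bar>)"
    proof (rule sum_mono)
      fix e :: 'e assume e: "e \<in> Basis"
      have "(?w \<bullet> e) * B ?w e \<le> \<bar>?w \<bullet> e\<bar> * \<bar>B ?w e\<bar>" by (metis abs_ge_self abs_mult)
      also have "\<dots> \<le> norm ?w * \<bar>B ?w e\<bar>" using Basis_le_norm[OF e] by (intro mult_right_mono) auto
      finally show "(?w \<bullet> e) * B ?w e \<le> norm ?w * \<bar>B (q s) e - B z e\<bar>" by (simp add: bilinear_lsub[OF B])
    qed
    also have "\<dots> = norm ?w * (\<Sum>e\<in>Basis. \<bar>B (q s) e - B z e\<bar>)" by (simp add: sum_distrib_left)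
    finally have "norm ?w * (m * norm ?w) \<le> norm ?w * (\<Sum>e\<in>Basis. \<bar>B (q s) e - B z e\<bar>)"
      by (simp add: power2_eq_square mult_ac)
    then have "m * norm ?w \<le> (\<Sum>e\<in>Basis. \<bar>B (q s) e - B z e\<bar>)" using False by simp
    then show ?thesis using m(1) by (simp add: field_simps)
  qed
  have "((\<lambda>s. (\<Sum>e\<in>Basis. \<bar>B (q s) e - B z e\<bar>) / m) \<longlongrightarrow> (\<Sum>e\<in>(Basis::'e set). \<bar>B z e - B z e\<bar>) / m) F"
    using lim m(1) by (intro tendsto_intros) auto
  then have "((\<lambda>s. (\<Sum>e\<in>Basis. \<bar>B (q s) e - B z e\<bar>) / m) \<longlongrightarrow> 0) F" by simp
  then have "((\<lambda>s. norm (q s - z)) \<longlongrightarrow> 0) F"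
    by (rule Lim_null_comparison[rotated]) (simp add: bd)
  then show ?thesis by (simp add: tendsto_norm_zero_iff LIM_zero_iff)
qed

lemma posdef_solve:
  fixes B :: "'e::euclidean_space \<Rightarrow> 'e \<Rightarrow> real"
  assumes B: "bilinear B" and pos: "\<And>z. z \<noteq> 0 \<Longrightarrow> B z z > 0"
  obtains z where "\<And>e. e \<in> Basis \<Longrightarrow> B z e = l e"
proof -
  define L where "L = (\<lambda>z. \<Sum>e\<in>Basis. B z e *\<^sub>R e)"
  have lin: "linear L" unfolding L_def
    by (rule linearI) (simp_all add: bilinear_ladd[OF B] bilinear_lmul[OF B] scaleR_add_left sum.distrib scaleR_sum_right)
  have Le: "L z \<bullet> e = B z e" if "e \<in> Basis" for z e
    unfolding L_def using that by (rule inner_sum_left_Basis)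
  have "z = 0" if "L z = 0" for z
  proof (rule ccontr)
    assume "z \<noteq> 0"
    have "B z e = 0" if "e \<in> Basis" for e
      using Le[OF that, of z] \<open>L z = 0\<close> by simp
    then have "B z z = 0" using bilinear_expand_right[OF B, of z z] by simp
    then show False using pos \<open>z \<noteq> 0\<close> by fastforce
  qed
  then have "inj L" using lin linear_injective_0 by blast
  then have "surj L" using lin linear_injective_imp_surjective by blast
  then obtain z where z: "L z = (\<Sum>e\<in>Basis. l e *\<^sub>R e)" by (metis surjD)
  then have "B z e = l e" if "e \<in> Basis" for e
    using Le[OF that, of z] that unfolding z by (simp add: inner_sum_left_Basis)
  then show thesis using that by blast
qed


lemma bilinear_diff_bound:
  fixes B C :: "'e::euclidean_space \<Rightarrow> 'e \<Rightarrow> real"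
  assumes B: "bilinear B" and C: "bilinear C"
  shows "\<bar>B v w - C v w\<bar> \<le> norm v * norm w * (\<Sum>b\<in>Basis. \<Sum>e\<in>Basis. \<bar>B b e - C b e\<bar>)"
proof -
  have "B v w - C v w = (\<Sum>b\<in>Basis. \<Sum>e\<in>Basis. (v \<bullet> b) * (w \<bullet> e) * (B b e - C b e))"
    by (simp add: bilinear_expand[OF B, of v w] bilinear_expand[OF C, of v w] sum_subtractf right_diff_distrib)
  also have "\<bar>\<dots>\<bar> \<le> (\<Sum>b\<in>Basis. \<Sum>e\<in>Basis. \<bar>(v \<bullet> b) * (w \<bullet> e) * (B b e - C b e)\<bar>)"
    by (rule order.trans[OF sum_abs]) (intro sum_mono sum_abs)
  also have "\<dots> \<le> (\<Sum>b\<in>Basis. \<Sum>e\<in>Basis. norm v * norm w * \<bar>B b e - C b e\<bar>)"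
    unfolding abs_mult using Basis_le_norm by (intro sum_mono mult_right_mono mult_mono) auto
  finally show ?thesis by (simp add: sum_distrib_left)
qed

text \<open>Subtracting the systems at \<open>s\<close> and \<open>t\<close> and testing with the
  increment of \<open>y\<close> itself gives a bound by coercivity at the fixed parameter
  \<open>t\<close>; no uniform lower bound along \<open>J\<close> and no inverse matrix
  enter.\<close>

lemma posdef_solution_continuous:
  fixes B :: "real \<Rightarrow> 'e::euclidean_space \<Rightarrow> 'e \<Rightarrow> real"
  assumes B: "\<And>t. t \<in> J \<Longrightarrow> bilinear (B t)" and pos: "\<And>t z. t \<in> J \<Longrightarrow> z \<noteq> 0 \<Longrightarrow> B t z z > 0"
    and Bc: "\<And>b e. b \<in> Basis \<Longrightarrow> e \<in> Basis \<Longrightarrow> continuous_on J (\<lambda>t. B t b e)"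
    and pc: "\<And>e. e \<in> Basis \<Longrightarrow> continuous_on J (p e)"
    and y: "\<And>t e. t \<in> J \<Longrightarrow> e \<in> Basis \<Longrightarrow> B t (y t) e = p e t"
  shows "continuous_on J y"
  unfolding continuous_on_def
proof
  fix t assume t: "t \<in> J"
  let ?F = "at t within J"
  define D where "D = (\<lambda>s. \<Sum>b\<in>Basis. \<Sum>e\<in>Basis. \<bar>B s b e - B t b e\<bar>)"
  define P where "P = (\<lambda>s. \<Sum>e\<in>Basis. \<bar>p e s - p e t\<bar>)"
  obtain m where m: "m > 0" "\<And>z. m * (norm z)\<^sup>2 \<le> B t z z"
    by (rule posdef_lower_bound[OF B[OF t] pos[OF t]]) (assumption, rule that)
  have D0: "(D \<longlongrightarrow> 0) ?F"
  proof -
    have "(D \<longlongrightarrow> (\<Sum>b\<in>(Basis::'e set). \<Sum>e\<in>(Basis::'e set). \<bar>B t b e - B t b e\<bar>)) ?F"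
      unfolding D_def using Bc t by (intro tendsto_intros) (auto simp: continuous_on_def)
    then show ?thesis by simp
  qed
  have P0: "(P \<longlongrightarrow> 0) ?F"
  proof -
    have "(P \<longlongrightarrow> (\<Sum>e\<in>(Basis::'e set). \<bar>p e t - p e t\<bar>)) ?F"
      unfolding P_def using pc t by (intro tendsto_intros) (auto simp: continuous_on_def)
    then show ?thesis by simp
  qed
  \<comment> \<open>The error term contains the unknown \<open>y s\<close>, estimated by
    \<open>norm w + norm (y t)\<close>. For \<open>D s < m / 2\<close> the part with
    \<open>norm w\<close> is absorbed by half of the left-hand side, whence the factor
    \<open>2 / m\<close>.\<close>
  have bd: "norm (y s - y t) \<le> 2 / m * (norm (y t) * D s + P s)" if s: "s \<in> J" "D s < m / 2" for s
  proof -
    define w where "w = y s - y t"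
    have D_nn: "D s \<ge> 0" "P s \<ge> 0" by (auto simp: D_def P_def intro!: sum_nonneg)
    have "m * (norm w)\<^sup>2 \<le> B t (y s) w - B t (y t) w"
      using m(2)[of w] by (simp add: w_def bilinear_lsub[OF B[OF t]])
    also have "\<dots> = (B t (y s) w - B s (y s) w) + (\<Sum>e\<in>Basis. (w \<bullet> e) * (p e s - p e t))"
      by (simp add: bilinear_expand_right[OF B[OF t], of "y t" w] bilinear_expand_right[OF B[OF s(1)], of "y s" w]
          y[OF t] y[OF s(1)] right_diff_distrib sum_subtractf)
    also have "\<dots> \<le> norm (y s) * norm w * D s + norm w * P s"
    proof (rule add_mono)
      have "D s = (\<Sum>b\<in>Basis. \<Sum>e\<in>Basis. \<bar>B t b e - B s b e\<bar>)" by (simp add: D_def abs_minus_commute)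
      then show "B t (y s) w - B s (y s) w \<le> norm (y s) * norm w * D s"
        using bilinear_diff_bound[OF B[OF t] B[OF s(1)], of "y s" w] by simp
      have "(\<Sum>e\<in>Basis. (w \<bullet> e) * (p e s - p e t)) \<le> (\<Sum>e\<in>Basis. norm w * \<bar>p e s - p e t\<bar>)"
      proof (rule sum_mono)
        fix e :: 'e assume e: "e \<in> Basis"
        have "(w \<bullet> e) * (p e s - p e t) \<le> \<bar>w \<bullet> e\<bar> * \<bar>p e s - p e t\<bar>" by (metis abs_ge_self abs_mult)
        also have "\<dots> \<le> norm w * \<bar>p e s - p e t\<bar>" using Basis_le_norm[OF e] by (intro mult_right_mono) auto
        finally show "(w \<bullet> e) * (p e s - p e t) \<le> norm w * \<bar>p e s - p e t\<bar>" .
      qed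
      then show "(\<Sum>e\<in>Basis. (w \<bullet> e) * (p e s - p e t)) \<le> norm w * P s" by (simp add: P_def sum_distrib_left)
    qed
    also have "\<dots> = norm w * (norm (y s) * D s + P s)" by (simp add: algebra_simps)
    finally have "norm w * (m * norm w) \<le> norm w * (norm (y s) * D s + P s)"
      by (simp add: power2_eq_square mult_ac)
    then have "norm w = 0 \<or> m * norm w \<le> norm (y s) * D s + P s"
      by (metis mult_le_cancel_left norm_ge_zero less_eq_real_def)
    then have "m * norm w \<le> norm (y s) * D s + P s" using D_nn by auto
    moreover have "norm (y s) * D s \<le> (norm w + norm (y t)) * D s"
      unfolding w_def using D_nn by (intro mult_right_mono) (auto intro: order.trans[OF _ norm_triangle_ineq])
    moreover have "norm w * D s \<le> norm w * (m / 2)" using s by (intro mult_left_mono) auto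
    ultimately have "m * norm w \<le> norm w * (m / 2) + norm (y t) * D s + P s"
      by (simp add: distrib_right)
    then show ?thesis using m(1) unfolding w_def by (simp add: field_simps)
  qed
  have "((\<lambda>s. 2 / m * (norm (y t) * D s + P s)) \<longlongrightarrow> 2 / m * (norm (y t) * 0 + 0)) ?F"
    using D0 P0 by (intro tendsto_intros)
  then have "((\<lambda>s. 2 / m * (norm (y t) * D s + P s)) \<longlongrightarrow> 0) ?F" by simp
  moreover have "\<forall>\<^sub>F s in ?F. norm (norm (y s - y t)) \<le> 2 / m * (norm (y t) * D s + P s)"
  proof -
    have "\<forall>\<^sub>F s in ?F. D s < m / 2" using order_tendstoD(2)[OF D0, of "m / 2"] m(1) by simp
    moreover have "\<forall>\<^sub>F s in ?F. s \<in> J" by (simp add: eventually_at_filter)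
    ultimately show ?thesis by eventually_elim (use bd in simp)
  qed
  ultimately have "((\<lambda>s. norm (y s - y t)) \<longlongrightarrow> 0) ?F"
    by (rule Lim_null_comparison[rotated])
  then show "(y \<longlongrightarrow> y t) ?F" by (simp add: tendsto_norm_zero_iff LIM_zero_iff)
qed

text \<open>Differentiating the system gives a system with the same form \<open>B t\<close> for the
  derivative of \<open>y\<close>, so the order of differentiability passes from the data to the
  solution by induction. This is how a velocity inherits the regularity of its momentum.\<close>

lemma Ck_solve:
  fixes B :: "real \<Rightarrow> 'e::euclidean_space \<Rightarrow> 'e \<Rightarrow> real"
  assumes B: "\<And>t. t \<in> J \<Longrightarrow> bilinear (B t)" and pos: "\<And>t z. t \<in> J \<Longrightarrow> z \<noteq> 0 \<Longrightarrow> B t z z > 0"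
    and Bk: "\<And>b e. b \<in> Basis \<Longrightarrow> e \<in> Basis \<Longrightarrow> Ck k J (\<lambda>t. B t b e)"
    and pk: "\<And>e. e \<in> Basis \<Longrightarrow> Ck k J (p e)"
    and y: "\<And>t e. t \<in> J \<Longrightarrow> e \<in> Basis \<Longrightarrow> B t (y t) e = p e t"
  shows "Ck k J y"
  using Bk pk y
proof (induction k arbitrary: y p)
  case 0
  then show ?case using posdef_solution_continuous[of J B p y] B pos by simp
next
  case (Suc k)
  have cont: "continuous_on J y"
    by (rule posdef_solution_continuous[of J B p, OF B pos])
       (use Suc.prems Ck_imp_continuous_on in blast)+
  have "\<forall>b\<in>Basis. \<forall>e\<in>Basis. \<exists>B'. (\<forall>t\<in>J. ((\<lambda>t. B t b e) has_vector_derivative B' t) (at t within J)) \<and> Ck k J B'"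
    using Suc.prems(1) by simp
  then obtain B' where B': "\<And>b e t. b \<in> Basis \<Longrightarrow> e \<in> Basis \<Longrightarrow> t \<in> J \<Longrightarrow> ((\<lambda>t. B t b e) has_vector_derivative B' b e t) (at t within J)"
    "\<And>b e. b \<in> Basis \<Longrightarrow> e \<in> Basis \<Longrightarrow> Ck k J (B' b e)" by metis
  have "\<forall>e\<in>Basis. \<exists>p'. (\<forall>t\<in>J. (p e has_vector_derivative p' t) (at t within J)) \<and> Ck k J p'"
    using Suc.prems(2) by simp
  then obtain p' where p': "\<And>e t. e \<in> Basis \<Longrightarrow> t \<in> J \<Longrightarrow> (p e has_vector_derivative p' e t) (at t within J)"
    "\<And>e. e \<in> Basis \<Longrightarrow> Ck k J (p' e)" by metis
  \<comment> \<open>The right-hand side of the formally differentiated system; \<open>y'\<close> is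
    defined as its solution and only then shown to be the derivative.\<close>
  define q where "q = (\<lambda>e t. p' e t - (\<Sum>b\<in>Basis. (y t \<bullet> b) * B' b e t))"
  have "\<forall>t\<in>J. \<exists>z. \<forall>e\<in>Basis. B t z e = q e t"
  proof
    fix t assume t: "t \<in> J"
    show "\<exists>z. \<forall>e\<in>Basis. B t z e = q e t"
      by (rule posdef_solve[OF B[OF t] pos[OF t], where l="\<lambda>e. q e t"]) auto
  qed
  then obtain y' where y': "\<And>t e. t \<in> J \<Longrightarrow> e \<in> Basis \<Longrightarrow> B t (y' t) e = q e t" by metis
  have der: "(y has_vector_derivative y' t) (at t within J)" if t: "t \<in> J" for t
    unfolding has_vector_derivative_iff_quotient
  proof (rule posdef_tendsto[OF B[OF t] pos[OF t]])
    fix e :: 'e assume e: "e \<in> Basis"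
    let ?R = "\<lambda>s. (p e s - p e t) /\<^sub>R (s - t) - (\<Sum>b\<in>Basis. (y s \<bullet> b) * ((B s b e - B t b e) /\<^sub>R (s - t)))"
    have "(?R \<longlongrightarrow> p' e t - (\<Sum>b\<in>Basis. (y t \<bullet> b) * B' b e t)) (at t within J)"
    proof (intro tendsto_intros)
      show "((\<lambda>s. (p e s - p e t) /\<^sub>R (s - t)) \<longlongrightarrow> p' e t) (at t within J)"
        using p'(1)[OF e t] by (simp add: has_vector_derivative_iff_quotient)
      show "(y \<longlongrightarrow> y t) (at t within J)" using cont t by (simp add: continuous_on_def)
      fix b :: 'e assume b: "b \<in> Basis"
      show "((\<lambda>s. (B s b e - B t b e) /\<^sub>R (s - t)) \<longlongrightarrow> B' b e t) (at t within J)"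
        using B'(1)[OF b e t] by (simp add: has_vector_derivative_iff_quotient)
    qed
    moreover have "\<forall>\<^sub>F s in at t within J. B t ((y s - y t) /\<^sub>R (s - t)) e = ?R s"
      unfolding eventually_at_filter
    proof (rule eventuallyI, intro impI)
      fix s assume st: "s \<noteq> t" and s: "s \<in> J"
      have exp: "B r z e = (\<Sum>b\<in>Basis. (z \<bullet> b) * B r b e)" if "r \<in> J" for r z
      proof -
        have "bilinear (\<lambda>x y. B r y x)" using B[OF that] by (simp add: bilinear_def)
        from bilinear_expand_right[OF this] show ?thesis .
      qed
      have "B t (y s) e - B t (y t) e = (p e s - p e t) - (\<Sum>b\<in>Basis. (y s \<bullet> b) * (B s b e - B t b e))"
        using exp[OF t, of "y s"] exp[OF s, of "y s"] Suc.prems(3)[OF s e] Suc.prems(3)[OF t e]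
        by (simp add: right_diff_distrib sum_subtractf)
      then show "B t ((y s - y t) /\<^sub>R (s - t)) e = ?R s"
        by (simp add: bilinear_lmul[OF B[OF t]] bilinear_lsub[OF B[OF t]] right_diff_distrib sum_distrib_left mult_ac)
    qed
    ultimately show "((\<lambda>s. B t ((y s - y t) /\<^sub>R (s - t)) e) \<longlongrightarrow> B t (y' t) e) (at t within J)"
      unfolding y'[OF t e] q_def by (rule tendsto_cong[THEN iffD2, rotated])
  qed
  have yk: "Ck k J y"
  proof (rule Suc.IH)
    show "\<And>b e. b \<in> Basis \<Longrightarrow> e \<in> Basis \<Longrightarrow> Ck k J (\<lambda>t. B t b e)" using Suc.prems(1) Ck_Suc_imp by blast
    show "\<And>e. e \<in> Basis \<Longrightarrow> Ck k J (p e)" using Suc.prems(2) Ck_Suc_imp by blast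
  qed (rule Suc.prems(3))
  have "Ck k J (\<lambda>t. p' e t + (\<Sum>b\<in>Basis. (-1) * ((y t \<bullet> b) * B' b e t)))" if "e \<in> Basis" for e
    using p'(2) B'(2) yk that by (intro Ck_add Ck_sum Ck_mult Ck_inner Ck_const) auto
  then have "Ck k J (q e)" if "e \<in> Basis" for e
    unfolding q_def using that by (simp add: sum_negf)
  moreover have "Ck k J (\<lambda>t. B t b e)" if "b \<in> Basis" "e \<in> Basis" for b e
    using Suc.prems(1)[OF that] Ck_Suc_imp by blast
  ultimately have "Ck k J y'" by (intro Suc.IH[of q y'] y')
  then show ?case using der unfolding Ck.simps by (intro exI[of _ y'] conjI ballI)
qed

section \<open>Slopes\<close>

text \<open>A one-sided infinitesimal bound suffices: after a small slope is subtracted, the last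
  parameter at which \<open>G\<close> is nonpositive cannot lie before \<open>b\<close>. It will be
  applied to the distance along a curve, which is not known to be differentiable.\<close>

lemma dini_nonincreasing:
  fixes F :: "real \<Rightarrow> real"
  assumes "a \<le> b" and cont: "continuous_on {a..b} F"
    and dini: "\<And>s \<epsilon>. a \<le> s \<Longrightarrow> s < b \<Longrightarrow> \<epsilon> > 0 \<Longrightarrow>
      \<exists>\<delta>>0. \<forall>t. s < t \<and> t < s + \<delta> \<and> t \<le> b \<longrightarrow> F t \<le> F s + \<epsilon> * (t - s)"
  shows "F b \<le> F a"
proof (rule field_le_epsilon)
  fix e :: real assume "e > 0"
  \<comment> \<open>The slack accumulated over the whole interval is then at most \<open>e\<close>;
    the summand 1 in the denominator covers \<open>a = b\<close>.\<close>
  define \<epsilon> where "\<epsilon> = e / (b - a + 1)"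
  have \<epsilon>: "\<epsilon> > 0" "\<epsilon> * (b - a) \<le> e"
    using \<open>e > 0\<close> assms(1) by (auto simp: \<epsilon>_def field_simps)
  define G where "G = (\<lambda>t. F t - F a - \<epsilon> * (t - a))"
  have "G b \<le> 0"
  proof (rule ccontr)
    assume Gb: "\<not> G b \<le> 0"
    let ?Z = "{a..b} \<inter> G -` {..0}"
    have "closed ?Z" unfolding G_def
      by (intro continuous_closed_preimage continuous_intros cont)
    then have "compact ?Z" by (metis compact_Icc compact_Int_closed inf_left_idem)
    moreover have "a \<in> ?Z" using assms(1) by (simp add: G_def)
    ultimately have "\<exists>c\<in>?Z. \<forall>t\<in>?Z. t \<le> c" by (intro compact_attains_sup) auto
    then obtain c where c: "a \<le> c" "c \<le> b" "G c \<le> 0" "\<And>t. a \<le> t \<Longrightarrow> t \<le> b \<Longrightarrow> G t \<le> 0 \<Longrightarrow> t \<le> c" by auto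
    have "c < b" using c(2,3) Gb by (metis less_eq_real_def)
    obtain \<delta> where \<delta>: "\<delta> > 0" "\<And>t. c < t \<Longrightarrow> t < c + \<delta> \<Longrightarrow> t \<le> b \<Longrightarrow> F t \<le> F c + \<epsilon> * (t - c)"
      using dini[OF c(1) \<open>c < b\<close> \<epsilon>(1)] by blast
    define t where "t = min b (c + \<delta> / 2)"
    have t: "c < t" "t < c + \<delta>" "t \<le> b" using \<open>c < b\<close> \<delta>(1) by (auto simp: t_def)
    have "G t \<le> G c" using \<delta>(2)[OF t] by (simp add: G_def algebra_simps)
    then show False using c(3) c(4)[of t] t c(1) by auto
  qed
  then show "F b \<le> F a + e" using \<epsilon>(2) by (simp add: G_def)
qed

definition slope :: "(real \<Rightarrow> 'e::real_normed_vector) \<Rightarrow> real \<Rightarrow> real \<Rightarrow> 'e" where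
  "slope u s t = (u t - u s) /\<^sub>R (t - s)"

lemma slope_commute: "slope u s t = slope u t s"
proof -
  have "inverse (t - s) = - inverse (s - t)" by (metis inverse_minus_eq minus_diff_eq)
  then show ?thesis by (simp add: slope_def algebra_simps)
qed

text \<open>The three-point estimate below says that \<open>u\<close> is almost affine at every scale; the
  constant 4 in the conclusion is a solution of \<open>1 + C / sqrt 2 \<le> C\<close>.\<close>

lemma slope_limit_right:
  fixes u :: "real \<Rightarrow> 'e::banach"
  assumes K: "K \<ge> 0"
    and H: "\<And>s t r. a \<le> s \<Longrightarrow> s < t \<Longrightarrow> t < r \<Longrightarrow> r \<le> b \<Longrightarrow>
       (t - s) * (r - t) * (norm (slope u s t - slope u t r))\<^sup>2 \<le> K * (r - s) ^ 3"
  shows "\<exists>v. \<forall>s t. a \<le> s \<longrightarrow> s < t \<longrightarrow> t \<le> b \<longrightarrow> norm (slope u s t - v s) \<le> 4 * sqrt (K * (t - s))"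
proof -
  \<comment> \<open>Lengthening \<open>{s..t}\<close> to \<open>{s..r}\<close> by at most its own
    length: the slope moves by \<open>\<beta> / (\<alpha> + \<beta>)\<close> times the gap of the
    two partial slopes, and \<open>\<beta> \<le> \<alpha>\<close> removes the remaining quotient
    \<open>\<beta> / \<alpha>\<close>.\<close>
  have mid: "norm (slope u s r - slope u s t) \<le> sqrt (K * (r - s))"
    if "a \<le> s" "s < t" "t < r" "r \<le> b" "r - t \<le> t - s" for s t r
  proof -
    define \<alpha> \<beta> where "\<alpha> = t - s" and "\<beta> = r - t"
    have pos: "\<alpha> > 0" "\<beta> > 0" "\<beta> \<le> \<alpha>" "r - s = \<alpha> + \<beta>" using that by (auto simp: \<alpha>_def \<beta>_def)
    define N where "N = norm (slope u s t - slope u t r)"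
    have "slope u s r - slope u s t = (\<beta> / (\<alpha> + \<beta>)) *\<^sub>R (slope u t r - slope u s t)"
    proof -
      have "u r - u s = \<alpha> *\<^sub>R slope u s t + \<beta> *\<^sub>R slope u t r"
        using pos by (simp add: slope_def \<alpha>_def \<beta>_def)
      then have "slope u s r = (\<alpha> / (\<alpha> + \<beta>)) *\<^sub>R slope u s t + (\<beta> / (\<alpha> + \<beta>)) *\<^sub>R slope u t r"
        using pos by (simp add: slope_def[of u s r] scaleR_add_right divide_inverse mult.commute)
      moreover have "\<alpha> / (\<alpha> + \<beta>) = 1 - \<beta> / (\<alpha> + \<beta>)" using pos by (simp add: field_simps)
      ultimately show ?thesis by (simp add: algebra_simps)
    qed
    then have eq: "norm (slope u s r - slope u s t) = \<beta> / (\<alpha> + \<beta>) * N"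
      using pos by (simp add: N_def norm_minus_commute)
    have "\<alpha> * \<beta> * N\<^sup>2 \<le> K * (\<alpha> + \<beta>) ^ 3"
      using H[OF that(1-4)] by (simp add: \<alpha>_def \<beta>_def N_def)
    have "(\<beta> / (\<alpha> + \<beta>) * N)\<^sup>2 = (\<beta> / \<alpha>) * (\<alpha> * \<beta> * N\<^sup>2) / (\<alpha> + \<beta>)\<^sup>2"
      using pos by (simp add: power2_eq_square field_simps)
    also have "\<dots> \<le> (\<beta> / \<alpha>) * (K * (\<alpha> + \<beta>) ^ 3) / (\<alpha> + \<beta>)\<^sup>2"
      using \<open>\<alpha> * \<beta> * N\<^sup>2 \<le> _\<close> pos by (intro divide_right_mono mult_left_mono) auto
    also have "\<dots> = (\<beta> / \<alpha>) * (K * (\<alpha> + \<beta>))"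
      using pos by (simp add: power2_eq_square power3_eq_cube)
    also have "\<dots> \<le> 1 * (K * (\<alpha> + \<beta>))"
      using pos K by (intro mult_right_mono) auto
    finally have "\<beta> / (\<alpha> + \<beta>) * N \<le> sqrt (K * (\<alpha> + \<beta>))" by (simp add: real_le_rsqrt)
    then show ?thesis using eq pos by simp
  qed
  \<comment> \<open>The interval is halved until its length is comparable with \<open>t - s\<close>.
    Each halving costs \<open>sqrt (K * l)\<close> with \<open>l\<close> the current length, so the
    costs form a geometric series of ratio \<open>1 / sqrt 2\<close>.\<close>
  have rec: "norm (slope u s r - slope u s t) \<le> 4 * sqrt (K * (r - s))"
    if "a \<le> s" "s < t" "t \<le> r" "r \<le> b" "s + (r - s) / 2 ^ n \<le> t" for s t r n
    using that
  proof (induction n arbitrary: r)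
    case 0
    then have "t = r" by simp
    then show ?case using K 0 by simp
  next
    case (Suc n)
    define m where "m = (s + r) / 2"
    have m: "s < m" "m < r" "r - m = m - s" "m - s = (r - s) / 2" using Suc.prems by (auto simp: m_def field_simps)
    have sq: "0 \<le> sqrt (K * (r - s))" using K Suc.prems by simp
    show ?case
    proof (cases "m \<le> t")
      case True
      show ?thesis
      proof (cases "t = r")
        case False
        then have "norm (slope u s r - slope u s t) \<le> sqrt (K * (r - s))"
          using Suc.prems True m by (intro mid) auto
        then show ?thesis using sq by linarith
      qed (use sq in simp)
    next
      case False
      have 1: "norm (slope u s r - slope u s m) \<le> sqrt (K * (r - s))"
        using Suc.prems m by (intro mid) auto
      have 2: "norm (slope u s m - slope u s t) \<le> 4 * sqrt (K * (m - s))"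
      proof (rule Suc.IH)
        show "s + (m - s) / 2 ^ n \<le> t" using Suc.prems(5) by (simp add: m(4))
      qed (use Suc.prems m False in auto)
      have "sqrt (K * (m - s)) = sqrt (K * (r - s)) / sqrt 2"
        unfolding m(4) by (simp add: real_sqrt_divide[symmetric])
      moreover have "4 / sqrt 2 \<le> (3::real)"
      proof -
        have "4 / 3 \<le> sqrt (2::real)" by (rule real_le_rsqrt) (simp add: power2_eq_square)
        then show ?thesis by (simp add: field_simps)
      qed
      then have "4 / sqrt 2 * sqrt (K * (r - s)) \<le> 3 * sqrt (K * (r - s))"
        using sq by (rule mult_right_mono)
      ultimately have "4 * sqrt (K * (m - s)) \<le> 3 * sqrt (K * (r - s))" by simp
      moreover have "norm (slope u s r - slope u s t) \<le> norm (slope u s r - slope u s m) + norm (slope u s m - slope u s t)"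
        using norm_triangle_ineq[of "slope u s r - slope u s m" "slope u s m - slope u s t"] by simp
      ultimately show ?thesis using 1 2 by linarith
    qed
  qed
  have ex: "\<exists>v. \<forall>t. s < t \<longrightarrow> t \<le> b \<longrightarrow> norm (slope u s t - v) \<le> 4 * sqrt (K * (t - s))" if s: "a \<le> s" "s < b" for s
  proof -
    define X where "X = (\<lambda>n. slope u s (s + (b - s) / 2 ^ n))"
    have to_s: "(\<lambda>n. (b - s) / 2 ^ n) \<longlonglongrightarrow> 0"
      using LIMSEQ_divide_realpow_zero[of 2 "b - s"] by simp
    have X: "norm (slope u s t - X n) \<le> 4 * sqrt (K * (t - s))"
      if t: "s < t" "t \<le> b" "s + (b - s) / 2 ^ n \<le> t" for t n
    proof -
      obtain k where k: "(t - s) / 2 ^ k \<le> (b - s) / 2 ^ n"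
      proof -
        have "(\<lambda>k. (t - s) / 2 ^ k) \<longlonglongrightarrow> 0"
          using LIMSEQ_divide_realpow_zero[of 2 "t - s"] by simp
        then have "\<forall>\<^sub>F k in sequentially. (t - s) / 2 ^ k < (b - s) / 2 ^ n"
          using s by (intro order_tendstoD(2)) auto
        then show ?thesis using that by (meson eventually_sequentially less_imp_le order_refl)
      qed
      show ?thesis unfolding X_def
        by (rule rec[where n=k]) (use s t k in auto)
    qed
    have "Cauchy X"
    proof (rule CauchyI)
      fix e :: real assume e: "e > 0"
      have "(\<lambda>n. 8 * sqrt (K * ((b - s) / 2 ^ n))) \<longlonglongrightarrow> 8 * sqrt (K * 0)"
        using to_s by (intro tendsto_intros)
      then have "\<forall>\<^sub>F n in sequentially. 8 * sqrt (K * ((b - s) / 2 ^ n)) < e"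
        using e by (intro order_tendstoD(2)) auto
      then obtain M where M: "8 * sqrt (K * ((b - s) / 2 ^ M)) < e" by (auto simp: eventually_sequentially)
      have *: "norm (X M - X n) \<le> 4 * sqrt (K * ((b - s) / 2 ^ M))" if "n \<ge> M" for n
      proof -
        have "(b - s) / 2 ^ n \<le> (b - s) / 2 ^ M" using s that by (intro divide_left_mono) auto
        moreover have "(b - s) / 2 ^ M \<le> (b - s) / 1" using s by (intro divide_left_mono) auto
        ultimately show ?thesis
          using X[of "s + (b - s) / 2 ^ M" n] s by (simp add: X_def)
      qed
      show "\<exists>M. \<forall>m\<ge>M. \<forall>n\<ge>M. norm (X m - X n) < e"
      proof (intro exI allI impI)
        fix m n assume "m \<ge> M" "n \<ge> M"
        then show "norm (X m - X n) < e"
          using *[of m] *[of n] M norm_triangle_ineq[of "X m - X M" "X M - X n"] by (simp add: norm_minus_commute)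
      qed
    qed
    then obtain v where v: "X \<longlonglongrightarrow> v" using Cauchy_convergent convergent_def by blast
    show ?thesis
    proof (intro exI allI impI)
      fix t assume t: "s < t" "t \<le> b"
      have "\<forall>\<^sub>F n in sequentially. (b - s) / 2 ^ n < t - s"
        using to_s t by (intro order_tendstoD(2)) auto
      then have "\<forall>\<^sub>F n in sequentially. norm (slope u s t - X n) \<le> 4 * sqrt (K * (t - s))"
        by eventually_elim (use X t in auto)
      moreover have "(\<lambda>n. norm (slope u s t - X n)) \<longlonglongrightarrow> norm (slope u s t - v)"
        using v by (intro tendsto_intros)
      ultimately show "norm (slope u s t - v) \<le> 4 * sqrt (K * (t - s))"
        using tendsto_upperbound sequentially_bot by blast
    qed
  qed
  have "\<forall>s. \<exists>v. a \<le> s \<longrightarrow> (\<forall>t. s < t \<longrightarrow> t \<le> b \<longrightarrow> norm (slope u s t - v) \<le> 4 * sqrt (K * (t - s)))"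
  proof (intro allI)
    fix s show "\<exists>v. a \<le> s \<longrightarrow> (\<forall>t. s < t \<longrightarrow> t \<le> b \<longrightarrow> norm (slope u s t - v) \<le> 4 * sqrt (K * (t - s)))"
    proof (cases "a \<le> s \<and> s < b")
      case True then show ?thesis using ex[of s] by simp
    next
      case False then show ?thesis by auto
    qed
  qed
  then obtain v where "\<forall>s. a \<le> s \<longrightarrow> (\<forall>t. s < t \<longrightarrow> t \<le> b \<longrightarrow> norm (slope u s t - v s) \<le> 4 * sqrt (K * (t - s)))"
    by (elim choice[THEN exE])
  then show ?thesis by (intro exI[of _ v]) simp
qed

text \<open>Slopes have limits from the right and, by reversing time, from the left. At an interior
  point the three-point estimate on symmetric intervals forces the two limits to agree. Continuity
  of the derivative follows because its values at \<open>s\<close> and at \<open>t\<close> are both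
  close to the same slope between \<open>s\<close> and \<open>t\<close>.\<close>

lemma slopes_imp_C1:
  fixes u :: "real \<Rightarrow> 'e::banach"
  assumes ab: "a < b" and K: "K \<ge> 0"
    and H: "\<And>s t r. a \<le> s \<Longrightarrow> s < t \<Longrightarrow> t < r \<Longrightarrow> r \<le> b \<Longrightarrow>
       (t - s) * (r - t) * (norm (slope u s t - slope u t r))\<^sup>2 \<le> K * (r - s) ^ 3"
  obtains u' where "\<And>t. t \<in> {a..b} \<Longrightarrow> (u has_vector_derivative u' t) (at t within {a..b})"
    "continuous_on {a..b} u'"
proof -
  obtain v where v: "\<And>s t. a \<le> s \<Longrightarrow> s < t \<Longrightarrow> t \<le> b \<Longrightarrow> norm (slope u s t - v s) \<le> 4 * sqrt (K * (t - s))"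
    using slope_limit_right[OF K H] by blast
  define z where "z = (\<lambda>t. u (- t))"
  have z: "slope z s t = - slope u (-t) (-s)" for s t
    unfolding slope_def z_def by (simp add: algebra_simps)
  have "\<exists>v. \<forall>s t. -b \<le> s \<longrightarrow> s < t \<longrightarrow> t \<le> -a \<longrightarrow> norm (slope z s t - v s) \<le> 4 * sqrt (K * (t - s))"
  proof (rule slope_limit_right[OF K])
    fix s t r assume "-b \<le> s" "s < t" "t < r" "r \<le> -a"
    then have "(-t - -r) * (-s - -t) * (norm (slope u (-r) (-t) - slope u (-t) (-s)))\<^sup>2 \<le> K * (-s - -r) ^ 3"
      by (intro H) auto
    then show "(t - s) * (r - t) * (norm (slope z s t - slope z t r))\<^sup>2 \<le> K * (r - s) ^ 3"
      unfolding z by (simp add: mult_ac)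
  qed
  then obtain w0 where w0: "\<And>s t. -b \<le> s \<Longrightarrow> s < t \<Longrightarrow> t \<le> -a \<Longrightarrow> norm (slope z s t - w0 s) \<le> 4 * sqrt (K * (t - s))"
    by blast
  define w where "w = (\<lambda>s. - w0 (- s))"
  have w: "norm (slope u s t - w s) \<le> 4 * sqrt (K * (s - t))" if "a \<le> t" "t < s" "s \<le> b" for s t
  proof -
    have "norm (slope z (-s) (-t) - w0 (-s)) \<le> 4 * sqrt (K * (-t - -s))"
      using that by (intro w0) auto
    moreover have "slope z (-s) (-t) - w0 (-s) = - (slope u s t - w s)"
      unfolding z w_def by (simp add: slope_commute[of u t s])
    ultimately show ?thesis by (simp add: norm_minus_commute)
  qed
  have wv: "w s = v s" if s: "a < s" "s < b" for s
  proof -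
    have "norm (w s - v s) \<le> 12 * sqrt (K * \<eta>)" if \<eta>: "0 < \<eta>" "\<eta> < min (s - a) (b - s)" for \<eta>
    proof -
      let ?X = "slope u (s - \<eta>) s" and ?Y = "slope u s (s + \<eta>)"
      have "\<eta> * \<eta> * (norm (?X - ?Y))\<^sup>2 \<le> K * (2 * \<eta>) ^ 3"
        using H[of "s - \<eta>" s "s + \<eta>"] \<eta> s by simp
      then have "\<eta>\<^sup>2 * (norm (?X - ?Y))\<^sup>2 \<le> \<eta>\<^sup>2 * (8 * (K * \<eta>))"
        by (simp add: power2_eq_square power3_eq_cube mult_ac)
      then have "(norm (?X - ?Y))\<^sup>2 \<le> 8 * (K * \<eta>)" using \<eta> by simp
      then have "norm (?X - ?Y) \<le> sqrt (16 * (K * \<eta>))"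
        using K \<eta> by (intro real_le_rsqrt) (simp add: order.trans[OF _ mult_right_mono])
      then have "norm (?X - ?Y) \<le> 4 * sqrt (K * \<eta>)" by (simp add: real_sqrt_mult)
      moreover have "norm (?X - w s) \<le> 4 * sqrt (K * \<eta>)"
        using w[of "s - \<eta>" s] \<eta> s by (simp add: slope_commute[of u s])
      moreover have "norm (?Y - v s) \<le> 4 * sqrt (K * \<eta>)"
        using v[of s "s + \<eta>"] \<eta> s by simp
      moreover have "norm (w s - v s) \<le> norm (?X - w s) + norm (?X - ?Y) + norm (?Y - v s)"
        using norm_triangle_ineq[of "w s - ?X" "?X - v s"] norm_triangle_ineq[of "?X - ?Y" "?Y - v s"]
        by (simp add: norm_minus_commute)
      ultimately show ?thesis by linarith
    qed
    then have "\<forall>\<^sub>F \<eta> in at_right 0. norm (w s - v s) \<le> 12 * sqrt (K * \<eta>)"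
      using s by (intro eventually_at_rightI[of 0 "min (s - a) (b - s)"]) auto
    moreover have "((\<lambda>\<eta>. 12 * sqrt (K * \<eta>)) \<longlongrightarrow> 12 * sqrt (K * 0)) (at_right 0)"
      by (intro tendsto_intros)
    ultimately have "norm (w s - v s) \<le> 12 * sqrt (K * 0)"
      using tendsto_lowerbound trivial_limit_at_right_real by blast
    then show ?thesis by simp
  qed
  \<comment> \<open>At \<open>b\<close> there are no slopes to the right, so the limit from the left
    is taken.\<close>
  define u' where "u' = (\<lambda>s. if s < b then v s else w s)"
  have est: "norm (slope u s t - u' s) \<le> 4 * sqrt (K * \<bar>t - s\<bar>)" if "s \<in> {a..b}" "t \<in> {a..b}" "s \<noteq> t" for s t
  proof (cases "s < t")
    case True then show ?thesis using that v[of s t] by (simp add: u'_def)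
  next
    case False
    then have "u' s = w s" using that wv[of s] by (auto simp: u'_def)
    then show ?thesis using False that w[of t s] by simp
  qed
  have lim: "((\<lambda>t. c * sqrt (K * \<bar>t - s\<bar>)) \<longlongrightarrow> 0) (at s within {a..b})" for c s
  proof -
    have "((\<lambda>t. c * sqrt (K * \<bar>t - s\<bar>)) \<longlongrightarrow> c * sqrt (K * \<bar>s - s\<bar>)) (at s within {a..b})"
      by (intro tendsto_intros)
    then show ?thesis by simp
  qed
  show thesis
  proof
    fix s assume s: "s \<in> {a..b}"
    have "((\<lambda>t. slope u s t - u' s) \<longlongrightarrow> 0) (at s within {a..b})"
      by (rule Lim_null_comparison[OF _ lim[of 4 s]]) (use est s in \<open>auto simp: eventually_at_filter\<close>)
    then show "(u has_vector_derivative u' s) (at s within {a..b})"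
      unfolding has_vector_derivative_iff_quotient slope_def by (simp add: LIM_zero_iff)
  next
    show "continuous_on {a..b} u'" unfolding continuous_on_def
    proof
      fix s assume s: "s \<in> {a..b}"
      have "norm (u' t - u' s) \<le> 8 * sqrt (K * \<bar>t - s\<bar>)" if "t \<in> {a..b}" "t \<noteq> s" for t
        using est[OF s that(1)] est[OF that(1) s] that(2) norm_triangle_ineq[of "u' t - slope u s t" "slope u s t - u' s"]
        by (simp add: slope_commute[of u t s] norm_minus_commute abs_minus_commute)
      then have "((\<lambda>t. u' t - u' s) \<longlongrightarrow> 0) (at s within {a..b})"
        by (intro Lim_null_comparison[OF _ lim[of 8 s]]) (auto simp: eventually_at_filter)
      then show "(u' \<longlongrightarrow> u' s) (at s within {a..b})" by (simp add: LIM_zero_iff)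
    qed
  qed
qed

section \<open>Isometric paths in a local metric\<close>

lemma finite_uniform_bound:
  fixes P :: "'i \<Rightarrow> real \<Rightarrow> bool"
  assumes "finite I" and ex: "\<And>i. i \<in> I \<Longrightarrow> \<exists>L. P i L"
    and mono: "\<And>i L L'. P i L \<Longrightarrow> L \<le> L' \<Longrightarrow> P i L'"
  obtains L where "L \<ge> 0" "\<And>i. i \<in> I \<Longrightarrow> P i L"
proof -
  obtain f where f: "\<And>i. i \<in> I \<Longrightarrow> P i (f i)" using ex by metis
  show thesis
  proof
    show "(\<Sum>i\<in>I. \<bar>f i\<bar>) \<ge> 0" by (simp add: sum_nonneg)
    fix i assume i: "i \<in> I"
    have "\<bar>f i\<bar> \<le> (\<Sum>i\<in>I. \<bar>f i\<bar>)" using assms(1) i by (intro member_le_sum) auto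
    then show "P i (\<Sum>i\<in>I. \<bar>f i\<bar>)" using f[OF i] mono by (metis abs_ge_self order_trans)
  qed
qed

lemma real_analytic_bounded_lipschitz:
  fixes F :: "'e::euclidean_space \<Rightarrow> real"
  assumes S: "open S" "real_analytic_on S F" and K: "compact K" "convex K" "K \<subseteq> S"
  obtains L where "L \<ge> 0" "\<And>x. x \<in> K \<Longrightarrow> \<bar>F x\<bar> \<le> L" "\<And>x y. x \<in> K \<Longrightarrow> y \<in> K \<Longrightarrow> \<bar>F x - F y\<bar> \<le> L * norm (x - y)"
proof -
  note fd = real_analytic_frechet_derivative[OF S]
  have bd: "\<exists>L. \<forall>x\<in>K. \<bar>G x\<bar> \<le> L" if "real_analytic_on S G" for G :: "'e \<Rightarrow> real"
  proof -
    have "continuous_on K G" using real_analytic_continuous_on[OF S(1) that] K(3) continuous_on_subset by blast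
    then have "bounded (G ` K)" using K(1) compact_continuous_image compact_imp_bounded by blast
    then show ?thesis by (auto simp: bounded_iff)
  qed
  obtain L0 where L0: "\<And>x. x \<in> K \<Longrightarrow> \<bar>F x\<bar> \<le> L0" using bd[OF S(2)] by blast
  obtain B where B: "B \<ge> 0" "\<And>b. b \<in> Basis \<Longrightarrow> \<forall>x\<in>K. \<bar>frechet_derivative F (at x) b\<bar> \<le> B"
    by (rule finite_uniform_bound[of "Basis::'e set" "\<lambda>b L. \<forall>x\<in>K. \<bar>frechet_derivative F (at x) b\<bar> \<le> L"])
       (simp, rule bd[OF fd(2)], assumption, force, rule that)
  define L where "L = \<bar>L0\<bar> + B * DIM('e)"
  show thesis
  proof
    show "L \<ge> 0" using B by (simp add: L_def)
    show "\<bar>F x\<bar> \<le> L" if "x \<in> K" for x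
    proof -
      have "0 \<le> B * DIM('e)" using B by simp
      then show ?thesis using L0[OF that] by (simp add: L_def)
    qed
    fix x y assume xy: "x \<in> K" "y \<in> K"
    have "norm (F x - F y) \<le> B * DIM('e) * norm (x - y)"
    proof (rule differentiable_bound[OF K(2) _ _ xy])
      fix z assume z: "z \<in> K"
      show "(F has_derivative frechet_derivative F (at z)) (at z within K)"
        using fd(1) z K(3) has_derivative_at_withinI by blast
      show "onorm (frechet_derivative F (at z)) \<le> B * DIM('e)"
      proof (rule onorm_le)
        fix w
        have "F differentiable (at z)" using fd(1) z K(3) by (auto simp: differentiable_def)
        then have "frechet_derivative F (at z) w = (\<Sum>b\<in>Basis. (w \<bullet> b) * frechet_derivative F (at z) b)"
          by (rule frechet_derivative_expand)
        also have "norm \<dots> \<le> (\<Sum>b\<in>(Basis::'e set). norm w * B)"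
          using B z Basis_le_norm by (intro sum_norm_le) (auto simp: abs_mult intro!: mult_mono)
        finally show "norm (frechet_derivative F (at z) w) \<le> B * DIM('e) * norm w" by (simp add: mult_ac)
      qed
    qed
    also have "\<dots> \<le> L * norm (x - y)" by (intro mult_right_mono) (auto simp: L_def)
    finally show "\<bar>F x - F y\<bar> \<le> L * norm (x - y)" by simp
  qed
qed

text \<open>A Riemannian metric read in one chart: \<open>S\<close> is the image of the chart domain
  and \<open>h x\<close> the inner product at the point with coordinates \<open>x\<close>.\<close>

locale local_metric =
  fixes S :: "'e::euclidean_space set" and h :: "'e \<Rightarrow> 'e \<Rightarrow> 'e \<Rightarrow> real"
  assumes open_S: "open S"
    and bil: "\<And>x. x \<in> S \<Longrightarrow> bilinear (h x)"
    and sym: "\<And>x u v. x \<in> S \<Longrightarrow> h x u v = h x v u"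
    and pos: "\<And>x u. x \<in> S \<Longrightarrow> u \<noteq> 0 \<Longrightarrow> h x u u > 0"
    and ana: "\<And>u v. real_analytic_on S (\<lambda>x. h x u v)"
begin

definition nrm :: "'e \<Rightarrow> 'e \<Rightarrow> real" where "nrm x v = sqrt (h x v v)"

definition dh :: "'e \<Rightarrow> 'e \<Rightarrow> 'e \<Rightarrow> 'e \<Rightarrow> real" where
  "dh x w u v = frechet_derivative (\<lambda>y. h y u v) (at x) w"

lemma h_nonneg: "x \<in> S \<Longrightarrow> h x v v \<ge> 0"
  using pos[of x v] bilinear_lzero[OF bil] by (cases "v = 0") (auto intro: less_imp_le)

lemma nrm_sq: "x \<in> S \<Longrightarrow> (nrm x v)\<^sup>2 = h x v v"
  by (simp add: nrm_def h_nonneg)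

lemma nrm_nonneg: "x \<in> S \<Longrightarrow> nrm x v \<ge> 0"
  by (simp add: nrm_def h_nonneg)

lemma nrm_scaleR: "x \<in> S \<Longrightarrow> nrm x (c *\<^sub>R v) = \<bar>c\<bar> * nrm x v"
  unfolding nrm_def
  by (simp add: bilinear_lmul[OF bil] bilinear_rmul[OF bil] real_sqrt_mult flip: mult.assoc)

lemma nrm_minus: "x \<in> S \<Longrightarrow> nrm x (- v) = nrm x v"
  using nrm_scaleR[of x "-1" v] by simp

lemma h_has_derivative: "x \<in> S \<Longrightarrow> ((\<lambda>y. h y u v) has_derivative (\<lambda>w. dh x w u v)) (at x)"
  unfolding dh_def by (rule real_analytic_frechet_derivative(1)[OF open_S ana])

lemma dh_expand:
  assumes x: "x \<in> S"
  shows "dh x w u v = (\<Sum>b\<in>Basis. \<Sum>c\<in>Basis. (u \<bullet> b) * (v \<bullet> c) * dh x w b c)"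
proof -
  have "((\<lambda>y. \<Sum>b\<in>Basis. \<Sum>c\<in>Basis. (u \<bullet> b) * (v \<bullet> c) * h y b c) has_derivative
      (\<lambda>w. \<Sum>b\<in>Basis. \<Sum>c\<in>Basis. (u \<bullet> b) * (v \<bullet> c) * dh x w b c)) (at x)"
    by (intro has_derivative_sum has_derivative_mult_right h_has_derivative[OF x])
  then have "((\<lambda>y. h y u v) has_derivative
      (\<lambda>w. \<Sum>b\<in>Basis. \<Sum>c\<in>Basis. (u \<bullet> b) * (v \<bullet> c) * dh x w b c)) (at x)"
    by (rule has_derivative_transform_within_open[OF _ open_S x]) (simp add: bilinear_expand[OF bil, symmetric])
  from has_derivative_unique[OF h_has_derivative[OF x] this]
  show ?thesis by (rule fun_cong)
qed

lemma dh_linear: "x \<in> S \<Longrightarrow> linear (\<lambda>w. dh x w u v)"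
  using has_derivative_linear[OF h_has_derivative] by simp

lemma dh_expand_dir:
  assumes x: "x \<in> S" shows "dh x w u v = (\<Sum>a\<in>Basis. (w \<bullet> a) * dh x a u v)"
  unfolding dh_def by (rule frechet_derivative_expand) (use h_has_derivative[OF x] in \<open>auto simp: differentiable_def\<close>)

lemma dh_bilinear: "x \<in> S \<Longrightarrow> bilinear (dh x w)"
proof -
  assume x: "x \<in> S"
  have "bilinear (\<lambda>u v. \<Sum>b\<in>Basis. \<Sum>c\<in>Basis. (u \<bullet> b) * (v \<bullet> c) * G b c)" for G :: "'e \<Rightarrow> 'e \<Rightarrow> real"
    unfolding bilinear_def
    by (intro conjI allI linearI)
       (simp_all add: inner_add_left algebra_simps sum.distrib sum_distrib_left)
  from this[of "dh x w"] show ?thesis unfolding dh_expand[OF x, symmetric] .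
qed

lemma dh_sym: "x \<in> S \<Longrightarrow> dh x w u v = dh x w v u"
proof -
  assume x: "x \<in> S"
  have "((\<lambda>y. h y v u) has_derivative (\<lambda>w. dh x w u v)) (at x)"
    by (rule has_derivative_transform_within_open[OF h_has_derivative[OF x] open_S x]) (rule sym)
  from fun_cong[OF has_derivative_unique[OF h_has_derivative[OF x] this], of w] show ?thesis by simp
qed

lemma dh_analytic: "b \<in> Basis \<Longrightarrow> real_analytic_on S (\<lambda>x. dh x b u v)"
  unfolding dh_def by (rule real_analytic_frechet_derivative(2)[OF open_S ana])

lemma bounds:
  assumes K: "compact K" "convex K" "K \<subseteq> S" "K \<noteq> {}"
  obtains m L where "m > 0" "L \<ge> 0"
    "\<And>x u. x \<in> K \<Longrightarrow> m * (norm u)\<^sup>2 \<le> h x u u"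
    "\<And>x u v. x \<in> K \<Longrightarrow> \<bar>h x u v\<bar> \<le> L * norm u * norm v"
    "\<And>x y u v. x \<in> K \<Longrightarrow> y \<in> K \<Longrightarrow> \<bar>h x u v - h y u v\<bar> \<le> L * norm (x - y) * norm u * norm v"
    "\<And>x w u v. x \<in> K \<Longrightarrow> \<bar>dh x w u v\<bar> \<le> L * norm w * norm u * norm v"
    "\<And>x y w u v. x \<in> K \<Longrightarrow> y \<in> K \<Longrightarrow> \<bar>dh x w u v - dh y w u v\<bar> \<le> L * norm (x - y) * norm w * norm u * norm v"
proof -
  define n where "n = real DIM('e)"
  have n: "n \<ge> 1" unfolding n_def by (simp add: Suc_leI)
  define Bl where "Bl = (\<lambda>(F::'e \<Rightarrow> real) L. (\<forall>x\<in>K. \<bar>F x\<bar> \<le> L) \<and> (\<forall>x\<in>K. \<forall>y\<in>K. \<bar>F x - F y\<bar> \<le> L * norm (x - y)))"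
  have Bl_ex: "\<exists>L. Bl F L" if F: "real_analytic_on S F" for F
  proof (rule real_analytic_bounded_lipschitz[OF open_S F K(1-3)])
    fix L assume "\<And>x. x \<in> K \<Longrightarrow> \<bar>F x\<bar> \<le> L" "\<And>x y. x \<in> K \<Longrightarrow> y \<in> K \<Longrightarrow> \<bar>F x - F y\<bar> \<le> L * norm (x - y)"
    then show "\<exists>L. Bl F L" unfolding Bl_def by (intro exI[of _ L]) simp
  qed
  have Bl_mono: "Bl F L'" if L: "Bl F L" "L \<le> L'" for F L L'
    unfolding Bl_def
  proof (intro conjI ballI)
    show "\<bar>F x\<bar> \<le> L'" if "x \<in> K" for x using L that by (auto simp: Bl_def intro: order.trans)
    fix x y assume "x \<in> K" "y \<in> K"
    then have "\<bar>F x - F y\<bar> \<le> L * norm (x - y)" using L by (auto simp: Bl_def)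
    also have "\<dots> \<le> L' * norm (x - y)" using L(2) by (intro mult_right_mono) auto
    finally show "\<bar>F x - F y\<bar> \<le> L' * norm (x - y)" .
  qed
  obtain L1 where L1: "L1 \<ge> 0" "\<And>i. i \<in> (Basis \<times> Basis :: ('e \<times> 'e) set) \<Longrightarrow> Bl (\<lambda>x. h x (fst i) (snd i)) L1"
    by (rule finite_uniform_bound[of "Basis \<times> Basis :: ('e \<times> 'e) set" "\<lambda>i. Bl (\<lambda>x. h x (fst i) (snd i))"])
       (simp, rule Bl_ex[OF ana], rule Bl_mono, assumption, assumption, rule that)
  obtain L2 where L2: "L2 \<ge> 0" "\<And>i. i \<in> (Basis \<times> Basis \<times> Basis :: ('e \<times> 'e \<times> 'e) set) \<Longrightarrow> Bl (\<lambda>x. dh x (fst i) (fst (snd i)) (snd (snd i))) L2"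
    by (rule finite_uniform_bound[of "Basis \<times> Basis \<times> Basis :: ('e \<times> 'e \<times> 'e) set" "\<lambda>i. Bl (\<lambda>x. dh x (fst i) (fst (snd i)) (snd (snd i)))"])
       (simp, rule Bl_ex[OF dh_analytic], force, rule Bl_mono, assumption, assumption, rule that)
  have h2: "\<bar>\<Sum>b\<in>Basis. \<Sum>c\<in>Basis. (u \<bullet> b) * (v \<bullet> c) * G b c\<bar> \<le> n\<^sup>2 * L * norm u * norm v"
    if "\<And>b c. b \<in> Basis \<Longrightarrow> c \<in> Basis \<Longrightarrow> \<bar>G b c\<bar> \<le> L" for G and u v :: 'e and L
  proof -
    have "\<bar>\<Sum>b\<in>Basis. \<Sum>c\<in>Basis. (u \<bullet> b) * (v \<bullet> c) * G b c\<bar> \<le> (\<Sum>b\<in>Basis. \<Sum>c\<in>Basis. \<bar>(u \<bullet> b) * (v \<bullet> c) * G b c\<bar>)"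
      by (rule order.trans[OF sum_abs]) (intro sum_mono sum_abs)
    also have "\<dots> \<le> (\<Sum>b\<in>(Basis::'e set). \<Sum>c\<in>(Basis::'e set). norm u * norm v * L)"
      unfolding abs_mult using Basis_le_norm that by (intro sum_mono mult_mono) auto
    finally show ?thesis by (simp add: n_def power2_eq_square mult_ac)
  qed
  have h1: "\<bar>\<Sum>a\<in>Basis. (w \<bullet> a) * G a\<bar> \<le> n * norm w * L"
    if "\<And>b. b \<in> Basis \<Longrightarrow> \<bar>G b\<bar> \<le> L" for G and w :: 'e and L
  proof -
    have "\<bar>\<Sum>a\<in>Basis. (w \<bullet> a) * G a\<bar> \<le> (\<Sum>a\<in>Basis. \<bar>(w \<bullet> a) * G a\<bar>)" by (rule sum_abs)
    also have "\<dots> \<le> (\<Sum>a\<in>(Basis::'e set). norm w * L)"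
      unfolding abs_mult using Basis_le_norm that by (intro sum_mono mult_mono) auto
    finally show ?thesis by (simp add: n_def mult_ac)
  qed
  \<comment> \<open>There are \<open>n\<close> squared pairs of basis vectors for \<open>h\<close>,
    and a further factor \<open>n\<close> for the direction of differentiation in
    \<open>dh\<close>.\<close>
  define L where "L = n\<^sup>2 * L1 + n * (n\<^sup>2 * L2)"
  have LL: "L \<ge> 0" "n\<^sup>2 * L1 \<le> L" "n * (n\<^sup>2 * L2) \<le> L" using L1(1) L2(1) n by (auto simp: L_def)
  have "continuous_on (K \<times> sphere 0 1) (\<lambda>z. h (fst z) (snd z) (snd z))"
  proof -
    have "continuous_on (K \<times> sphere 0 1) (\<lambda>z. \<Sum>b\<in>Basis. \<Sum>c\<in>Basis. (snd z \<bullet> b) * (snd z \<bullet> c) * h (fst z) b c)"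
    proof (intro continuous_intros)
      fix b c :: 'e
      show "continuous_on (K \<times> sphere 0 1) (\<lambda>z. h (fst z) b c)"
        by (rule continuous_on_compose2[OF real_analytic_continuous_on[OF open_S ana]])
           (use K(3) in \<open>auto intro: continuous_intros\<close>)
    qed
    then show ?thesis
      by (rule continuous_on_eq) (use K(3) in \<open>auto simp: bilinear_expand[OF bil, symmetric]\<close>)
  qed
  moreover have "compact (K \<times> sphere (0::'e) 1)" "K \<times> sphere (0::'e) 1 \<noteq> {}" using K by (auto simp: compact_Times)
  ultimately have "\<exists>z0\<in>K \<times> sphere 0 1. \<forall>z\<in>K \<times> sphere 0 1. h (fst z0) (snd z0) (snd z0) \<le> h (fst z) (snd z) (snd z)"
    by (intro continuous_attains_inf)
  then obtain z0 where z0: "fst z0 \<in> K" "norm (snd z0) = 1"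
     "\<And>x u. x \<in> K \<Longrightarrow> norm u = 1 \<Longrightarrow> h (fst z0) (snd z0) (snd z0) \<le> h x u u" by force
  define m where "m = h (fst z0) (snd z0) (snd z0)"
  show thesis
  proof
    show "m > 0" unfolding m_def using z0(1,2) K(3) by (intro pos) auto
    show "L \<ge> 0" by fact
    fix x assume x: "x \<in> K"
    then have xS: "x \<in> S" using K(3) by auto
    show "m * (norm u)\<^sup>2 \<le> h x u u" for u
    proof (cases "u = 0")
      case False
      have e: "norm u *\<^sub>R sgn u = u" using False by (simp add: sgn_div_norm)
      have "h x (norm u *\<^sub>R sgn u) (norm u *\<^sub>R sgn u) = (norm u)\<^sup>2 * h x (sgn u) (sgn u)"
        by (simp only: bilinear_lmul[OF bil[OF xS]] bilinear_rmul[OF bil[OF xS]] power2_eq_square mult.assoc real_scaleR_def)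
      moreover have "m \<le> h x (sgn u) (sgn u)" unfolding m_def using False x by (intro z0(3)) (auto simp: norm_sgn)
      ultimately show ?thesis unfolding e using mult_left_mono[of m "h x (sgn u) (sgn u)" "(norm u)\<^sup>2"] by (simp add: mult.commute)
    qed (simp add: bilinear_lzero[OF bil[OF xS]])
    show "\<bar>h x u v\<bar> \<le> L * norm u * norm v" for u v
    proof -
      have "\<bar>h x u v\<bar> \<le> n\<^sup>2 * L1 * norm u * norm v"
        unfolding bilinear_expand[OF bil[OF xS], of u v]
        by (rule h2) (use L1(2) x in \<open>force simp: Bl_def\<close>)
      also have "\<dots> \<le> L * norm u * norm v" using LL by (intro mult_right_mono) auto
      finally show ?thesis .
    qed
    have dh_bd: "\<bar>dh x w u v\<bar> \<le> n * norm w * (n\<^sup>2 * L2 * norm u * norm v)" for w u v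
      unfolding dh_expand_dir[OF xS, of w u v]
    proof (rule h1)
      fix a :: 'e assume "a \<in> Basis"
      then show "\<bar>dh x a u v\<bar> \<le> n\<^sup>2 * L2 * norm u * norm v"
        unfolding dh_expand[OF xS, of a u v] by (intro h2) (use L2(2) x in \<open>force simp: Bl_def\<close>)
    qed
    show "\<bar>dh x w u v\<bar> \<le> L * norm w * norm u * norm v" for w u v
    proof -
      have "\<bar>dh x w u v\<bar> \<le> (n * (n\<^sup>2 * L2)) * (norm w * norm u * norm v)" using dh_bd[of w u v] by (simp add: mult_ac)
      also have "\<dots> \<le> L * (norm w * norm u * norm v)" using LL by (intro mult_right_mono) auto
      finally show ?thesis by (simp add: mult_ac)
    qed
    fix y assume y: "y \<in> K"
    then have yS: "y \<in> S" using K(3) by auto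
    show "\<bar>h x u v - h y u v\<bar> \<le> L * norm (x - y) * norm u * norm v" for u v
    proof -
      have eq: "h x u v - h y u v = (\<Sum>b\<in>Basis. \<Sum>c\<in>Basis. (u \<bullet> b) * (v \<bullet> c) * (h x b c - h y b c))"
        by (simp add: bilinear_expand[OF bil[OF xS], of u v] bilinear_expand[OF bil[OF yS], of u v] right_diff_distrib sum_subtractf)
      have "\<bar>h x u v - h y u v\<bar> \<le> n\<^sup>2 * (L1 * norm (x - y)) * norm u * norm v"
        unfolding eq by (rule h2) (use L1(2) x y in \<open>force simp: Bl_def\<close>)
      also have "\<dots> = (n\<^sup>2 * L1) * (norm (x - y) * norm u * norm v)" by (simp add: mult_ac)
      also have "\<dots> \<le> L * (norm (x - y) * norm u * norm v)" using LL by (intro mult_right_mono) auto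
      finally show ?thesis by (simp add: mult_ac)
    qed
    show "\<bar>dh x w u v - dh y w u v\<bar> \<le> L * norm (x - y) * norm w * norm u * norm v" for w u v
    proof -
      have eq: "dh x w u v - dh y w u v = (\<Sum>a\<in>Basis. (w \<bullet> a) * (dh x a u v - dh y a u v))"
        by (simp add: dh_expand_dir[OF xS, of w u v] dh_expand_dir[OF yS, of w u v] right_diff_distrib sum_subtractf)
      have "\<bar>dh x w u v - dh y w u v\<bar> \<le> n * norm w * (n\<^sup>2 * (L2 * norm (x - y)) * norm u * norm v)"
        unfolding eq
      proof (rule h1)
        fix a :: 'e assume a: "a \<in> Basis"
        have eq: "dh x a u v - dh y a u v = (\<Sum>b\<in>Basis. \<Sum>c\<in>Basis. (u \<bullet> b) * (v \<bullet> c) * (dh x a b c - dh y a b c))"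
          by (simp add: dh_expand[OF xS, of a u v] dh_expand[OF yS, of a u v] right_diff_distrib sum_subtractf)
        show "\<bar>dh x a u v - dh y a u v\<bar> \<le> n\<^sup>2 * (L2 * norm (x - y)) * norm u * norm v"
          unfolding eq by (rule h2) (use L2(2) x y a in \<open>force simp: Bl_def\<close>)
      qed
      also have "\<dots> = (n * (n\<^sup>2 * L2)) * (norm (x - y) * norm w * norm u * norm v)" by (simp add: mult_ac)
      also have "\<dots> \<le> L * (norm (x - y) * norm w * norm u * norm v)" using LL by (intro mult_right_mono) auto
      finally show ?thesis by (simp add: mult_ac)
    qed
  qed
qed

end

lemma has_vector_derivative_imp_continuous_on:
  assumes "\<And>t. t \<in> J \<Longrightarrow> (f has_vector_derivative f' t) (at t within J)"
  shows "continuous_on J f"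
  unfolding continuous_on_eq_continuous_within
proof
  fix t assume "t \<in> J"
  show "continuous (at t within J) f"
    by (rule has_vector_derivative_continuous[OF assms[OF \<open>t \<in> J\<close>]])
qed

context local_metric
begin

lemma continuous_on_h:
  assumes x: "continuous_on J x" "\<And>t. t \<in> J \<Longrightarrow> x t \<in> S" and uv: "continuous_on J u" "continuous_on J v"
  shows "continuous_on J (\<lambda>t. h (x t) (u t) (v t))"
proof -
  have "continuous_on J (\<lambda>t. \<Sum>b\<in>Basis. \<Sum>e\<in>Basis. (u t \<bullet> b) * (v t \<bullet> e) * h (x t) b e)"
  proof (intro continuous_intros uv)
    fix b e :: 'e
    show "continuous_on J (\<lambda>t. h (x t) b e)"
      by (rule continuous_on_compose2[OF real_analytic_continuous_on[OF open_S ana]]) (use x in auto)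
  qed
  then show ?thesis
    by (rule continuous_on_eq) (simp add: bilinear_expand[OF bil, symmetric] x(2))
qed

lemma continuous_on_dh:
  assumes x: "continuous_on J x" "\<And>t. t \<in> J \<Longrightarrow> x t \<in> S"
    and uv: "continuous_on J w" "continuous_on J u" "continuous_on J v"
  shows "continuous_on J (\<lambda>t. dh (x t) (w t) (u t) (v t))"
proof -
  have "continuous_on J (\<lambda>t. \<Sum>a\<in>Basis. (w t \<bullet> a) * (\<Sum>b\<in>Basis. \<Sum>e\<in>Basis. (u t \<bullet> b) * (v t \<bullet> e) * dh (x t) a b e))"
  proof (intro continuous_intros uv)
    fix a b e :: 'e assume "a \<in> Basis"
    then show "continuous_on J (\<lambda>t. dh (x t) a b e)"
      by (intro continuous_on_compose2[OF real_analytic_continuous_on[OF open_S dh_analytic]]) (use x in auto)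
  qed
  then show ?thesis
    by (rule continuous_on_eq) (simp add: dh_expand[OF x(2), symmetric] dh_expand_dir[OF x(2), symmetric])
qed

lemma continuous_on_nrm:
  assumes "continuous_on J x" "\<And>t. t \<in> J \<Longrightarrow> x t \<in> S" "continuous_on J u"
  shows "continuous_on J (\<lambda>t. nrm (x t) (u t))"
  unfolding nrm_def using assms by (intro continuous_intros continuous_on_h)

text \<open>The square root is not Lipschitz at 0, so the difference of the norms is multiplied by
  their sum, which turns it into a difference of values of \<open>h\<close>; the sum is at least
  \<open>sqrt m * norm v\<close> by coercivity.\<close>

lemma nrm_bounds:
  assumes K: "compact K" "convex K" "K \<subseteq> S" "K \<noteq> {}"
  obtains N where "N \<ge> 0" "\<And>x v. x \<in> K \<Longrightarrow> nrm x v \<le> N * norm v"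
    "\<And>x y v. x \<in> K \<Longrightarrow> y \<in> K \<Longrightarrow> \<bar>nrm x v - nrm y v\<bar> \<le> N * norm (x - y) * norm v"
proof (rule bounds[OF K])
  fix m L assume mL: "m > 0" "L \<ge> (0::real)"
    and b1: "\<And>x u. x \<in> K \<Longrightarrow> m * (norm u)\<^sup>2 \<le> h x u u"
    and b2: "\<And>x u v. x \<in> K \<Longrightarrow> \<bar>h x u v\<bar> \<le> L * norm u * norm v"
    and b3: "\<And>x y u v. x \<in> K \<Longrightarrow> y \<in> K \<Longrightarrow> \<bar>h x u v - h y u v\<bar> \<le> L * norm (x - y) * norm u * norm v"
  define N where "N = sqrt L + L / sqrt m"
  have N: "N \<ge> 0" "sqrt L \<le> N" "L / sqrt m \<le> N" using mL by (auto simp: N_def)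
  show thesis
  proof (rule that[OF N(1)])
    fix x v assume x: "x \<in> K"
    have "nrm x v \<le> sqrt (L * norm v * norm v)" unfolding nrm_def using b2[OF x, of v v] by simp
    also have "\<dots> = sqrt L * norm v" by (simp add: real_sqrt_mult mult.assoc)
    also have "\<dots> \<le> N * norm v" using N by (intro mult_right_mono) auto
    finally show "nrm x v \<le> N * norm v" .
  next
    fix x y v assume x: "x \<in> K" and y: "y \<in> K"
    have xS: "x \<in> S" "y \<in> S" using x y K(3) by auto
    show "\<bar>nrm x v - nrm y v\<bar> \<le> N * norm (x - y) * norm v"
    proof (cases "v = 0")
      case True then show ?thesis using xS by (simp add: nrm_def bilinear_lzero[OF bil])
    next
      case False
      have low: "sqrt m * norm v \<le> nrm x v"
      proof -
        have "sqrt (m * (norm v)\<^sup>2) \<le> nrm x v" unfolding nrm_def using b1[OF x, of v] by simp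
        then show ?thesis by (simp add: real_sqrt_mult)
      qed
      have "\<bar>nrm x v - nrm y v\<bar> * (sqrt m * norm v) \<le> \<bar>nrm x v - nrm y v\<bar> * (nrm x v + nrm y v)"
        using low nrm_nonneg[OF xS(2), of v] by (intro mult_left_mono) auto
      also have "\<dots> = \<bar>(nrm x v)\<^sup>2 - (nrm y v)\<^sup>2\<bar>"
        using nrm_nonneg[OF xS(1), of v] nrm_nonneg[OF xS(2), of v]
        by (simp add: power2_eq_square square_diff_square_factored abs_mult mult.commute)
      also have "\<dots> \<le> L * norm (x - y) * norm v * norm v" using b3[OF x y, of v v] by (simp add: nrm_sq xS)
      finally have "(\<bar>nrm x v - nrm y v\<bar> * sqrt m) * norm v \<le> (L * norm (x - y) * norm v) * norm v" by (simp add: mult_ac)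
      then have "\<bar>nrm x v - nrm y v\<bar> * sqrt m \<le> L * norm (x - y) * norm v" using False by simp
      then have "\<bar>nrm x v - nrm y v\<bar> \<le> (L / sqrt m) * (norm (x - y) * norm v)" using mL by (simp add: field_simps)
      also have "\<dots> \<le> N * (norm (x - y) * norm v)" using N by (intro mult_right_mono) auto
      finally show ?thesis by (simp add: mult_ac)
    qed
  qed
qed

text \<open>Unit speed solutions of the Euler-Lagrange equation in momentum form: the components of
  the momentum are differentiated, not the velocity. This makes sense for C1 curves, which is all
  that is known when the equation is first derived.\<close>

definition extremal :: "real \<Rightarrow> real \<Rightarrow> (real \<Rightarrow> 'e) \<Rightarrow> (real \<Rightarrow> 'e) \<Rightarrow> bool" where
  "extremal a b u u' \<longleftrightarrow> (\<forall>t\<in>{a..b}. u t \<in> S) \<and> continuous_on {a..b} u' \<and> (\<forall>t\<in>{a..b}.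
     (u has_vector_derivative u' t) (at t within {a..b}) \<and> h (u t) (u' t) (u' t) = 1 \<and>
     (\<forall>e. ((\<lambda>t. h (u t) (u' t) e) has_vector_derivative dh (u t) e (u' t) (u' t) / 2) (at t within {a..b})))"

end

text \<open>\<open>dd\<close> will be the global distance transported to a coordinate ball.
  \<open>LM\<close> says that it agrees with the norm at the first point up to second order;
  \<open>low\<close> compares it with the Euclidean distance. Its definition by curves is
  deliberately kept out of sight.\<close>

locale local_metric_dist = local_metric S h for S :: "'e::euclidean_space set" and h +
  fixes p :: 'e and r C c :: real and dd :: "'e \<Rightarrow> 'e \<Rightarrow> real"
  assumes r: "r > 0" and cball_S: "cball p r \<subseteq> S" and C: "C \<ge> 0" and c: "c > 0"
    and tri: "\<And>x y z. x \<in> ball p r \<Longrightarrow> y \<in> ball p r \<Longrightarrow> z \<in> ball p r \<Longrightarrow> dd x z \<le> dd x y + dd y z"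
    and LM: "\<And>x y. x \<in> ball p r \<Longrightarrow> y \<in> ball p r \<Longrightarrow> \<bar>dd x y - nrm x (x - y)\<bar> \<le> C * (norm (x - y))\<^sup>2"
    and low: "\<And>x y. x \<in> ball p r \<Longrightarrow> y \<in> ball p r \<Longrightarrow> c * norm (x - y) \<le> dd x y"
begin

lemma ball_S: "x \<in> ball p r \<Longrightarrow> x \<in> S" using cball_S by auto

lemma ball_cball: "x \<in> ball p r \<Longrightarrow> x \<in> cball p r" by auto

lemma cball_props: "compact (cball p r)" "convex (cball p r)" "cball p r \<subseteq> S" "cball p r \<noteq> {}"
  using cball_S r by auto

lemma dd_self: "x \<in> ball p r \<Longrightarrow> dd x x = 0"
  using LM[of x x] by (simp add: nrm_def bilinear_lzero[OF bil[OF ball_S]])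

lemma dist_le_length:
  assumes ab: "a \<le> b" and v: "\<And>t. t \<in> {a..b} \<Longrightarrow> v t \<in> ball p r"
    and v': "\<And>t. t \<in> {a..b} \<Longrightarrow> (v has_vector_derivative v' t) (at t within {a..b})" "continuous_on {a..b} v'"
  shows "dd (v a) (v b) \<le> integral {a..b} (\<lambda>t. nrm (v t) (v' t))"
proof (rule nrm_bounds[OF cball_props])
  fix N assume N: "N \<ge> 0" "\<And>x v. x \<in> cball p r \<Longrightarrow> nrm x v \<le> N * norm v"
  have vS: "\<And>t. t \<in> {a..b} \<Longrightarrow> v t \<in> S" using v ball_S by blast
  have vc: "continuous_on {a..b} v"
    by (rule has_vector_derivative_imp_continuous_on[OF v'(1)])
  define g where "g = (\<lambda>t. nrm (v t) (v' t))"
  have g: "continuous_on {a..b} g" unfolding g_def by (intro continuous_on_nrm vc vS v'(2))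
  define I where "I = (\<lambda>t. integral {a..t} g)"
  have I: "(I has_vector_derivative g t) (at t within {a..b})" if "t \<in> {a..b}" for t
    unfolding I_def by (rule integral_has_vector_derivative[OF g that])
  have up: "dd x y \<le> (N + 2 * C * r) * norm (x - y)" if "x \<in> ball p r" "y \<in> ball p r" for x y
  proof -
    have "dd x y \<le> nrm x (x - y) + C * (norm (x - y))\<^sup>2" using LM[OF that] by linarith
    also have "nrm x (x - y) \<le> N * norm (x - y)" using N(2) that by (meson ball_cball)
    also have "norm (x - y) \<le> 2 * r"
      using that norm_triangle_ineq4[of "x - p" "y - p"] by (simp add: dist_norm norm_minus_commute)
    then have "C * (norm (x - y))\<^sup>2 \<le> C * (2 * r * norm (x - y))"
      using C unfolding power2_eq_square by (intro mult_left_mono mult_right_mono) auto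
    finally show ?thesis by (simp add: algebra_simps)
  qed
  have ddc: "continuous_on {a..b} (\<lambda>t. dd (v a) (v t))"
    unfolding continuous_on_def
  proof
    fix s assume s: "s \<in> {a..b}"
    have va: "v a \<in> ball p r" using v ab by auto
    have "\<bar>dd (v a) (v t) - dd (v a) (v s)\<bar> \<le> (N + 2 * C * r) * norm (v t - v s)" if t: "t \<in> {a..b}" for t
      using tri[OF va v[OF t] v[OF s]] tri[OF va v[OF s] v[OF t]] up[OF v[OF t] v[OF s]] up[OF v[OF s] v[OF t]]
      by (simp add: norm_minus_commute)
    then have "\<forall>\<^sub>F t in at s within {a..b}. norm (dd (v a) (v t) - dd (v a) (v s)) \<le> (N + 2 * C * r) * norm (v t - v s)"
      by (auto simp: eventually_at_filter)
    moreover have "((\<lambda>t. (N + 2 * C * r) * norm (v t - v s)) \<longlongrightarrow> (N + 2 * C * r) * norm (v s - v s)) (at s within {a..b})"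
      using vc s by (intro tendsto_intros) (auto simp: continuous_on_def)
    then have "((\<lambda>t. (N + 2 * C * r) * norm (v t - v s)) \<longlongrightarrow> 0) (at s within {a..b})" by simp
    ultimately have "((\<lambda>t. dd (v a) (v t) - dd (v a) (v s)) \<longlongrightarrow> 0) (at s within {a..b})"
      by (rule Lim_null_comparison)
    then show "((\<lambda>t. dd (v a) (v t)) \<longlongrightarrow> dd (v a) (v s)) (at s within {a..b})" by (simp add: LIM_zero_iff)
  qed
  have "dd (v a) (v b) - I b \<le> dd (v a) (v a) - I a"
  proof (rule dini_nonincreasing[OF ab, where F="\<lambda>t. dd (v a) (v t) - I t"])
    show "continuous_on {a..b} (\<lambda>t. dd (v a) (v t) - I t)"
      by (intro continuous_intros ddc has_vector_derivative_imp_continuous_on[OF I])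
    fix s \<epsilon> :: real assume s: "a \<le> s" "s < b" and \<epsilon>: "\<epsilon> > 0"
    then have s': "s \<in> {a..b}" by auto
    let ?F = "at s within {a..b}"
    let ?q = "\<lambda>t. (v t - v s) /\<^sub>R (t - s)" and ?i = "\<lambda>t. (I t - I s) /\<^sub>R (t - s)"
    have q: "(?q \<longlongrightarrow> v' s) ?F" using v'(1)[OF s'] by (simp add: has_vector_derivative_iff_quotient)
    have i: "(?i \<longlongrightarrow> g s) ?F" using I[OF s'] by (simp add: has_vector_derivative_iff_quotient)
    have "continuous_on UNIV (\<lambda>w. nrm (v s) w)" using vS[OF s'] by (intro continuous_on_nrm) auto
    then have nq: "((\<lambda>t. nrm (v s) (?q t)) \<longlongrightarrow> nrm (v s) (v' s)) ?F"
      by (rule continuous_on_tendsto_compose[OF _ q]) auto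
    have "((\<lambda>t. nrm (v s) (?q t) + C * (norm (?q t))\<^sup>2 * (t - s) - ?i t) \<longlongrightarrow> nrm (v s) (v' s) + C * (norm (v' s))\<^sup>2 * (s - s) - g s) ?F"
      by (intro tendsto_intros nq q i)
    then have "\<forall>\<^sub>F t in ?F. nrm (v s) (?q t) + C * (norm (?q t))\<^sup>2 * (t - s) - ?i t < \<epsilon>"
      using \<epsilon> by (intro order_tendstoD(2)) (auto simp: g_def)
    then obtain \<delta> where \<delta>: "\<delta> > 0" "\<And>t. t \<in> {a..b} \<Longrightarrow> t \<noteq> s \<Longrightarrow> dist t s < \<delta> \<Longrightarrow> nrm (v s) (?q t) + C * (norm (?q t))\<^sup>2 * (t - s) - ?i t < \<epsilon>"
      unfolding eventually_at by blast
    show "\<exists>\<delta>>0. \<forall>t. s < t \<and> t < s + \<delta> \<and> t \<le> b \<longrightarrow> dd (v a) (v t) - I t \<le> dd (v a) (v s) - I s + \<epsilon> * (t - s)"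
    proof (intro exI conjI allI impI)
      show "\<delta> > 0" by fact
      fix t assume t: "s < t \<and> t < s + \<delta> \<and> t \<le> b"
      then have t': "t \<in> {a..b}" using s by auto
      define Q J where "Q = ?q t" and "J = ?i t"
      have e: "v t - v s = (t - s) *\<^sub>R Q" "I t - I s = (t - s) * J" using t by (simp_all add: Q_def J_def)
      have "dd (v s) (v t) \<le> nrm (v s) (v t - v s) + C * (norm (v t - v s))\<^sup>2"
        using LM[OF v[OF s'] v[OF t']] nrm_minus[OF vS[OF s'], of "v t - v s"] by (simp add: norm_minus_commute)
      also have "\<dots> = (t - s) * (nrm (v s) Q + C * (norm Q)\<^sup>2 * (t - s))"
        unfolding e(1) nrm_scaleR[OF vS[OF s']] norm_scaleR using t by (simp add: power2_eq_square algebra_simps)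
      finally have "dd (v s) (v t) - (I t - I s) \<le> (t - s) * (nrm (v s) Q + C * (norm Q)\<^sup>2 * (t - s) - J)"
        unfolding e(2) by (simp add: right_diff_distrib)
      also have "\<dots> \<le> (t - s) * \<epsilon>"
        using \<delta>(2)[OF t'] t unfolding Q_def J_def by (intro mult_left_mono) (auto simp: dist_real_def)
      finally show "dd (v a) (v t) - I t \<le> dd (v a) (v s) - I s + \<epsilon> * (t - s)"
        using tri[of "v a" "v s" "v t"] v ab s' t' by (simp add: mult.commute)
    qed
  qed
  then show ?thesis using dd_self[of "v a"] v ab by (simp add: I_def g_def)
qed

definition isometric :: "real \<Rightarrow> real \<Rightarrow> (real \<Rightarrow> 'e) \<Rightarrow> bool" where
  "isometric a b u \<longleftrightarrow> (\<forall>t\<in>{a..b}. u t \<in> ball p r) \<and> (\<forall>s\<in>{a..b}. \<forall>t\<in>{a..b}. dd (u s) (u t) = \<bar>s - t\<bar>)"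

text \<open>By \<open>low\<close> the path has Euclidean Lipschitz constant \<open>1 / c\<close>.
  Hence both the quadratic error in \<open>LM\<close> and the change of \<open>nrm\<close> from the
  base point \<open>u s\<close> to \<open>u \<tau>\<close> are at most a multiple of
  \<open>l\<close> times the parameter difference. They contribute \<open>C\<close> and
  \<open>N\<close> to \<open>D\<close>, each divided by the square of \<open>c\<close>.\<close>

lemma isometric_nrm:
  assumes u: "isometric a b u"
  obtains D where "D \<ge> 0" "\<And>\<tau> s t l. {\<tau>, s, t} \<subseteq> {a..b} \<Longrightarrow> \<bar>\<tau> - s\<bar> \<le> l \<Longrightarrow> \<bar>s - t\<bar> \<le> l \<Longrightarrow> \<bar>nrm (u \<tau>) (u t - u s) - \<bar>t - s\<bar>\<bar> \<le> D * l * \<bar>t - s\<bar>"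
proof (rule nrm_bounds[OF cball_props])
  fix N assume N: "N \<ge> 0" "\<And>x y v. x \<in> cball p r \<Longrightarrow> y \<in> cball p r \<Longrightarrow> \<bar>nrm x v - nrm y v\<bar> \<le> N * norm (x - y) * norm v"
  have uB: "u t \<in> ball p r" if "t \<in> {a..b}" for t using u that by (auto simp: isometric_def)
  have lip: "norm (u s - u t) \<le> \<bar>s - t\<bar> / c" if "s \<in> {a..b}" "t \<in> {a..b}" for s t
    using low[OF uB[OF that(1)] uB[OF that(2)]] u that c by (simp add: isometric_def field_simps)
  define D where "D = (C + N) / c\<^sup>2"
  show thesis
  proof (rule that)
    show "D \<ge> 0" using C N c by (simp add: D_def)
    fix \<tau> s t l assume sub: "{\<tau>, s, t} \<subseteq> {a..b}" and l: "\<bar>\<tau> - s\<bar> \<le> l" "\<bar>s - t\<bar> \<le> l"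
    then have mem: "\<tau> \<in> {a..b}" "s \<in> {a..b}" "t \<in> {a..b}" by auto
    have l0: "l \<ge> 0" using l by linarith
    have "\<bar>dd (u s) (u t) - nrm (u s) (u s - u t)\<bar> \<le> C * (norm (u s - u t))\<^sup>2"
      by (rule LM[OF uB[OF mem(2)] uB[OF mem(3)]])
    also have "\<dots> \<le> C * (\<bar>s - t\<bar> / c)\<^sup>2" using lip[OF mem(2,3)] C by (intro mult_left_mono power_mono) auto
    also have "\<dots> = C / c\<^sup>2 * (\<bar>s - t\<bar> * \<bar>s - t\<bar>)" by (simp add: power2_eq_square)
    also have "\<dots> \<le> C / c\<^sup>2 * (l * \<bar>s - t\<bar>)" using l C c by (intro mult_left_mono mult_right_mono) auto
    finally have 1: "\<bar>\<bar>t - s\<bar> - nrm (u s) (u t - u s)\<bar> \<le> C / c\<^sup>2 * (l * \<bar>t - s\<bar>)"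
      using u mem nrm_minus[OF ball_S[OF uB[OF mem(2)]], of "u t - u s"] by (simp add: isometric_def abs_minus_commute)
    have "\<bar>nrm (u \<tau>) (u t - u s) - nrm (u s) (u t - u s)\<bar> \<le> N * norm (u \<tau> - u s) * norm (u t - u s)"
      by (intro N(2) ball_cball uB mem)
    also have "\<dots> \<le> N * (\<bar>\<tau> - s\<bar> / c) * (\<bar>t - s\<bar> / c)"
      using lip[OF mem(1,2)] lip[OF mem(3,2)] N(1) c by (intro mult_mono mult_nonneg_nonneg) auto
    also have "\<dots> = N / c\<^sup>2 * (\<bar>\<tau> - s\<bar> * \<bar>t - s\<bar>)" by (simp add: power2_eq_square)
    also have "\<dots> \<le> N / c\<^sup>2 * (l * \<bar>t - s\<bar>)" using l N c by (intro mult_left_mono mult_right_mono) auto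
    finally have 2: "\<bar>nrm (u \<tau>) (u t - u s) - nrm (u s) (u t - u s)\<bar> \<le> N / c\<^sup>2 * (l * \<bar>t - s\<bar>)" .
    have "D * l * \<bar>t - s\<bar> = C / c\<^sup>2 * (l * \<bar>t - s\<bar>) + N / c\<^sup>2 * (l * \<bar>t - s\<bar>)"
      by (simp add: D_def add_divide_distrib algebra_simps)
    then show "\<bar>nrm (u \<tau>) (u t - u s) - \<bar>t - s\<bar>\<bar> \<le> D * l * \<bar>t - s\<bar>" using 1 2 by linarith
  qed
qed

text \<open>For three points on an isometric curve the triangle inequality is almost an equality, so by
  the parallelogram identity in the inner product at one of them the two slopes almost agree.\<close>

lemma isometric_slopes:
  assumes u: "isometric a b u"
  obtains K where "K \<ge> 0" "\<And>s t q. a \<le> s \<Longrightarrow> s < t \<Longrightarrow> t < q \<Longrightarrow> q \<le> b \<Longrightarrow>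
       (t - s) * (q - t) * (norm (slope u s t - slope u t q))\<^sup>2 \<le> K * (q - s) ^ 3"
proof (rule isometric_nrm[OF u], rule bounds[OF cball_props])
  fix D m L assume D: "D \<ge> 0"
    and DD: "\<And>\<tau> s t l. {\<tau>, s, t} \<subseteq> {a..b} \<Longrightarrow> \<bar>\<tau> - s\<bar> \<le> l \<Longrightarrow> \<bar>s - t\<bar> \<le> l \<Longrightarrow> \<bar>nrm (u \<tau>) (u t - u s) - \<bar>t - s\<bar>\<bar> \<le> D * l * \<bar>t - s\<bar>"
    and m: "m > 0" "\<And>x u. x \<in> cball p r \<Longrightarrow> m * (norm u)\<^sup>2 \<le> h x u u"
  define K where "K = (4 * D + D\<^sup>2 * \<bar>b - a\<bar>) / m"
  show thesis
  proof (rule that)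
    show "K \<ge> 0" using D m by (simp add: K_def)
    fix s t q assume stq: "a \<le> s" "s < t" "t < q" "q \<le> b"
    define \<alpha> \<beta> l where "\<alpha> = t - s" and "\<beta> = q - t" and "l = q - s"
    have ab: "\<alpha> > 0" "\<beta> > 0" and lab: "\<alpha> + \<beta> = l" and lb: "l \<le> \<bar>b - a\<bar>" and l0: "l > 0" using stq by (auto simp: \<alpha>_def \<beta>_def l_def)
    have us: "u s \<in> ball p r" using u stq by (auto simp: isometric_def)
    have usS: "u s \<in> S" by (rule ball_S[OF us])
    define X Y where "X = slope u s t" and "Y = slope u t q"
    have X: "u t - u s = \<alpha> *\<^sub>R X" and Y: "u q - u t = \<beta> *\<^sub>R Y" using ab by (auto simp: X_def Y_def slope_def \<alpha>_def \<beta>_def)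
    have XY: "u q - u s = \<alpha> *\<^sub>R X + \<beta> *\<^sub>R Y" using X Y by (metis add.commute diff_add_cancel add_diff_eq)
    let ?n = "nrm (u s)" and ?Q = "h (u s)"
    note B = bil[OF usS]
    have "\<bar>?n (u t - u s) - \<alpha>\<bar> \<le> D * l * \<alpha>"
      using DD[of s s t l] stq by (simp add: \<alpha>_def l_def)
    then have "\<alpha> * ?n X \<le> \<alpha> * (1 + D * l)" unfolding X nrm_scaleR[OF usS] using ab by (simp add: algebra_simps)
    then have nX: "?n X \<le> 1 + D * l" using ab by simp
    have "\<bar>?n (u q - u t) - \<beta>\<bar> \<le> D * l * \<beta>"
      using DD[of s t q l] stq by (simp add: \<beta>_def l_def)
    then have "\<beta> * ?n Y \<le> \<beta> * (1 + D * l)" unfolding Y nrm_scaleR[OF usS] using ab by (simp add: algebra_simps)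
    then have nY: "?n Y \<le> 1 + D * l" using ab by simp
    have QX: "?Q X X \<le> (1 + D * l)\<^sup>2" unfolding nrm_sq[OF usS, symmetric] using nX nrm_nonneg[OF usS] by (intro power_mono)
    have QY: "?Q Y Y \<le> (1 + D * l)\<^sup>2" unfolding nrm_sq[OF usS, symmetric] using nY nrm_nonneg[OF usS] by (intro power_mono)
    let ?z = "?n (u q - u s)"
    have "\<bar>?z - l\<bar> \<le> D * l * l"
      using DD[of s s q l] stq by (simp add: l_def)
    then have "l * (l - ?z) \<le> l * (D * l * l)" using l0 by (intro mult_left_mono) auto
    moreover have "(?z - l)\<^sup>2 \<ge> 0" by simp
    ultimately have "l\<^sup>2 - 2 * (l * (D * l * l)) \<le> ?z\<^sup>2" by (simp add: power2_eq_square algebra_simps)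
    then have QZ: "l\<^sup>2 - 2 * D * l ^ 3 \<le> ?Q (\<alpha> *\<^sub>R X + \<beta> *\<^sub>R Y) (\<alpha> *\<^sub>R X + \<beta> *\<^sub>R Y)"
      unfolding nrm_sq[OF usS] XY by (simp add: power2_eq_square power3_eq_cube mult_ac)
    have QZe: "?Q (\<alpha> *\<^sub>R X + \<beta> *\<^sub>R Y) (\<alpha> *\<^sub>R X + \<beta> *\<^sub>R Y) = \<alpha>\<^sup>2 * ?Q X X + 2 * \<alpha> * \<beta> * ?Q X Y + \<beta>\<^sup>2 * ?Q Y Y"
      using sym[OF usS, of Y X] by (simp add: bilinear_ladd[OF B] bilinear_radd[OF B] bilinear_lmul[OF B] bilinear_rmul[OF B] power2_eq_square algebra_simps)
    have QD: "?Q (X - Y) (X - Y) = ?Q X X - 2 * ?Q X Y + ?Q Y Y"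
      using sym[OF usS, of Y X] by (simp add: bilinear_lsub[OF B] bilinear_rsub[OF B])
    \<comment> \<open>The weighted parallelogram identity. After inserting the three estimates the
      terms of order \<open>l\<close> squared cancel, and a remainder of order \<open>l ^ 3\<close>
      is left.\<close>
    have "\<alpha> * \<beta> * ?Q (X - Y) (X - Y) = (\<alpha> + \<beta>) * (\<alpha> * ?Q X X + \<beta> * ?Q Y Y) - ?Q (\<alpha> *\<^sub>R X + \<beta> *\<^sub>R Y) (\<alpha> *\<^sub>R X + \<beta> *\<^sub>R Y)"
      unfolding QZe QD by (simp add: power2_eq_square algebra_simps)
    also have "\<dots> \<le> (\<alpha> + \<beta>) * (\<alpha> * (1 + D * l)\<^sup>2 + \<beta> * (1 + D * l)\<^sup>2) - (l\<^sup>2 - 2 * D * l ^ 3)"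
      using QX QY QZ ab by (intro diff_mono mult_left_mono add_mono) auto
    also have "\<dots> = l\<^sup>2 * (1 + D * l)\<^sup>2 - (l\<^sup>2 - 2 * D * l ^ 3)"
      by (simp add: lab[symmetric] power2_eq_square algebra_simps)
    also have "\<dots> = (4 * D + D\<^sup>2 * l) * l ^ 3" by (simp add: power2_eq_square power3_eq_cube algebra_simps)
    also have "\<dots> \<le> (4 * D + D\<^sup>2 * \<bar>b - a\<bar>) * l ^ 3"
      using lb l0 D by (intro mult_right_mono add_mono mult_left_mono) auto
    finally have "\<alpha> * \<beta> * ?Q (X - Y) (X - Y) \<le> (4 * D + D\<^sup>2 * \<bar>b - a\<bar>) * l ^ 3" .
    moreover have "\<alpha> * \<beta> * (m * (norm (X - Y))\<^sup>2) \<le> \<alpha> * \<beta> * ?Q (X - Y) (X - Y)"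
      using m(2)[OF ball_cball[OF us], of "X - Y"] ab by (intro mult_left_mono) auto
    ultimately have "m * (\<alpha> * \<beta> * (norm (X - Y))\<^sup>2) \<le> (4 * D + D\<^sup>2 * \<bar>b - a\<bar>) * l ^ 3" by (simp add: mult_ac)
    then have "\<alpha> * \<beta> * (norm (X - Y))\<^sup>2 \<le> K * l ^ 3"
      using m(1) by (simp add: K_def field_simps)
    then show "(t - s) * (q - t) * (norm (slope u s t - slope u t q))\<^sup>2 \<le> K * (q - s) ^ 3"
      by (simp add: \<alpha>_def \<beta>_def l_def X_def Y_def)
  qed
qed

lemma isometric_C1:
  assumes ab: "a < b" and u: "isometric a b u"
  obtains u' where "\<And>t. t \<in> {a..b} \<Longrightarrow> (u has_vector_derivative u' t) (at t within {a..b})"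
    "continuous_on {a..b} u'" "\<And>t. t \<in> {a..b} \<Longrightarrow> h (u t) (u' t) (u' t) = 1"
proof (rule isometric_slopes[OF u])
  fix K assume K: "K \<ge> 0" "\<And>s t q. a \<le> s \<Longrightarrow> s < t \<Longrightarrow> t < q \<Longrightarrow> q \<le> b \<Longrightarrow>
       (t - s) * (q - t) * (norm (slope u s t - slope u t q))\<^sup>2 \<le> K * (q - s) ^ 3"
  show thesis
  proof (rule slopes_imp_C1[OF ab K])
    fix u' assume u': "\<And>t. t \<in> {a..b} \<Longrightarrow> (u has_vector_derivative u' t) (at t within {a..b})" "continuous_on {a..b} u'"
    have "h (u s) (u' s) (u' s) = 1" if s: "s \<in> {a..b}" for s
    proof (rule isometric_nrm[OF u])
      fix D assume D: "D \<ge> 0" "\<And>\<tau> s t l. {\<tau>, s, t} \<subseteq> {a..b} \<Longrightarrow> \<bar>\<tau> - s\<bar> \<le> l \<Longrightarrow> \<bar>s - t\<bar> \<le> l \<Longrightarrow> \<bar>nrm (u \<tau>) (u t - u s) - \<bar>t - s\<bar>\<bar> \<le> D * l * \<bar>t - s\<bar>"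
      have usS: "u s \<in> S" using u s ball_S by (auto simp: isometric_def)
      let ?F = "at s within {a..b}"
      have nb: "?F \<noteq> bot" using s ab by (simp add: trivial_limit_within islimpt_Icc)
      let ?q = "\<lambda>t. (u t - u s) /\<^sub>R (t - s)"
      have q: "(?q \<longlongrightarrow> u' s) ?F" using u'(1)[OF s] by (simp add: has_vector_derivative_iff_quotient)
      have "continuous_on UNIV (\<lambda>w. nrm (u s) w)" using usS by (intro continuous_on_nrm) auto
      then have 1: "((\<lambda>t. nrm (u s) (?q t)) \<longlongrightarrow> nrm (u s) (u' s)) ?F"
        by (rule continuous_on_tendsto_compose[OF _ q]) auto
      have "((\<lambda>t. nrm (u s) (?q t) - 1) \<longlongrightarrow> 0) ?F"
      proof (rule Lim_null_comparison)
        show "((\<lambda>t. D * \<bar>t - s\<bar>) \<longlongrightarrow> 0) ?F"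
          by (rule tendsto_eq_rhs[where x="D * \<bar>s - s\<bar>"]) (intro tendsto_intros, simp)
        have "norm (nrm (u s) (?q t) - 1) \<le> D * \<bar>t - s\<bar>" if t: "t \<in> {a..b}" "t \<noteq> s" for t
        proof -
          have "\<bar>nrm (u s) (u t - u s) - \<bar>t - s\<bar>\<bar> \<le> D * \<bar>t - s\<bar> * \<bar>t - s\<bar>"
            using D(2)[of s s t "\<bar>t - s\<bar>"] s t by (simp add: abs_minus_commute)
          moreover have "nrm (u s) (u t - u s) = \<bar>t - s\<bar> * nrm (u s) (?q t)"
            using nrm_scaleR[OF usS, of "t - s" "?q t"] t by simp
          ultimately have "\<bar>\<bar>t - s\<bar> * (nrm (u s) (?q t) - 1)\<bar> \<le> \<bar>t - s\<bar> * (D * \<bar>t - s\<bar>)" by (simp add: algebra_simps)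
          then show ?thesis using t unfolding abs_mult by simp
        qed
        then show "\<forall>\<^sub>F t in ?F. norm (nrm (u s) (?q t) - 1) \<le> D * \<bar>t - s\<bar>" by (simp add: eventually_at_filter)
      qed
      then have "((\<lambda>t. nrm (u s) (?q t)) \<longlongrightarrow> 1) ?F" by (simp add: LIM_zero_iff)
      then have "nrm (u s) (u' s) = 1" using 1 nb tendsto_unique by blast
      then show ?thesis using nrm_sq[OF usS, of "u' s"] by simp
    qed
    then show thesis using that u' by blast
  qed
qed

end

text \<open>The test function \<theta> is the primitive of \<open>D\<close>, that is, of
  \<open>F - \<Psi>\<close> minus its mean \<open>k\<close>; subtracting the mean makes \<theta>
  vanish at \<open>b\<close>. For this choice the variational identity says that the integral of
  \<open>D * D\<close> is 0, so \<open>F\<close> is \<Psi> plus a constant.\<close>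

lemma du_bois_reymond:
  fixes F G :: "real \<Rightarrow> real"
  assumes ab: "a < b" and F: "continuous_on {a..b} F" and G: "continuous_on {a..b} G"
    and var: "\<And>\<theta> \<theta>'. (\<And>t. t \<in> {a..b} \<Longrightarrow> (\<theta> has_vector_derivative \<theta>' t) (at t within {a..b})) \<Longrightarrow>
       continuous_on {a..b} \<theta>' \<Longrightarrow> \<theta> a = 0 \<Longrightarrow> \<theta> b = 0 \<Longrightarrow>
       integral {a..b} (\<lambda>t. F t * \<theta>' t + G t * \<theta> t) = 0"
    and t: "t \<in> {a..b}"
  shows "(F has_vector_derivative G t) (at t within {a..b})"
proof -
  define \<Psi> where "\<Psi> = (\<lambda>t. integral {a..t} G)"
  have \<Psi>: "(\<Psi> has_vector_derivative G t) (at t within {a..b})" if "t \<in> {a..b}" for t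
    unfolding \<Psi>_def by (rule integral_has_vector_derivative[OF G that])
  have \<Psi>c: "continuous_on {a..b} \<Psi>" by (rule has_vector_derivative_imp_continuous_on[OF \<Psi>])
  define k where "k = integral {a..b} (\<lambda>t. F t - \<Psi> t) / (b - a)"
  define D where "D = (\<lambda>t. F t - \<Psi> t - k)"
  have Dc: "continuous_on {a..b} D" unfolding D_def by (intro continuous_intros F \<Psi>c)
  define \<theta> where "\<theta> = (\<lambda>t. integral {a..t} D)"
  have \<theta>: "(\<theta> has_vector_derivative D t) (at t within {a..b})" if "t \<in> {a..b}" for t
    unfolding \<theta>_def by (rule integral_has_vector_derivative[OF Dc that])
  have \<theta>c: "continuous_on {a..b} \<theta>" by (rule has_vector_derivative_imp_continuous_on[OF \<theta>])
  have \<theta>0: "\<theta> a = 0" by (simp add: \<theta>_def)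
  have "integral {a..b} D = integral {a..b} (\<lambda>t. F t - \<Psi> t) - integral {a..b} (\<lambda>t. k)"
    unfolding D_def by (intro integral_diff integrable_continuous_real continuous_intros F \<Psi>c)
  also have "\<dots> = 0" using ab by (simp add: k_def)
  finally have \<theta>1: "\<theta> b = 0" by (simp add: \<theta>_def)
  have 1: "((\<lambda>t. F t * D t + G t * \<theta> t) has_integral 0) {a..b}"
  proof -
    have "(\<lambda>t. F t * D t + G t * \<theta> t) integrable_on {a..b}"
      by (intro integrable_continuous_real continuous_intros F G Dc \<theta>c)
    then show ?thesis using var[OF \<theta> Dc \<theta>0 \<theta>1] by (simp add: has_integral_integral)
  qed
  have 2: "((\<lambda>t. \<Psi> t * D t + G t * \<theta> t) has_integral (\<Psi> b * \<theta> b - \<Psi> a * \<theta> a)) {a..b}"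
    using ab \<Psi> \<theta> by (intro fundamental_theorem_of_calculus has_vector_derivative_mult) auto
  have 3: "(D has_integral (\<theta> b - \<theta> a)) {a..b}"
    using ab \<theta> by (intro fundamental_theorem_of_calculus) auto
  have "((\<lambda>t. (F t * D t + G t * \<theta> t) - (\<Psi> t * D t + G t * \<theta> t) - k * D t) has_integral (0 - (\<Psi> b * \<theta> b - \<Psi> a * \<theta> a) - k * (\<theta> b - \<theta> a))) {a..b}"
    by (intro has_integral_diff 1 2 has_integral_mult_right 3)
  moreover have "(F t * D t + G t * \<theta> t) - (\<Psi> t * D t + G t * \<theta> t) - k * D t = D t * D t" for t
    by (simp add: D_def algebra_simps)
  ultimately have "((\<lambda>t. D t * D t) has_integral 0) {a..b}" using \<theta>0 \<theta>1 by simp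
  then have "D t * D t = 0" if "t \<in> {a..b}" for t
    using has_integral_0_cbox_imp_0[of a b "\<lambda>t. D t * D t" t] ab that Dc
    by (auto intro!: continuous_intros)
  then have "D t = 0" if "t \<in> {a..b}" for t using that by simp
  then have eq: "F t = \<Psi> t + k" if "t \<in> {a..b}" for t using that unfolding D_def by fastforce
  have "((\<lambda>t. \<Psi> t + k) has_vector_derivative G t) (at t within {a..b})"
    using \<Psi>[OF t] by (simp add: has_vector_derivative_add_const)
  then show ?thesis
    by (rule has_vector_derivative_transform[OF t, rotated]) (simp add: eq)
qed

section \<open>The first variation of length\<close>

context local_metric
begin

lemma h_taylor:
  assumes K: "compact K" "convex K" "K \<subseteq> S" "K \<noteq> {}"
  obtains L where "L \<ge> 0" "\<And>x u v. x \<in> K \<Longrightarrow> \<bar>h x u v\<bar> \<le> L * norm u * norm v"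
     "\<And>x w u v. x \<in> K \<Longrightarrow> \<bar>dh x w u v\<bar> \<le> L * norm w * norm u * norm v"
     "\<And>x y v. x \<in> K \<Longrightarrow> y \<in> K \<Longrightarrow> \<bar>h y v v - h x v v - dh x (y - x) v v\<bar> \<le> L * (norm (y - x))\<^sup>2 * (norm v)\<^sup>2"
proof (rule bounds[OF K])
  fix m L assume L: "L \<ge> (0::real)"
    and b2: "\<And>x u v. x \<in> K \<Longrightarrow> \<bar>h x u v\<bar> \<le> L * norm u * norm v"
    and b4: "\<And>x w u v. x \<in> K \<Longrightarrow> \<bar>dh x w u v\<bar> \<le> L * norm w * norm u * norm v"
    and b5: "\<And>x y w u v. x \<in> K \<Longrightarrow> y \<in> K \<Longrightarrow> \<bar>dh x w u v - dh y w u v\<bar> \<le> L * norm (x - y) * norm w * norm u * norm v"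
  show thesis
  proof (rule that[OF L b2 b4])
    fix x y v assume x: "x \<in> K" and y: "y \<in> K"
    let ?T = "closed_segment x y"
    have T: "?T \<subseteq> K" using K(2) x y by (simp add: closed_segment_subset)
    have lin: "linear (\<lambda>w. dh x w v v)" using x K(3) by (intro dh_linear) auto
    have "norm (h y v v - h x v v - dh x (y - x) v v) \<le> norm (y - x) * (L * norm (y - x) * norm v * norm v)"
    proof (rule differentiable_bound_linearization[where S="?T" and f="\<lambda>z. h z v v" and f'="\<lambda>z w. dh z w v v"])
      show "x + t *\<^sub>R (y - x) \<in> ?T" if "t \<in> {0..1}" for t
        using that by (auto simp: in_segment algebra_simps intro!: exI[of _ t])
      fix z assume z: "z \<in> ?T"
      then have zK: "z \<in> K" "z \<in> S" using T K(3) by blast+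
      show "((\<lambda>z. h z v v) has_derivative (\<lambda>w. dh z w v v)) (at z within ?T)"
        by (rule has_derivative_at_withinI[OF h_has_derivative[OF zK(2)]])
      show "onorm ((\<lambda>w. dh z w v v) - (\<lambda>w. dh x w v v)) \<le> L * norm (y - x) * norm v * norm v"
      proof (rule onorm_le)
        fix w
        have "norm (z - x) \<le> norm (y - x)" using segment_bound1[OF z] .
        have "\<bar>dh z w v v - dh x w v v\<bar> \<le> L * norm (z - x) * norm w * norm v * norm v"
          by (rule b5[OF zK(1) x])
        also have "\<dots> \<le> L * norm (y - x) * norm w * norm v * norm v"
          using \<open>norm (z - x) \<le> norm (y - x)\<close> L by (intro mult_right_mono mult_left_mono) auto
        finally show "norm (((\<lambda>w. dh z w v v) - (\<lambda>w. dh x w v v)) w) \<le> L * norm (y - x) * norm v * norm v * norm w"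
          by (simp add: mult_ac)
      qed
    qed simp
    then show "\<bar>h y v v - h x v v - dh x (y - x) v v\<bar> \<le> L * (norm (y - x))\<^sup>2 * (norm v)\<^sup>2"
      by (simp add: power2_eq_square mult_ac)
  qed
qed

text \<open>The coefficient of \<epsilon> is twice the integrand of the first variation.
  \<open>Q\<close> is uniform over all data bounded by \<open>M\<close>, so the estimate can be
  integrated along a curve. An upper bound is enough because the length of the varied curve is
  bounded below by a distance.\<close>

lemma h_second_order:
  assumes K: "compact K" "convex K" "K \<subseteq> S" "K \<noteq> {}" and M: "M \<ge> 0"
  obtains Q where "Q \<ge> 0" "\<And>x w w' U \<epsilon>. x \<in> K \<Longrightarrow> x + \<epsilon> *\<^sub>R w \<in> K \<Longrightarrow> \<bar>\<epsilon>\<bar> \<le> 1 \<Longrightarrow> norm w \<le> M \<Longrightarrow> norm w' \<le> M \<Longrightarrow> norm U \<le> M \<Longrightarrow>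
    h (x + \<epsilon> *\<^sub>R w) (U + \<epsilon> *\<^sub>R w') (U + \<epsilon> *\<^sub>R w') \<le> h x U U + \<epsilon> * (2 * h x U w' + dh x w U U) + Q * \<epsilon>\<^sup>2"
proof (rule h_taylor[OF K])
  fix L assume L: "L \<ge> 0" and b2: "\<And>x u v. x \<in> K \<Longrightarrow> \<bar>h x u v\<bar> \<le> L * norm u * norm v"
    and b4: "\<And>x w u v. x \<in> K \<Longrightarrow> \<bar>dh x w u v\<bar> \<le> L * norm w * norm u * norm v"
    and ta: "\<And>x y v. x \<in> K \<Longrightarrow> y \<in> K \<Longrightarrow> \<bar>h y v v - h x v v - dh x (y - x) v v\<bar> \<le> L * (norm (y - x))\<^sup>2 * (norm v)\<^sup>2"
  define Q where "Q = L * M\<^sup>2 + 3 * (L * M * M * M) + L * M\<^sup>2 * (2 * M)\<^sup>2"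
  show thesis
  proof (rule that)
    show "Q \<ge> 0" using L M by (simp add: Q_def)
    fix x w w' U :: 'e and \<epsilon> :: real
    assume x: "x \<in> K" "x + \<epsilon> *\<^sub>R w \<in> K" and \<epsilon>: "\<bar>\<epsilon>\<bar> \<le> 1" and n: "norm w \<le> M" "norm w' \<le> M" "norm U \<le> M"
    have xS: "x \<in> S" using x K(3) by auto
    note B = bil[OF xS] and dB = dh_bilinear[OF xS]
    define V where "V = U + \<epsilon> *\<^sub>R w'"
    have nV: "norm V \<le> 2 * M"
    proof -
      have "norm V \<le> norm U + \<bar>\<epsilon>\<bar> * norm w'" unfolding V_def using norm_triangle_ineq[of U "\<epsilon> *\<^sub>R w'"] by simp
      also have "\<bar>\<epsilon>\<bar> * norm w' \<le> 1 * norm w'" using \<epsilon> by (intro mult_right_mono) auto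
      finally show ?thesis using n by simp
    qed
    have "h (x + \<epsilon> *\<^sub>R w) V V \<le> h x V V + dh x (\<epsilon> *\<^sub>R w) V V + L * (norm (\<epsilon> *\<^sub>R w))\<^sup>2 * (norm V)\<^sup>2"
      using ta[OF x, of V] by simp
    also have "L * (norm (\<epsilon> *\<^sub>R w))\<^sup>2 * (norm V)\<^sup>2 = (L * (norm w)\<^sup>2 * (norm V)\<^sup>2) * \<epsilon>\<^sup>2" by (simp add: power_mult_distrib)
    also have "\<dots> \<le> (L * M\<^sup>2 * (2 * M)\<^sup>2) * \<epsilon>\<^sup>2"
      using n nV L by (intro mult_right_mono mult_mono mult_left_mono power_mono) auto
    finally have 1: "h (x + \<epsilon> *\<^sub>R w) V V \<le> h x V V + dh x (\<epsilon> *\<^sub>R w) V V + (L * M\<^sup>2 * (2 * M)\<^sup>2) * \<epsilon>\<^sup>2" by simp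
    have "h x V V = h x U U + 2 * \<epsilon> * h x U w' + h x w' w' * \<epsilon>\<^sup>2"
      using sym[OF xS, of w' U] by (simp add: V_def bilinear_ladd[OF B] bilinear_radd[OF B] bilinear_lmul[OF B] bilinear_rmul[OF B] power2_eq_square algebra_simps)
    also have "h x w' w' * \<epsilon>\<^sup>2 \<le> L * M\<^sup>2 * \<epsilon>\<^sup>2"
    proof (rule mult_right_mono)
      have "h x w' w' \<le> L * norm w' * norm w'" using b2[OF x(1), of w' w'] by simp
      also have "\<dots> \<le> L * M * M" using n L M by (intro mult_mono) auto
      finally show "h x w' w' \<le> L * M\<^sup>2" by (simp add: power2_eq_square mult.assoc)
    qed simp
    finally have 2: "h x V V \<le> h x U U + 2 * \<epsilon> * h x U w' + L * M\<^sup>2 * \<epsilon>\<^sup>2" by simp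
    have dl: "dh x (\<epsilon> *\<^sub>R w) V V = \<epsilon> * dh x w V V"
      using linear_scale[OF dh_linear[OF xS, of V V], of \<epsilon> w] by simp
    have "dh x w V V = dh x w U U + 2 * \<epsilon> * dh x w U w' + \<epsilon>\<^sup>2 * dh x w w' w'"
      using dh_sym[OF xS, of w w' U] by (simp add: V_def bilinear_ladd[OF dB] bilinear_radd[OF dB] bilinear_lmul[OF dB] bilinear_rmul[OF dB] power2_eq_square algebra_simps)
    then have "dh x (\<epsilon> *\<^sub>R w) V V = \<epsilon> * dh x w U U + \<epsilon>\<^sup>2 * (2 * dh x w U w' + \<epsilon> * dh x w w' w')"
      unfolding dl by (simp add: power2_eq_square algebra_simps)
    also have "\<epsilon>\<^sup>2 * (2 * dh x w U w' + \<epsilon> * dh x w w' w') \<le> \<epsilon>\<^sup>2 * (3 * (L * M * M * M))"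
    proof (rule mult_left_mono)
      have "\<bar>dh x w U w'\<bar> \<le> L * norm w * norm U * norm w'" by (rule b4[OF x(1)])
      also have "\<dots> \<le> L * M * M * M" using n L M by (intro mult_mono) auto
      finally have i: "\<bar>dh x w U w'\<bar> \<le> L * M * M * M" .
      have "\<bar>dh x w w' w'\<bar> \<le> L * norm w * norm w' * norm w'" by (rule b4[OF x(1)])
      also have "\<dots> \<le> L * M * M * M" using n L M by (intro mult_mono) auto
      finally have ii: "\<bar>dh x w w' w'\<bar> \<le> L * M * M * M" .
      have "\<epsilon> * dh x w w' w' \<le> \<bar>\<epsilon>\<bar> * \<bar>dh x w w' w'\<bar>" by (metis abs_ge_self abs_mult)
      also have "\<dots> \<le> 1 * \<bar>dh x w w' w'\<bar>" using \<epsilon> by (intro mult_right_mono) auto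
      finally show "2 * dh x w U w' + \<epsilon> * dh x w w' w' \<le> 3 * (L * M * M * M)" using i ii by linarith
    qed simp
    finally have 3: "dh x (\<epsilon> *\<^sub>R w) V V \<le> \<epsilon> * dh x w U U + 3 * (L * M * M * M) * \<epsilon>\<^sup>2" by (simp add: mult_ac)
    have "Q * \<epsilon>\<^sup>2 = L * M\<^sup>2 * \<epsilon>\<^sup>2 + 3 * (L * M * M * M) * \<epsilon>\<^sup>2 + (L * M\<^sup>2 * (2 * M)\<^sup>2) * \<epsilon>\<^sup>2"
      by (simp add: Q_def algebra_simps)
    moreover have "\<epsilon> * (2 * h x U w' + dh x w U U) = 2 * \<epsilon> * h x U w' + \<epsilon> * dh x w U U" by (simp add: algebra_simps)
    ultimately show "h (x + \<epsilon> *\<^sub>R w) (U + \<epsilon> *\<^sub>R w') (U + \<epsilon> *\<^sub>R w') \<le> h x U U + \<epsilon> * (2 * h x U w' + dh x w U U) + Q * \<epsilon>\<^sup>2"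
      unfolding V_def[symmetric] using 1 2 3 by linarith
  qed
qed

end

lemma continuous_on_Icc_bounded:
  fixes f :: "real \<Rightarrow> 'f::real_normed_vector"
  assumes "continuous_on {a..b} f"
  obtains M where "M \<ge> 0" "\<And>t. t \<in> {a..b} \<Longrightarrow> norm (f t) \<le> M"
proof -
  have "bounded (f ` {a..b})" using assms compact_Icc compact_continuous_image compact_imp_bounded by blast
  then obtain M where "\<forall>y\<in>f ` {a..b}. norm y \<le> M" by (auto simp: bounded_iff)
  then show thesis by (intro that[of "\<bar>M\<bar>"]) force+
qed

context local_metric_dist
begin

text \<open>The varied curve has the same end points, so its length is at least
  \<open>b - a\<close>. An upper bound of this length by \<open>b - a + \<epsilon> * I\<close> plus
  a quadratic term therefore gives an inequality for small \<epsilon> of either sign, which forces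
  \<open>I = 0\<close>.\<close>

lemma first_variation:
  assumes ab: "a < b" and u: "isometric a b u"
    and u': "\<And>t. t \<in> {a..b} \<Longrightarrow> (u has_vector_derivative u' t) (at t within {a..b})"
      "continuous_on {a..b} u'" "\<And>t. t \<in> {a..b} \<Longrightarrow> h (u t) (u' t) (u' t) = 1"
    and \<theta>: "\<And>t. t \<in> {a..b} \<Longrightarrow> (\<theta> has_vector_derivative \<theta>' t) (at t within {a..b})"
       "continuous_on {a..b} \<theta>'" "\<theta> a = 0" "\<theta> b = 0"
  shows "integral {a..b} (\<lambda>t. h (u t) (u' t) e * \<theta>' t + dh (u t) e (u' t) (u' t) / 2 * \<theta> t) = 0"
proof -
  define A where "A = (\<lambda>t. h (u t) (u' t) e * \<theta>' t + dh (u t) e (u' t) (u' t) / 2 * \<theta> t)"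
  have uB: "u t \<in> ball p r" if "t \<in> {a..b}" for t using u that by (auto simp: isometric_def)
  note uS = ball_S[OF uB]
  have uc: "continuous_on {a..b} u" by (rule has_vector_derivative_imp_continuous_on[OF u'(1)])
  have \<theta>c: "continuous_on {a..b} \<theta>" by (rule has_vector_derivative_imp_continuous_on[OF \<theta>(1)])
  have Ac: "continuous_on {a..b} A"
    unfolding A_def by (intro continuous_intros continuous_on_h continuous_on_dh uc uS u'(2) \<theta>(2) \<theta>c) auto
  obtain M1 where M1: "M1 \<ge> 0" "\<And>t. t \<in> {a..b} \<Longrightarrow> norm (u' t) \<le> M1"
    by (rule continuous_on_Icc_bounded[OF u'(2)]) (rule that)
  have "continuous_on {a..b} (\<lambda>t. \<theta> t *\<^sub>R e)" "continuous_on {a..b} (\<lambda>t. \<theta>' t *\<^sub>R e)"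
    by (intro continuous_intros \<theta>c \<theta>(2))+
  note bc = this
  obtain M2 where M2: "M2 \<ge> 0" "\<And>t. t \<in> {a..b} \<Longrightarrow> norm (\<theta> t *\<^sub>R e) \<le> M2"
    by (rule continuous_on_Icc_bounded[OF bc(1)]) (rule that)
  obtain M3 where M3: "M3 \<ge> 0" "\<And>t. t \<in> {a..b} \<Longrightarrow> norm (\<theta>' t *\<^sub>R e) \<le> M3"
    by (rule continuous_on_Icc_bounded[OF bc(2)]) (rule that)
  define M where "M = M1 + M2 + M3 + 1"
  have MM: "M > 0" "M1 \<le> M" "M2 \<le> M" "M3 \<le> M" unfolding M_def using M1(1) M2(1) M3(1) by auto
  have M: "M > 0" "\<And>t. t \<in> {a..b} \<Longrightarrow> norm (u' t) \<le> M" "\<And>t. t \<in> {a..b} \<Longrightarrow> norm (\<theta> t *\<^sub>R e) \<le> M"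
    "\<And>t. t \<in> {a..b} \<Longrightarrow> norm (\<theta>' t *\<^sub>R e) \<le> M"
    using MM(1) order.trans[OF M1(2) MM(2)] order.trans[OF M2(2) MM(3)] order.trans[OF M3(2) MM(4)] by blast+
  obtain Q where Q: "Q \<ge> 0" "\<And>x w w' U \<epsilon>. x \<in> cball p r \<Longrightarrow> x + \<epsilon> *\<^sub>R w \<in> cball p r \<Longrightarrow> \<bar>\<epsilon>\<bar> \<le> 1 \<Longrightarrow> norm w \<le> M \<Longrightarrow> norm w' \<le> M \<Longrightarrow> norm U \<le> M \<Longrightarrow>
    h (x + \<epsilon> *\<^sub>R w) (U + \<epsilon> *\<^sub>R w') (U + \<epsilon> *\<^sub>R w') \<le> h x U U + \<epsilon> * (2 * h x U w' + dh x w U U) + Q * \<epsilon>\<^sup>2"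
    by (rule h_second_order[OF cball_props less_imp_le[OF M(1)]]) (rule that)
  have "\<exists>t0\<in>{a..b}. \<forall>t\<in>{a..b}. dist p (u t) \<le> dist p (u t0)"
    using ab by (intro continuous_attains_sup continuous_intros uc) auto
  then obtain t0 where t0: "t0 \<in> {a..b}" "\<And>t. t \<in> {a..b} \<Longrightarrow> dist p (u t) \<le> dist p (u t0)" by blast
  define \<rho> where "\<rho> = dist p (u t0)"
  have \<rho>: "\<rho> < r" "\<And>t. t \<in> {a..b} \<Longrightarrow> dist p (u t) \<le> \<rho>" using uB[OF t0(1)] t0(2) by (auto simp: \<rho>_def)
  \<comment> \<open>The curve keeps at least the distance \<open>r - \<rho>\<close> from the
    boundary of the ball; a displacement of at most half of it stays inside, where \<open>dd\<close>
    is controlled.\<close>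
  define \<epsilon>0 where "\<epsilon>0 = min 1 ((r - \<rho>) / (2 * M))"
  have \<epsilon>0: "\<epsilon>0 > 0" "\<epsilon>0 \<le> 1" "\<epsilon>0 * M \<le> (r - \<rho>) / 2"
    using \<rho>(1) M(1) by (auto simp: \<epsilon>0_def min_def field_simps)
  define I where "I = integral {a..b} A"
  have ineq: "0 \<le> \<epsilon> * I + Q * (b - a) / 2 * \<epsilon>\<^sup>2" if \<epsilon>: "\<bar>\<epsilon>\<bar> \<le> \<epsilon>0" for \<epsilon>
  proof -
    define v where "v = (\<lambda>t. u t + \<epsilon> *\<^sub>R (\<theta> t *\<^sub>R e))"
    define v' where "v' = (\<lambda>t. u' t + \<epsilon> *\<^sub>R (\<theta>' t *\<^sub>R e))"
    have vB: "v t \<in> ball p r" if t: "t \<in> {a..b}" for t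
    proof -
      have "dist p (v t) \<le> dist p (u t) + norm (\<epsilon> *\<^sub>R (\<theta> t *\<^sub>R e))"
        unfolding v_def dist_norm using norm_triangle_ineq4[of "p - u t" "\<epsilon> *\<^sub>R (\<theta> t *\<^sub>R e)"] by (simp add: algebra_simps)
      also have "norm (\<epsilon> *\<^sub>R (\<theta> t *\<^sub>R e)) \<le> \<epsilon>0 * M"
        unfolding norm_scaleR[of \<epsilon>] using \<epsilon> M(3)[OF t] \<epsilon>0(1) by (intro mult_mono) auto
      finally have "dist p (v t) \<le> \<rho> + (r - \<rho>) / 2" using \<rho>(2)[OF t] \<epsilon>0(3) by linarith
      then show ?thesis using \<rho>(1) by (simp add: field_simps)
    qed
    have vd: "(v has_vector_derivative v' t) (at t within {a..b})" if t: "t \<in> {a..b}" for t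
    proof -
      have "((\<lambda>t. \<theta> t *\<^sub>R e) has_vector_derivative \<theta>' t *\<^sub>R e) (at t within {a..b})"
        using bounded_linear.has_vector_derivative[OF bounded_linear_scaleR_left \<theta>(1)[OF t]] .
      then have "((\<lambda>t. \<epsilon> *\<^sub>R (\<theta> t *\<^sub>R e)) has_vector_derivative \<epsilon> *\<^sub>R (\<theta>' t *\<^sub>R e)) (at t within {a..b})"
        by (rule bounded_linear.has_vector_derivative[OF bounded_linear_scaleR_right])
      then show ?thesis unfolding v_def v'_def by (intro has_vector_derivative_add u'(1) t)
    qed
    have v'c: "continuous_on {a..b} v'" unfolding v'_def by (intro continuous_intros u'(2) \<theta>(2))
    have vc: "continuous_on {a..b} v" by (rule has_vector_derivative_imp_continuous_on[OF vd])
    have "b - a = dd (v a) (v b)" using u ab \<theta>(3,4) by (simp add: isometric_def v_def)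
    also have "\<dots> \<le> integral {a..b} (\<lambda>t. nrm (v t) (v' t))"
      by (rule dist_le_length[OF less_imp_le[OF ab] vB vd v'c])
    also have "\<dots> \<le> integral {a..b} (\<lambda>t. 1 + (\<epsilon> * A t + Q / 2 * \<epsilon>\<^sup>2))"
    proof (rule integral_le)
      show "(\<lambda>t. nrm (v t) (v' t)) integrable_on {a..b}"
        by (intro integrable_continuous_real continuous_on_nrm vc v'c ball_S vB)
      show "(\<lambda>t. 1 + (\<epsilon> * A t + Q / 2 * \<epsilon>\<^sup>2)) integrable_on {a..b}"
        by (intro integrable_continuous_real continuous_intros Ac)
      fix t assume t: "t \<in> {a..b}"
      note xS = uS[OF t]
      \<comment> \<open>Length is compared with energy: \<open>sqrt z\<close> is at most
        \<open>(1 + z) / 2\<close>, with equality at the unit speed of \<open>u\<close>, so no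
        first-order term is lost.\<close>
      have "nrm (v t) (v' t) \<le> (1 + h (v t) (v' t) (v' t)) / 2"
        using arith_geo_mean_sqrt[of 1 "h (v t) (v' t) (v' t)"] h_nonneg[OF ball_S[OF vB[OF t]]] by (simp add: nrm_def)
      moreover have "h (v t) (v' t) (v' t) \<le> h (u t) (u' t) (u' t) +
          \<epsilon> * (2 * h (u t) (u' t) (\<theta>' t *\<^sub>R e) + dh (u t) (\<theta> t *\<^sub>R e) (u' t) (u' t)) + Q * \<epsilon>\<^sup>2"
        unfolding v_def v'_def
        by (rule Q(2)) (use vB[OF t] uB[OF t] \<epsilon> \<epsilon>0 M t in \<open>auto simp: v_def\<close>)
      moreover have "h (u t) (u' t) (\<theta>' t *\<^sub>R e) = \<theta>' t * h (u t) (u' t) e"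
        by (simp add: bilinear_rmul[OF bil[OF xS]])
      moreover have "dh (u t) (\<theta> t *\<^sub>R e) (u' t) (u' t) = \<theta> t * dh (u t) e (u' t) (u' t)"
        using linear_scale[OF dh_linear[OF xS]] by simp
      ultimately show "nrm (v t) (v' t) \<le> 1 + (\<epsilon> * A t + Q / 2 * \<epsilon>\<^sup>2)"
        using u'(3)[OF t] by (simp add: A_def algebra_simps)
    qed
    also have "\<dots> = (b - a) + (\<epsilon> * I + Q / 2 * \<epsilon>\<^sup>2 * (b - a))"
    proof (rule integral_unique)
      have c: "((\<lambda>t. x) has_integral x * (b - a)) {a..b}" for x :: real
        using has_integral_const_real[of x a b] ab by (simp add: mult.commute)
      have "(A has_integral I) {a..b}"
        unfolding I_def by (intro integrable_integral integrable_continuous_real Ac)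
      then have "((\<lambda>t. 1 + (\<epsilon> * A t + Q / 2 * \<epsilon>\<^sup>2)) has_integral (1 * (b - a) + (\<epsilon> * I + Q / 2 * \<epsilon>\<^sup>2 * (b - a)))) {a..b}"
        by (intro has_integral_add c has_integral_mult_right)
      then show "((\<lambda>t. 1 + (\<epsilon> * A t + Q / 2 * \<epsilon>\<^sup>2)) has_integral ((b - a) + (\<epsilon> * I + Q / 2 * \<epsilon>\<^sup>2 * (b - a)))) {a..b}" by simp
    qed
    finally show ?thesis by (simp add: mult_ac)
  qed
  define Q' where "Q' = Q * (b - a) / 2 + 1"
  have "0 \<le> Q * (b - a)" using Q(1) ab by simp
  then have Q': "Q' > 0" by (simp add: Q'_def)
  have "\<bar>I\<bar> \<le> 0"
  proof (rule field_le_epsilon)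
    fix \<delta> :: real assume \<delta>: "\<delta> > 0"
    define \<eta> where "\<eta> = min \<epsilon>0 (\<delta> / Q')"
    have \<eta>: "\<eta> > 0" "\<eta> \<le> \<epsilon>0" "Q' * \<eta> \<le> \<delta>" using \<delta> \<epsilon>0 Q' by (auto simp: \<eta>_def min_def field_simps)
    have "\<eta> * \<bar>I\<bar> \<le> Q' * \<eta>\<^sup>2"
    proof -
      have "Q * (b - a) / 2 * \<eta>\<^sup>2 \<le> Q' * \<eta>\<^sup>2" by (intro mult_right_mono) (auto simp: Q'_def)
      moreover have "\<eta> * \<bar>I\<bar> = \<bar>\<eta> * I\<bar>" using \<eta>(1) by (simp add: abs_mult)
      moreover have "0 \<le> \<eta> * I + Q * (b - a) / 2 * \<eta>\<^sup>2" using ineq[of \<eta>] \<eta> by simp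
      moreover have "0 \<le> - (\<eta> * I) + Q * (b - a) / 2 * \<eta>\<^sup>2" using ineq[of "- \<eta>"] \<eta> by simp
      ultimately show ?thesis by linarith
    qed
    then have "\<bar>I\<bar> \<le> Q' * \<eta>" using \<eta>(1) by (simp add: power2_eq_square)
    then show "\<bar>I\<bar> \<le> 0 + \<delta>" using \<eta>(3) by simp
  qed
  then show ?thesis by (simp add: I_def A_def)
qed

lemma isometric_extremal:
  assumes ab: "a < b" and u: "isometric a b u"
  obtains u' where "extremal a b u u'"
proof (rule isometric_C1[OF assms])
  fix u' assume u': "\<And>t. t \<in> {a..b} \<Longrightarrow> (u has_vector_derivative u' t) (at t within {a..b})"
    "continuous_on {a..b} u'" "\<And>t. t \<in> {a..b} \<Longrightarrow> h (u t) (u' t) (u' t) = 1"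
  have uS: "u t \<in> S" if "t \<in> {a..b}" for t using u that by (auto simp: isometric_def intro: ball_S)
  have uc: "continuous_on {a..b} u" by (rule has_vector_derivative_imp_continuous_on[OF u'(1)])
  have EL: "((\<lambda>t. h (u t) (u' t) e) has_vector_derivative dh (u t) e (u' t) (u' t) / 2) (at t within {a..b})"
    if t: "t \<in> {a..b}" for t e
  proof (rule du_bois_reymond[OF ab _ _ _ t])
    show "continuous_on {a..b} (\<lambda>t. h (u t) (u' t) e)" by (intro continuous_on_h uc uS u'(2) continuous_intros)
    show "continuous_on {a..b} (\<lambda>t. dh (u t) e (u' t) (u' t) / 2)"
      by (intro continuous_on_divide continuous_on_dh uc uS u'(2) continuous_on_const) auto
  next
    fix \<theta> \<theta>' :: "real \<Rightarrow> real" assume "\<And>t. t \<in> {a..b} \<Longrightarrow> (\<theta> has_vector_derivative \<theta>' t) (at t within {a..b})"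
       "continuous_on {a..b} \<theta>'" "\<theta> a = 0" "\<theta> b = 0"
    from first_variation[OF ab u u' this]
    show "integral {a..b} (\<lambda>t. h (u t) (u' t) e * \<theta>' t + dh (u t) e (u' t) (u' t) / 2 * \<theta> t) = 0" .
  qed
  show thesis
  proof (rule that)
    show "extremal a b u u'" unfolding extremal_def
      by (intro conjI ballI allI uS u' EL)
  qed
qed

end

section \<open>Smoothness, geodesic equation and uniqueness of extremals\<close>

lemma at_within_Icc_not_bot: "a < b \<Longrightarrow> t \<in> {a..b} \<Longrightarrow> at t within {a..b} \<noteq> bot" for a b t :: real
  by (simp add: trivial_limit_within islimpt_Icc)

context local_metric
begin

lemma Ck_h:
  assumes x: "Ck k J x" "\<And>t. t \<in> J \<Longrightarrow> x t \<in> S"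
  shows "Ck k J (\<lambda>t. h (x t) b e)"
  by (rule Ck_compose_analytic[OF open_S x(2) ana x(1)])

lemma Ck_dh:
  assumes x: "Ck k J x" "\<And>t. t \<in> J \<Longrightarrow> x t \<in> S" and uv: "Ck k J u" "Ck k J v" and w: "w \<in> Basis"
  shows "Ck k J (\<lambda>t. dh (x t) w (u t) (v t))"
proof -
  have "Ck k J (\<lambda>t. \<Sum>b\<in>Basis. \<Sum>e\<in>Basis. (u t \<bullet> b) * (v t \<bullet> e) * dh (x t) w b e)"
    by (intro Ck_sum Ck_mult Ck_inner uv Ck_compose_analytic[OF open_S x(2) dh_analytic[OF w] x(1)])
  then show ?thesis
    by (rule Ck_cong) (simp add: dh_expand[OF x(2), symmetric])
qed

text \<open>The bootstrap: if \<open>u\<close> and \<open>u'\<close> are of class k, so is the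
  derivative of the momentum, hence the momentum is of class k + 1. \<open>Ck_solve\<close> then
  recovers \<open>u'\<close> from it with the same regularity.\<close>

lemma extremal_Ck:
  assumes "extremal a b u u'"
  shows "Ck k {a..b} u \<and> Ck k {a..b} u'"
proof (induction k)
  note ex = assms[unfolded extremal_def]
  case 0
  have "continuous_on {a..b} u" by (rule has_vector_derivative_imp_continuous_on) (use ex in blast)
  then show ?case using ex by simp
next
  case (Suc k)
  note ex = assms[unfolded extremal_def]
  have uS: "\<And>t. t \<in> {a..b} \<Longrightarrow> u t \<in> S" using ex by blast
  have u: "Ck (Suc k) {a..b} u" unfolding Ck.simps using ex Suc by (intro exI[of _ u']) auto
  have "Ck (Suc k) {a..b} u'"
  proof (rule Ck_solve[where B="\<lambda>t. h (u t)" and p="\<lambda>e t. h (u t) (u' t) e"])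
    show "\<And>d e. Ck (Suc k) {a..b} (\<lambda>t. h (u t) d e)" by (rule Ck_h[OF u uS])
    fix e :: 'e assume e: "e \<in> Basis"
    have "Ck k {a..b} (\<lambda>t. (1/2) * dh (u t) e (u' t) (u' t))"
      using Suc by (intro Ck_mult Ck_const Ck_dh uS e) auto
    then have "Ck k {a..b} (\<lambda>t. dh (u t) e (u' t) (u' t) / 2)" by simp
    then show "Ck (Suc k) {a..b} (\<lambda>t. h (u t) (u' t) e)"
      unfolding Ck.simps using ex by (intro exI[of _ "\<lambda>t. dh (u t) e (u' t) (u' t) / 2"] conjI ballI) auto
  qed (use uS bil pos in auto)
  then show ?case using u by simp
qed

text \<open>The derivative of the momentum is computed a second time by the product rule and
  compared with the Euler-Lagrange equation. The outcome is the Koszul formula of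
  \<open>christoffel\<close> with both arguments equal to the velocity, where two of its three terms
  coincide.\<close>

lemma extremal_geodesic_equation:
  assumes ab: "a < b" and ext: "extremal a b u u'" and t: "t \<in> {a..b}"
  obtains u'' where "(u' has_vector_derivative u'') (at t within {a..b})"
    "\<And>w. 2 * h (u t) (- u'') w = 2 * dh (u t) (u' t) (u' t) w - dh (u t) w (u' t) (u' t)"
proof -
  note ex = ext[unfolded extremal_def]
  have uS: "\<And>t. t \<in> {a..b} \<Longrightarrow> u t \<in> S" using ex by blast
  have ud: "(u has_vector_derivative u' t) (at t within {a..b})" using ex t by blast
  have "Ck 1 {a..b} u'" using extremal_Ck[OF ext] by blast
  then obtain u'' where "\<forall>s\<in>{a..b}. (u' has_vector_derivative u'' s) (at s within {a..b})" by auto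
  then have u'': "(u' has_vector_derivative u'' t) (at t within {a..b})" using t by blast
  let ?F = "at t within {a..b}"
  have hd: "((\<lambda>s. h (u s) b e) has_vector_derivative dh (u t) (u' t) b e) ?F" for b e
  proof -
    have "((\<lambda>s. h (u s) b e) has_derivative (\<lambda>x. dh (u t) (x *\<^sub>R u' t) b e)) ?F"
      by (rule has_derivative_compose[where f=u and g="\<lambda>y. h y b e",
            OF ud[unfolded has_vector_derivative_def] h_has_derivative[OF uS[OF t]]])
    then show ?thesis unfolding has_vector_derivative_def
      using linear_scale[OF dh_linear[OF uS[OF t]]] by simp
  qed
  have "2 * h (u t) (- u'' t) w = 2 * dh (u t) (u' t) (u' t) w - dh (u t) w (u' t) (u' t)" for w
  proof -
    note B = bil[OF uS[OF t]]
    have "((\<lambda>s. \<Sum>b\<in>Basis. (u' s \<bullet> b) * h (u s) b w) has_vector_derivative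
        (\<Sum>b\<in>Basis. (u' t \<bullet> b) * dh (u t) (u' t) b w + (u'' t \<bullet> b) * h (u t) b w)) ?F"
      by (intro has_vector_derivative_sum has_vector_derivative_mult hd
          bounded_linear.has_vector_derivative[OF bounded_linear_inner_left u''])
    moreover have flip: "bilinear (\<lambda>x y. f y x)" if "bilinear f" for f :: "'e \<Rightarrow> 'e \<Rightarrow> real"
      using that by (simp add: bilinear_def)
    have exp: "(\<Sum>b\<in>Basis. (v \<bullet> b) * f b w) = f v w" if "bilinear f" for f :: "'e \<Rightarrow> 'e \<Rightarrow> real" and v
      using bilinear_expand_right[OF flip[OF that], where v=w and w=v] by simp
    ultimately have "((\<lambda>s. \<Sum>b\<in>Basis. (u' s \<bullet> b) * h (u s) b w) has_vector_derivative
        (dh (u t) (u' t) (u' t) w + h (u t) (u'' t) w)) ?F"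
      by (simp add: sum.distrib exp[OF B] exp[OF dh_bilinear[OF uS[OF t]]])
    then have "((\<lambda>s. h (u s) (u' s) w) has_vector_derivative
        (dh (u t) (u' t) (u' t) w + h (u t) (u'' t) w)) ?F"
      by (rule has_vector_derivative_transform[OF t, rotated]) (simp add: exp[OF bil[OF uS]])
    moreover have "((\<lambda>s. h (u s) (u' s) w) has_vector_derivative dh (u t) w (u' t) (u' t) / 2) ?F"
      using ex t by blast
    ultimately have "dh (u t) (u' t) (u' t) w + h (u t) (u'' t) w = dh (u t) w (u' t) (u' t) / 2"
      by (rule vector_derivative_unique_within[OF at_within_Icc_not_bot[OF ab t]])
    moreover have "h (u t) (- u'' t) w = - h (u t) (u'' t) w"
      using bilinear_lneg[OF B] by simp
    ultimately show ?thesis by simp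
  qed
  then show thesis using that[OF u''] by simp
qed

text \<open>Uniqueness uses the momenta \<open>h (u t) (u' t) \<cdot>\<close> in place of the velocities: in these
  variables the equation of motion needs no inverse metric.\<close>

lemma extremal_unique:
  assumes K: "compact K" "convex K" "K \<subseteq> S"
    and u: "extremal a b u u'" "\<And>t. t \<in> {a..b} \<Longrightarrow> u t \<in> K"
    and v: "extremal a b v v'" "\<And>t. t \<in> {a..b} \<Longrightarrow> v t \<in> K"
    and ab: "a \<le> b" and init: "u b = v b" "u' b = v' b" and t: "t \<in> {a..b}"
  shows "u t = v t"
proof -
  have "K \<noteq> {}" using u(2) ab by force
  show ?thesis
  proof (rule bounds[OF K \<open>K \<noteq> {}\<close>])
    fix m L assume mL: "m > 0" "L \<ge> (0::real)"
      and b1: "\<And>x u. x \<in> K \<Longrightarrow> m * (norm u)\<^sup>2 \<le> h x u u"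
      and b3: "\<And>x y u v. x \<in> K \<Longrightarrow> y \<in> K \<Longrightarrow> \<bar>h x u v - h y u v\<bar> \<le> L * norm (x - y) * norm u * norm v"
      and b4: "\<And>x w u v. x \<in> K \<Longrightarrow> \<bar>dh x w u v\<bar> \<le> L * norm w * norm u * norm v"
      and b5: "\<And>x y w u v. x \<in> K \<Longrightarrow> y \<in> K \<Longrightarrow> \<bar>dh x w u v - dh y w u v\<bar> \<le> L * norm (x - y) * norm w * norm u * norm v"
    note eu = u(1)[unfolded extremal_def] and ev = v(1)[unfolded extremal_def]
    \<comment> \<open>\<open>P\<close> and \<open>Q\<close> are the momenta assembled into vectors,
      and \<open>W\<close> below is the squared distance of the two solutions in phase
      space.\<close>
    define P where "P = (\<lambda>t. \<Sum>e\<in>Basis. h (u t) (u' t) e *\<^sub>R e)"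
    define Q where "Q = (\<lambda>t. \<Sum>e\<in>Basis. h (v t) (v' t) e *\<^sub>R e)"
    define P' where "P' = (\<lambda>t. \<Sum>e\<in>Basis. (dh (u t) e (u' t) (u' t) / 2) *\<^sub>R e)"
    define Q' where "Q' = (\<lambda>t. \<Sum>e\<in>Basis. (dh (v t) e (v' t) (v' t) / 2) *\<^sub>R e)"
    define W where "W = (\<lambda>t. (u t - v t) \<bullet> (u t - v t) + (P t - Q t) \<bullet> (P t - Q t))"
    define W' where "W' = (\<lambda>t. 2 * ((u t - v t) \<bullet> (u' t - v' t)) + 2 * ((P t - Q t) \<bullet> (P' t - Q' t)))"
    define n where "n = real DIM('e)"
    define M where "M = 1 / sqrt m"
    have M: "M \<ge> 0" using mL by (simp add: M_def)
    have vel: "norm y \<le> M" if "x \<in> K" "h x y y = 1" for x y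
    proof -
      have "(norm y)\<^sup>2 \<le> 1 / m" using b1[OF that(1), of y] that(2) mL by (simp add: field_simps)
      then have "norm y \<le> sqrt (1 / m)" by (rule real_le_rsqrt)
      then show ?thesis by (simp add: M_def real_sqrt_divide)
    qed
    \<comment> \<open>\<open>K1\<close> bounds the difference of the velocities: coercivity recovers
      them from the momenta, and \<open>L * M\<close> accounts for the change of the metric between
      \<open>u t\<close> and \<open>v t\<close>. \<open>K2\<close> collects, over the
      \<open>n\<close> basis directions, the change of \<open>dh\<close> in its base point and in
      its two velocity arguments.\<close>
    define K1 where "K1 = (1 + L * M) / m + 1"
    define K2 where "K2 = n * (L * M * M + 2 * L * M * K1)"
    have K12: "K1 \<ge> 0" "K2 \<ge> 0" using mL M by (auto simp: K1_def K2_def n_def)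
    have est: "norm (u' t - v' t) \<le> K1 * (norm (u t - v t) + norm (P t - Q t)) \<and>
        norm (P' t - Q' t) \<le> K2 * (norm (u t - v t) + norm (P t - Q t))" if t: "t \<in> {a..b}" for t
    proof
      let ?z = "norm (u t - v t)" and ?y = "norm (P t - Q t)"
      have uK: "u t \<in> K" "u t \<in> S" and vK: "v t \<in> K" "v t \<in> S" using u(2) v(2) t K(3) by auto
      have nu: "norm (u' t) \<le> M" and nv: "norm (v' t) \<le> M"
        using vel[OF uK(1)] vel[OF vK(1)] eu ev t by auto
      note B = bil[OF uK(2)]
      define w where "w = u' t - v' t"
      have "m * (norm w)\<^sup>2 \<le> h (u t) (u' t) w - h (u t) (v' t) w"
        using b1[OF uK(1), of w] by (simp add: w_def bilinear_lsub[OF B])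
      also have "h (u t) (u' t) w = w \<bullet> P t"
        unfolding P_def inner_sum_right bilinear_expand_right[OF B, of "u' t" w] by (simp add: mult.commute)
      also have "h (u t) (v' t) w = (h (u t) (v' t) w - h (v t) (v' t) w) + w \<bullet> Q t"
        unfolding Q_def inner_sum_right bilinear_expand_right[OF bil[OF vK(2)], of "v' t" w] by (simp add: mult.commute)
      also have "w \<bullet> P t - ((h (u t) (v' t) w - h (v t) (v' t) w) + w \<bullet> Q t) = w \<bullet> (P t - Q t) - (h (u t) (v' t) w - h (v t) (v' t) w)"
        by (simp add: inner_diff_right)
      also have "\<dots> \<le> norm w * ?y + L * ?z * norm (v' t) * norm w"
        using norm_cauchy_schwarz[of w "P t - Q t"] b3[OF uK(1) vK(1), of "v' t" w] by linarith
      also have "L * ?z * norm (v' t) * norm w \<le> L * ?z * M * norm w"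
        using nv mL by (intro mult_right_mono mult_left_mono) auto
      finally have "norm w * (m * norm w) \<le> norm w * (?y + L * M * ?z)" by (simp add: power2_eq_square algebra_simps)
      then have "w = 0 \<or> m * norm w \<le> ?y + L * M * ?z" by (auto simp: mult_le_cancel_left)
      moreover have "0 \<le> ?y + L * M * ?z" using mL M by simp
      ultimately have "m * norm w \<le> ?y + L * M * ?z" by auto
      also have "\<dots> \<le> (1 + L * M) * (?z + ?y)" using mL M by (simp add: algebra_simps)
      finally have "norm w \<le> (1 + L * M) / m * (?z + ?y)" using mL by (simp add: field_simps)
      also have "\<dots> \<le> K1 * (?z + ?y)" by (intro mult_right_mono) (auto simp: K1_def)
      finally show w: "norm (u' t - v' t) \<le> K1 * (?z + ?y)" by (simp add: w_def)
      have PQ: "P' t - Q' t = (\<Sum>e\<in>Basis. ((dh (u t) e (u' t) (u' t) - dh (v t) e (v' t) (v' t)) / 2) *\<^sub>R e)"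
        by (simp add: P'_def Q'_def sum_subtractf[symmetric] scaleR_diff_left[symmetric] diff_divide_distrib)
      have "norm (P' t - Q' t) \<le> (\<Sum>e\<in>(Basis::'e set). (L * M * M + 2 * L * M * K1) * (?z + ?y))"
        unfolding PQ
      proof (rule sum_norm_le)
        fix e :: 'e assume e: "e \<in> Basis"
        note dB = dh_bilinear[OF vK(2), of e]
        have "dh (v t) e (u' t) (u' t) - dh (v t) e (v' t) (v' t) = dh (v t) e w (u' t) + dh (v t) e (v' t) w"
          by (simp add: w_def bilinear_lsub[OF dB] bilinear_rsub[OF dB])
        moreover have "\<bar>dh (v t) e w (u' t)\<bar> \<le> L * M * norm w"
        proof -
          have "\<bar>dh (v t) e w (u' t)\<bar> \<le> L * norm e * norm w * norm (u' t)" by (rule b4[OF vK(1)])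
          also have "\<dots> \<le> L * norm e * norm w * M" using nu mL by (intro mult_left_mono) auto
          finally show ?thesis using e by (simp add: mult_ac)
        qed
        moreover have "\<bar>dh (v t) e (v' t) w\<bar> \<le> L * M * norm w"
        proof -
          have "\<bar>dh (v t) e (v' t) w\<bar> \<le> L * norm e * norm (v' t) * norm w" by (rule b4[OF vK(1)])
          also have "\<dots> \<le> L * norm e * M * norm w" using nv mL by (intro mult_right_mono mult_left_mono) auto
          finally show ?thesis using e by (simp add: mult_ac)
        qed
        moreover have "\<bar>dh (u t) e (u' t) (u' t) - dh (v t) e (u' t) (u' t)\<bar> \<le> L * M * M * ?z"
        proof -
          have "\<bar>dh (u t) e (u' t) (u' t) - dh (v t) e (u' t) (u' t)\<bar> \<le> L * ?z * norm e * norm (u' t) * norm (u' t)"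
            by (rule b5[OF uK(1) vK(1)])
          also have "\<dots> \<le> L * ?z * norm e * M * M" using nu mL M by (intro mult_mono) auto
          finally show ?thesis using e by (simp add: mult_ac)
        qed
        ultimately have "\<bar>dh (u t) e (u' t) (u' t) - dh (v t) e (v' t) (v' t)\<bar> \<le> L * M * M * ?z + 2 * (L * M * norm w)"
          by linarith
        also have "L * M * norm w \<le> L * M * (K1 * (?z + ?y))" using w mL M unfolding w_def by (intro mult_left_mono) auto
        also have "L * M * M * ?z \<le> L * M * M * (?z + ?y)" using mL M by (intro mult_left_mono) auto
        finally have "\<bar>dh (u t) e (u' t) (u' t) - dh (v t) e (v' t) (v' t)\<bar> \<le> (L * M * M + 2 * L * M * K1) * (?z + ?y)"
          by (simp add: algebra_simps)
        moreover have "norm ((x / 2) *\<^sub>R e) \<le> \<bar>x\<bar>" for x :: real using e by simp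
        ultimately show "norm (((dh (u t) e (u' t) (u' t) - dh (v t) e (v' t) (v' t)) / 2) *\<^sub>R e) \<le> (L * M * M + 2 * L * M * K1) * (?z + ?y)"
          using order.trans by blast
      qed
      then show "norm (P' t - Q' t) \<le> K2 * (?z + ?y)" by (simp only: K2_def n_def sum_constant mult.assoc)
    qed
    note eu' = eu[THEN conjunct2, THEN conjunct2, THEN bspec] and ev' = ev[THEN conjunct2, THEN conjunct2, THEN bspec]
    have hu: "((\<lambda>t. h (u t) (u' t) e) has_vector_derivative dh (u t) e (u' t) (u' t) / 2) (at t within {a..b})"
      if "t \<in> {a..b}" for t e using eu'[OF that] by blast
    have hv: "((\<lambda>t. h (v t) (v' t) e) has_vector_derivative dh (v t) e (v' t) (v' t) / 2) (at t within {a..b})"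
      if "t \<in> {a..b}" for t e using ev'[OF that] by blast
    have ud: "(u has_vector_derivative u' t) (at t within {a..b})" if "t \<in> {a..b}" for t
      using eu'[OF that] by blast
    have vd: "(v has_vector_derivative v' t) (at t within {a..b})" if "t \<in> {a..b}" for t
      using ev'[OF that] by blast
    have Pd: "(P has_vector_derivative P' t) (at t within {a..b})" if "t \<in> {a..b}" for t
      unfolding P_def P'_def
      by (intro has_vector_derivative_sum bounded_linear.has_vector_derivative[OF bounded_linear_scaleR_left] hu that)
    have Qd: "(Q has_vector_derivative Q' t) (at t within {a..b})" if "t \<in> {a..b}" for t
      unfolding Q_def Q'_def
      by (intro has_vector_derivative_sum bounded_linear.has_vector_derivative[OF bounded_linear_scaleR_left] hv that)
    have Wd: "(W has_vector_derivative W' t) (at t within {a..b})" if t: "t \<in> {a..b}" for t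
    proof -
      have 1: "((\<lambda>t. u t - v t) has_vector_derivative (u' t - v' t)) (at t within {a..b})"
        by (intro has_vector_derivative_diff ud vd t)
      have 2: "((\<lambda>t. P t - Q t) has_vector_derivative (P' t - Q' t)) (at t within {a..b})"
        by (intro has_vector_derivative_diff Pd Qd t)
      have "((\<lambda>t. f t \<bullet> f t) has_vector_derivative 2 * (f t \<bullet> f')) (at t within {a..b})"
        if "(f has_vector_derivative f') (at t within {a..b})" for f :: "real \<Rightarrow> 'e" and f'
        using has_derivative_inner[OF that[unfolded has_vector_derivative_def] that[unfolded has_vector_derivative_def]]
        unfolding has_vector_derivative_def by (simp add: inner_commute algebra_simps)
      from has_vector_derivative_add[OF this[OF 1] this[OF 2]] show ?thesis by (simp add: W_def W'_def)
    qed
    define k where "k = 4 * (K1 + K2)"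
    have WW: "W' t + k * W t \<ge> 0" if t: "t \<in> {a..b}" for t
    proof -
      let ?z = "norm (u t - v t)" and ?y = "norm (P t - Q t)"
      have "\<bar>(u t - v t) \<bullet> (u' t - v' t)\<bar> \<le> ?z * (K1 * (?z + ?y))"
        using order.trans[OF Cauchy_Schwarz_ineq2 mult_left_mono[OF conjunct1[OF est[OF t]] norm_ge_zero]] .
      also have "\<dots> \<le> (?z + ?y) * (K1 * (?z + ?y))" using K12 by (intro mult_right_mono) auto
      finally have 1: "\<bar>(u t - v t) \<bullet> (u' t - v' t)\<bar> \<le> K1 * (?z + ?y)\<^sup>2" by (simp add: power2_eq_square mult_ac)
      have "\<bar>(P t - Q t) \<bullet> (P' t - Q' t)\<bar> \<le> ?y * (K2 * (?z + ?y))"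
        using order.trans[OF Cauchy_Schwarz_ineq2 mult_left_mono[OF conjunct2[OF est[OF t]] norm_ge_zero]] .
      also have "\<dots> \<le> (?z + ?y) * (K2 * (?z + ?y))" using K12 by (intro mult_right_mono) auto
      finally have 2: "\<bar>(P t - Q t) \<bullet> (P' t - Q' t)\<bar> \<le> K2 * (?z + ?y)\<^sup>2" by (simp add: power2_eq_square mult_ac)
      have "(?z - ?y)\<^sup>2 \<ge> 0" by simp
      then have "(?z + ?y)\<^sup>2 \<le> 2 * (?z\<^sup>2 + ?y\<^sup>2)" by (simp add: power2_eq_square algebra_simps)
      also have "?z\<^sup>2 + ?y\<^sup>2 = W t" by (simp add: W_def power2_norm_eq_inner)
      finally have "(2 * (K1 + K2)) * (?z + ?y)\<^sup>2 \<le> (2 * (K1 + K2)) * (2 * W t)" using K12 by (intro mult_left_mono) auto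
      then show ?thesis using 1 2 by (simp add: W'_def k_def algebra_simps)
    qed
    \<comment> \<open>Gronwall's argument run backwards: \<open>W x * exp (k * x)\<close> is
      nondecreasing and vanishes at \<open>b\<close>, where the data agree, so it is nonpositive
      before \<open>b\<close>.\<close>
    have "((\<lambda>x. W x * (k * exp (k * x)) + W' x * exp (k * x)) has_integral (W b * exp (k * b) - W t * exp (k * t))) {t..b}"
    proof (rule fundamental_theorem_of_calculus)
      show "t \<le> b" using t by simp
      fix x assume x: "x \<in> {t..b}"
      have "(W has_vector_derivative W' x) (at x within {t..b})"
        by (rule has_vector_derivative_within_subset[OF Wd]) (use t x in auto)
      moreover have "((\<lambda>x. exp (k * x)) has_vector_derivative k * exp (k * x)) (at x within {t..b})"
        unfolding has_real_derivative_iff_has_vector_derivative[symmetric]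
        by (auto intro!: derivative_eq_intros)
      ultimately show "((\<lambda>x. W x * exp (k * x)) has_vector_derivative W x * (k * exp (k * x)) + W' x * exp (k * x)) (at x within {t..b})"
        by (rule has_vector_derivative_mult)
    qed
    then have "0 \<le> W b * exp (k * b) - W t * exp (k * t)"
    proof (rule has_integral_nonneg)
      fix x assume "x \<in> {t..b}"
      then have "0 \<le> (W' x + k * W x) * exp (k * x)" using WW[of x] t by simp
      then show "0 \<le> W x * (k * exp (k * x)) + W' x * exp (k * x)" by (simp add: algebra_simps)
    qed
    moreover have "W b = 0" using init by (simp add: W_def P_def Q_def)
    ultimately have "W t \<le> 0" by (simp add: mult_le_0_iff)
    moreover have "(u t - v t) \<bullet> (u t - v t) \<le> W t" by (simp add: W_def)
    ultimately have "(u t - v t) \<bullet> (u t - v t) \<le> 0" by linarith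
    then show ?thesis by (metis eq_iff_diff_eq_0 inner_eq_zero_iff inner_ge_zero order_antisym)
  qed
qed

end

section \<open>Riemannian manifolds\<close>

lemma real_analytic_vec_has_derivative:
  fixes F :: "'e::euclidean_space \<Rightarrow> 'f::euclidean_space"
  assumes "open S" "real_analytic_on S F" "x \<in> S"
  obtains D where "(F has_derivative D) (at x)"
proof
  let ?d = "\<lambda>i. frechet_derivative (\<lambda>y. F y \<bullet> i) (at x)"
  have d: "((\<lambda>y. F y \<bullet> i) has_derivative ?d i) (at x)" for i
    by (rule real_analytic_frechet_derivative(1)[OF assms(1) real_analytic_on_inner[OF assms(2)] assms(3)])
  show "(F has_derivative (\<lambda>h. \<Sum>i\<in>Basis. ?d i h *\<^sub>R i)) (at x)"
    unfolding has_derivative_componentwise_within[of F]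
  proof
    fix i :: 'f assume i: "i \<in> Basis"
    show "((\<lambda>y. F y \<bullet> i) has_derivative (\<lambda>h. (\<Sum>i\<in>Basis. ?d i h *\<^sub>R i) \<bullet> i)) (at x)"
      using d[of i] unfolding inner_sum_left_Basis[OF i] .
  qed
qed

lemma dir_deriv_eq:
  assumes D: "(F has_derivative D) (at x)"
  shows "dir_deriv F x u = D u"
proof -
  have 1: "((\<lambda>t::real. x + t *\<^sub>R u) has_derivative (\<lambda>t. t *\<^sub>R u)) (at 0)"
    by (auto intro!: derivative_eq_intros)
  have "((\<lambda>t. F (x + t *\<^sub>R u)) has_derivative (\<lambda>t. D (t *\<^sub>R u))) (at 0)"
    by (rule has_derivative_compose[where f="\<lambda>t. x + t *\<^sub>R u" and g=F, OF 1]) (use D in simp)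
  moreover have "D (t *\<^sub>R u) = t *\<^sub>R D u" for t
    using linear_scale[OF has_derivative_linear[OF D]] .
  ultimately have "((\<lambda>t. F (x + t *\<^sub>R u)) has_vector_derivative D u) (at 0)"
    by (simp add: has_vector_derivative_def)
  then show ?thesis unfolding dir_deriv_def by (rule vector_derivative_at)
qed

text \<open>The case \<open>E = UNIV\<close>, that is, positive dimension; dimension 0 is treated by
  \<open>ls_cat_zero_dimensional\<close>.\<close>

locale riemannian =
  fixes M :: "'a topology" and \<A> :: "('a, 'e::euclidean_space) chart set" and g :: "('a, 'e) metric"
  assumes mfd: "analytic_manifold M UNIV \<A>" and met: "analytic_riemannian_metric UNIV \<A> g"
begin

lemma Hausdorff: "Hausdorff_space M"
  using mfd by (simp add: analytic_manifold_def)

lemma chart_cover: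
  assumes "p \<in> topspace M"
  obtains U \<phi> where "(U, \<phi>) \<in> \<A>" "p \<in> U"
proof -
  have "p \<in> (\<Union>(U, \<phi>)\<in>\<A>. U)" using mfd assms by (simp add: analytic_manifold_def)
  then show thesis using that by auto
qed

lemma is_chartD:
  assumes "(U, \<phi>) \<in> \<A>"
  shows "openin M U" "open (\<phi> ` U)" "homeomorphic_map (subtopology M U) (top_of_set (\<phi> ` U)) \<phi>"
proof -
  have "is_chart M UNIV (U, \<phi>)" using mfd assms by (auto simp: analytic_manifold_def)
  then show "openin M U" "open (\<phi> ` U)" "homeomorphic_map (subtopology M U) (top_of_set (\<phi> ` U)) \<phi>"
    by (simp_all add: is_chart_def)
qed

lemma chart_subset: "(U, \<phi>) \<in> \<A> \<Longrightarrow> U \<subseteq> topspace M"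
  using is_chartD(1) openin_subset by blast

lemma chart_inj: "(U, \<phi>) \<in> \<A> \<Longrightarrow> inj_on \<phi> U"
  using homeomorphic_imp_injective_map[OF is_chartD(3)] chart_subset
  by (metis inf.absorb_iff2 topspace_subtopology)

lemma chart_continuous: "(U, \<phi>) \<in> \<A> \<Longrightarrow> continuous_map (subtopology M U) euclidean \<phi>"
  using homeomorphic_imp_continuous_map[OF is_chartD(3)] continuous_map_in_subtopology by blast

lemma chart_inv_continuous:
  assumes C: "(U, \<phi>) \<in> \<A>"
  shows "continuous_map (top_of_set (\<phi> ` U)) (subtopology M U) (inv_into U \<phi>)"
proof -
  obtain f where f: "homeomorphic_maps (subtopology M U) (top_of_set (\<phi> ` U)) \<phi> f"
    using is_chartD(3)[OF C] homeomorphic_map_maps by blast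
  then have fc: "continuous_map (top_of_set (\<phi> ` U)) (subtopology M U) f"
    and ff: "\<And>x. x \<in> U \<Longrightarrow> f (\<phi> x) = x"
    using chart_subset[OF C] by (auto simp: homeomorphic_maps_def)
  show ?thesis
    by (rule continuous_map_eq[OF fc]) (use ff chart_inj[OF C] in auto)
qed

lemma chart_inv [simp]: "(U, \<phi>) \<in> \<A> \<Longrightarrow> x \<in> U \<Longrightarrow> inv_into U \<phi> (\<phi> x) = x"
  by (simp add: chart_inj)

lemma chart_preimage_open:
  assumes C: "(U, \<phi>) \<in> \<A>" and B: "open B"
  shows "openin M {x \<in> U. \<phi> x \<in> B}"
proof -
  have "openin (subtopology M U) {x \<in> topspace (subtopology M U). \<phi> x \<in> B}"
    using openin_continuous_map_preimage[OF chart_continuous[OF C]] B by simp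
  moreover have T: "topspace (subtopology M U) = U" using chart_subset[OF C] by auto
  ultimately show ?thesis using is_chartD(1)[OF C] unfolding T by (simp add: openin_open_subtopology)
qed

lemma chart_image_open:
  assumes C: "(U, \<phi>) \<in> \<A>" and W: "openin M W"
  shows "open (\<phi> ` (U \<inter> W))"
proof -
  have "openin (subtopology M U) (U \<inter> W)" using W by (auto simp: openin_subtopology)
  then have "openin (top_of_set (\<phi> ` U)) (\<phi> ` (U \<inter> W))"
    using homeomorphic_imp_open_map[OF is_chartD(3)[OF C]] by (simp add: open_map_def)
  then show ?thesis using is_chartD(2)[OF C] by (simp add: openin_open_eq)
qed

lemma chart_local_metric:
  assumes C: "(U, \<phi>) \<in> \<A>"
  shows "local_metric (\<phi> ` U) (g (U, \<phi>))"
proof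
  show "open (\<phi> ` U)" by (rule is_chartD(2)[OF C])
qed (use met C in \<open>auto simp: analytic_riemannian_metric_def\<close>)

lemma transition_apply:
  "(U, \<phi>) \<in> \<A> \<Longrightarrow> x \<in> U \<Longrightarrow> transition (U, \<phi>) (V, \<psi>) (\<phi> x) = \<psi> x"
  by (simp add: transition_def)

lemma transition_analytic:
  assumes "(U, \<phi>) \<in> \<A>" "(V, \<psi>) \<in> \<A>"
  shows "real_analytic_on (\<phi> ` (U \<inter> V)) (transition (U, \<phi>) (V, \<psi>))"
proof -
  have "analytically_compatible (U, \<phi>) (V, \<psi>)"
    using mfd assms unfolding analytic_manifold_def by blast
  then show ?thesis by (simp add: analytically_compatible_def)
qed

lemma transition_derivative:
  assumes C: "(U, \<phi>) \<in> \<A>" and D: "(V, \<psi>) \<in> \<A>" and x: "x \<in> U \<inter> V"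
  obtains T where "(transition (U, \<phi>) (V, \<psi>) has_derivative T) (at (\<phi> x))"
    "\<And>u v. g (U, \<phi>) (\<phi> x) u v = g (V, \<psi>) (\<psi> x) (T u) (T v)"
proof -
  have "open (\<phi> ` (U \<inter> V))" by (rule chart_image_open[OF C is_chartD(1)[OF D]])
  moreover have "\<phi> x \<in> \<phi> ` (U \<inter> V)" using x by blast
  ultimately obtain T where T: "(transition (U, \<phi>) (V, \<psi>) has_derivative T) (at (\<phi> x))"
    using real_analytic_vec_has_derivative[OF _ transition_analytic[OF C D]] by blast
  have "\<forall>(U, \<phi>)\<in>\<A>. \<forall>(V, \<psi>)\<in>\<A>. \<forall>p \<in> U \<inter> V. \<forall>u\<in>UNIV. \<forall>v\<in>UNIV.
        g (U, \<phi>) (\<phi> p) u v =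
        g (V, \<psi>) (\<psi> p)
          (dir_deriv (transition (U, \<phi>) (V, \<psi>)) (\<phi> p) u)
          (dir_deriv (transition (U, \<phi>) (V, \<psi>)) (\<phi> p) v)"
    using met unfolding analytic_riemannian_metric_def by (elim conjE)
  from bspec[OF bspec[OF this C, simplified] D, simplified, rule_format, of x] x
  have "g (U, \<phi>) (\<phi> x) u v = g (V, \<psi>) (\<psi> x)
          (dir_deriv (transition (U, \<phi>) (V, \<psi>)) (\<phi> x) u)
          (dir_deriv (transition (U, \<phi>) (V, \<psi>)) (\<phi> x) v)" for u v by blast
  then have "g (U, \<phi>) (\<phi> x) u v = g (V, \<psi>) (\<psi> x) (T u) (T v)" for u v
    unfolding dir_deriv_eq[OF T] .
  then show thesis using that T by blast
qed

lemma curve_chart_nbhd: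
  assumes \<gamma>: "continuous_map (top_of_set I) M \<gamma>" and t: "t \<in> I" "\<gamma> t \<in> W" and W: "openin M W"
  obtains d where "d > 0" "\<And>s. s \<in> I \<Longrightarrow> dist s t < d \<Longrightarrow> \<gamma> s \<in> W"
proof -
  have "openin (top_of_set I) {s \<in> I. \<gamma> s \<in> W}"
    using openin_continuous_map_preimage[OF \<gamma> W] by simp
  then show thesis using t that unfolding openin_euclidean_subtopology_iff by blast
qed

lemma velocity_change:
  assumes C: "(U, \<phi>) \<in> \<A>" and D: "(V, \<psi>) \<in> \<A>"
    and \<gamma>: "continuous_map (top_of_set I) M \<gamma>" and t: "t \<in> I" "\<gamma> t \<in> U \<inter> V"
    and w: "((\<phi> \<circ> \<gamma>) has_vector_derivative w) (at t within I)"
    and T: "(transition (U, \<phi>) (V, \<psi>) has_derivative T) (at (\<phi> (\<gamma> t)))"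
  shows "((\<psi> \<circ> \<gamma>) has_vector_derivative T w) (at t within I)"
proof -
  obtain d where d: "d > 0" "\<And>s. s \<in> I \<Longrightarrow> dist s t < d \<Longrightarrow> \<gamma> s \<in> U \<inter> V"
    using curve_chart_nbhd[OF \<gamma> t openin_Int[OF is_chartD(1)[OF C] is_chartD(1)[OF D]]] by blast
  have "((\<lambda>s. transition (U, \<phi>) (V, \<psi>) ((\<phi> \<circ> \<gamma>) s)) has_derivative (\<lambda>x. T (x *\<^sub>R w))) (at t within I)"
    by (rule has_derivative_compose[where f="\<phi> \<circ> \<gamma>", OF w[unfolded has_vector_derivative_def]]) (use T in simp)
  then have "((\<lambda>s. transition (U, \<phi>) (V, \<psi>) ((\<phi> \<circ> \<gamma>) s)) has_vector_derivative T w) (at t within I)"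
    unfolding has_vector_derivative_def linear_scale[OF has_derivative_linear[OF T]] .
  then show ?thesis
    by (rule has_vector_derivative_transform_within[OF _ d(1) t(1)])
       (use d(2) transition_apply[OF C] in auto)
qed

text \<open>This resolves the definite description in \<open>speed\<close>: the derivative of a
  transition map carries one chart metric to the other, so all charts around
  \<open>\<gamma> t\<close> assign the same value. Nontriviality of the filter makes the velocity
  itself unique.\<close>

lemma speed_eq:
  assumes C: "(U, \<phi>) \<in> \<A>" and nb: "at t within I \<noteq> bot"
    and \<gamma>: "continuous_map (top_of_set I) M \<gamma>" and t: "t \<in> I" "\<gamma> t \<in> U"
    and w: "((\<phi> \<circ> \<gamma>) has_vector_derivative w) (at t within I)"
  shows "speed \<A> g I \<gamma> t = sqrt (g (U, \<phi>) (\<phi> (\<gamma> t)) w w)"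
proof -
  let ?v = "\<lambda>(V, \<psi>). velocity (V, \<psi>) I \<gamma> t"
  have v: "velocity (U, \<phi>) I \<gamma> t = w"
    unfolding velocity_def using vector_derivative_within[OF nb w] by simp
  have ex: "sqrt (g (U, \<phi>) (\<phi> (\<gamma> t)) w w) = sqrt (g (V, \<psi>) (\<psi> (\<gamma> t)) (velocity (V, \<psi>) I \<gamma> t) (velocity (V, \<psi>) I \<gamma> t))"
    if D: "(V, \<psi>) \<in> \<A>" and V: "\<gamma> t \<in> V" for V \<psi>
  proof -
    have UV: "\<gamma> t \<in> U \<inter> V" using t V by blast
    obtain T where T: "(transition (U, \<phi>) (V, \<psi>) has_derivative T) (at (\<phi> (\<gamma> t)))"
      "\<And>u v. g (U, \<phi>) (\<phi> (\<gamma> t)) u v = g (V, \<psi>) (\<psi> (\<gamma> t)) (T u) (T v)"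
      using transition_derivative[OF C D UV] by blast
    have "velocity (V, \<psi>) I \<gamma> t = T w"
      unfolding velocity_def using vector_derivative_within[OF nb velocity_change[OF C D \<gamma> t(1) UV w T(1)]] by simp
    then show ?thesis using T(2) by simp
  qed
  show ?thesis unfolding speed_def
  proof (rule the_equality)
    show "\<forall>(V, \<psi>)\<in>\<A>. \<gamma> t \<in> V \<longrightarrow> sqrt (g (U, \<phi>) (\<phi> (\<gamma> t)) w w) = sqrt (g (V, \<psi>) (\<psi> (\<gamma> t)) (velocity (V, \<psi>) I \<gamma> t) (velocity (V, \<psi>) I \<gamma> t))"
      using ex by blast
    fix s assume "\<forall>(V, \<psi>)\<in>\<A>. \<gamma> t \<in> V \<longrightarrow> s = sqrt (g (V, \<psi>) (\<psi> (\<gamma> t)) (velocity (V, \<psi>) I \<gamma> t) (velocity (V, \<psi>) I \<gamma> t))"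
    from bspec[OF this C] t(2) v show "s = sqrt (g (U, \<phi>) (\<phi> (\<gamma> t)) w w)" by simp
  qed
qed

lemma speed_interior:
  assumes "t \<in> interior I" "t \<in> interior J"
  shows "speed \<A> g I \<gamma> t = speed \<A> g J \<gamma> t"
  unfolding speed_def velocity_def using at_within_interior[OF assms(1)] at_within_interior[OF assms(2)] by simp

text \<open>The two-sided speed does not refer to an interval. It agrees with \<open>speed\<close>
  in the interior of any interval, so lengths over different intervals become integrals of one
  function.\<close>

definition spd :: "(real \<Rightarrow> 'a) \<Rightarrow> real \<Rightarrow> real" where "spd = speed \<A> g UNIV"

lemma speed_eq_spd: "a < t \<Longrightarrow> t < b \<Longrightarrow> speed \<A> g {a..b} \<gamma> t = spd \<gamma> t"
  unfolding spd_def by (rule speed_interior) auto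

lemma curve_length_eq: "curve_length \<A> g a b \<gamma> = integral {a..b} (spd \<gamma>)"
  unfolding curve_length_def
  by (rule integral_spike[of "{a, b}"]) (auto simp: speed_eq_spd)

lemma spd_cong:
  assumes "open T" "t \<in> T" "\<And>s. s \<in> T \<Longrightarrow> \<gamma> s = \<delta> s"
  shows "spd \<gamma> t = spd \<delta> t"
proof -
  have "vector_derivative (\<phi> \<circ> \<gamma>) (at t) = vector_derivative (\<phi> \<circ> \<delta>) (at t)" for \<phi> :: "'a \<Rightarrow> 'e"
    using assms by (intro vector_derivative_cong_eq) (auto simp: eventually_nhds)
  then show ?thesis unfolding spd_def speed_def velocity_def using assms by simp
qed

end

section \<open>Restriction, reparametrization and concatenation of piecewise smooth curves\<close>

lemma smooth_fun_on_subset: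
  assumes "smooth_fun_on T f" "T' \<subseteq> T"
  shows "smooth_fun_on T' f"
proof -
  obtain D where D: "\<forall>t\<in>T. D 0 t = f t"
     "\<forall>k::nat. \<forall>t\<in>T. (D k has_vector_derivative D (Suc k) t) (at t within T)"
    using assms(1) unfolding smooth_fun_on_def by blast
  have "(D k has_vector_derivative D (Suc k) t) (at t within T')" if "t \<in> T'" for k t
    by (rule has_vector_derivative_within_subset[OF _ assms(2)]) (use D(2) that assms(2) in blast)
  then show ?thesis unfolding smooth_fun_on_def using assms(2) D(1)
    by (intro exI[of _ D]) auto
qed

lemma smooth_fun_on_cong:
  assumes "smooth_fun_on T f" "\<And>t. t \<in> T \<Longrightarrow> f t = h t"
  shows "smooth_fun_on T h"
proof -
  obtain D where "\<forall>t\<in>T. D 0 t = f t"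
     "\<forall>k::nat. \<forall>t\<in>T. (D k has_vector_derivative D (Suc k) t) (at t within T)"
    using assms(1) unfolding smooth_fun_on_def by blast
  then show ?thesis unfolding smooth_fun_on_def using assms(2)
    by (intro exI[of _ D]) simp
qed

lemma smooth_fun_on_affine:
  assumes f: "smooth_fun_on T f" and T': "\<And>t. t \<in> T' \<Longrightarrow> \<sigma> * t + c \<in> T"
  shows "smooth_fun_on T' (\<lambda>t. f (\<sigma> * t + c))"
proof -
  obtain D where D: "\<forall>t\<in>T. D 0 t = f t"
     "\<forall>k::nat. \<forall>t\<in>T. (D k has_vector_derivative D (Suc k) t) (at t within T)"
    using f unfolding smooth_fun_on_def by blast
  let ?r = "\<lambda>t. \<sigma> * t + c"
  show ?thesis unfolding smooth_fun_on_def
  proof (intro exI[of _ "\<lambda>k t. \<sigma> ^ k *\<^sub>R D k (?r t)"] conjI allI ballI)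
    show "\<sigma> ^ 0 *\<^sub>R D 0 (?r t) = f (?r t)" if "t \<in> T'" for t using D(1) T'[OF that] by simp
    fix k t assume t: "t \<in> T'"
    have "(?r has_vector_derivative \<sigma>) (at t within T')"
      by (auto intro!: derivative_eq_intros simp flip: has_real_derivative_iff_has_vector_derivative)
    moreover have "(D k has_vector_derivative D (Suc k) (?r t)) (at (?r t) within ?r ` T')"
      by (rule has_vector_derivative_within_subset[of _ _ _ T]) (use D(2) T' t in auto)
    ultimately have "((D k \<circ> ?r) has_vector_derivative \<sigma> *\<^sub>R D (Suc k) (?r t)) (at t within T')"
      by (rule vector_diff_chain_within)
    then have "((\<lambda>t. \<sigma> ^ k *\<^sub>R (D k \<circ> ?r) t) has_vector_derivative \<sigma> ^ k *\<^sub>R (\<sigma> *\<^sub>R D (Suc k) (?r t))) (at t within T')"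
      by (rule bounded_linear.has_vector_derivative[OF bounded_linear_scaleR_right])
    then show "((\<lambda>t. \<sigma> ^ k *\<^sub>R D k (?r t)) has_vector_derivative \<sigma> ^ Suc k *\<^sub>R D (Suc k) (?r t)) (at t within T')"
      by (simp add: o_def mult.commute)
  qed
qed

lemma smooth_curve_subinterval:
  "smooth_curve M \<A> a b \<gamma> \<Longrightarrow> a \<le> a' \<Longrightarrow> b' \<le> b \<Longrightarrow> smooth_curve M \<A> a' b' \<gamma>"
  unfolding smooth_curve_def
proof (elim conjE, intro conjI ballI)
  assume "continuous_map (top_of_set {a..b}) M \<gamma>" "a \<le> a'" "b' \<le> b"
  then show "continuous_map (top_of_set {a'..b'}) M \<gamma>"
    by (elim continuous_map_from_subtopology_mono) auto
  fix C assume "\<forall>(U, \<phi>)\<in>\<A>. smooth_fun_on {t \<in> {a..b}. \<gamma> t \<in> U} (\<phi> \<circ> \<gamma>)" "C \<in> \<A>"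
  then have "case C of (U, \<phi>) \<Rightarrow> smooth_fun_on {t \<in> {a..b}. \<gamma> t \<in> U} (\<phi> \<circ> \<gamma>)" by (rule bspec)
  then show "case C of (U, \<phi>) \<Rightarrow> smooth_fun_on {t \<in> {a'..b'}. \<gamma> t \<in> U} (\<phi> \<circ> \<gamma>)"
    unfolding case_prod_beta
    by (rule smooth_fun_on_subset) (use \<open>a \<le> a'\<close> \<open>b' \<le> b\<close> in auto)
qed

lemma smooth_curve_cong:
  assumes "smooth_curve M \<A> a b \<gamma>" and eq: "\<And>t. t \<in> {a..b} \<Longrightarrow> \<gamma> t = \<delta> t"
  shows "smooth_curve M \<A> a b \<delta>"
  unfolding smooth_curve_def
proof (intro conjI ballI)
  show "continuous_map (top_of_set {a..b}) M \<delta>"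
    using assms(1) unfolding smooth_curve_def by (elim conjE continuous_map_eq) (simp add: eq)
  fix C assume "C \<in> \<A>"
  then have "case C of (U, \<phi>) \<Rightarrow> smooth_fun_on {t \<in> {a..b}. \<gamma> t \<in> U} (\<phi> \<circ> \<gamma>)"
    using assms(1) unfolding smooth_curve_def by (elim conjE bspec)
  moreover have "{t \<in> {a..b}. \<gamma> t \<in> U} = {t \<in> {a..b}. \<delta> t \<in> U}" for U using eq by auto
  ultimately show "case C of (U, \<phi>) \<Rightarrow> smooth_fun_on {t \<in> {a..b}. \<delta> t \<in> U} (\<phi> \<circ> \<delta>)"
    unfolding case_prod_beta by (auto elim!: smooth_fun_on_cong simp: eq)
qed

lemma smooth_curve_affine:
  assumes \<gamma>: "smooth_curve M \<A> a b \<gamma>" and r: "\<And>t. t \<in> {a'..b'} \<Longrightarrow> \<sigma> * t + c \<in> {a..b}"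
  shows "smooth_curve M \<A> a' b' (\<lambda>t. \<gamma> (\<sigma> * t + c))"
  unfolding smooth_curve_def
proof (intro conjI ballI)
  have 1: "continuous_map (top_of_set {a'..b'}) (top_of_set {a..b}) (\<lambda>t. \<sigma> * t + c)"
    using r by (auto simp: continuous_map_in_subtopology intro!: continuous_intros)
  have 2: "continuous_map (top_of_set {a..b}) M \<gamma>" using \<gamma> by (simp add: smooth_curve_def)
  show "continuous_map (top_of_set {a'..b'}) M (\<lambda>t. \<gamma> (\<sigma> * t + c))"
    using continuous_map_compose[OF 1 2] by (simp add: o_def)
  fix C assume "C \<in> \<A>"
  then have "case C of (U, \<phi>) \<Rightarrow> smooth_fun_on {t \<in> {a..b}. \<gamma> t \<in> U} (\<phi> \<circ> \<gamma>)"
    using \<gamma> unfolding smooth_curve_def by (elim conjE bspec)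
  then show "case C of (U, \<phi>) \<Rightarrow> smooth_fun_on {t \<in> {a'..b'}. \<gamma> (\<sigma> * t + c) \<in> U} (\<phi> \<circ> (\<lambda>t. \<gamma> (\<sigma> * t + c)))"
    unfolding case_prod_beta
    by (rule smooth_fun_on_cong[OF smooth_fun_on_affine[where T'="{t \<in> {a'..b'}. \<gamma> (\<sigma> * t + c) \<in> fst C}" and \<sigma>=\<sigma> and c=c]])
       (use r in auto)
qed

text \<open>Meant for properties that pass from adjacent intervals to their union, such as
  integrability of the speed. The piece ending in \<open>x\<close> is split off, and the number of
  points of \<open>F\<close> strictly between \<open>a\<close> and \<open>x\<close>
  decreases.\<close>

lemma consecutive_induct:
  fixes F :: "real set"
  assumes F: "finite F" "a \<in> F" "b \<in> F" "F \<subseteq> {a..b}" and ab: "a < b"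
    and cons: "\<And>s t. s \<in> F \<Longrightarrow> t \<in> F \<Longrightarrow> s < t \<Longrightarrow> {s<..<t} \<inter> F = {} \<Longrightarrow> P s t"
    and trans: "\<And>s t u. a \<le> s \<Longrightarrow> s < t \<Longrightarrow> t < u \<Longrightarrow> u \<le> b \<Longrightarrow> P s t \<Longrightarrow> P t u \<Longrightarrow> P s u"
  shows "P a b"
proof -
  have "P a x" if "x \<in> F" "a < x" for x
    using that
  proof (induction "card (F \<inter> {a<..<x})" arbitrary: x rule: less_induct)
    case less
    define m where "m = Max (F \<inter> {..<x})"
    have fin: "finite (F \<inter> {..<x})" "F \<inter> {..<x} \<noteq> {}" using F(1,2) less.prems by auto
    have m: "m \<in> F \<inter> {..<x}" "\<And>y. y \<in> F \<Longrightarrow> y < x \<Longrightarrow> y \<le> m"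
      unfolding m_def using Max_in[OF fin] Max_ge[OF fin(1)] by auto
    have mx: "P m x" by (rule cons) (use m less.prems in force)+
    show ?case
    proof (cases "m = a")
      case False
      then have am: "a < m" using m(1) F(4) by force
      have "F \<inter> {a<..<m} \<subset> F \<inter> {a<..<x}" using m(1) am by auto
      then have "P a m" using less.hyps[of m] m(1) am F(1) by (auto intro: psubset_card_mono)
      then show ?thesis using trans[of a m x] am m(1) mx F(4) less.prems by auto
    qed (use mx in simp)
  qed
  then show ?thesis using F ab by blast
qed

context riemannian
begin

abbreviation "PS \<equiv> piecewise_smooth_curve M \<A>"
abbreviation "len \<equiv> curve_length \<A> g"

lemma PS_continuous: "PS a b \<gamma> \<Longrightarrow> continuous_map (top_of_set {a..b}) M \<gamma>"
  by (simp add: piecewise_smooth_curve_def)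

lemma PS_le: "PS a b \<gamma> \<Longrightarrow> a \<le> b"
  by (simp add: piecewise_smooth_curve_def)

lemma smooth_curve_imp_PS:
  "smooth_curve M \<A> a b \<gamma> \<Longrightarrow> a \<le> b \<Longrightarrow> PS a b \<gamma>"
  unfolding piecewise_smooth_curve_def
  by (intro conjI exI[of _ "{a, b}"]) (auto simp: smooth_curve_def)

lemma PS_pieces:
  assumes "PS a b \<gamma>"
  obtains F where "finite F" "a \<in> F" "b \<in> F" "F \<subseteq> {a..b}"
    "\<And>s t. s \<in> F \<Longrightarrow> t \<in> F \<Longrightarrow> s < t \<Longrightarrow> {s<..<t} \<inter> F = {} \<Longrightarrow> smooth_curve M \<A> s t \<gamma>"
proof -
  obtain F where "finite F" "a \<in> F" "b \<in> F" "F \<subseteq> {a..b}"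
    "\<forall>s\<in>F. \<forall>t\<in>F. s < t \<and> {s<..<t} \<inter> F = {} \<longrightarrow> smooth_curve M \<A> s t \<gamma>"
    using assms unfolding piecewise_smooth_curve_def by (elim conjE exE) (rule that)
  then show thesis using that[of F] by simp
qed

lemma PS_I:
  assumes "a \<le> b" "continuous_map (top_of_set {a..b}) M \<gamma>" "finite F" "a \<in> F" "b \<in> F" "F \<subseteq> {a..b}"
    "\<And>s t. s \<in> F \<Longrightarrow> t \<in> F \<Longrightarrow> s < t \<Longrightarrow> {s<..<t} \<inter> F = {} \<Longrightarrow> smooth_curve M \<A> s t \<gamma>"
  shows "PS a b \<gamma>"
  unfolding piecewise_smooth_curve_def using assms by (intro conjI exI[of _ F]) auto

lemma finite_bracket:
  fixes F :: "real set"
  assumes F: "finite F" "a \<in> F" "b \<in> F" and st: "a \<le> s" "s < t" "t \<le> b" "{s<..<t} \<inter> F = {}"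
  obtains s0 t0 where "s0 \<in> F" "t0 \<in> F" "s0 \<le> s" "t \<le> t0" "{s0<..<t0} \<inter> F = {}"
proof
  have 1: "finite (F \<inter> {..s})" "F \<inter> {..s} \<noteq> {}" "finite (F \<inter> {t..})" "F \<inter> {t..} \<noteq> {}" using assms by auto
  show "Max (F \<inter> {..s}) \<in> F" "Max (F \<inter> {..s}) \<le> s" using Max_in[OF 1(1,2)] by auto
  show "Min (F \<inter> {t..}) \<in> F" "t \<le> Min (F \<inter> {t..})" using Min_in[OF 1(3,4)] by auto
  show "{Max (F \<inter> {..s})<..<Min (F \<inter> {t..})} \<inter> F = {}"
  proof (rule ccontr)
    assume "\<not> ?thesis"
    then obtain x where x: "x \<in> F" "Max (F \<inter> {..s}) < x" "x < Min (F \<inter> {t..})" by auto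
    have "\<not> x \<le> s" using Max_ge[OF 1(1), of x] x by auto
    moreover have "\<not> t \<le> x" using Min_le[OF 1(3), of x] x by auto
    ultimately have "x \<in> {s<..<t} \<inter> F" using x(1) by simp
    then show False using st(4) by blast
  qed
qed

lemma PS_restrict:
  assumes \<gamma>: "PS a b \<gamma>" and c: "a \<le> c" "c \<le> d" "d \<le> b"
  shows "PS c d \<gamma>"
proof (rule PS_pieces[OF \<gamma>])
  fix F assume F: "finite F" "a \<in> F" "b \<in> F" "F \<subseteq> {a..b}"
    and sm: "\<And>s t. s \<in> F \<Longrightarrow> t \<in> F \<Longrightarrow> s < t \<Longrightarrow> {s<..<t} \<inter> F = {} \<Longrightarrow> smooth_curve M \<A> s t \<gamma>"
  show ?thesis
  proof (rule PS_I[of c d \<gamma> "insert c (insert d (F \<inter> {c..d}))"])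
    show "continuous_map (top_of_set {c..d}) M \<gamma>"
      using PS_continuous[OF \<gamma>] c by (elim continuous_map_from_subtopology_mono) auto
    fix s t assume st: "s \<in> insert c (insert d (F \<inter> {c..d}))" "t \<in> insert c (insert d (F \<inter> {c..d}))" "s < t"
      and e: "{s<..<t} \<inter> insert c (insert d (F \<inter> {c..d})) = {}"
    have b: "c \<le> s" "t \<le> d" using st c by auto
    have "{s<..<t} \<inter> F = {}" using e b by auto
    then obtain s0 t0 where "s0 \<in> F" "t0 \<in> F" "s0 \<le> s" "t \<le> t0" "{s0<..<t0} \<inter> F = {}"
      using finite_bracket[OF F(1-3), of s t] b c st(3) by auto
    then show "smooth_curve M \<A> s t \<gamma>"
      using smooth_curve_subinterval[OF sm[of s0 t0], of s t] st(3) by auto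
  qed (use F c in auto)
qed

lemma PS_cong:
  assumes \<gamma>: "PS a b \<gamma>" and eq: "\<And>t. t \<in> {a..b} \<Longrightarrow> \<gamma> t = \<delta> t"
  shows "PS a b \<delta>"
proof (rule PS_pieces[OF \<gamma>])
  fix F assume F: "finite F" "a \<in> F" "b \<in> F" "F \<subseteq> {a..b}"
    and sm: "\<And>s t. s \<in> F \<Longrightarrow> t \<in> F \<Longrightarrow> s < t \<Longrightarrow> {s<..<t} \<inter> F = {} \<Longrightarrow> smooth_curve M \<A> s t \<gamma>"
  show ?thesis
  proof (rule PS_I[OF PS_le[OF \<gamma>] _ F])
    show "continuous_map (top_of_set {a..b}) M \<delta>"
      by (rule continuous_map_eq[OF PS_continuous[OF \<gamma>]]) (simp add: eq)
    fix s t assume st: "s \<in> F" "t \<in> F" "s < t" "{s<..<t} \<inter> F = {}"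
    have "{s..t} \<subseteq> {a..b}" using st(1,2) F(4) by auto
    then show "smooth_curve M \<A> s t \<delta>"
      by (intro smooth_curve_cong[OF sm[OF st]] eq) blast
  qed
qed

lemma PS_join:
  assumes 1: "PS a b \<gamma>" and 2: "PS b c \<gamma>"
  shows "PS a c \<gamma>"
proof (rule PS_pieces[OF 1], rule PS_pieces[OF 2])
  fix F1 F2 assume F1: "finite F1" "a \<in> F1" "b \<in> F1" "F1 \<subseteq> {a..b}"
    and sm1: "\<And>s t. s \<in> F1 \<Longrightarrow> t \<in> F1 \<Longrightarrow> s < t \<Longrightarrow> {s<..<t} \<inter> F1 = {} \<Longrightarrow> smooth_curve M \<A> s t \<gamma>"
    and F2: "finite F2" "b \<in> F2" "c \<in> F2" "F2 \<subseteq> {b..c}"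
    and sm2: "\<And>s t. s \<in> F2 \<Longrightarrow> t \<in> F2 \<Longrightarrow> s < t \<Longrightarrow> {s<..<t} \<inter> F2 = {} \<Longrightarrow> smooth_curve M \<A> s t \<gamma>"
  have abc: "a \<le> b" "b \<le> c" using PS_le 1 2 by auto
  show ?thesis
  proof (rule PS_I[of a c \<gamma> "F1 \<union> F2"])
    show "continuous_map (top_of_set {a..c}) M \<gamma>"
      unfolding continuous_map_closedin_preimage_eq
    proof (intro conjI allI impI)
      have i: "{a..c} \<inter> {a..b} = {a..b}" "{a..c} \<inter> {b..c} = {b..c}" using abc by auto
      have ac: "{a..c} = {a..b} \<union> {b..c}" using abc by auto
      note c1 = PS_continuous[OF 1, unfolded continuous_map_closedin_preimage_eq]
        and c2 = PS_continuous[OF 2, unfolded continuous_map_closedin_preimage_eq]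
      show "\<gamma> \<in> topspace (top_of_set {a..c}) \<rightarrow> topspace M"
        using c1 c2 by (auto simp: ac)
      fix C assume C: "closedin M C"
      have "closed ({a..b} \<inter> \<gamma> -` C)" "closed ({b..c} \<inter> \<gamma> -` C)"
        using c1 c2 C by (auto simp: closedin_closed_eq)
      then have "closed ({a..b} \<inter> \<gamma> -` C \<union> {b..c} \<inter> \<gamma> -` C)" by (rule closed_Un)
      moreover have "{a..b} \<inter> \<gamma> -` C \<union> {b..c} \<inter> \<gamma> -` C = {a..c} \<inter> \<gamma> -` C" unfolding ac by blast
      ultimately show "closedin (top_of_set {a..c}) (topspace (top_of_set {a..c}) \<inter> \<gamma> -` C)"
        by (simp add: closedin_closed_eq)
    qed
    fix s t assume st: "s \<in> F1 \<union> F2" "t \<in> F1 \<union> F2" "s < t" and e: "{s<..<t} \<inter> (F1 \<union> F2) = {}"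
    show "smooth_curve M \<A> s t \<gamma>"
    proof (cases "t \<le> b")
      case True
      then have "s \<in> F1" "t \<in> F1" using st F1 F2 by force+
      then show ?thesis using sm1 st(3) e by auto
    next
      case False
      then have "b \<le> s" using e F1(3) st(3) by (metis IntI UnCI emptyE greaterThanLessThan_iff not_le)
      then have "s \<in> F2" "t \<in> F2" using st F1 F2 False by force+
      then show ?thesis using sm2 st(3) e by auto
    qed
  qed (use abc F1 F2 in auto)
qed

text \<open>Translation and reversal of the parameter in one statement. Since \<sigma> squared is 1,
  the map \<open>t \<mapsto> \<sigma> * (t - c)\<close> inverts the substitution.\<close>

lemma PS_affine:
  assumes \<gamma>: "PS a b \<gamma>" and \<sigma>: "\<sigma> = 1 \<and> a' = a - c \<and> b' = b - c \<or> \<sigma> = -1 \<and> a' = c - b \<and> b' = c - a"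
  shows "PS a' b' (\<lambda>t. \<gamma> (\<sigma> * t + c))"
proof (rule PS_pieces[OF \<gamma>])
  fix F assume F: "finite F" "a \<in> F" "b \<in> F" "F \<subseteq> {a..b}"
    and sm: "\<And>s t. s \<in> F \<Longrightarrow> t \<in> F \<Longrightarrow> s < t \<Longrightarrow> {s<..<t} \<inter> F = {} \<Longrightarrow> smooth_curve M \<A> s t \<gamma>"
  let ?r = "\<lambda>t. \<sigma> * t + c" and ?i = "\<lambda>t. \<sigma> * (t - c)"
  have ri: "?r (?i t) = t" "?i (?r t) = t" for t using \<sigma> by auto
  show ?thesis
  proof (rule PS_I[of a' b' _ "?i ` F"])
    show "a' \<le> b'" using PS_le[OF \<gamma>] \<sigma> by auto
    have "continuous_map (top_of_set {a'..b'}) (top_of_set {a..b}) ?r"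
      using \<sigma> by (auto simp: continuous_map_in_subtopology intro!: continuous_intros)
    from continuous_map_compose[OF this PS_continuous[OF \<gamma>]]
    show "continuous_map (top_of_set {a'..b'}) M (\<lambda>t. \<gamma> (?r t))" by (simp add: o_def)
    show "a' \<in> ?i ` F" "b' \<in> ?i ` F" using F \<sigma> by (auto simp: image_iff intro: bexI[of _ a] bexI[of _ b])
    show "?i ` F \<subseteq> {a'..b'}" using F(4) \<sigma> by force
    fix s t assume st: "s \<in> ?i ` F" "t \<in> ?i ` F" "s < t" "{s<..<t} \<inter> ?i ` F = {}"
    have rs: "?r s \<in> F" "?r t \<in> F" using st(1,2) ri by auto
    have e: "\<not> (s < ?i x \<and> ?i x < t)" if "x \<in> F" for x using st(4) that by auto
    consider "\<sigma> = 1" | "\<sigma> = -1" using \<sigma> by auto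
    then show "smooth_curve M \<A> s t (\<lambda>t. \<gamma> (?r t))"
    proof cases
      case 1
      have "smooth_curve M \<A> (?r s) (?r t) \<gamma>"
        by (rule sm) (use rs st(3) e 1 in force)+
      then show ?thesis by (rule smooth_curve_affine) (use 1 in auto)
    next
      case 2
      have "smooth_curve M \<A> (?r t) (?r s) \<gamma>"
        by (rule sm) (use rs st(3) e 2 in force)+
      then show ?thesis by (rule smooth_curve_affine) (use 2 in auto)
    qed
  qed (use F in auto)
qed


section \<open>Speed and length of piecewise smooth curves\<close>

lemma at_within_chart_preimage:
  fixes I :: "real set"
  assumes \<gamma>: "continuous_map (top_of_set I) M \<gamma>" and t: "t \<in> I" "\<gamma> t \<in> W" and W: "openin M W"
  shows "at t within {s \<in> I. \<gamma> s \<in> W} = at t within I"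
proof (rule curve_chart_nbhd[OF assms])
  fix d assume d: "d > 0" "\<And>s. s \<in> I \<Longrightarrow> dist s t < d \<Longrightarrow> \<gamma> s \<in> W"
  show ?thesis
    by (rule at_within_nhd[of t "ball t d"]) (use d in \<open>auto simp: dist_commute\<close>)
qed

lemma smooth_curve_deriv:
  assumes \<gamma>: "smooth_curve M \<A> a b \<gamma>" and C: "(U, \<phi>) \<in> \<A>"
  obtains w where "continuous_on {t \<in> {a..b}. \<gamma> t \<in> U} w"
    "\<And>t. t \<in> {a..b} \<Longrightarrow> \<gamma> t \<in> U \<Longrightarrow> ((\<phi> \<circ> \<gamma>) has_vector_derivative w t) (at t within {a..b})"
proof -
  let ?J = "{t \<in> {a..b}. \<gamma> t \<in> U}"
  have c: "continuous_map (top_of_set {a..b}) M \<gamma>" using \<gamma> by (simp add: smooth_curve_def)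
  have "case (U, \<phi>) of (U, \<phi>) \<Rightarrow> smooth_fun_on {t \<in> {a..b}. \<gamma> t \<in> U} (\<phi> \<circ> \<gamma>)"
    using \<gamma> C unfolding smooth_curve_def by (elim conjE bspec)
  then have "smooth_fun_on ?J (\<phi> \<circ> \<gamma>)" by (simp only: prod.case)
  then have "Ck (Suc 0) ?J (\<phi> \<circ> \<gamma>)" by (rule smooth_fun_on_imp_Ck)
  then obtain w where w: "\<forall>t\<in>?J. ((\<phi> \<circ> \<gamma>) has_vector_derivative w t) (at t within ?J)" "continuous_on ?J w"
    unfolding Ck.simps by blast
  have "((\<phi> \<circ> \<gamma>) has_vector_derivative w t) (at t within {a..b})" if "t \<in> {a..b}" "\<gamma> t \<in> U" for t
  proof -
    have "((\<phi> \<circ> \<gamma>) has_vector_derivative w t) (at t within ?J)" using w(1) that by blast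
    then show ?thesis unfolding at_within_chart_preimage[OF c that is_chartD(1)[OF C]] .
  qed
  then show thesis using that w(2) by blast
qed

lemma smooth_curve_speed_continuous:
  assumes \<gamma>: "smooth_curve M \<A> a b \<gamma>" and ab: "a < b"
  shows "continuous_on {a..b} (speed \<A> g {a..b} \<gamma>)"
  unfolding continuous_on_eq_continuous_within
proof
  fix t assume t: "t \<in> {a..b}"
  have c: "continuous_map (top_of_set {a..b}) M \<gamma>" using \<gamma> by (simp add: smooth_curve_def)
  have "\<gamma> t \<in> topspace M" using continuous_map_image_subset_topspace[OF c] t by auto
  then obtain U \<phi> where C: "(U, \<phi>) \<in> \<A>" "\<gamma> t \<in> U" by (rule chart_cover)
  interpret local_metric "\<phi> ` U" "g (U, \<phi>)" by (rule chart_local_metric[OF C(1)])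
  let ?J = "{t \<in> {a..b}. \<gamma> t \<in> U}"
  obtain w where w: "continuous_on ?J w"
    "\<And>t. t \<in> {a..b} \<Longrightarrow> \<gamma> t \<in> U \<Longrightarrow> ((\<phi> \<circ> \<gamma>) has_vector_derivative w t) (at t within {a..b})"
    by (rule smooth_curve_deriv[OF \<gamma> C(1)]) (rule that)
  have "continuous_on ?J (\<phi> \<circ> \<gamma>)"
    by (rule has_vector_derivative_imp_continuous_on[of _ _ w])
       (use w(2) in \<open>auto intro: has_vector_derivative_within_subset[of _ _ _ "{a..b}"]\<close>)
  then have "continuous_on ?J (\<lambda>t. nrm ((\<phi> \<circ> \<gamma>) t) (w t))"
    by (rule continuous_on_nrm) (use w(1) in auto)
  then have "continuous_on ?J (speed \<A> g {a..b} \<gamma>)"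
  proof (rule continuous_on_eq)
    fix s assume "s \<in> ?J"
    then have s: "s \<in> {a..b}" "\<gamma> s \<in> U" by auto
    show "nrm ((\<phi> \<circ> \<gamma>) s) (w s) = speed \<A> g {a..b} \<gamma> s"
      using speed_eq[OF C(1) at_within_Icc_not_bot[OF ab s(1)] c s w(2)[OF s]] by (simp add: nrm_def)
  qed
  then have "continuous (at t within ?J) (speed \<A> g {a..b} \<gamma>)"
    using t C(2) by (simp add: continuous_on_eq_continuous_within)
  then show "continuous (at t within {a..b}) (speed \<A> g {a..b} \<gamma>)"
    unfolding at_within_chart_preimage[OF c t C(2) is_chartD(1)[OF C(1)]] .
qed

lemma smooth_curve_spd_integrable:
  assumes \<gamma>: "smooth_curve M \<A> a b \<gamma>" and ab: "a < b"
  shows "spd \<gamma> integrable_on {a..b}"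
proof (rule integrable_spike_finite[of "{a, b}"])
  show "speed \<A> g {a..b} \<gamma> integrable_on {a..b}"
    by (rule integrable_continuous_real[OF smooth_curve_speed_continuous[OF assms]])
qed (auto simp: speed_eq_spd)

lemma PS_spd_integrable:
  assumes \<gamma>: "PS a b \<gamma>" shows "spd \<gamma> integrable_on {a..b}"
proof (cases "a = b")
  case True then show ?thesis using integrable_on_refl[of "spd \<gamma>" a] by simp
next
  case False
  then have ab: "a < b" using PS_le[OF \<gamma>] by simp
  show ?thesis
  proof (rule PS_pieces[OF \<gamma>])
    fix F assume F: "finite F" "a \<in> F" "b \<in> F" "F \<subseteq> {a..b}"
      and sm: "\<And>s t. s \<in> F \<Longrightarrow> t \<in> F \<Longrightarrow> s < t \<Longrightarrow> {s<..<t} \<inter> F = {} \<Longrightarrow> smooth_curve M \<A> s t \<gamma>"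
    show ?thesis
    proof (rule consecutive_induct[OF F ab, of "\<lambda>s t. spd \<gamma> integrable_on {s..t}"])
      show "spd \<gamma> integrable_on {s..t}" if "s \<in> F" "t \<in> F" "s < t" "{s<..<t} \<inter> F = {}" for s t
        by (rule smooth_curve_spd_integrable[OF sm[OF that] that(3)])
      show "spd \<gamma> integrable_on {s..u}"
        if "a \<le> s" "s < t" "t < u" "u \<le> b" "spd \<gamma> integrable_on {s..t}" "spd \<gamma> integrable_on {t..u}" for s t u
        by (rule Henstock_Kurzweil_Integration.integrable_combine[of s t u]) (use that in auto)
    qed
  qed
qed

lemma PS_differentiable:
  assumes \<gamma>: "PS a b \<gamma>"
  obtains F where "finite F" "\<And>t U \<phi>. t \<in> {a<..<b} - F \<Longrightarrow> (U, \<phi>) \<in> \<A> \<Longrightarrow> \<gamma> t \<in> U \<Longrightarrow>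
     \<exists>w. ((\<phi> \<circ> \<gamma>) has_vector_derivative w) (at t) \<and> spd \<gamma> t = sqrt (g (U, \<phi>) (\<phi> (\<gamma> t)) w w)"
proof (rule PS_pieces[OF \<gamma>])
  fix F assume F: "finite F" "a \<in> F" "b \<in> F" "F \<subseteq> {a..b}"
    and sm: "\<And>s t. s \<in> F \<Longrightarrow> t \<in> F \<Longrightarrow> s < t \<Longrightarrow> {s<..<t} \<inter> F = {} \<Longrightarrow> smooth_curve M \<A> s t \<gamma>"
  show thesis
  proof (rule that[OF F(1)])
    fix t U \<phi> assume t: "t \<in> {a<..<b} - F" and C: "(U, \<phi>) \<in> \<A>" "\<gamma> t \<in> U"
    have 1: "finite (F \<inter> {..t})" "F \<inter> {..t} \<noteq> {}" "finite (F \<inter> {t..})" "F \<inter> {t..} \<noteq> {}" using F t by auto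
    define s0 t0 where "s0 = Max (F \<inter> {..t})" and "t0 = Min (F \<inter> {t..})"
    have s0: "s0 \<in> F" "s0 \<le> t" using Max_in[OF 1(1,2)] by (auto simp: s0_def)
    have t0: "t0 \<in> F" "t \<le> t0" using Min_in[OF 1(3,4)] by (auto simp: t0_def)
    have lt: "s0 < t" "t < t0" using s0 t0 t by (auto simp: less_le)
    have "{s0<..<t0} \<inter> F = {}"
    proof (rule ccontr)
      assume "\<not> ?thesis"
      then obtain x where x: "x \<in> F" "s0 < x" "x < t0" by auto
      have "\<not> x \<le> t" using Max_ge[OF 1(1), of x] x by (auto simp: s0_def)
      moreover have "\<not> t \<le> x" using Min_le[OF 1(3), of x] x by (auto simp: t0_def)
      ultimately show False by auto
    qed
    then have "smooth_curve M \<A> s0 t0 \<gamma>" using sm[OF s0(1) t0(1)] lt by auto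
    then obtain w where w: "((\<phi> \<circ> \<gamma>) has_vector_derivative w t) (at t within {s0..t0})"
      using smooth_curve_deriv[OF _ C(1)] C(2) lt by (metis atLeastAtMost_iff less_imp_le)
    have i: "t \<in> interior {s0..t0}" "t \<in> interior {a..b}" using lt t by auto
    have w': "((\<phi> \<circ> \<gamma>) has_vector_derivative w t) (at t)" using w at_within_interior[OF i(1)] by simp
    have ab: "a < b" "t \<in> {a..b}" using t by auto
    have "speed \<A> g {a..b} \<gamma> t = sqrt (g (U, \<phi>) (\<phi> (\<gamma> t)) (w t) (w t))"
      by (rule speed_eq[OF C(1) at_within_Icc_not_bot[OF ab] PS_continuous[OF \<gamma>] ab(2) C(2)])
         (use w' at_within_interior[OF i(2)] in simp)
    then show "\<exists>w. ((\<phi> \<circ> \<gamma>) has_vector_derivative w) (at t) \<and> spd \<gamma> t = sqrt (g (U, \<phi>) (\<phi> (\<gamma> t)) w w)"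
      using w' speed_eq_spd[of a t b \<gamma>] t by auto
  qed
qed

lemma PS_in_topspace: "PS a b \<gamma> \<Longrightarrow> t \<in> {a..b} \<Longrightarrow> \<gamma> t \<in> topspace M"
  using continuous_map_image_subset_topspace[OF PS_continuous] by fastforce

lemma len_nonneg:
  assumes \<gamma>: "PS a b \<gamma>" shows "0 \<le> len a b \<gamma>"
proof (rule PS_differentiable[OF \<gamma>])
  fix F assume F: "finite F" and d: "\<And>t U \<phi>. t \<in> {a<..<b} - F \<Longrightarrow> (U, \<phi>) \<in> \<A> \<Longrightarrow> \<gamma> t \<in> U \<Longrightarrow>
     \<exists>w. ((\<phi> \<circ> \<gamma>) has_vector_derivative w) (at t) \<and> spd \<gamma> t = sqrt (g (U, \<phi>) (\<phi> (\<gamma> t)) w w)"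
  have nn: "0 \<le> spd \<gamma> t" if t: "t \<in> {a<..<b} - F" for t
  proof -
    have "t \<in> {a..b}" using t by auto
    then obtain U \<phi> where C: "(U, \<phi>) \<in> \<A>" "\<gamma> t \<in> U" using PS_in_topspace[OF \<gamma>] chart_cover by metis
    interpret local_metric "\<phi> ` U" "g (U, \<phi>)" by (rule chart_local_metric[OF C(1)])
    obtain w where w: "spd \<gamma> t = sqrt (g (U, \<phi>) (\<phi> (\<gamma> t)) w w)" using d[OF t C] by blast
    have "\<phi> (\<gamma> t) \<in> \<phi> ` U" using C(2) by blast
    from h_nonneg[OF this] show ?thesis unfolding w by simp
  qed
  \<comment> \<open>At the exceptional parameters the definite description in \<open>speed\<close>
    may have an arbitrary value, possibly negative; these finitely many values are replaced by
    0.\<close>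
  define f where "f = (\<lambda>t. if t \<in> {a<..<b} - F then spd \<gamma> t else 0)"
  have "integral {a..b} (spd \<gamma>) = integral {a..b} f"
  proof (rule integral_spike[of "insert a (insert b F)"])
    show "negligible (insert a (insert b F))" using F by (simp add: negligible_finite)
  qed (auto simp: f_def)
  moreover have "f integrable_on {a..b}"
    by (rule integrable_spike_finite[OF _ _ PS_spd_integrable[OF \<gamma>], of "insert a (insert b F)"])
       (auto simp: F f_def)
  then have "0 \<le> integral {a..b} f"
    by (rule integral_nonneg) (use nn in \<open>auto simp: f_def\<close>)
  ultimately show ?thesis unfolding curve_length_eq by simp
qed

lemma len_split:
  assumes \<gamma>: "PS a b \<gamma>" and c: "a \<le> c" "c \<le> b"
  shows "len a c \<gamma> + len c b \<gamma> = len a b \<gamma>"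
  unfolding curve_length_eq
  by (rule Henstock_Kurzweil_Integration.integral_combine[OF c PS_spd_integrable[OF \<gamma>]])

lemma len_cong:
  assumes "\<And>t. a < t \<Longrightarrow> t < b \<Longrightarrow> \<gamma> t = \<delta> t"
  shows "len a b \<gamma> = len a b \<delta>"
  unfolding curve_length_eq
proof (rule integral_spike[of "{a, b}"])
  fix t assume "t \<in> {a..b} - {a, b}"
  then show "spd \<delta> t = spd \<gamma> t" by (intro spd_cong[of "{a<..<b}"]) (auto simp: assms)
qed auto

lemma len_affine:
  assumes \<gamma>: "PS a b \<gamma>" and \<sigma>: "\<sigma> = 1 \<and> a' = a - c \<and> b' = b - c \<or> \<sigma> = -1 \<and> a' = c - b \<and> b' = c - a"
  shows "len a' b' (\<lambda>t. \<gamma> (\<sigma> * t + c)) = len a b \<gamma>"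
proof (rule PS_differentiable[OF \<gamma>])
  let ?r = "\<lambda>t. \<sigma> * t + c" and ?i = "\<lambda>t. \<sigma> * (t - c)"
  have ri: "?i (?r t) = t" for t using \<sigma> by auto
  fix F assume F: "finite F" and d: "\<And>t U \<phi>. t \<in> {a<..<b} - F \<Longrightarrow> (U, \<phi>) \<in> \<A> \<Longrightarrow> \<gamma> t \<in> U \<Longrightarrow>
     \<exists>w. ((\<phi> \<circ> \<gamma>) has_vector_derivative w) (at t) \<and> spd \<gamma> t = sqrt (g (U, \<phi>) (\<phi> (\<gamma> t)) w w)"
  have PS': "PS a' b' (\<lambda>t. \<gamma> (?r t))" by (rule PS_affine[OF assms])
  have eq: "spd (\<lambda>t. \<gamma> (?r t)) t = spd \<gamma> (?r t)" if t: "t \<in> {a'..b'} - ?i ` (insert a (insert b F))" for t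
  proof -
    have rt: "?r t \<in> {a<..<b} - F"
    proof -
      have "?r t \<notin> insert a (insert b F)" using t ri[of t] by (metis DiffD2 imageI)
      moreover have "?r t \<in> {a..b}" using t \<sigma> by auto
      ultimately show ?thesis by auto
    qed
    then have "?r t \<in> {a..b}" by auto
    then obtain U \<phi> where C: "(U, \<phi>) \<in> \<A>" "\<gamma> (?r t) \<in> U" using PS_in_topspace[OF \<gamma>] chart_cover by metis
    interpret local_metric "\<phi> ` U" "g (U, \<phi>)" by (rule chart_local_metric[OF C(1)])
    obtain w where w: "((\<phi> \<circ> \<gamma>) has_vector_derivative w) (at (?r t))" "spd \<gamma> (?r t) = sqrt (g (U, \<phi>) (\<phi> (\<gamma> (?r t))) w w)"
      using d[OF rt C] by blast
    have "(?r has_vector_derivative \<sigma>) (at t)"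
      by (auto intro!: derivative_eq_intros simp flip: has_real_derivative_iff_has_vector_derivative)
    from vector_diff_chain_at[OF this w(1)]
    have w': "((\<phi> \<circ> (\<lambda>t. \<gamma> (?r t))) has_vector_derivative \<sigma> *\<^sub>R w) (at t)" by (simp add: o_def)
    have tt: "a' < t" "t < b'" using rt \<sigma> by auto
    then have i: "t \<in> interior {a'..b'}" "t \<in> {a'..b'}" "a' < b'" by auto
    have "speed \<A> g {a'..b'} (\<lambda>t. \<gamma> (?r t)) t = sqrt (g (U, \<phi>) (\<phi> (\<gamma> (?r t))) (\<sigma> *\<^sub>R w) (\<sigma> *\<^sub>R w))"
      by (rule speed_eq[OF C(1) at_within_Icc_not_bot[OF i(3,2)] PS_continuous[OF PS'] i(2) C(2)])
         (use w' at_within_interior[OF i(1)] in simp)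
    also have "\<dots> = sqrt (g (U, \<phi>) (\<phi> (\<gamma> (?r t))) w w)"
    proof -
      have S: "\<phi> (\<gamma> (?r t)) \<in> \<phi> ` U" using C(2) by blast
      have "\<bar>\<sigma>\<bar> = 1" using \<sigma> by auto
      then show ?thesis using nrm_scaleR[OF S, of \<sigma> w] by (simp add: nrm_def)
    qed
    finally show ?thesis using w(2) speed_eq_spd[OF tt] by simp
  qed
  have "(spd \<gamma> has_integral len a b \<gamma>) (cbox a b)"
    using integrable_integral[OF PS_spd_integrable[OF \<gamma>]] by (simp add: curve_length_eq)
  from has_integral_affinity[OF this, of \<sigma> c]
  have "((\<lambda>t. spd \<gamma> (?r t)) has_integral len a b \<gamma>) ((\<lambda>x. (1 / \<sigma>) *\<^sub>R x + - ((1 / \<sigma>) *\<^sub>R c)) ` cbox a b)"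
    using \<sigma> by auto
  moreover have "(\<lambda>x. (1 / \<sigma>) *\<^sub>R x + - ((1 / \<sigma>) *\<^sub>R c)) ` cbox a b = {a'..b'}"
    using \<sigma> PS_le[OF \<gamma>] by (auto simp: image_affinity_atLeastAtMost image_affinity_atLeastAtMost_diff algebra_simps)
  ultimately have "((\<lambda>t. spd \<gamma> (?r t)) has_integral len a b \<gamma>) {a'..b'}" by simp
  then have "(spd (\<lambda>t. \<gamma> (?r t)) has_integral len a b \<gamma>) {a'..b'}"
    by (rule has_integral_spike_finite[rotated 2, where S="?i ` (insert a (insert b F))"]) (use F eq in auto)
  then show ?thesis unfolding curve_length_eq[of a' b'] by (rule integral_unique)
qed

text \<open>A calibration: a linear form dominated by the metric norm along the curve can grow by at
  most the length. This gives lower bounds for lengths without minimizing over curves.\<close>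

lemma len_ge_linear:
  assumes \<gamma>: "PS a b \<gamma>" and C: "(U, \<phi>) \<in> \<A>" "\<And>t. t \<in> {a..b} \<Longrightarrow> \<gamma> t \<in> U"
    and \<l>: "bounded_linear \<l>" "\<And>t w. t \<in> {a..b} \<Longrightarrow> \<l> w \<le> sqrt (g (U, \<phi>) (\<phi> (\<gamma> t)) w w)"
  shows "\<l> (\<phi> (\<gamma> b)) - \<l> (\<phi> (\<gamma> a)) \<le> len a b \<gamma>"
proof (rule PS_differentiable[OF \<gamma>])
  fix F assume F: "finite F" and d: "\<And>t U \<phi>. t \<in> {a<..<b} - F \<Longrightarrow> (U, \<phi>) \<in> \<A> \<Longrightarrow> \<gamma> t \<in> U \<Longrightarrow>
     \<exists>w. ((\<phi> \<circ> \<gamma>) has_vector_derivative w) (at t) \<and> spd \<gamma> t = sqrt (g (U, \<phi>) (\<phi> (\<gamma> t)) w w)"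
  have "\<exists>w. ((\<phi> \<circ> \<gamma>) has_vector_derivative w) (at t) \<and> \<l> w \<le> spd \<gamma> t" if t: "t \<in> {a<..<b} - F" for t
  proof -
    have t': "t \<in> {a..b}" using t by auto
    show ?thesis using d[OF t C(1) C(2)[OF t']] \<l>(2)[OF t'] by auto
  qed
  then obtain w where w: "\<And>t. t \<in> {a<..<b} - F \<Longrightarrow> ((\<phi> \<circ> \<gamma>) has_vector_derivative w t) (at t)"
    "\<And>t. t \<in> {a<..<b} - F \<Longrightarrow> \<l> (w t) \<le> spd \<gamma> t" by metis
  have cont: "continuous_on {a..b} (\<lambda>t. \<l> (\<phi> (\<gamma> t)))"
  proof -
    have "continuous_map (top_of_set {a..b}) (subtopology M U) \<gamma>"
      using PS_continuous[OF \<gamma>] C(2) by (auto simp: continuous_map_in_subtopology)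
    from continuous_map_compose[OF this chart_continuous[OF C(1)]]
    have "continuous_on {a..b} (\<lambda>t. \<phi> (\<gamma> t))" by (simp add: o_def)
    then show ?thesis by (rule bounded_linear.continuous_on[OF \<l>(1)])
  qed
  have "((\<lambda>t. \<l> (w t)) has_integral (\<l> (\<phi> (\<gamma> b)) - \<l> (\<phi> (\<gamma> a)))) {a..b}"
  proof (rule fundamental_theorem_of_calculus_interior_strong[OF F PS_le[OF \<gamma>] _ cont])
    fix t assume t: "t \<in> {a<..<b} - F"
    show "((\<lambda>t. \<l> (\<phi> (\<gamma> t))) has_vector_derivative \<l> (w t)) (at t)"
      using bounded_linear.has_vector_derivative[OF \<l>(1) w(1)[OF t]] by (simp add: o_def)
  qed
  then have "((\<lambda>t. if t \<in> {a<..<b} - F then \<l> (w t) else spd \<gamma> t) has_integral (\<l> (\<phi> (\<gamma> b)) - \<l> (\<phi> (\<gamma> a)))) {a..b}"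
    by (rule has_integral_spike_finite[rotated 2, where S="insert a (insert b F)"]) (use F in auto)
  from has_integral_le[OF this integrable_integral[OF PS_spd_integrable[OF \<gamma>]]]
  show ?thesis unfolding curve_length_eq using w(2) by simp
qed

end

section \<open>Lengths of joining curves and their comparison with a chart\<close>

lemma Ck_subset: "Ck k J f \<Longrightarrow> J' \<subseteq> J \<Longrightarrow> Ck k J' f"
proof (induction k arbitrary: f)
  case 0 then show ?case using continuous_on_subset by auto
next
  case (Suc k)
  then obtain f' where f': "\<forall>t\<in>J. (f has_vector_derivative f' t) (at t within J)" "Ck k J f'" by auto
  have "(f has_vector_derivative f' t) (at t within J')" if "t \<in> J'" for t
    by (rule has_vector_derivative_within_subset[OF _ Suc.prems(2)]) (use f'(1) that Suc.prems(2) in blast)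
  moreover have "Ck k J' f'" by (rule Suc.IH[OF f'(2) Suc.prems(2)])
  ultimately show ?case by auto
qed

lemma (in local_metric) h_cauchy_schwarz:
  assumes x: "x \<in> S" shows "h x v w \<le> nrm x v * nrm x w"
proof (cases "w = 0")
  case True then show ?thesis using bilinear_rzero[OF bil[OF x]] by (simp add: nrm_def)
next
  case False
  note B = bil[OF x]
  have pw: "h x w w > 0" using pos[OF x False] .
  define s where "s = h x v w / h x w w"
  have "0 \<le> h x (v - s *\<^sub>R w) (v - s *\<^sub>R w)" by (rule h_nonneg[OF x])
  also have "\<dots> = h x v v - 2 * s * h x v w + s * s * h x w w"
    using sym[OF x, of w v] by (simp add: bilinear_lsub[OF B] bilinear_rsub[OF B] bilinear_lmul[OF B] bilinear_rmul[OF B] algebra_simps)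
  also have "\<dots> = h x v v - (h x v w)\<^sup>2 / h x w w" using pw by (simp add: s_def power2_eq_square field_simps)
  finally have "(h x v w)\<^sup>2 \<le> h x v v * h x w w" using pw by (simp add: field_simps)
  then have "h x v w \<le> sqrt (h x v v * h x w w)" by (rule real_le_rsqrt)
  then show ?thesis by (simp add: nrm_def real_sqrt_mult)
qed

context riemannian
begin

lemma chart_inv_curve_continuous:
  assumes C: "(U, \<phi>) \<in> \<A>" and c: "continuous_on J c" "c ` J \<subseteq> \<phi> ` U"
  shows "continuous_map (top_of_set J) M (\<lambda>t. inv_into U \<phi> (c t))"
proof -
  have "continuous_map (top_of_set J) (top_of_set (\<phi> ` U)) c"
    using c by (auto simp: continuous_map_in_subtopology)
  moreover have "continuous_map (top_of_set (\<phi> ` U)) M (inv_into U \<phi>)"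
    using chart_inv_continuous[OF C] continuous_map_in_subtopology by blast
  ultimately have "continuous_map (top_of_set J) M (inv_into U \<phi> \<circ> c)" by (rule continuous_map_compose)
  then show ?thesis by (simp add: o_def)
qed

text \<open>Smoothness has to be verified in every chart. Another chart sees the curve through an
  analytic transition map, on the parameters that lie over the overlap.\<close>

lemma chart_curve_smooth:
  fixes c :: "real \<Rightarrow> 'e"
  assumes C: "(U, \<phi>) \<in> \<A>" and ab: "a < b" and c: "\<And>k. Ck k {a..b} c" "c ` {a..b} \<subseteq> \<phi> ` U"
  shows "smooth_curve M \<A> a b (\<lambda>t. inv_into U \<phi> (c t))"
proof -
  let ?\<gamma> = "\<lambda>t. inv_into U \<phi> (c t)"
  have cont: "continuous_map (top_of_set {a..b}) M ?\<gamma>"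
    by (rule chart_inv_curve_continuous[OF C Ck_imp_continuous_on[OF c(1)] c(2)])
  have in_U: "?\<gamma> t \<in> U" "\<phi> (?\<gamma> t) = c t" if "t \<in> {a..b}" for t
  proof -
    have "c t \<in> \<phi> ` U" using c(2) that by blast
    then show "?\<gamma> t \<in> U" "\<phi> (?\<gamma> t) = c t" by (simp_all add: inv_into_into f_inv_into_f)
  qed
  have "smooth_fun_on {t \<in> {a..b}. ?\<gamma> t \<in> V} (\<psi> \<circ> ?\<gamma>)" if D: "(V, \<psi>) \<in> \<A>" for V \<psi>
  proof (rule Ck_imp_smooth_fun_on)
    let ?J = "{t \<in> {a..b}. ?\<gamma> t \<in> V}"
    fix t assume t: "t \<in> ?J"
    then have t': "t \<in> {a..b}" "?\<gamma> t \<in> V" by auto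
    show "at t within ?J \<noteq> bot"
      unfolding at_within_chart_preimage[OF cont t' is_chartD(1)[OF D]] by (rule at_within_Icc_not_bot[OF ab t'(1)])
  next
    fix k
    let ?J = "{t \<in> {a..b}. ?\<gamma> t \<in> V}"
    have S: "open (\<phi> ` (U \<inter> V))" by (rule chart_image_open[OF C is_chartD(1)[OF D]])
    have cS: "c t \<in> \<phi> ` (U \<inter> V)" if "t \<in> ?J" for t
      using that in_U[of t] by (metis (mono_tags, lifting) IntI image_eqI mem_Collect_eq)
    have "Ck k ?J (\<lambda>t. transition (U, \<phi>) (V, \<psi>) (c t))"
    proof (rule Ck_componentwise)
      fix b :: 'e assume "b \<in> Basis"
      show "Ck k ?J (\<lambda>t. transition (U, \<phi>) (V, \<psi>) (c t) \<bullet> b)"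
        by (rule Ck_compose_analytic[OF S _ real_analytic_on_inner[OF transition_analytic[OF C D]] Ck_subset[OF c(1)]])
           (use cS in auto)
    qed
    then show "Ck k ?J (\<psi> \<circ> ?\<gamma>)"
    proof (rule Ck_cong)
      fix t assume "t \<in> ?J"
      then have t: "t \<in> {a..b}" by simp
      show "transition (U, \<phi>) (V, \<psi>) (c t) = (\<psi> \<circ> ?\<gamma>) t"
        using transition_apply[OF C in_U(1)[OF t], of V \<psi>] in_U(2)[OF t] by simp
    qed
  qed
  then show ?thesis unfolding smooth_curve_def using cont by blast
qed

lemma segment_curve:
  assumes C: "(U, \<phi>) \<in> \<A>" and xy: "closed_segment x y \<subseteq> \<phi> ` U"
  defines "\<gamma> \<equiv> \<lambda>t::real. inv_into U \<phi> (x + t *\<^sub>R (y - x))"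
  shows "PS 0 1 \<gamma>" "len 0 1 \<gamma> = integral {0..1} (\<lambda>t. sqrt (g (U, \<phi>) (x + t *\<^sub>R (y - x)) (y - x) (y - x)))"
proof -
  let ?c = "\<lambda>t::real. x + t *\<^sub>R (y - x)"
  have d: "(?c has_vector_derivative (y - x)) (at t within T)" for t T
    by (auto intro!: derivative_eq_intros)
  have img: "?c ` {0..1} \<subseteq> \<phi> ` U"
    using xy by (force simp: closed_segment_def algebra_simps)
  have "Ck k {0..1} ?c" for k
    using d by (cases k) (auto intro!: continuous_intros exI[of _ "\<lambda>_. y - x"])
  then have sm: "smooth_curve M \<A> 0 1 \<gamma>"
    unfolding \<gamma>_def by (intro chart_curve_smooth[OF C _ _ img]) auto
  then show "PS 0 1 \<gamma>" by (rule smooth_curve_imp_PS) simp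
  have c: "continuous_map (top_of_set {0..1}) M \<gamma>" using sm by (simp add: smooth_curve_def)
  show "len 0 1 \<gamma> = integral {0..1} (\<lambda>t. sqrt (g (U, \<phi>) (?c t) (y - x) (y - x)))"
    unfolding curve_length_def
  proof (rule integral_cong)
    fix t :: real assume t: "t \<in> {0..1}"
    have inv: "\<gamma> s \<in> U" "\<phi> (\<gamma> s) = ?c s" if "s \<in> {0..1}" for s
    proof -
      have "?c s \<in> \<phi> ` U" using img that by blast
      then show "\<gamma> s \<in> U" "\<phi> (\<gamma> s) = ?c s" by (simp_all add: \<gamma>_def inv_into_into f_inv_into_f)
    qed
    have "((\<phi> \<circ> \<gamma>) has_vector_derivative (y - x)) (at t within {0..1})"
      by (rule has_vector_derivative_transform[OF t _ d]) (simp add: inv)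
    from speed_eq[OF C at_within_Icc_not_bot[OF zero_less_one t] c t inv(1)[OF t] this]
    show "speed \<A> g {0..1} \<gamma> t = sqrt (g (U, \<phi>) (?c t) (y - x) (y - x))"
      using inv(2)[OF t] by simp
  qed
qed

text \<open>Records which lengths occur between two points. Both \<open>rd\<close> and
  \<open>dist_to\<close> are infima of such lengths, and the parameter intervals disappear from
  view.\<close>

definition joined :: "'a \<Rightarrow> 'a \<Rightarrow> real \<Rightarrow> bool" where
  "joined x y l \<longleftrightarrow> (\<exists>a b \<gamma>. PS a b \<gamma> \<and> \<gamma> a = x \<and> \<gamma> b = y \<and> len a b \<gamma> = l)"

lemma joined_nonneg: "joined x y l \<Longrightarrow> 0 \<le> l"
  unfolding joined_def using len_nonneg by blast

lemma joined_in_topspace: "joined x y l \<Longrightarrow> x \<in> topspace M \<and> y \<in> topspace M"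
  unfolding joined_def by (elim exE conjE) (metis PS_in_topspace PS_le atLeastAtMost_iff order_refl)

lemma joined_refl:
  assumes "x \<in> topspace M" shows "joined x x 0"
proof -
  have "PS 0 0 (\<lambda>_. x)" by (rule PS_I[of _ _ _ "{0}"]) (use assms in auto)
  moreover have "len 0 0 (\<lambda>_. x) = 0" by (simp add: curve_length_def)
  ultimately show ?thesis unfolding joined_def by blast
qed

lemma joined_sym:
  assumes "joined x y l" shows "joined y x l"
proof -
  obtain a b \<gamma> where \<gamma>: "PS a b \<gamma>" "\<gamma> a = x" "\<gamma> b = y" "len a b \<gamma> = l" using assms unfolding joined_def by blast
  let ?\<delta> = "\<lambda>t. \<gamma> (-1 * t + 0)"
  have "PS (0 - b) (0 - a) ?\<delta>" by (rule PS_affine[OF \<gamma>(1)]) simp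
  moreover have "len (0 - b) (0 - a) ?\<delta> = l" unfolding \<gamma>(4)[symmetric] by (rule len_affine[OF \<gamma>(1)]) simp
  moreover have "?\<delta> (0 - b) = y" "?\<delta> (0 - a) = x" using \<gamma> by auto
  ultimately show ?thesis unfolding joined_def by blast
qed

lemma joined_trans:
  assumes "joined x y l" "joined y z l'" shows "joined x z (l + l')"
proof -
  obtain a b \<gamma> where \<gamma>: "PS a b \<gamma>" "\<gamma> a = x" "\<gamma> b = y" "len a b \<gamma> = l" using assms unfolding joined_def by blast
  obtain c d \<delta> where \<delta>: "PS c d \<delta>" "\<delta> c = y" "\<delta> d = z" "len c d \<delta> = l'" using assms unfolding joined_def by blast
  let ?\<delta> = "\<lambda>t. \<delta> (1 * t + (c - b))"
  let ?e = "d - (c - b)"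
  have \<delta>': "PS (c - (c - b)) ?e ?\<delta>" "len (c - (c - b)) ?e ?\<delta> = l'"
    unfolding \<delta>(4)[symmetric] by (rule PS_affine[OF \<delta>(1)] len_affine[OF \<delta>(1)]; simp)+
  then have \<delta>': "PS b ?e ?\<delta>" "len b ?e ?\<delta> = l'" by simp_all
  define \<epsilon> where "\<epsilon> = (\<lambda>t. if t \<le> b then \<gamma> t else ?\<delta> t)"
  have 1: "PS a b \<epsilon>" by (rule PS_cong[OF \<gamma>(1)]) (simp add: \<epsilon>_def)
  have 2: "PS b ?e \<epsilon>" by (rule PS_cong[OF \<delta>'(1)]) (use \<gamma>(3) \<delta>(2) in \<open>auto simp: \<epsilon>_def\<close>)
  have 12: "PS a ?e \<epsilon>" by (rule PS_join[OF 1 2])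
  have "len a b \<epsilon> = l" unfolding \<gamma>(4)[symmetric] by (rule len_cong) (simp add: \<epsilon>_def)
  moreover have "len b ?e \<epsilon> = l'" unfolding \<delta>'(2)[symmetric] by (rule len_cong) (simp add: \<epsilon>_def)
  ultimately have "len a ?e \<epsilon> = l + l'" using len_split[OF 12 PS_le[OF 1] PS_le[OF 2]] by simp
  moreover have "\<epsilon> a = x" using PS_le[OF 1] \<gamma> by (simp add: \<epsilon>_def)
  moreover have "\<epsilon> ?e = z" using PS_le[OF 2] \<gamma> \<delta> by (auto simp: \<epsilon>_def)
  ultimately show ?thesis unfolding joined_def using 12 by blast
qed

lemma chart_nbhd_joined:
  assumes C: "(U, \<phi>) \<in> \<A>" and B: "convex B" "B \<subseteq> \<phi> ` U" and xy: "x \<in> U" "\<phi> x \<in> B" "y \<in> U" "\<phi> y \<in> B"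
  shows "\<exists>l. joined x y l"
proof -
  have "closed_segment (\<phi> x) (\<phi> y) \<subseteq> \<phi> ` U" using B xy closed_segment_subset by blast
  note seg = segment_curve(1)[OF C this]
  show ?thesis unfolding joined_def
    by (intro exI conjI, rule seg) (use xy chart_inv[OF C] in auto)
qed

text \<open>The points that can be reached from \<open>x\<close> form a clopen set, because
  coordinate balls are reached by segments. It ensures that the distances are infima of nonempty
  sets.\<close>

lemma ex_joined:
  assumes pc: "path_connected_space M" and xy: "x \<in> topspace M" "y \<in> topspace M"
  shows "\<exists>l. joined x y l"
proof -
  define R where "R = {y \<in> topspace M. \<exists>l. joined x y l}"
  have nb: "\<exists>W. openin M W \<and> z \<in> W \<and> (\<forall>z1\<in>W. \<exists>l. joined z z1 l)" if z: "z \<in> topspace M" for z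
  proof -
    obtain U \<phi> where C: "(U, \<phi>) \<in> \<A>" "z \<in> U" using chart_cover[OF z] .
    obtain r where r: "r > 0" "ball (\<phi> z) r \<subseteq> \<phi> ` U"
      using is_chartD(2)[OF C(1)] C(2) openE by blast
    let ?W = "{w \<in> U. \<phi> w \<in> ball (\<phi> z) r}"
    have "openin M ?W" by (rule chart_preimage_open[OF C(1)]) simp
    moreover have "z \<in> ?W" using C(2) r by simp
    moreover have "\<forall>z1\<in>?W. \<exists>l. joined z z1 l"
      using chart_nbhd_joined[OF C(1) convex_ball r(2)] C(2) r(1) by auto
    ultimately show ?thesis by blast
  qed
  have "openin M R"
  proof (subst openin_subopen, intro ballI)
    fix z assume z: "z \<in> R"
    then obtain W where W: "openin M W" "z \<in> W" "\<forall>z1\<in>W. \<exists>l. joined z z1 l" using nb unfolding R_def by blast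
    have "W \<subseteq> R" using W z joined_trans openin_subset[OF W(1)] unfolding R_def by blast
    then show "\<exists>T. openin M T \<and> z \<in> T \<and> T \<subseteq> R" using W by blast
  qed
  moreover have "openin M (topspace M - R)"
  proof (subst openin_subopen, intro ballI)
    fix z assume z: "z \<in> topspace M - R"
    then obtain W where W: "openin M W" "z \<in> W" "\<forall>z1\<in>W. \<exists>l. joined z z1 l" using nb by blast
    have "W \<subseteq> topspace M - R" using W z joined_trans joined_sym openin_subset[OF W(1)] unfolding R_def by blast
    then show "\<exists>T. openin M T \<and> z \<in> T \<and> T \<subseteq> topspace M - R" using W by blast
  qed
  then have "closedin M R" by (auto simp: closedin_def R_def)
  moreover have "connected_space M" using path_connected_imp_connected_space[OF pc] .
  ultimately have "R = {} \<or> R = topspace M" by (auto simp: connected_space_clopen_in)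
  moreover have "x \<in> R" using joined_refl xy by (auto simp: R_def)
  ultimately show ?thesis using xy by (auto simp: R_def)
qed

text \<open>The first parameter at which the curve is outside the open coordinate ball is
  considered. Up to and including it the curve lies in \<open>K\<close>, the copy of the closed
  coordinate ball, which is closed in \<open>M\<close> since it is compact and \<open>M\<close> is
  Hausdorff; hence the curve cannot leave the chart domain without first meeting the coordinate
  sphere.\<close>

lemma exit_or_stay:
  assumes C: "(U, \<phi>) \<in> \<A>" and \<gamma>: "PS a b \<gamma>" and a: "\<gamma> a \<in> U" and \<rho>: "\<rho> > 0" "cball (\<phi> (\<gamma> a)) \<rho> \<subseteq> \<phi> ` U"
  shows "(\<forall>t\<in>{a..b}. \<gamma> t \<in> U \<and> \<phi> (\<gamma> t) \<in> ball (\<phi> (\<gamma> a)) \<rho>) \<or>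
    (\<exists>\<tau>\<in>{a..b}. (\<forall>t\<in>{a..\<tau>}. \<gamma> t \<in> U \<and> \<phi> (\<gamma> t) \<in> cball (\<phi> (\<gamma> a)) \<rho>) \<and> norm (\<phi> (\<gamma> \<tau>) - \<phi> (\<gamma> a)) = \<rho>)"
proof -
  define W where "W = {x \<in> U. \<phi> x \<in> ball (\<phi> (\<gamma> a)) \<rho>}"
  define K where "K = inv_into U \<phi> ` cball (\<phi> (\<gamma> a)) \<rho>"
  have Wo: "openin M W" unfolding W_def by (rule chart_preimage_open[OF C]) simp
  have "compactin (top_of_set (\<phi> ` U)) (cball (\<phi> (\<gamma> a)) \<rho>)" using \<rho> by (simp add: compactin_subtopology)
  then have "compactin (subtopology M U) K" unfolding K_def using chart_inv_continuous[OF C] image_compactin by blast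
  then have "compactin M K" by (simp add: compactin_subtopology)
  then have Kc: "closedin M K" by (rule compactin_imp_closedin[OF Hausdorff])
  have KU: "x \<in> U \<and> \<phi> x \<in> cball (\<phi> (\<gamma> a)) \<rho>" if x: "x \<in> K" for x
  proof -
    obtain y where y: "x = inv_into U \<phi> y" "y \<in> cball (\<phi> (\<gamma> a)) \<rho>" using x unfolding K_def by blast
    then have "y \<in> \<phi> ` U" using \<rho>(2) by blast
    then show ?thesis using y inv_into_into[of y \<phi> U] f_inv_into_f[of y \<phi> U] by simp
  qed
  have WK: "W \<subseteq> K"
  proof
    fix x assume "x \<in> W"
    then have "x = inv_into U \<phi> (\<phi> x)" "\<phi> x \<in> cball (\<phi> (\<gamma> a)) \<rho>" using chart_inv[OF C] by (auto simp: W_def)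
    then show "x \<in> K" unfolding K_def by blast
  qed
  let ?G = "{t \<in> {a..b}. \<gamma> t \<notin> W}"
  note cont = PS_continuous[OF \<gamma>]
  show ?thesis
  proof (cases "?G = {}")
    case True
    then show ?thesis by (auto simp: W_def)
  next
    case False
    have "openin (top_of_set {a..b}) {t \<in> {a..b}. \<gamma> t \<in> W}"
      using openin_continuous_map_preimage[OF cont Wo] by simp
    then have "closedin (top_of_set {a..b}) ({a..b} - {t \<in> {a..b}. \<gamma> t \<in> W})" by (rule closedin_diff[rotated]) auto
    moreover have "{a..b} - {t \<in> {a..b}. \<gamma> t \<in> W} = ?G" by auto
    ultimately have "compact ?G" using closedin_compact[of "{a..b}" ?G] by simp
    then have "\<exists>\<tau>\<in>?G. \<forall>t\<in>?G. \<tau> \<le> t" using False by (intro compact_attains_inf)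
    then obtain \<tau> where \<tau>: "\<tau> \<in> {a..b}" "\<gamma> \<tau> \<notin> W" "\<And>t. t \<in> {a..b} \<Longrightarrow> \<gamma> t \<notin> W \<Longrightarrow> \<tau> \<le> t" by auto
    have before: "\<gamma> t \<in> W" if "a \<le> t" "t < \<tau>" for t using \<tau> that by (meson atLeastAtMost_iff leD le_less_trans less_imp_le order_trans)
    have "\<gamma> a \<in> W" using a \<rho> by (simp add: W_def)
    then have "a < \<tau>" using \<tau>(1,2) by (metis atLeastAtMost_iff less_eq_real_def)
    have "closedin (top_of_set {a..b}) {t \<in> {a..b}. \<gamma> t \<in> K}"
      using closedin_continuous_map_preimage[OF cont Kc] by simp
    then have "closed {t \<in> {a..b}. \<gamma> t \<in> K}" by (simp add: closedin_closed_eq)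
    moreover have "{a<..<\<tau>} \<subseteq> {t \<in> {a..b}. \<gamma> t \<in> K}" using before WK \<tau>(1) by force
    ultimately have "closure {a<..<\<tau>} \<subseteq> {t \<in> {a..b}. \<gamma> t \<in> K}" by (rule closure_minimal[rotated])
    then have all: "\<gamma> t \<in> K" if "t \<in> {a..\<tau>}" for t using that \<open>a < \<tau>\<close> by auto
    have "\<gamma> \<tau> \<in> K" using all \<open>a < \<tau>\<close> by simp
    then have "\<gamma> \<tau> \<in> U" "dist (\<phi> (\<gamma> a)) (\<phi> (\<gamma> \<tau>)) \<le> \<rho>" "\<not> dist (\<phi> (\<gamma> a)) (\<phi> (\<gamma> \<tau>)) < \<rho>"
      using KU[of "\<gamma> \<tau>"] \<tau>(2) by (auto simp: W_def)
    then have "norm (\<phi> (\<gamma> \<tau>) - \<phi> (\<gamma> a)) = \<rho>" by (simp add: dist_norm norm_minus_commute)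
    then show ?thesis using all KU \<tau>(1) by blast
  qed
qed


lemma len_ge_prefix:
  assumes "PS a b \<gamma>" "\<tau> \<in> {a..b}"
  shows "len a \<tau> \<gamma> \<le> len a b \<gamma>"
proof -
  have "PS \<tau> b \<gamma>" by (rule PS_restrict[OF assms(1)]) (use assms in auto)
  then show ?thesis using len_split[OF assms(1), of \<tau>] len_nonneg assms(2) by fastforce
qed

lemma len_ge_norm:
  assumes \<gamma>: "PS a b \<gamma>" and C: "(U, \<phi>) \<in> \<A>" "\<And>t. t \<in> {a..b} \<Longrightarrow> \<gamma> t \<in> U" and k: "k \<ge> 0"
    and low: "\<And>t w. t \<in> {a..b} \<Longrightarrow> k * norm w \<le> sqrt (g (U, \<phi>) (\<phi> (\<gamma> t)) w w)"
  shows "k * norm (\<phi> (\<gamma> b) - \<phi> (\<gamma> a)) \<le> len a b \<gamma>"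
proof -
  let ?e = "sgn (\<phi> (\<gamma> b) - \<phi> (\<gamma> a))"
  let ?l = "\<lambda>w. k * (w \<bullet> ?e)"
  have "?l (\<phi> (\<gamma> b)) - ?l (\<phi> (\<gamma> a)) \<le> len a b \<gamma>"
  proof (rule len_ge_linear[OF \<gamma> C])
    show "bounded_linear ?l"
      by (rule bounded_linear_const_mult[OF bounded_linear_inner_left])
    fix t w assume "t \<in> {a..b}"
    have "w \<bullet> ?e \<le> norm w * norm ?e" by (rule norm_cauchy_schwarz)
    also have "\<dots> \<le> norm w * 1" by (intro mult_left_mono) (auto simp: norm_sgn)
    finally have "?l w \<le> k * norm w" using k by (simp add: mult_left_mono)
    then show "?l w \<le> sqrt (g (U, \<phi>) (\<phi> (\<gamma> t)) w w)" using low[OF \<open>t \<in> _\<close>, of w] by linarith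
  qed
  moreover have "?l (\<phi> (\<gamma> b)) - ?l (\<phi> (\<gamma> a)) = k * norm (\<phi> (\<gamma> b) - \<phi> (\<gamma> a))"
  proof -
    let ?d = "\<phi> (\<gamma> b) - \<phi> (\<gamma> a)"
    have "?d \<bullet> sgn ?d = norm ?d"
      by (cases "?d = 0") (simp_all add: sgn_div_norm power2_norm_eq_inner[symmetric] power2_eq_square)
    then show ?thesis by (simp add: inner_diff_left flip: right_diff_distrib)
  qed
  ultimately show ?thesis by simp
qed

text \<open>Upper bounds come from coordinate segments. For lower bounds a curve either leaves a
  ball of radius proportional to the coordinate distance of its ends, and is then too long, or stays
  where the metric is close to its value at the starting point, and is then measured by a
  calibration.\<close>

lemma chart_distance_estimates:
  assumes C: "(U, \<phi>) \<in> \<A>" and p: "p \<in> U"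
  obtains r k B where "r > 0" "k > 0" "B \<ge> 0" "cball (\<phi> p) r \<subseteq> \<phi> ` U"
    "\<And>x y l. x \<in> U \<Longrightarrow> \<phi> x \<in> ball (\<phi> p) r \<Longrightarrow> y \<in> U \<Longrightarrow> \<phi> y \<in> ball (\<phi> p) r \<Longrightarrow> joined x y l \<Longrightarrow>
       k * norm (\<phi> x - \<phi> y) \<le> l \<and>
       sqrt (g (U, \<phi>) (\<phi> x) (\<phi> x - \<phi> y) (\<phi> x - \<phi> y)) - B * (norm (\<phi> x - \<phi> y))\<^sup>2 \<le> l"
    "\<And>x y. x \<in> U \<Longrightarrow> \<phi> x \<in> ball (\<phi> p) r \<Longrightarrow> y \<in> U \<Longrightarrow> \<phi> y \<in> ball (\<phi> p) r \<Longrightarrow>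
       \<exists>l. joined x y l \<and> l \<le> sqrt (g (U, \<phi>) (\<phi> x) (\<phi> x - \<phi> y) (\<phi> x - \<phi> y)) + B * (norm (\<phi> x - \<phi> y))\<^sup>2"
    "\<And>q l r'. 0 < r' \<Longrightarrow> r' \<le> r \<Longrightarrow> \<not> (q \<in> U \<and> \<phi> q \<in> ball (\<phi> p) r') \<Longrightarrow> joined p q l \<Longrightarrow> k * r' \<le> l"
proof -
  interpret local_metric "\<phi> ` U" "g (U, \<phi>)" by (rule chart_local_metric[OF C])
  let ?h = "g (U, \<phi>)"
  obtain R where R: "R > 0" "cball (\<phi> p) R \<subseteq> \<phi> ` U"
    using is_chartD(2)[OF C] p open_contains_cball by (metis image_eqI)
  let ?K = "cball (\<phi> p) R"
  have K: "compact ?K" "convex ?K" "?K \<subseteq> \<phi> ` U" "?K \<noteq> {}" using R by auto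
  obtain m where m: "m > 0" "\<And>x u. x \<in> ?K \<Longrightarrow> m * (norm u)\<^sup>2 \<le> ?h x u u"
    by (rule bounds[OF K]) (rule that)
  obtain N where N: "N \<ge> 0" "\<And>x v. x \<in> ?K \<Longrightarrow> nrm x v \<le> N * norm v"
    "\<And>x y v. x \<in> ?K \<Longrightarrow> y \<in> ?K \<Longrightarrow> \<bar>nrm x v - nrm y v\<bar> \<le> N * norm (x - y) * norm v"
    by (rule nrm_bounds[OF K]) (rule that)
  define k where "k = sqrt m"
  have k: "k > 0" using m by (simp add: k_def)
  have klow: "k * norm u \<le> nrm x u" if "x \<in> ?K" for x u
  proof -
    have "sqrt (m * (norm u)\<^sup>2) \<le> nrm x u" unfolding nrm_def using m(2)[OF that, of u] by simp
    then show ?thesis by (simp add: k_def real_sqrt_mult)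
  qed
  \<comment> \<open>With \<open>k * \<kappa> = N + k\<close>, a curve that leaves the ball of radius
    \<open>\<kappa> * \<delta>\<close> around its start has length at least
    \<open>(N + k) * \<delta>\<close>, which covers both lower bounds at once; \<delta> is the
    coordinate distance of its ends.\<close>
  define \<kappa> where "\<kappa> = N / k + 1"
  have \<kappa>: "\<kappa> \<ge> 1" "k * \<kappa> = N + k" using N(1) k by (auto simp: \<kappa>_def field_simps)
  \<comment> \<open>Two points of the ball of radius \<open>r\<close> have coordinate distance below
    \<open>2 * r\<close>, and the ball of radius \<kappa> times this distance around one of them
    still lies in the ball of radius \<open>R\<close>.\<close>
  define r where "r = R / (1 + 2 * \<kappa>)"
  have rR: "r * (1 + 2 * \<kappa>) = R" using \<kappa>(1) by (simp add: r_def)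
  have r: "r > 0" "r \<le> R" "r + \<kappa> * (2 * r) = R"
    using R(1) \<kappa>(1) rR by (auto simp: r_def field_simps)[2] (simp add: rR[symmetric] algebra_simps)
  \<comment> \<open>The first summand serves the lower estimate, the second the segment in the upper
    estimate.\<close>
  define B where "B = N * (N * \<kappa> / k) + N"
  have B: "B \<ge> 0" using N(1) k \<kappa>(1) by (simp add: B_def)
  have rK: "x \<in> ?K" if "x \<in> ball (\<phi> p) r" for x using that r(2) by auto
  have exit: "k * \<rho> \<le> len a b \<gamma>"
    if \<gamma>: "PS a b \<gamma>" and aU: "\<gamma> a \<in> U" and \<rho>: "cball (\<phi> (\<gamma> a)) \<rho> \<subseteq> ?K"
      and \<tau>: "\<tau> \<in> {a..b}" "\<forall>t\<in>{a..\<tau>}. \<gamma> t \<in> U \<and> \<phi> (\<gamma> t) \<in> cball (\<phi> (\<gamma> a)) \<rho>" "norm (\<phi> (\<gamma> \<tau>) - \<phi> (\<gamma> a)) = \<rho>"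
    for a b \<gamma> \<rho> \<tau>
  proof -
    have "PS a \<tau> \<gamma>" by (rule PS_restrict[OF \<gamma>]) (use \<tau>(1) in auto)
    then have "k * norm (\<phi> (\<gamma> \<tau>) - \<phi> (\<gamma> a)) \<le> len a \<tau> \<gamma>"
    proof (rule len_ge_norm[OF _ C])
      show "\<gamma> t \<in> U" if "t \<in> {a..\<tau>}" for t using \<tau>(2) that by blast
      show "k * norm w \<le> sqrt (?h (\<phi> (\<gamma> t)) w w)" if "t \<in> {a..\<tau>}" for t w
        using klow[of "\<phi> (\<gamma> t)" w] \<tau>(2) \<rho> that unfolding nrm_def by blast
    qed (use k in simp)
    then show ?thesis using len_ge_prefix[OF \<gamma> \<tau>(1)] unfolding \<tau>(3) by linarith
  qed
  have lower: "k * norm (\<phi> x - \<phi> y) \<le> l \<and> nrm (\<phi> x) (\<phi> x - \<phi> y) - B * (norm (\<phi> x - \<phi> y))\<^sup>2 \<le> l"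
    if x: "x \<in> U" "\<phi> x \<in> ball (\<phi> p) r" and y: "y \<in> U" "\<phi> y \<in> ball (\<phi> p) r" and j: "joined x y l" for x y l
  proof (cases "\<phi> x = \<phi> y")
    case True
    have "\<phi> x \<in> \<phi> ` U" using x by blast
    then have "nrm (\<phi> x) 0 = 0" by (simp add: nrm_def bilinear_lzero[OF bil])
    then show ?thesis using True joined_nonneg[OF j] by simp
  next
    case False
    obtain a b \<gamma> where \<gamma>: "PS a b \<gamma>" "\<gamma> a = x" "\<gamma> b = y" "len a b \<gamma> = l" using j unfolding joined_def by blast
    let ?D = "\<phi> y - \<phi> x"
    define \<delta> where "\<delta> = norm (\<phi> x - \<phi> y)"
    have \<delta>: "\<delta> > 0" "norm ?D = \<delta>" using False by (auto simp: \<delta>_def norm_minus_commute)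
    have "dist (\<phi> x) (\<phi> y) \<le> dist (\<phi> p) (\<phi> x) + dist (\<phi> p) (\<phi> y)" by (metis dist_commute dist_triangle)
    then have \<delta>r: "\<delta> < 2 * r" using x(2) y(2) by (simp add: \<delta>_def dist_norm)
    define \<rho> where "\<rho> = \<kappa> * \<delta>"
    have \<rho>: "\<rho> > 0" using \<kappa>(1) \<delta> by (simp add: \<rho>_def)
    have \<rho>r: "\<rho> \<le> \<kappa> * (2 * r)" unfolding \<rho>_def using \<delta>r \<kappa>(1) by (intro mult_left_mono) auto
    have cb: "cball (\<phi> x) \<rho> \<subseteq> ?K"
    proof
      fix z assume "z \<in> cball (\<phi> x) \<rho>"
      then have "dist (\<phi> x) z \<le> \<kappa> * (2 * r)" using \<rho>r by simp
      moreover have "dist (\<phi> p) z \<le> dist (\<phi> p) (\<phi> x) + dist (\<phi> x) z" by (rule dist_triangle)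
      ultimately show "z \<in> ?K" using x(2) r(3) by simp
    qed
    have xK: "\<phi> x \<in> ?K" using rK x(2) by blast
    have xS: "\<phi> x \<in> \<phi> ` U" using x(1) by blast
    have nn: "nrm (\<phi> x) (\<phi> x - \<phi> y) = nrm (\<phi> x) ?D" using nrm_minus[OF xS, of ?D] by simp
    have nD: "nrm (\<phi> x) ?D \<le> N * \<delta>" using N(2)[OF xK, of ?D] \<delta>(2) by simp
    have "cball (\<phi> (\<gamma> a)) \<rho> \<subseteq> \<phi> ` U" "\<gamma> a \<in> U" using cb K(3) \<gamma>(2) x(1) by auto
    from exit_or_stay[OF C \<gamma>(1) this(2) \<rho> this(1)] show ?thesis
    proof
      assume "\<exists>\<tau>\<in>{a..b}. (\<forall>t\<in>{a..\<tau>}. \<gamma> t \<in> U \<and> \<phi> (\<gamma> t) \<in> cball (\<phi> (\<gamma> a)) \<rho>) \<and> norm (\<phi> (\<gamma> \<tau>) - \<phi> (\<gamma> a)) = \<rho>"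
      then have "k * \<rho> \<le> l" using exit[OF \<gamma>(1), of \<rho>] \<gamma>(2,4) x(1) cb by blast
      moreover have "k * \<rho> = (N + k) * \<delta>" using \<kappa>(2) by (simp add: \<rho>_def flip: mult.assoc)
      moreover have "B * \<delta>\<^sup>2 \<ge> 0" "N * \<delta> \<ge> 0" "k * \<delta> \<ge> 0" using B N(1) k \<delta> by auto
      ultimately show ?thesis using nD unfolding nn \<delta>_def[symmetric] by (simp add: distrib_right)
    next
      assume stay: "\<forall>t\<in>{a..b}. \<gamma> t \<in> U \<and> \<phi> (\<gamma> t) \<in> ball (\<phi> (\<gamma> a)) \<rho>"
      have stU: "\<gamma> t \<in> U" and stK: "\<phi> (\<gamma> t) \<in> ?K" and st\<rho>: "norm (\<phi> x - \<phi> (\<gamma> t)) \<le> \<rho>" if "t \<in> {a..b}" for t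
      proof -
        have *: "\<gamma> t \<in> U" "\<phi> (\<gamma> t) \<in> cball (\<phi> x) \<rho>" using stay that \<gamma>(2) by (auto simp: less_imp_le)
        show "\<gamma> t \<in> U" "\<phi> (\<gamma> t) \<in> ?K" using * cb by blast+
        show "norm (\<phi> x - \<phi> (\<gamma> t)) \<le> \<rho>" using *(2) by (simp add: dist_norm)
      qed
      have 1: "k * norm (\<phi> (\<gamma> b) - \<phi> (\<gamma> a)) \<le> len a b \<gamma>"
        by (rule len_ge_norm[OF \<gamma>(1) C stU]) (use klow[OF stK] k in \<open>auto simp: nrm_def\<close>)
      \<comment> \<open>\<open>A\<close> bounds the ratio of the norm at \<open>\<phi> x\<close> to
        the norm at points of the curve, all within \<rho> of \<open>\<phi> x\<close>. The linear
        form dual to \<open>?D\<close>, normalized and divided by \<open>A\<close>, is therefore a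
        calibration along the whole curve.\<close>
      define A where "A = 1 + N * \<kappa> / k * \<delta>"
      have A: "A \<ge> 1" using N(1) k \<kappa>(1) \<delta> by (simp add: A_def)
      have pD: "nrm (\<phi> x) ?D > 0" using pos[OF xS, of ?D] False by (simp add: nrm_def)
      let ?l = "\<lambda>w. ?h (\<phi> x) w ?D / (nrm (\<phi> x) ?D * A)"
      have "?l (\<phi> (\<gamma> b)) - ?l (\<phi> (\<gamma> a)) \<le> len a b \<gamma>"
      proof (rule len_ge_linear[OF \<gamma>(1) C stU])
        have "linear (\<lambda>w. ?h (\<phi> x) w ?D)" using bil[OF xS] by (simp add: bilinear_def)
        then have "bounded_linear (\<lambda>w. ?h (\<phi> x) w ?D)" by (simp add: linear_conv_bounded_linear)
        then show "bounded_linear ?l" by (rule bounded_linear_compose[OF bounded_linear_divide])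
        fix t w assume t: "t \<in> {a..b}"
        let ?z = "\<phi> (\<gamma> t)"
        have "?h (\<phi> x) w ?D \<le> nrm (\<phi> x) w * nrm (\<phi> x) ?D" by (rule h_cauchy_schwarz[OF xS])
        then have i: "?l w \<le> nrm (\<phi> x) w / A" using pD A by (simp add: field_simps)
        have "nrm (\<phi> x) w \<le> nrm ?z w + N * norm (\<phi> x - ?z) * norm w" using N(3)[OF xK stK[OF t], of w] by linarith
        also have "N * norm (\<phi> x - ?z) * norm w \<le> N * \<rho> * norm w"
          using st\<rho>[OF t] N(1) by (intro mult_right_mono mult_left_mono) auto
        also have "N * \<rho> * norm w \<le> N * \<rho> * (nrm ?z w / k)"
          using klow[OF stK[OF t], of w] k N(1) \<rho> by (intro mult_left_mono) (auto simp: field_simps)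
        finally have "nrm (\<phi> x) w \<le> A * nrm ?z w" by (simp add: A_def \<rho>_def algebra_simps)
        then have "nrm (\<phi> x) w / A \<le> nrm ?z w" using A by (simp add: field_simps)
        then show "?l w \<le> sqrt (?h ?z w w)" using i by (simp add: nrm_def)
      qed
      moreover have "?l (\<phi> (\<gamma> b)) - ?l (\<phi> (\<gamma> a)) = nrm (\<phi> x) ?D / A"
      proof -
        have "?h (\<phi> x) (\<phi> y) ?D - ?h (\<phi> x) (\<phi> x) ?D = nrm (\<phi> x) ?D * nrm (\<phi> x) ?D"
          using nrm_sq[OF xS, of ?D] by (simp add: bilinear_lsub[OF bil[OF xS]] power2_eq_square)
        then show ?thesis using pD \<gamma>(2,3) by (simp flip: diff_divide_distrib)
      qed
      ultimately have ii: "nrm (\<phi> x) ?D / A \<le> l" using \<gamma>(4) by simp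
      have "nrm (\<phi> x) ?D - B * \<delta>\<^sup>2 \<le> nrm (\<phi> x) ?D / A"
      proof -
        \<comment> \<open>\<open>A - 1\<close> is of order \<delta> and the norm of
          \<open>?D\<close> is too, so dividing by \<open>A\<close> costs only a term of second
          order.\<close>
        have "1 - 1 / A \<le> A - 1"
        proof -
          have "(A - 1) * (A - 1) \<ge> 0" by simp
          then show ?thesis using A by (simp add: field_simps)
        qed
        then have "nrm (\<phi> x) ?D * (1 - 1 / A) \<le> (N * \<delta>) * (A - 1)"
          using nD pD A N(1) \<delta> by (intro mult_mono) auto
        also have "\<dots> = N * (N * \<kappa> / k) * \<delta>\<^sup>2" by (simp add: A_def power2_eq_square)
        also have "\<dots> \<le> B * \<delta>\<^sup>2" using N(1) by (intro mult_right_mono) (auto simp: B_def)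
        finally show ?thesis by (simp add: right_diff_distrib)
      qed
      then show ?thesis using ii 1 \<gamma>(2,3,4) \<delta>(2) unfolding nn \<delta>_def[symmetric] by simp
    qed
  qed
  have upper: "\<exists>l. joined x y l \<and> l \<le> nrm (\<phi> x) (\<phi> x - \<phi> y) + B * (norm (\<phi> x - \<phi> y))\<^sup>2"
    if x: "x \<in> U" "\<phi> x \<in> ball (\<phi> p) r" and y: "y \<in> U" "\<phi> y \<in> ball (\<phi> p) r" for x y
  proof -
    let ?D = "\<phi> y - \<phi> x" and ?c = "\<lambda>t::real. \<phi> x + t *\<^sub>R (\<phi> y - \<phi> x)"
    have seg: "closed_segment (\<phi> x) (\<phi> y) \<subseteq> ?K" using x(2) y(2) rK by (intro closed_segment_subset K(2)) auto
    then have segU: "closed_segment (\<phi> x) (\<phi> y) \<subseteq> \<phi> ` U" using K(3) by blast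
    note sc = segment_curve[OF C segU]
    have xS: "\<phi> x \<in> \<phi> ` U" using x(1) by blast
    have xK: "\<phi> x \<in> ?K" using rK x(2) by blast
    have cK: "?c t \<in> ?K" if "t \<in> {0..1}" for t
      using seg that by (force simp: closed_segment_def algebra_simps)
    have cS: "?c t \<in> \<phi> ` U" if "t \<in> {0..1}" for t using cK[OF that] K(3) by blast
    have "integral {0..1} (\<lambda>t. sqrt (?h (?c t) ?D ?D)) \<le> integral {0..1} (\<lambda>t::real. nrm (\<phi> x) ?D + N * (norm ?D)\<^sup>2)"
    proof (rule integral_le)
      have "continuous_on {0..1} (\<lambda>t. nrm (?c t) ?D)"
        by (rule continuous_on_nrm) (use cS in \<open>auto intro!: continuous_intros\<close>)
      then show "(\<lambda>t. sqrt (?h (?c t) ?D ?D)) integrable_on {0..1}"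
        unfolding nrm_def by (rule integrable_continuous_real)
      show "(\<lambda>t::real. nrm (\<phi> x) ?D + N * (norm ?D)\<^sup>2) integrable_on {0..1}" by (rule integrable_const_ivl)
      fix t :: real assume t: "t \<in> {0..1}"
      have "nrm (?c t) ?D \<le> nrm (\<phi> x) ?D + N * norm (?c t - \<phi> x) * norm ?D"
        using N(3)[OF cK[OF t] xK, of ?D] by linarith
      also have "N * norm (?c t - \<phi> x) * norm ?D \<le> N * norm ?D * norm ?D"
      proof (intro mult_right_mono mult_left_mono)
        show "norm (?c t - \<phi> x) \<le> norm ?D" using t by (simp add: mult_left_le_one_le)
      qed (use N(1) in auto)
      finally show "sqrt (?h (?c t) ?D ?D) \<le> nrm (\<phi> x) ?D + N * (norm ?D)\<^sup>2"
        by (simp add: nrm_def power2_eq_square mult.assoc)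
    qed
    also have "\<dots> = nrm (\<phi> x) ?D + N * (norm ?D)\<^sup>2" by simp
    also have "\<dots> \<le> nrm (\<phi> x) ?D + B * (norm ?D)\<^sup>2"
      using N(1) k \<kappa>(1) by (intro add_left_mono mult_right_mono) (auto simp: B_def)
    also have "\<dots> = nrm (\<phi> x) (\<phi> x - \<phi> y) + B * (norm (\<phi> x - \<phi> y))\<^sup>2"
      using nrm_minus[OF xS, of ?D] by (simp add: norm_minus_commute)
    finally have "integral {0..1} (\<lambda>t. sqrt (?h (?c t) ?D ?D)) \<le> nrm (\<phi> x) (\<phi> x - \<phi> y) + B * (norm (\<phi> x - \<phi> y))\<^sup>2" .
    moreover have "joined x y (integral {0..1} (\<lambda>t. sqrt (?h (?c t) ?D ?D)))"
      unfolding joined_def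
      by (intro exI conjI, rule sc(1), use chart_inv[OF C] x y in simp, use chart_inv[OF C] x y in simp, rule sc(2))
    ultimately show ?thesis by blast
  qed
  have far: "k * r' \<le> l"
    if r': "0 < r'" "r' \<le> r" and q: "\<not> (q \<in> U \<and> \<phi> q \<in> ball (\<phi> p) r')" and j: "joined p q l" for q l r'
  proof -
    obtain a b \<gamma> where \<gamma>: "PS a b \<gamma>" "\<gamma> a = p" "\<gamma> b = q" "len a b \<gamma> = l" using j unfolding joined_def by blast
    have cb: "cball (\<phi> (\<gamma> a)) r' \<subseteq> ?K" using r' r(2) \<gamma>(2) by auto
    then have "cball (\<phi> (\<gamma> a)) r' \<subseteq> \<phi> ` U" "\<gamma> a \<in> U" using K(3) \<gamma>(2) p by auto
    from exit_or_stay[OF C \<gamma>(1) this(2) r'(1) this(1)]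
    obtain \<tau> where "\<tau> \<in> {a..b}" "\<forall>t\<in>{a..\<tau>}. \<gamma> t \<in> U \<and> \<phi> (\<gamma> t) \<in> cball (\<phi> (\<gamma> a)) r'" "norm (\<phi> (\<gamma> \<tau>) - \<phi> (\<gamma> a)) = r'"
      using q \<gamma>(2,3) PS_le[OF \<gamma>(1)] by fastforce
    from exit[OF \<gamma>(1) \<open>\<gamma> a \<in> U\<close> cb this] show ?thesis using \<gamma>(4) by simp
  qed
  show thesis
    by (rule that[OF r(1) k B _ lower[unfolded nrm_def] upper[unfolded nrm_def] far])
       (use r(2) R(2) in auto)
qed

end

section \<open>The Riemannian distance\<close>

locale compact_riemannian = riemannian M \<A> g
  for M :: "'a topology" and \<A> :: "('a, 'e::euclidean_space) chart set" and g +
  assumes cpt: "compact_space M" and pc: "path_connected_space M"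
begin

text \<open>The value 0 off the manifold makes nonnegativity and symmetry hold for all pairs of
  points, as \<open>Metric_space\<close> demands.\<close>

definition rd :: "'a \<Rightarrow> 'a \<Rightarrow> real" where
  "rd x y = (if x \<in> topspace M \<and> y \<in> topspace M then Inf {l. joined x y l} else 0)"

lemma joined_bdd: "bdd_below {l. joined x y l}"
  by (rule bdd_belowI[of _ 0]) (simp add: joined_nonneg)

lemma rd_le: "joined x y l \<Longrightarrow> rd x y \<le> l"
  using joined_in_topspace[of x y l] cInf_lower[OF _ joined_bdd, of l x y] by (simp add: rd_def)

lemma rd_greatest:
  assumes "x \<in> topspace M" "y \<in> topspace M" "\<And>l. joined x y l \<Longrightarrow> c \<le> l"
  shows "c \<le> rd x y"
  using cInf_greatest[of "{l. joined x y l}" c] assms ex_joined[OF pc assms(1,2)] by (auto simp: rd_def)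

lemma rd_approx:
  assumes "x \<in> topspace M" "y \<in> topspace M" "e > 0"
  obtains l where "joined x y l" "l < rd x y + e"
proof -
  have "\<not> (\<forall>l. joined x y l \<longrightarrow> rd x y + e \<le> l)" using rd_greatest[OF assms(1,2), of "rd x y + e"] assms(3) by auto
  then show thesis using that by auto
qed

lemma rd_nonneg: "0 \<le> rd x y"
  using rd_greatest[of x y 0] joined_nonneg by (cases "x \<in> topspace M \<and> y \<in> topspace M") (auto simp: rd_def)

lemma rd_commute: "rd x y = rd y x"
proof -
  have "{l. joined x y l} = {l. joined y x l}" using joined_sym by blast
  then show ?thesis by (auto simp: rd_def)
qed

lemma rd_self: "rd x x = 0"
  using rd_le[OF joined_refl, of x] rd_nonneg[of x x] by (cases "x \<in> topspace M") (auto simp: rd_def)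

lemma rd_triangle:
  assumes "x \<in> topspace M" "y \<in> topspace M" "z \<in> topspace M"
  shows "rd x z \<le> rd x y + rd y z"
proof (rule field_le_epsilon)
  fix e :: real assume e: "e > 0"
  then have e2: "e / 2 > 0" by simp
  obtain l l' where l: "joined x y l" "l < rd x y + e / 2" "joined y z l'" "l' < rd y z + e / 2"
    by (rule rd_approx[OF assms(1,2) e2], rule rd_approx[OF assms(2,3) e2]) (rule that)
  have "rd x z \<le> l + l'" by (rule rd_le[OF joined_trans[OF l(1,3)]])
  then show "rd x z \<le> rd x y + rd y z + e" using l by simp
qed

text \<open>The interface between the manifold and the local analysis. The last clause localizes: a
  point outside the coordinate ball of radius \<open>r'\<close> has distance at least
  \<open>c * r'\<close>, so nearby points in the metric can be read in the chart.\<close>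

lemma chart_metric_dist:
  assumes C: "(U, \<phi>) \<in> \<A>" and p: "p \<in> U"
  obtains r B c where "r > 0" "c > 0"
    "local_metric_dist (\<phi> ` U) (g (U, \<phi>)) (\<phi> p) r B c (\<lambda>x y. rd (inv_into U \<phi> x) (inv_into U \<phi> y))"
    "\<And>q r'. 0 < r' \<Longrightarrow> r' \<le> r \<Longrightarrow> q \<in> topspace M \<Longrightarrow> \<not> (q \<in> U \<and> \<phi> q \<in> ball (\<phi> p) r') \<Longrightarrow> c * r' \<le> rd p q"
proof (rule chart_distance_estimates[OF assms])
  fix r k B :: real
  assume r: "r > 0" "k > 0" "B \<ge> 0" "cball (\<phi> p) r \<subseteq> \<phi> ` U"
    and low: "\<And>x y l. x \<in> U \<Longrightarrow> \<phi> x \<in> ball (\<phi> p) r \<Longrightarrow> y \<in> U \<Longrightarrow> \<phi> y \<in> ball (\<phi> p) r \<Longrightarrow> joined x y l \<Longrightarrow>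
       k * norm (\<phi> x - \<phi> y) \<le> l \<and>
       sqrt (g (U, \<phi>) (\<phi> x) (\<phi> x - \<phi> y) (\<phi> x - \<phi> y)) - B * (norm (\<phi> x - \<phi> y))\<^sup>2 \<le> l"
    and up: "\<And>x y. x \<in> U \<Longrightarrow> \<phi> x \<in> ball (\<phi> p) r \<Longrightarrow> y \<in> U \<Longrightarrow> \<phi> y \<in> ball (\<phi> p) r \<Longrightarrow>
       \<exists>l. joined x y l \<and> l \<le> sqrt (g (U, \<phi>) (\<phi> x) (\<phi> x - \<phi> y) (\<phi> x - \<phi> y)) + B * (norm (\<phi> x - \<phi> y))\<^sup>2"
    and far: "\<And>q l r'. 0 < r' \<Longrightarrow> r' \<le> r \<Longrightarrow> \<not> (q \<in> U \<and> \<phi> q \<in> ball (\<phi> p) r') \<Longrightarrow> joined p q l \<Longrightarrow> k * r' \<le> l"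
  interpret local_metric "\<phi> ` U" "g (U, \<phi>)" by (rule chart_local_metric[OF C])
  note UM = chart_subset[OF C]
  let ?i = "inv_into U \<phi>"
  have inv: "?i x \<in> U" "\<phi> (?i x) = x" "?i x \<in> topspace M" if "x \<in> ball (\<phi> p) r" for x
  proof -
    have "x \<in> \<phi> ` U" using that r(4) by auto
    then show "?i x \<in> U" "\<phi> (?i x) = x" by (simp_all add: inv_into_into f_inv_into_f)
    then show "?i x \<in> topspace M" using UM by blast
  qed
  have "local_metric_dist (\<phi> ` U) (g (U, \<phi>)) (\<phi> p) r B k (\<lambda>x y. rd (?i x) (?i y))"
  proof
    show "r > 0" "cball (\<phi> p) r \<subseteq> \<phi> ` U" "B \<ge> 0" "k > 0" by fact+
    fix x y assume x: "x \<in> ball (\<phi> p) r" and y: "y \<in> ball (\<phi> p) r"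
    note xy = inv(1)[OF x] _ inv(1)[OF y] _
    have xb: "\<phi> (?i x) \<in> ball (\<phi> p) r" "\<phi> (?i y) \<in> ball (\<phi> p) r" unfolding inv(2)[OF x] inv(2)[OF y] by fact+
    show "rd (?i x) (?i z) \<le> rd (?i x) (?i y) + rd (?i y) (?i z)" if z: "z \<in> ball (\<phi> p) r" for z
      by (rule rd_triangle[OF inv(3)[OF x] inv(3)[OF y] inv(3)[OF z]])
    have l: "k * norm (x - y) \<le> l \<and> nrm x (x - y) - B * (norm (x - y))\<^sup>2 \<le> l" if "joined (?i x) (?i y) l" for l
      using low[OF inv(1)[OF x] xb(1) inv(1)[OF y] xb(2) that] unfolding inv(2)[OF x] inv(2)[OF y] nrm_def .
    show "k * norm (x - y) \<le> rd (?i x) (?i y)"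
      by (rule rd_greatest[OF inv(3)[OF x] inv(3)[OF y]]) (use l in blast)
    have 1: "nrm x (x - y) - B * (norm (x - y))\<^sup>2 \<le> rd (?i x) (?i y)"
      by (rule rd_greatest[OF inv(3)[OF x] inv(3)[OF y]]) (use l in blast)
    obtain l where "joined (?i x) (?i y) l" "l \<le> nrm x (x - y) + B * (norm (x - y))\<^sup>2"
      using up[OF inv(1)[OF x] xb(1) inv(1)[OF y] xb(2)] unfolding inv(2)[OF x] inv(2)[OF y] nrm_def by blast
    then have "rd (?i x) (?i y) \<le> nrm x (x - y) + B * (norm (x - y))\<^sup>2" using rd_le by fastforce
    then show "\<bar>rd (?i x) (?i y) - nrm x (x - y)\<bar> \<le> B * (norm (x - y))\<^sup>2" using 1 by linarith
  qed
  moreover have "k * r' \<le> rd p q" if "0 < r'" "r' \<le> r" "q \<in> topspace M" "\<not> (q \<in> U \<and> \<phi> q \<in> ball (\<phi> p) r')" for q r'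
    by (rule rd_greatest[OF subsetD[OF UM p] that(3)]) (rule far[OF that(1,2,4)])
  ultimately show thesis using that r(1,2) by blast
qed

lemma rd_zero:
  assumes xy: "x \<in> topspace M" "y \<in> topspace M" and z: "rd x y = 0"
  shows "x = y"
proof -
  obtain U \<phi> where CH: "(U, \<phi>) \<in> \<A>" "x \<in> U" using chart_cover[OF xy(1)] .
  show ?thesis
  proof (rule chart_metric_dist[OF CH])
    fix r B c assume rp: "r > 0" "c > 0"
      and L: "local_metric_dist (\<phi> ` U) (g (U, \<phi>)) (\<phi> x) r B c (\<lambda>x y. rd (inv_into U \<phi> x) (inv_into U \<phi> y))"
      and far: "\<And>q r'. 0 < r' \<Longrightarrow> r' \<le> r \<Longrightarrow> q \<in> topspace M \<Longrightarrow> \<not> (q \<in> U \<and> \<phi> q \<in> ball (\<phi> x) r') \<Longrightarrow> c * r' \<le> rd x q"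
    interpret local_metric_dist "\<phi> ` U" "g (U, \<phi>)" "\<phi> x" r B c "\<lambda>x y. rd (inv_into U \<phi> x) (inv_into U \<phi> y)" by (rule L)
    have "c * r > 0" using rp by simp
    then have y: "y \<in> U" "\<phi> y \<in> ball (\<phi> x) r" using far[OF rp(1) order_refl xy(2)] z by auto
    have "c * norm (\<phi> x - \<phi> y) \<le> 0"
      using low[of "\<phi> x" "\<phi> y"] y z rp(1) chart_inv[OF CH(1)] CH(2) by simp
    then have "\<phi> x = \<phi> y" using rp(2) by (simp add: mult_le_0_iff)
    then show ?thesis using chart_inj[OF CH(1)] CH(2) y(1) by (auto dest: inj_onD)
  qed
qed

sublocale Metric_space "topspace M" rd
  by unfold_locales (use rd_nonneg rd_commute rd_zero rd_self rd_triangle in auto)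

text \<open>Small metric balls lie in coordinate balls by the last clause of
  \<open>chart_metric_dist\<close>; conversely \<open>LM\<close> bounds \<open>rd\<close> by a
  continuous function of the coordinates that vanishes at the centre.\<close>

lemma mtopology_eq: "mtopology = M"
proof (rule topology_eq[THEN iffD2], intro allI iffI)
  fix W assume W: "openin M W"
  show "openin mtopology W" unfolding openin_mtopology
  proof (intro conjI allI impI)
    show "W \<subseteq> topspace M" using openin_subset[OF W] .
    fix x assume x: "x \<in> W"
    then have xM: "x \<in> topspace M" using openin_subset[OF W] by blast
    obtain U \<phi> where C: "(U, \<phi>) \<in> \<A>" "x \<in> U" using chart_cover[OF xM] .
    show "\<exists>r>0. mball x r \<subseteq> W"
    proof (rule chart_metric_dist[OF C])
      fix r B c :: real assume r: "r > 0" "c > 0"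
        and far: "\<And>q r'. 0 < r' \<Longrightarrow> r' \<le> r \<Longrightarrow> q \<in> topspace M \<Longrightarrow> \<not> (q \<in> U \<and> \<phi> q \<in> ball (\<phi> x) r') \<Longrightarrow> c * r' \<le> rd x q"
      have "\<phi> x \<in> \<phi> ` (U \<inter> W)" using C(2) x by blast
      then obtain r1 where r1: "r1 > 0" "ball (\<phi> x) r1 \<subseteq> \<phi> ` (U \<inter> W)"
        using chart_image_open[OF C(1) W] openE by blast
      define r' where "r' = min r r1"
      have r': "0 < r'" "r' \<le> r" "r' \<le> r1" using r r1 by (auto simp: r'_def)
      have "mball x (c * r') \<subseteq> W"
      proof
        fix q assume "q \<in> mball x (c * r')"
        then have q: "q \<in> topspace M" "rd x q < c * r'" by (auto simp: mball_def)
        then have qU: "q \<in> U" "\<phi> q \<in> ball (\<phi> x) r'" using far[OF r'(1,2) q(1)] by auto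
        then have "\<phi> q \<in> \<phi> ` (U \<inter> W)" using r1(2) r'(3) by auto
        then obtain w where "w \<in> U" "w \<in> W" "\<phi> q = \<phi> w" by auto
        then show "q \<in> W" using chart_inj[OF C(1)] qU(1) by (metis inj_onD)
      qed
      then show ?thesis using r' r by (intro exI[of _ "c * r'"]) auto
    qed
  qed
next
  fix W assume W: "openin mtopology W"
  then have WM: "W \<subseteq> topspace M" and Wb: "\<And>x. x \<in> W \<Longrightarrow> \<exists>r>0. mball x r \<subseteq> W" by (auto simp: openin_mtopology)
  show "openin M W"
  proof (subst openin_subopen, intro ballI)
    fix x assume x: "x \<in> W"
    then have xM: "x \<in> topspace M" using WM by blast
    obtain e where e: "e > 0" "mball x e \<subseteq> W" using Wb[OF x] by blast
    obtain U \<phi> where CH: "(U, \<phi>) \<in> \<A>" "x \<in> U" using chart_cover[OF xM] .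
    show "\<exists>T. openin M T \<and> x \<in> T \<and> T \<subseteq> W"
    proof (rule chart_metric_dist[OF CH])
      fix r B c :: real assume rp: "r > 0" "c > 0"
        and L: "local_metric_dist (\<phi> ` U) (g (U, \<phi>)) (\<phi> x) r B c (\<lambda>x y. rd (inv_into U \<phi> x) (inv_into U \<phi> y))"
      interpret local_metric_dist "\<phi> ` U" "g (U, \<phi>)" "\<phi> x" r B c "\<lambda>x y. rd (inv_into U \<phi> x) (inv_into U \<phi> y)" by (rule L)
      have xS: "\<phi> x \<in> \<phi> ` U" using CH(2) by blast
      define f where "f = (\<lambda>z. nrm (\<phi> x) (\<phi> x - z) + B * (norm (\<phi> x - z))\<^sup>2)"
      have "continuous_on UNIV f" unfolding f_def
        by (intro continuous_intros continuous_on_nrm xS)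
      then have "open (f -` {..<e} \<inter> ball (\<phi> x) r)"
        by (intro open_Int open_ball open_vimage open_lessThan)
      then have o: "openin M {u \<in> U. \<phi> u \<in> f -` {..<e} \<inter> ball (\<phi> x) r}" by (rule chart_preimage_open[OF CH(1)])
      have "f (\<phi> x) = 0" by (simp add: f_def nrm_def bilinear_lzero[OF bil[OF xS]])
      then have "x \<in> {u \<in> U. \<phi> u \<in> f -` {..<e} \<inter> ball (\<phi> x) r}" using CH(2) e(1) rp(1) by simp
      moreover have "{u \<in> U. \<phi> u \<in> f -` {..<e} \<inter> ball (\<phi> x) r} \<subseteq> W"
      proof
        fix u assume "u \<in> {u \<in> U. \<phi> u \<in> f -` {..<e} \<inter> ball (\<phi> x) r}"
        then have u: "u \<in> U" "f (\<phi> u) < e" "\<phi> u \<in> ball (\<phi> x) r" by auto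
        have "rd x u \<le> f (\<phi> u)"
          using LM[of "\<phi> x" "\<phi> u"] u(3) rp(1) chart_inv[OF CH(1)] CH(2) u(1) by (simp add: f_def)
        then have "u \<in> mball x e" using u xM chart_subset[OF CH(1)] by (auto simp: mball_def)
        then show "u \<in> W" using e(2) by blast
      qed
      ultimately show ?thesis using o by blast
    qed
  qed
qed

lemma continuous_map_rd:
  assumes f: "continuous_map X M f" and h: "continuous_map X M h"
  shows "continuous_map X euclideanreal (\<lambda>x. rd (f x) (h x))"
proof -
  have "continuous_map X mtopology f" "continuous_map X mtopology h" unfolding mtopology_eq by (rule f, rule h)
  note c = this[unfolded continuous_map_to_metric]
  have "continuous_map X Met_TC.mtopology (\<lambda>x. rd (f x) (h x))"
    unfolding Met_TC.continuous_map_to_metric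
  proof (intro ballI allI impI)
    fix x and e :: real assume x: "x \<in> topspace X" and e: "0 < e"
    then have e2: "0 < e / 2" by simp
    obtain U where U: "openin X U" "x \<in> U" "\<And>y. y \<in> U \<Longrightarrow> f y \<in> mball (f x) (e / 2)"
      using c(1)[rule_format, OF x e2] by (elim exE conjE) (rule that, auto)
    obtain V where V: "openin X V" "x \<in> V" "\<And>y. y \<in> V \<Longrightarrow> h y \<in> mball (h x) (e / 2)"
      using c(2)[rule_format, OF x e2] by (elim exE conjE) (rule that, auto)
    have "rd (f y) (h y) \<in> Met_TC.mball (rd (f x) (h x)) e" if y: "y \<in> U \<inter> V" for y
    proof -
      have fy: "f x \<in> topspace M" "f y \<in> topspace M" "rd (f x) (f y) < e / 2"
        and hy: "h x \<in> topspace M" "h y \<in> topspace M" "rd (h x) (h y) < e / 2"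
        using U(3)[of y] V(3)[of y] y by auto
      have "rd (f x) (h x) \<le> rd (f x) (f y) + (rd (f y) (h y) + rd (h y) (h x))"
        using rd_triangle[OF fy(1,2) hy(1)] rd_triangle[OF fy(2) hy(2,1)] by linarith
      moreover have "rd (f y) (h y) \<le> rd (f y) (f x) + (rd (f x) (h x) + rd (h x) (h y))"
        using rd_triangle[OF fy(2,1) hy(2)] rd_triangle[OF fy(1) hy(1,2)] by linarith
      ultimately have "\<bar>rd (f x) (h x) - rd (f y) (h y)\<bar> < e"
        using fy(3) hy(3) rd_commute[of "f x" "f y"] rd_commute[of "h x" "h y"] by linarith
      then show ?thesis by (simp add: dist_real_def)
    qed
    then show "\<exists>U. openin X U \<and> x \<in> U \<and> (\<forall>y\<in>U. rd (f y) (h y) \<in> Met_TC.mball (rd (f x) (h x)) e)"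
      using U V by (intro exI[of _ "U \<inter> V"]) auto
  qed
  then show ?thesis by simp
qed

lemma compact_attains:
  fixes f :: "'a \<Rightarrow> real"
  assumes Z: "closedin M Z" "Z \<noteq> {}" and f: "continuous_map M euclideanreal f"
  obtains z where "z \<in> Z" "\<And>w. w \<in> Z \<Longrightarrow> f z \<le> f w"
proof -
  have "compactin M Z" using closedin_compact_space[OF cpt Z(1)] .
  then have "compact (f ` Z)" using image_compactin[OF _ f] by simp
  then have "\<exists>y\<in>f ` Z. \<forall>w\<in>f ` Z. y \<le> w" using Z(2) by (intro compact_attains_inf) auto
  then show thesis using that by blast
qed

text \<open>On an almost shortest curve the intermediate value theorem finds a point at distance
  \<open>s\<close> from \<open>x\<close> that almost satisfies the claim. Compactness of the sphere
  of radius \<open>s\<close> then provides an exact minimizer of the distance to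
  \<open>y\<close>.\<close>

lemma ex_between:
  assumes xy: "x \<in> topspace M" "y \<in> topspace M" and s: "0 \<le> s" "s \<le> rd x y"
  obtains z where "z \<in> topspace M" "rd x z = s" "rd z y = rd x y - s"
proof -
  let ?Z = "{z \<in> topspace M. rd x z \<in> {s}}"
  have approx: "\<exists>z\<in>?Z. rd z y \<le> rd x y - s + e" if "e > 0" for e
  proof (rule rd_approx[OF xy that])
    fix l assume l: "joined x y l" "l < rd x y + e"
    obtain a b \<gamma> where \<gamma>: "PS a b \<gamma>" "\<gamma> a = x" "\<gamma> b = y" "len a b \<gamma> = l" using l(1) unfolding joined_def by blast
    have "continuous_map (top_of_set {a..b}) euclideanreal (\<lambda>t. rd x (\<gamma> t))"
      by (rule continuous_map_rd) (use xy PS_continuous[OF \<gamma>(1)] in auto)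
    then have "continuous_on {a..b} (\<lambda>t. rd x (\<gamma> t))" by simp
    then have "\<exists>t\<ge>a. t \<le> b \<and> rd x (\<gamma> t) = s"
      by (intro IVT') (use s \<gamma> PS_le[OF \<gamma>(1)] rd_self in auto)
    then obtain t where t: "a \<le> t" "t \<le> b" "rd x (\<gamma> t) = s" by blast
    have "joined x (\<gamma> t) (len a t \<gamma>)" "joined (\<gamma> t) y (len t b \<gamma>)"
      unfolding joined_def using PS_restrict[OF \<gamma>(1)] t \<gamma>(2,3) by blast+
    then have "s \<le> len a t \<gamma>" "rd (\<gamma> t) y \<le> len t b \<gamma>" using rd_le t(3) by fastforce+
    then have "rd (\<gamma> t) y \<le> rd x y - s + e" using len_split[OF \<gamma>(1) t(1,2)] \<gamma>(4) l(2) by linarith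
    moreover have "\<gamma> t \<in> ?Z" using PS_in_topspace[OF \<gamma>(1)] t by simp
    ultimately show ?thesis by blast
  qed
  have cx: "continuous_map M euclideanreal (rd x)" and cy: "continuous_map M euclideanreal (\<lambda>z. rd z y)"
    by (rule continuous_map_rd; use xy in simp)+
  have cl: "closedin M ?Z" by (rule closedin_continuous_map_preimage[OF cx]) simp
  have ne: "?Z \<noteq> {}" using approx[of 1] by auto
  obtain z where z: "z \<in> ?Z" "\<And>w. w \<in> ?Z \<Longrightarrow> rd z y \<le> rd w y"
    by (rule compact_attains[OF cl ne cy]) (rule that)
  have "rd z y \<le> rd x y - s"
  proof (rule field_le_epsilon)
    fix e :: real assume "e > 0"
    then obtain w where "w \<in> ?Z" "rd w y \<le> rd x y - s + e" using approx by blast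
    then show "rd z y \<le> rd x y - s + e" using z(2) by force
  qed
  moreover have "rd x y \<le> rd x z + rd z y" by (rule rd_triangle) (use xy z(1) in auto)
  ultimately show thesis using that[of z] z(1) by auto
qed

text \<open>Minimal paths parametrized by arc length, with no regularity built in. The parameter set
  is arbitrary because the construction starts from finite sets of parameters.\<close>

definition isopath :: "real set \<Rightarrow> (real \<Rightarrow> 'a) \<Rightarrow> bool" where
  "isopath J f \<longleftrightarrow> (\<forall>s\<in>J. f s \<in> topspace M) \<and> (\<forall>s\<in>J. \<forall>t\<in>J. rd (f s) (f t) = \<bar>s - t\<bar>)"

text \<open>A new parameter \<open>t\<close> is placed between its neighbours \<open>s1\<close> and
  \<open>s2\<close> by \<open>ex_between\<close>. The distances to the remaining points follow from
  the triangle inequality through the two neighbours, which bounds them from both sides.\<close>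

lemma ex_finite_isopath:
  assumes xy: "x \<in> topspace M" "y \<in> topspace M" and S: "finite S" "S \<subseteq> {0..rd x y}"
  shows "\<exists>f. f 0 = x \<and> f (rd x y) = y \<and> isopath (insert 0 (insert (rd x y) S)) f"
  using S
proof (induction S rule: finite_induct)
  case empty
  \<comment> \<open>If \<open>rd x y = 0\<close> then \<open>x = y\<close>, so the two prescribed
    values do not conflict.\<close>
  define f where "f = (\<lambda>t::real. if t = 0 then x else y)"
  have "f (rd x y) = y" using rd_zero[OF xy] by (simp add: f_def)
  then show ?case using xy rd_self rd_commute rd_nonneg[of x y]
    by (intro exI[of _ f]) (auto simp: isopath_def f_def)
next
  case (insert t S)
  let ?T = "rd x y" and ?S = "insert 0 (insert (rd x y) S)"
  obtain f where f: "f 0 = x" "f ?T = y" "isopath ?S f" using insert by auto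
  have sub: "?S \<subseteq> {0..?T}" using insert.prems rd_nonneg[of x y] by auto
  have t: "0 \<le> t" "t \<le> ?T" using insert.prems by auto
  have fin: "finite ?S" using insert.hyps by simp
  show ?case
  proof (cases "t \<in> ?S")
    case True
    then have "insert 0 (insert ?T (insert t S)) = ?S" by auto
    then show ?thesis using f by auto
  next
    case False
    have 1: "finite (?S \<inter> {..<t})" "?S \<inter> {..<t} \<noteq> {}" "finite (?S \<inter> {t<..})" "?S \<inter> {t<..} \<noteq> {}"
      using fin t False by (auto simp: less_le)
    define s1 s2 where "s1 = Max (?S \<inter> {..<t})" and "s2 = Min (?S \<inter> {t<..})"
    have s1: "s1 \<in> ?S" "s1 < t" using Max_in[OF 1(1,2)] by (auto simp: s1_def)
    have s2: "s2 \<in> ?S" "t < s2" using Min_in[OF 1(3,4)] by (auto simp: s2_def)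
    have gap: "u \<le> s1 \<or> s2 \<le> u" if "u \<in> ?S" for u
    proof -
      have "u < t \<or> t < u" using that False by (metis linorder_neqE)
      then show ?thesis using that Max_ge[OF 1(1), of u] Min_le[OF 1(3), of u] by (auto simp: s1_def s2_def)
    qed
    have fM: "f u \<in> topspace M" if "u \<in> ?S" for u using f(3) that unfolding isopath_def by blast
    have fd: "rd (f u) (f v) = \<bar>u - v\<bar>" if "u \<in> ?S" "v \<in> ?S" for u v using f(3) that unfolding isopath_def by blast
    obtain z where z: "z \<in> topspace M" "rd (f s1) z = t - s1" "rd z (f s2) = rd (f s1) (f s2) - (t - s1)"
      by (rule ex_between[OF fM[OF s1(1)] fM[OF s2(1)], of "t - s1"]) (use fd[OF s1(1) s2(1)] s1 s2 in auto)
    have z2: "rd z (f s2) = s2 - t" using z(3) fd[OF s1(1) s2(1)] s1 s2 by simp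
    have zu: "rd z (f u) = \<bar>t - u\<bar>" if u: "u \<in> ?S" for u
    proof -
      have i: "rd z (f u) \<le> rd z (f s1) + rd (f s1) (f u)" "rd z (f u) \<le> rd z (f s2) + rd (f s2) (f u)"
        "rd (f s1) (f u) \<le> rd (f s1) z + rd z (f u)" "rd (f s2) (f u) \<le> rd (f s2) z + rd z (f u)"
        by (intro rd_triangle z(1) fM s1(1) s2(1) u)+
      have c: "rd z (f s1) = t - s1" "rd (f s2) z = s2 - t" using z(2) z2 rd_commute by metis+
      from gap[OF u] show ?thesis
      proof
        assume "u \<le> s1"
        then have "rd (f s1) (f u) = s1 - u" "rd (f s2) (f u) = s2 - u" using fd[OF s1(1) u] fd[OF s2(1) u] s1(2) s2(2) by auto
        then show ?thesis using i(1,4) c s1(2) \<open>u \<le> s1\<close> by linarith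
      next
        assume "s2 \<le> u"
        then have "rd (f s1) (f u) = u - s1" "rd (f s2) (f u) = u - s2" using fd[OF s1(1) u] fd[OF s2(1) u] s1(2) s2(2) by auto
        then show ?thesis using i(2,3) z2 z(2) s2(2) \<open>s2 \<le> u\<close> by linarith
      qed
    qed
    define h where "h = f(t := z)"
    have "isopath (insert 0 (insert ?T (insert t S))) h"
      unfolding isopath_def
    proof (intro conjI ballI)
      fix u v assume u: "u \<in> insert 0 (insert ?T (insert t S))" and v: "v \<in> insert 0 (insert ?T (insert t S))"
      have u': "u = t \<or> u \<in> ?S" "u \<in> ?S \<Longrightarrow> u \<noteq> t" and v': "v = t \<or> v \<in> ?S" "v \<in> ?S \<Longrightarrow> v \<noteq> t"
        using u v False by auto
      show "h u \<in> topspace M" using u' fM z(1) by (auto simp: h_def)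
      show "rd (h u) (h v) = \<bar>u - v\<bar>"
        using u' v' fd zu rd_self rd_commute by (auto simp: h_def abs_minus_commute)
    qed
    moreover have "h 0 = x" "h ?T = y" using f False by (auto simp: h_def)
    ultimately show ?thesis by blast
  qed
qed

text \<open>Compactness of the product \<open>M\<^bsup>[0,T]\<^esup>\<close> replaces the Arzela--Ascoli theorem.\<close>

lemma ex_isopath:
  assumes xy: "x \<in> topspace M" "y \<in> topspace M"
  obtains f where "f 0 = x" "f (rd x y) = y" "isopath {0..rd x y} f"
proof -
  let ?T = "rd x y"
  define X where "X = product_topology (\<lambda>_. M) {0..?T}"
  have T0: "0 \<le> ?T" by (rule rd_nonneg)
  have X: "compact_space X" unfolding X_def using cpt by (simp add: compact_space_product_topology)
  \<comment> \<open>The pair \<open>(0, 0)\<close> keeps the index set of the intersection nonempty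
    for \<open>S = {}\<close>, as \<open>closedin_INT\<close> requires; its condition always
    holds.\<close>
  define Z where "Z = (\<lambda>S. {f \<in> topspace X. f 0 \<in> {x}} \<inter> {f \<in> topspace X. f ?T \<in> {y}} \<inter>
     (\<Inter>q\<in>insert (0, 0) (S \<times> S). {f \<in> topspace X. rd (f (fst q)) (f (snd q)) \<in> {\<bar>fst q - snd q\<bar>}}))"
  define \<Z> where "\<Z> = Z ` {S. finite S \<and> S \<subseteq> {0..?T}}"
  have proj: "continuous_map X M (\<lambda>f. f s)" if "s \<in> {0..?T}" for s
    unfolding X_def using continuous_map_product_projection[of s "{0..?T}" "\<lambda>_. M"] that by simp
  have closed: "closedin X C" if C: "C \<in> \<Z>" for C
  proof -
    obtain S where S: "S \<subseteq> {0..?T}" "C = Z S" using C unfolding \<Z>_def by blast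
    have q: "fst q \<in> {0..?T}" "snd q \<in> {0..?T}" if "q \<in> insert (0, 0) (S \<times> S)" for q using that S(1) T0 by auto
    show ?thesis unfolding S(2) Z_def
      by (intro closedin_Int closedin_INT closedin_continuous_map_preimage[OF proj] closedin_continuous_map_preimage[OF continuous_map_rd[OF proj proj]]
          closedin_Hausdorff_singleton[OF Hausdorff] xy q) (use T0 in auto)
  qed
  have ne: "\<Inter>\<F> \<noteq> {}" if F: "finite \<F>" "\<F> \<subseteq> \<Z>" for \<F>
  proof -
    obtain \<S> where \<S>: "\<S> \<subseteq> {S. finite S \<and> S \<subseteq> {0..?T}}" "finite \<S>" "\<F> = Z ` \<S>"
      using finite_subset_image[OF F(1) F(2)[unfolded \<Z>_def]] by blast
    have "finite (\<Union>\<S>)" "\<Union>\<S> \<subseteq> {0..?T}" using \<S> by auto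
    from ex_finite_isopath[OF xy this] obtain f where f: "f 0 = x" "f ?T = y" "isopath (insert 0 (insert ?T (\<Union>\<S>))) f" by blast
    \<comment> \<open>Members of the product are \<open>undefined\<close> outside
      \<open>{0..?T}\<close>; at the unconstrained parameters any point of \<open>M\<close> will do,
      here \<open>x\<close>.\<close>
    define f' where "f' = (\<lambda>t. if t \<in> {0..?T} then if t \<in> insert 0 (insert ?T (\<Union>\<S>)) then f t else x else undefined)"
    have f'M: "f' \<in> topspace X" using f(3) xy by (auto simp: X_def f'_def isopath_def PiE_def extensional_def)
    have eq: "f' t = f t" if "t \<in> insert 0 (insert ?T (\<Union>\<S>))" for t
      using that \<open>\<Union>\<S> \<subseteq> _\<close> T0 by (auto simp: f'_def)
    have "f' \<in> Z S" if "S \<in> \<S>" for S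
    proof -
      have "rd (f' u) (f' v) = \<bar>u - v\<bar>" if "u \<in> insert 0 S" "v \<in> insert 0 S" for u v
      proof -
        have "u \<in> insert 0 (insert ?T (\<Union>\<S>))" "v \<in> insert 0 (insert ?T (\<Union>\<S>))" using that \<open>S \<in> \<S>\<close> by auto
        then show ?thesis using f(3) unfolding isopath_def by (metis eq)
      qed
      then show ?thesis using f'M f(1,2) eq[of 0] eq[of ?T] rd_self by (auto simp: Z_def)
    qed
    then show ?thesis using \<S>(3) by blast
  qed
  have "\<Inter>\<Z> \<noteq> {}" using X closed ne unfolding compact_space_fip by blast
  then obtain f where f: "f \<in> \<Inter>\<Z>" by blast
  have fZ: "f \<in> Z S" if "finite S" "S \<subseteq> {0..?T}" for S using f that unfolding \<Z>_def by blast
  have 0: "f \<in> Z {}" by (rule fZ) auto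
  show thesis
  proof (rule that)
    show "f 0 = x" "f ?T = y" using 0 by (auto simp: Z_def)
    show "isopath {0..?T} f" unfolding isopath_def
    proof (intro conjI ballI)
      fix s t assume s: "s \<in> {0..?T}" and t: "t \<in> {0..?T}"
      show "f s \<in> topspace M" using 0 s by (auto simp: Z_def X_def)
      have "f \<in> Z {s, t}" by (rule fZ) (use s t in auto)
      then show "rd (f s) (f t) = \<bar>s - t\<bar>" by (auto simp: Z_def)
    qed
  qed
qed


section \<open>Minimal paths\<close>

lemma lipschitz_continuous_map:
  fixes f :: "real \<Rightarrow> 'a"
  assumes f: "\<And>s. s \<in> J \<Longrightarrow> f s \<in> topspace M"
    and lip: "\<And>s t. s \<in> J \<Longrightarrow> t \<in> J \<Longrightarrow> rd (f s) (f t) \<le> \<bar>s - t\<bar>"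
  shows "continuous_map (top_of_set J) M f"
proof -
  have "continuous_map (top_of_set J) mtopology f"
    unfolding continuous_map_to_metric
  proof (intro ballI allI impI)
    fix t and e :: real assume t: "t \<in> topspace (top_of_set J)" and e: "0 < e"
    have "f s \<in> mball (f t) e" if s: "s \<in> J \<inter> ball t e" for s
      using lip[of t s] f[of s] f[of t] s t by (auto simp: dist_real_def)
    then show "\<exists>U. openin (top_of_set J) U \<and> t \<in> U \<and> (\<forall>s\<in>U. f s \<in> mball (f t) e)"
      using t e by (intro exI[of _ "J \<inter> ball t e"]) (auto simp: openin_open_Int)
  qed
  then show ?thesis unfolding mtopology_eq .
qed

lemma isopath_continuous: "isopath J f \<Longrightarrow> continuous_map (top_of_set J) M f"
  by (rule lipschitz_continuous_map) (auto simp: isopath_def)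

text \<open>The radius and \<eta> depend only on the point \<open>p\<close> and the chart, not on
  the path. Two paths through \<open>p\<close> can thus be compared on a common interval, which
  non-branching relies on.\<close>

lemma isopath_local:
  assumes CH: "(U, \<phi>) \<in> \<A>" "p \<in> U"
  obtains r \<eta> where "r > 0" "\<eta> > 0" "cball (\<phi> p) r \<subseteq> \<phi> ` U"
    "\<And>f a b t \<alpha> \<beta>. isopath {a..b} f \<Longrightarrow> f t = p \<Longrightarrow> a \<le> \<alpha> \<Longrightarrow> \<beta> \<le> b \<Longrightarrow> \<alpha> < \<beta> \<Longrightarrow> t \<in> {\<alpha>..\<beta>} \<Longrightarrow>
       t - \<eta> \<le> \<alpha> \<Longrightarrow> \<beta> \<le> t + \<eta> \<Longrightarrow>
       (\<forall>s\<in>{\<alpha>..\<beta>}. f s \<in> U \<and> \<phi> (f s) \<in> ball (\<phi> p) r) \<and>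
       (\<exists>u'. local_metric.extremal (\<phi> ` U) (g (U, \<phi>)) \<alpha> \<beta> (\<phi> \<circ> f) u')"
proof (rule chart_metric_dist[OF CH])
  fix r B c assume rp: "r > 0" "c > 0"
    and L: "local_metric_dist (\<phi> ` U) (g (U, \<phi>)) (\<phi> p) r B c (\<lambda>x y. rd (inv_into U \<phi> x) (inv_into U \<phi> y))"
    and far: "\<And>q r'. 0 < r' \<Longrightarrow> r' \<le> r \<Longrightarrow> q \<in> topspace M \<Longrightarrow> \<not> (q \<in> U \<and> \<phi> q \<in> ball (\<phi> p) r') \<Longrightarrow> c * r' \<le> rd p q"
  interpret L: local_metric_dist "\<phi> ` U" "g (U, \<phi>)" "\<phi> p" r B c "\<lambda>x y. rd (inv_into U \<phi> x) (inv_into U \<phi> y)" by (rule L)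
  \<comment> \<open>Up to time \<open>c * r / 2\<close> from \<open>t\<close> the path is closer
    than \<open>c * r\<close> to \<open>p\<close>, so by \<open>far\<close> it stays in the
    coordinate ball; the half makes room for closed intervals.\<close>
  have \<eta>: "c * r / 2 > 0" "c * r / 2 < c * r" using rp by auto
  show thesis
  proof (rule that[OF rp(1) \<eta>(1) L.cball_S])
    fix f a b t \<alpha> \<beta>
    assume f: "isopath {a..b} f" "f t = p" and ab: "a \<le> \<alpha>" "\<beta> \<le> b" "\<alpha> < \<beta>" "t \<in> {\<alpha>..\<beta>}" "t - c * r / 2 \<le> \<alpha>" "\<beta> \<le> t + c * r / 2"
    have near: "f s \<in> U \<and> \<phi> (f s) \<in> ball (\<phi> p) r" if s: "s \<in> {\<alpha>..\<beta>}" for s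
    proof -
      have "rd p (f s) = \<bar>t - s\<bar>" "f s \<in> topspace M" using f s ab unfolding isopath_def by auto
      moreover have "\<bar>t - s\<bar> < c * r" using s ab \<eta>(2) by (simp add: abs_le_iff abs_less_iff)
      ultimately show ?thesis using far[OF rp(1) order_refl, of "f s"] by auto
    qed
    have "L.isometric \<alpha> \<beta> (\<phi> \<circ> f)"
      unfolding L.isometric_def
    proof (intro conjI ballI)
      fix s s' assume s: "s \<in> {\<alpha>..\<beta>}" "s' \<in> {\<alpha>..\<beta>}"
      show "(\<phi> \<circ> f) s \<in> ball (\<phi> p) r" using near[OF s(1)] by simp
      show "rd (inv_into U \<phi> ((\<phi> \<circ> f) s)) (inv_into U \<phi> ((\<phi> \<circ> f) s')) = \<bar>s - s'\<bar>"
        using near[OF s(1)] near[OF s(2)] f(1) s ab CH(1) by (simp add: isopath_def)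
    qed
    then obtain u' where "L.extremal \<alpha> \<beta> (\<phi> \<circ> f) u'" by (rule L.isometric_extremal[OF ab(3)])
    then show "(\<forall>s\<in>{\<alpha>..\<beta>}. f s \<in> U \<and> \<phi> (f s) \<in> ball (\<phi> p) r) \<and> (\<exists>u'. L.extremal \<alpha> \<beta> (\<phi> \<circ> f) u')"
      using near by blast
  qed
qed

text \<open>The interval around \<open>t\<close> is cut off at 0 and at \<open>T\<close>. The set
  equations allow derivatives within the small interval to be exchanged for derivatives within
  \<open>{0..T}\<close>, also at the end points.\<close>

lemma isopath_chart_extremal:
  assumes f: "isopath {0..T} f" and T: "T > 0" and CH: "(U, \<phi>) \<in> \<A>" and t: "t \<in> {0..T}" "f t \<in> U"
  obtains \<alpha> \<beta> \<eta> u' where "\<eta> > 0" "\<alpha> < \<beta>" "t \<in> {\<alpha>..\<beta>}" "{0..T} \<inter> ball t \<eta> = {\<alpha>..\<beta>} \<inter> ball t \<eta>"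
    "{0..T} \<inter> ball t \<eta> \<subseteq> {\<alpha>..\<beta>}" "\<And>s. s \<in> {\<alpha>..\<beta>} \<Longrightarrow> s \<in> {0..T} \<and> f s \<in> U"
    "local_metric.extremal (\<phi> ` U) (g (U, \<phi>)) \<alpha> \<beta> (\<phi> \<circ> f) u'"
proof (rule isopath_local[OF CH t(2)])
  fix r \<eta> :: real
  assume r: "r > 0" "\<eta> > 0" and *: "\<And>h a b s \<alpha> \<beta>. isopath {a..b} h \<Longrightarrow> h s = f t \<Longrightarrow> a \<le> \<alpha> \<Longrightarrow> \<beta> \<le> b \<Longrightarrow> \<alpha> < \<beta> \<Longrightarrow> s \<in> {\<alpha>..\<beta>} \<Longrightarrow>
       s - \<eta> \<le> \<alpha> \<Longrightarrow> \<beta> \<le> s + \<eta> \<Longrightarrow>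
       (\<forall>s\<in>{\<alpha>..\<beta>}. h s \<in> U \<and> \<phi> (h s) \<in> ball (\<phi> (f t)) r) \<and>
       (\<exists>u'. local_metric.extremal (\<phi> ` U) (g (U, \<phi>)) \<alpha> \<beta> (\<phi> \<circ> h) u')"
  define \<alpha> \<beta> where "\<alpha> = max 0 (t - \<eta>)" and "\<beta> = min T (t + \<eta>)"
  have ab: "0 \<le> \<alpha>" "\<beta> \<le> T" "\<alpha> < \<beta>" "t \<in> {\<alpha>..\<beta>}" "t - \<eta> \<le> \<alpha>" "\<beta> \<le> t + \<eta>"
    using r t(1) T by (auto simp: \<alpha>_def \<beta>_def)
  have **: "\<forall>s\<in>{\<alpha>..\<beta>}. f s \<in> U" "\<exists>u'. local_metric.extremal (\<phi> ` U) (g (U, \<phi>)) \<alpha> \<beta> (\<phi> \<circ> f) u'"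
    using *[OF f refl ab] by auto
  obtain u' where u': "local_metric.extremal (\<phi> ` U) (g (U, \<phi>)) \<alpha> \<beta> (\<phi> \<circ> f) u'" using **(2) ..
  show thesis
  proof (rule that[OF r(2) ab(3,4) _ _ _ u'])
    show "{0..T} \<inter> ball t \<eta> = {\<alpha>..\<beta>} \<inter> ball t \<eta>" "{0..T} \<inter> ball t \<eta> \<subseteq> {\<alpha>..\<beta>}"
      by (auto simp: \<alpha>_def \<beta>_def dist_real_def)
    show "s \<in> {0..T} \<and> f s \<in> U" if "s \<in> {\<alpha>..\<beta>}" for s using that **(1) ab by auto
  qed
qed

lemma isopath_smooth:
  assumes f: "isopath {0..T} f" and T: "T > 0"
  shows "smooth_curve M \<A> 0 T f"
  unfolding smooth_curve_def
proof (intro conjI ballI isopath_continuous[OF f])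
  fix z assume z: "z \<in> \<A>"
  obtain U \<phi> where zU: "z = (U, \<phi>)" by fastforce
  have CH: "(U, \<phi>) \<in> \<A>" using z zU by simp
  interpret local_metric "\<phi> ` U" "g (U, \<phi>)" by (rule chart_local_metric[OF CH])
  let ?J = "{t \<in> {0..T}. f t \<in> U}"
  have nb: "at t within ?J \<noteq> bot" if "t \<in> ?J" for t
    using at_within_chart_preimage[OF isopath_continuous[OF f], of t U] is_chartD(1)[OF CH] at_within_Icc_not_bot[OF T, of t] that by simp
  have "smooth_fun_on ?J (\<phi> \<circ> f)"
  proof (rule Ck_imp_smooth_fun_on[OF nb], assumption)
    fix k
    show "Ck k ?J (\<phi> \<circ> f)"
    proof (rule Ck_locally[OF nb], assumption)
      fix t assume t: "t \<in> ?J"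
      then have t': "t \<in> {0..T}" "f t \<in> U" by auto
      show "\<exists>O'. open O' \<and> t \<in> O' \<and> Ck k (?J \<inter> O') (\<phi> \<circ> f)"
      proof (rule isopath_chart_extremal[OF f T CH t'])
        fix \<alpha> \<beta> \<eta> u' assume e: "\<eta> > 0" "\<alpha> < \<beta>" "{0..T} \<inter> ball t \<eta> \<subseteq> {\<alpha>..\<beta>}" "extremal \<alpha> \<beta> (\<phi> \<circ> f) u'"
        have "Ck k {\<alpha>..\<beta>} (\<phi> \<circ> f)" using extremal_Ck[OF e(4)] by blast
        then have "Ck k (?J \<inter> ball t \<eta>) (\<phi> \<circ> f)" by (rule Ck_subset) (use e(3) in auto)
        then show ?thesis using e(1) by (intro exI[of _ "ball t \<eta>"]) simp
      qed
    qed
  qed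
  then show "case z of (U, \<phi>) \<Rightarrow> smooth_fun_on {t \<in> {0..T}. f t \<in> U} (\<phi> \<circ> f)" by (simp add: zU)
qed

lemma isopath_geodesic:
  assumes f: "isopath {0..T} f" and T: "T > 0"
  shows "geodesic M UNIV \<A> g 0 T f" "\<And>t. t \<in> {0..T} \<Longrightarrow> speed \<A> g {0..T} f t = 1"
proof -
  have key: "speed \<A> g {0..T} f t = 1 \<and> vector_derivative (velocity (U, \<phi>) {0..T} f) (at t within {0..T}) +
        christoffel UNIV (g (U, \<phi>)) (\<phi> (f t)) (velocity (U, \<phi>) {0..T} f t) (velocity (U, \<phi>) {0..T} f t) = 0"
    if CH: "(U, \<phi>) \<in> \<A>" and t: "t \<in> {0..T}" "f t \<in> U" for U \<phi> t
  proof -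
    interpret local_metric "\<phi> ` U" "g (U, \<phi>)" by (rule chart_local_metric[OF CH])
    show ?thesis
    proof (rule isopath_chart_extremal[OF f T CH t])
      fix \<alpha> \<beta> \<eta> u' assume e: "\<eta> > 0" "\<alpha> < \<beta>" "t \<in> {\<alpha>..\<beta>}" "{0..T} \<inter> ball t \<eta> = {\<alpha>..\<beta>} \<inter> ball t \<eta>"
        "{0..T} \<inter> ball t \<eta> \<subseteq> {\<alpha>..\<beta>}" and x: "extremal \<alpha> \<beta> (\<phi> \<circ> f) u'"
      have atw: "at s within {\<alpha>..\<beta>} = at s within {0..T}" if "s \<in> ball t \<eta>" for s
        by (rule at_within_nhd[OF that open_ball]) (use e(4) in auto)
      have nb: "at s within {0..T} \<noteq> bot" if "s \<in> {0..T}" for s by (rule at_within_Icc_not_bot[OF T that])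
      have tb: "t \<in> ball t \<eta>" using e(1) by simp
      have u': "((\<phi> \<circ> f) has_vector_derivative u' s) (at s within {0..T})" if "s \<in> {0..T} \<inter> ball t \<eta>" for s
      proof -
        have "s \<in> {\<alpha>..\<beta>}" "s \<in> ball t \<eta>" using e(5) that by auto
        then show ?thesis using x unfolding extremal_def by (simp only: atw[symmetric])
      qed
      have vel: "velocity (U, \<phi>) {0..T} f s = u' s" if "s \<in> {0..T} \<inter> ball t \<eta>" for s
        unfolding velocity_def prod.case by (rule vector_derivative_within[OF nb u'[OF that]]) (use that in auto)
      have vt: "velocity (U, \<phi>) {0..T} f t = u' t" using vel t(1) tb by simp
      have unit: "g (U, \<phi>) (\<phi> (f t)) (u' t) (u' t) = 1" using x e(3) unfolding extremal_def by auto
      have "speed \<A> g {0..T} f t = 1"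
        using speed_eq[OF CH nb[OF t(1)] isopath_continuous[OF f] t u'] t(1) tb unit by simp
      moreover
      have xS: "\<phi> (f t) \<in> \<phi> ` U" using t(2) by blast
      obtain u'' where u'': "(u' has_vector_derivative u'') (at t within {\<alpha>..\<beta>})"
        "\<And>w. 2 * g (U, \<phi>) ((\<phi> \<circ> f) t) (- u'') w = 2 * dh ((\<phi> \<circ> f) t) (u' t) (u' t) w - dh ((\<phi> \<circ> f) t) w (u' t) (u' t)"
        by (rule extremal_geodesic_equation[OF e(2) x e(3)]) (rule that)
      have "(u' has_vector_derivative u'') (at t within {0..T})" using u''(1) atw[OF tb] by simp
      then have "(velocity (U, \<phi>) {0..T} f has_vector_derivative u'') (at t within {0..T})"
        by (rule has_vector_derivative_transform_within[OF _ e(1) t(1)]) (use vel in \<open>simp add: dist_commute\<close>)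
      then have 1: "vector_derivative (velocity (U, \<phi>) {0..T} f) (at t within {0..T}) = u''"
        by (rule vector_derivative_within[OF nb[OF t(1)]])
      have dd: "dir_deriv (\<lambda>y. g (U, \<phi>) y v w) (\<phi> (f t)) u = dh (\<phi> (f t)) u v w" for u v w
        by (rule dir_deriv_eq[OF h_has_derivative[OF xS]])
      \<comment> \<open>Positive definiteness of the metric makes the solution of the Koszul
        equation unique, so the definite description evaluates to \<open>- u''\<close>.\<close>
      have 2: "christoffel UNIV (g (U, \<phi>)) (\<phi> (f t)) (u' t) (u' t) = - u''"
        unfolding christoffel_def dd
      proof (rule the_equality)
        show "- u'' \<in> UNIV \<and> (\<forall>w\<in>UNIV. 2 * g (U, \<phi>) (\<phi> (f t)) (- u'') w =
            dh (\<phi> (f t)) (u' t) (u' t) w + dh (\<phi> (f t)) (u' t) (u' t) w - dh (\<phi> (f t)) w (u' t) (u' t))"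
          using u''(2) by simp
        fix z assume z: "z \<in> UNIV \<and> (\<forall>w\<in>UNIV. 2 * g (U, \<phi>) (\<phi> (f t)) z w =
            dh (\<phi> (f t)) (u' t) (u' t) w + dh (\<phi> (f t)) (u' t) (u' t) w - dh (\<phi> (f t)) w (u' t) (u' t))"
        have "2 * g (U, \<phi>) (\<phi> (f t)) z w = 2 * g (U, \<phi>) (\<phi> (f t)) (- u'') w" for w using z u''(2)[of w] by simp
        then have "g (U, \<phi>) (\<phi> (f t)) (z - - u'') (z - - u'') = 0"
          unfolding bilinear_lsub[OF bil[OF xS]] by simp
        then show "z = - u''" using pos[OF xS, of "z - - u''"] by (cases "z - - u'' = 0") (simp add: eq_neg_iff_add_eq_0, linarith)
      qed
      show ?thesis using calculation 1 2 vt by simp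
    qed
  qed
  show "geodesic M UNIV \<A> g 0 T f"
    unfolding geodesic_def using isopath_smooth[OF f T] key by auto
  show "speed \<A> g {0..T} f t = 1" if t: "t \<in> {0..T}" for t
  proof -
    have "f t \<in> topspace M" using f t unfolding isopath_def by blast
    then obtain U \<phi> where "(U, \<phi>) \<in> \<A>" "f t \<in> U" by (rule chart_cover)
    then show ?thesis using key t by blast
  qed
qed

end


section \<open>Lipschitz paths and non-branching\<close>

lemma (in local_metric) extremal_derivative:
  "extremal a b u u' \<Longrightarrow> t \<in> {a..b} \<Longrightarrow> (u has_vector_derivative u' t) (at t within {a..b})"
  unfolding extremal_def by (elim conjE) (drule (1) bspec, elim conjE)

lemma (in local_metric) extremal_subinterval:
  assumes u: "extremal a b u u'" and ab: "a \<le> a'" "b' \<le> b"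
  shows "extremal a' b' u u'"
proof -
  have sub: "{a'..b'} \<subseteq> {a..b}" using ab by auto
  show ?thesis
    unfolding extremal_def
  proof (intro conjI ballI allI)
    show "continuous_on {a'..b'} u'" using u sub continuous_on_subset unfolding extremal_def by blast
    fix t e assume t: "t \<in> {a'..b'}"
    then have t': "t \<in> {a..b}" using sub by blast
    note x = u[unfolded extremal_def]
    show "u t \<in> S" "h (u t) (u' t) (u' t) = 1" using x t' by blast+
    show "(u has_vector_derivative u' t) (at t within {a'..b'})"
      by (rule has_vector_derivative_within_subset[OF _ sub]) (use x t' in blast)
    show "((\<lambda>t. h (u t) (u' t) e) has_vector_derivative dh (u t) e (u' t) (u' t) / 2) (at t within {a'..b'})"
      by (rule has_vector_derivative_within_subset[OF _ sub]) (use x t' in blast)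
  qed
qed

context compact_riemannian
begin

text \<open>Joining two isometric paths yields only a 1-Lipschitz path in general;
  \<open>lip_imp_isopath\<close> recovers isometry from the distance to \<open>N\<close>.\<close>

definition lip :: "real set \<Rightarrow> (real \<Rightarrow> 'a) \<Rightarrow> bool" where
  "lip J f \<longleftrightarrow> (\<forall>s\<in>J. f s \<in> topspace M) \<and> (\<forall>s\<in>J. \<forall>t\<in>J. rd (f s) (f t) \<le> \<bar>s - t\<bar>)"

lemma isopath_imp_lip: "isopath J f \<Longrightarrow> lip J f"
  by (auto simp: isopath_def lip_def)

lemma lip_reparam:
  assumes "lip J f" "\<And>t. t \<in> J' \<Longrightarrow> \<sigma> t \<in> J" "\<And>s t. s \<in> J' \<Longrightarrow> t \<in> J' \<Longrightarrow> \<bar>\<sigma> s - \<sigma> t\<bar> \<le> \<bar>s - t\<bar>"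
  shows "lip J' (\<lambda>t. f (\<sigma> t))"
  using assms(1,2) order_trans[OF _ assms(3)] unfolding lip_def by blast

lemma lip_join:
  assumes f: "lip {a..c} f" and h: "lip {c..b} h" and fh: "f c = h c" and c: "a \<le> c" "c \<le> b"
  shows "lip {a..b} (\<lambda>t. if t \<le> c then f t else h t)"
proof -
  have mid: "rd (f s) (h t) \<le> t - s" if "s \<in> {a..c}" "t \<in> {c..b}" for s t
  proof -
    have m: "f s \<in> topspace M" "f c \<in> topspace M" "h t \<in> topspace M" using f h that c by (auto simp: lip_def)
    have "c \<in> {a..c}" "c \<in> {c..b}" using c by auto
    then have "rd (f s) (f c) \<le> \<bar>s - c\<bar>" "rd (h c) (h t) \<le> \<bar>c - t\<bar>" using f h that unfolding lip_def by blast+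
    then show ?thesis using rd_triangle[OF m] that fh by auto
  qed
  show ?thesis
    unfolding lip_def
  proof (intro conjI ballI)
    fix s t assume s: "s \<in> {a..b}" and t: "t \<in> {a..b}"
    show "(if s \<le> c then f s else h s) \<in> topspace M" using f h s by (auto simp: lip_def)
    show "rd (if s \<le> c then f s else h s) (if t \<le> c then f t else h t) \<le> \<bar>s - t\<bar>"
    proof (cases "s \<le> c"; cases "t \<le> c")
      assume "s \<le> c" "\<not> t \<le> c" then show ?thesis using mid[of s t] s t by simp
    next
      assume "\<not> s \<le> c" "t \<le> c" then show ?thesis using mid[of t s] s t rd_commute[of "h s" "f t"] by simp
    qed (use f h s t in \<open>auto simp: lip_def\<close>)
  qed
qed

text \<open>Two minimal paths that agree at the end agree throughout: go back to the first parameter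
  \<open>\<tau>\<close> from which on they agree, and apply uniqueness of geodesics there.\<close>

lemma isopath_nonbranching:
  assumes f: "isopath {0..T} f" and h: "isopath {0..T} h"
    and c: "0 \<le> c" "c < T" and eq: "\<And>t. t \<in> {c..T} \<Longrightarrow> f t = h t" and t: "t \<in> {0..T}"
  shows "f t = h t"
proof -
  define E where "E = {c \<in> {0..T}. \<forall>t\<in>{c..T}. f t = h t}"
  define \<tau> where "\<tau> = Inf E"
  have cE: "c \<in> E" using c eq by (auto simp: E_def)
  have bdd: "bdd_below E" by (rule bdd_belowI[of _ 0]) (auto simp: E_def)
  have \<tau>: "0 \<le> \<tau>" "\<tau> < T"
  proof -
    show "0 \<le> \<tau>" unfolding \<tau>_def proof (rule cInf_greatest)
      show "E \<noteq> {}" using cE by blast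
    qed (simp add: E_def)
    show "\<tau> < T" unfolding \<tau>_def using cInf_lower[OF cE bdd] c by simp
  qed
  have after: "f s = h s" if sT: "\<tau> < s" "s \<le> T" for s
  proof -
    have "E \<noteq> {}" using cE by blast
    then obtain e where e: "e \<in> E" "e < s" using cInf_lessD[of E s] sT(1) unfolding \<tau>_def by blast
    have "s \<in> {e..T}" using e(2) sT(2) by simp
    then show ?thesis using e(1) unfolding E_def by blast
  qed
  have fM: "f s \<in> topspace M" "h s \<in> topspace M" if "s \<in> {0..T}" for s using f h that by (auto simp: isopath_def)
  have at\<tau>: "f \<tau> = h \<tau>"
  proof (rule rd_zero)
    have \<tau>T: "\<tau> \<in> {0..T}" using \<tau> by auto
    show "f \<tau> \<in> topspace M" "h \<tau> \<in> topspace M" using fM \<tau>T by auto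
    have "rd (f \<tau>) (h \<tau>) \<le> 0 + e" if "e > 0" for e
    proof -
      define s where "s = min T (\<tau> + e / 2)"
      have s: "\<tau> < s" "s \<le> T" "s \<le> \<tau> + e / 2" using \<tau> that by (auto simp: s_def)
      then have sT: "s \<in> {0..T}" using \<tau> by auto
      have "rd (f \<tau>) (h \<tau>) \<le> rd (f \<tau>) (f s) + rd (h s) (h \<tau>)"
        using rd_triangle[of "f \<tau>" "f s" "h \<tau>"] fM \<tau>T sT after[OF s(1,2)] by simp
      also have "\<dots> = (s - \<tau>) + (s - \<tau>)" using f h \<tau>T sT s by (simp add: isopath_def)
      finally show ?thesis using s(3) by simp
    qed
    then have "rd (f \<tau>) (h \<tau>) \<le> 0" by (rule field_le_epsilon)
    then show "rd (f \<tau>) (h \<tau>) = 0" using rd_nonneg[of "f \<tau>" "h \<tau>"] by simp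
  qed
  have "\<tau> = 0"
  proof (rule ccontr)
    assume "\<tau> \<noteq> 0"
    then have \<tau>0: "0 < \<tau>" using \<tau> by simp
    obtain U \<phi> where CH: "(U, \<phi>) \<in> \<A>" "f \<tau> \<in> U" by (rule chart_cover[OF fM(1)[of \<tau>]]) (use \<tau> in auto)
    interpret local_metric "\<phi> ` U" "g (U, \<phi>)" by (rule chart_local_metric[OF CH(1)])
    show False
    proof (rule isopath_local[OF CH])
      fix r \<eta> :: real assume r: "r > 0" "\<eta> > 0" "cball (\<phi> (f \<tau>)) r \<subseteq> \<phi> ` U"
        and *: "\<And>h a b s \<alpha> \<beta>. isopath {a..b} h \<Longrightarrow> h s = f \<tau> \<Longrightarrow> a \<le> \<alpha> \<Longrightarrow> \<beta> \<le> b \<Longrightarrow> \<alpha> < \<beta> \<Longrightarrow> s \<in> {\<alpha>..\<beta>} \<Longrightarrow>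
           s - \<eta> \<le> \<alpha> \<Longrightarrow> \<beta> \<le> s + \<eta> \<Longrightarrow>
           (\<forall>s\<in>{\<alpha>..\<beta>}. h s \<in> U \<and> \<phi> (h s) \<in> ball (\<phi> (f \<tau>)) r) \<and> (\<exists>u'. extremal \<alpha> \<beta> (\<phi> \<circ> h) u')"
      \<comment> \<open>Since \<eta> does not depend on the path, one interval serves for
        both.\<close>
      define \<alpha> \<beta> where "\<alpha> = max 0 (\<tau> - \<eta>)" and "\<beta> = min T (\<tau> + \<eta>)"
      have ab: "0 \<le> \<alpha>" "\<beta> \<le> T" "\<alpha> < \<beta>" "\<tau> \<in> {\<alpha>..\<beta>}" "\<tau> - \<eta> \<le> \<alpha>" "\<beta> \<le> \<tau> + \<eta>" and \<alpha>\<tau>: "\<alpha> < \<tau>" and \<tau>\<beta>: "\<tau> < \<beta>"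
        using r \<tau> \<tau>0 by (auto simp: \<alpha>_def \<beta>_def)
      note F = *[OF f refl ab] and H = *[OF h at\<tau>[symmetric] ab]
      obtain u' where u: "extremal \<alpha> \<beta> (\<phi> \<circ> f) u'" using F[THEN conjunct2] ..
      obtain v' where v: "extremal \<alpha> \<beta> (\<phi> \<circ> h) v'" using H[THEN conjunct2] ..
      \<comment> \<open>The paths coincide after \<tau>, so their velocities at \<tau> agree. This
        is the condition at the right end under which \<open>extremal_unique\<close> applies on the
        interval before \<tau>.\<close>
      have sub: "{\<tau>..\<beta>} \<subseteq> {\<alpha>..\<beta>}" using \<alpha>\<tau> by auto
      have nb: "at \<tau> within {\<tau>..\<beta>} \<noteq> bot" by (rule at_within_Icc_not_bot[OF \<tau>\<beta>]) (use \<tau>\<beta> in auto)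
      have du: "((\<phi> \<circ> f) has_vector_derivative u' \<tau>) (at \<tau> within {\<tau>..\<beta>})"
        by (rule has_vector_derivative_within_subset[OF _ sub]) (rule extremal_derivative[OF u ab(4)])
      have "((\<phi> \<circ> h) has_vector_derivative v' \<tau>) (at \<tau> within {\<tau>..\<beta>})"
        by (rule has_vector_derivative_within_subset[OF _ sub]) (rule extremal_derivative[OF v ab(4)])
      then have "((\<phi> \<circ> f) has_vector_derivative v' \<tau>) (at \<tau> within {\<tau>..\<beta>})"
        by (rule has_vector_derivative_transform[rotated 2])
          (use \<tau>\<beta> ab(2) at\<tau> after in \<open>auto simp: le_less\<close>)
      then have v\<tau>: "u' \<tau> = v' \<tau>" by (rule vector_derivative_unique_within[OF nb du])
      have "f s = h s" if s: "s \<in> {\<alpha>..\<tau>}" for s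
      proof -
        have sb: "s \<in> {\<alpha>..\<beta>}" using s \<tau>\<beta> by auto
        have "(\<phi> \<circ> f) s = (\<phi> \<circ> h) s"
        proof (rule extremal_unique[OF compact_cball convex_cball r(3)])
          show "extremal \<alpha> \<tau> (\<phi> \<circ> f) u'" "extremal \<alpha> \<tau> (\<phi> \<circ> h) v'"
            using extremal_subinterval[OF u order_refl] extremal_subinterval[OF v order_refl] \<tau>\<beta> by auto
          show "(\<phi> \<circ> f) q \<in> cball (\<phi> (f \<tau>)) r" if "q \<in> {\<alpha>..\<tau>}" for q using F[THEN conjunct1, THEN bspec, of q] that \<tau>\<beta> by simp
          show "(\<phi> \<circ> h) q \<in> cball (\<phi> (f \<tau>)) r" if "q \<in> {\<alpha>..\<tau>}" for q using H[THEN conjunct1, THEN bspec, of q] that \<tau>\<beta> by simp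
        qed (use \<alpha>\<tau> at\<tau> v\<tau> s in auto)
        then show ?thesis using inj_onD[OF chart_inj[OF CH(1)]] F[THEN conjunct1, THEN bspec, OF sb] H[THEN conjunct1, THEN bspec, OF sb] by simp
      qed
      then have "f s = h s" if "s \<in> {\<alpha>..T}" for s using after[of s] that by (cases "s \<le> \<tau>") auto
      then have "\<alpha> \<in> E" using ab(1) \<alpha>\<tau> \<tau> by (auto simp: E_def)
      then show False using cInf_lower[OF _ bdd, of \<alpha>] \<alpha>\<tau> by (simp add: \<tau>_def)
    qed
  qed
  then show ?thesis using at\<tau> after[of t] t by (cases "t = 0") auto
qed

end

section \<open>Distance to a closed set and the cut locus\<close>

lemma (in compact_riemannian) nonexpansive_continuous:
  fixes k :: "'a \<Rightarrow> real"
  assumes k: "\<And>x y. x \<in> topspace M \<Longrightarrow> y \<in> topspace M \<Longrightarrow> k x \<le> rd x y + k y"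
  shows "continuous_map M euclideanreal k"
proof -
  have "continuous_map mtopology Met_TC.mtopology k"
    unfolding Met_TC.continuous_map_to_metric
  proof (intro ballI allI impI)
    fix x and e :: real assume x: "x \<in> topspace mtopology" and e: "0 < e"
    have "k y \<in> Met_TC.mball (k x) e" if y: "y \<in> mball x e" for y
      using k[of x y] k[of y x] y x rd_commute[of x y] by (simp add: dist_real_def abs_less_iff)
    then show "\<exists>U. openin mtopology U \<and> x \<in> U \<and> (\<forall>y\<in>U. k y \<in> Met_TC.mball (k x) e)"
      using x e by (intro exI[of _ "mball x e"]) auto
  qed
  then show ?thesis unfolding mtopology_eq by simp
qed

locale distance_to_closed = compact_riemannian M \<A> g
  for M :: "'a topology" and \<A> :: "('a, 'e::euclidean_space) chart set" and g +
  fixes N :: "'a set"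
  assumes N_closed: "closedin M N" and N_ne: "N \<noteq> {}"
begin

definition dN :: "'a \<Rightarrow> real" where "dN = dist_to M \<A> g N"

abbreviation "N_lengths x \<equiv> {len a b \<gamma> | a b \<gamma>. PS a b \<gamma> \<and> \<gamma> a = x \<and> \<gamma> b \<in> N}"

lemma N_sub: "N \<subseteq> topspace M" using closedin_subset[OF N_closed] .

lemma N_lengths_eq: "N_lengths x = {l. \<exists>y\<in>N. joined x y l}"
  unfolding joined_def by blast

lemma N_lengths_bdd: "bdd_below (N_lengths x)"
  unfolding N_lengths_eq by (rule bdd_belowI[of _ 0]) (use joined_nonneg in blast)

lemma dN_le_joined: "joined x y l \<Longrightarrow> y \<in> N \<Longrightarrow> dN x \<le> l"
  unfolding dN_def dist_to_def using N_lengths_bdd[of x] by (intro cInf_lower) (auto simp: N_lengths_eq)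

lemma dN_le: "x \<in> topspace M \<Longrightarrow> y \<in> N \<Longrightarrow> dN x \<le> rd x y"
  using dN_le_joined N_sub by (intro rd_greatest) auto

lemma dN_attained:
  assumes x: "x \<in> topspace M"
  obtains y where "y \<in> N" "dN x = rd x y"
proof -
  have "continuous_map M euclideanreal (rd x)" by (rule continuous_map_rd) (use x in simp_all)
  then obtain y where y: "y \<in> N" "\<And>w. w \<in> N \<Longrightarrow> rd x y \<le> rd x w"
    by (rule compact_attains[OF N_closed N_ne]) (rule that)
  have "rd x y \<le> dN x" unfolding dN_def dist_to_def
  proof (rule cInf_greatest)
    show "N_lengths x \<noteq> {}" unfolding N_lengths_eq using ex_joined[OF pc x, of y] y(1) N_sub by blast
    fix l assume "l \<in> N_lengths x"
    then obtain w where "w \<in> N" "joined x w l" unfolding N_lengths_eq by blast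
    then show "rd x y \<le> l" using y(2)[of w] rd_le[of x w l] by simp
  qed
  then show thesis using that[OF y(1)] dN_le[OF x y(1)] by simp
qed

lemma dN_nonneg: "x \<in> topspace M \<Longrightarrow> 0 \<le> dN x"
  by (rule dN_attained) (auto simp: rd_nonneg)

lemma dN_zero: "x \<in> topspace M \<Longrightarrow> dN x = 0 \<Longrightarrow> x \<in> N"
proof (rule dN_attained)
  fix y assume "x \<in> topspace M" "dN x = 0" "y \<in> N" "dN x = rd x y"
  then show "x \<in> N" using rd_zero[of x y] N_sub by auto
qed

lemma dN_triangle:
  assumes x: "x \<in> topspace M" and z: "z \<in> topspace M"
  shows "dN x \<le> rd x z + dN z"
proof (rule dN_attained[OF z])
  fix y assume y: "y \<in> N" "dN z = rd z y"
  then show ?thesis using dN_le[OF x y(1)] rd_triangle[OF x z, of y] N_sub by auto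
qed

lemma dN_continuous: "continuous_map M euclideanreal dN"
  by (rule nonexpansive_continuous[OF dN_triangle])

text \<open>No length is wasted: \<open>dN\<close> is 1-Lipschitz and has to grow from 0 to
  \<open>T\<close> in time \<open>T\<close>, so it equals \<open>t\<close> at time \<open>t\<close>.
  Differences of \<open>dN\<close> then bound the distances along the path from below.\<close>

lemma lip_imp_isopath:
  assumes f: "lip {0..T} f" "f 0 \<in> N" and T: "dN (f T) = T"
  shows "isopath {0..T} f" "\<And>t. t \<in> {0..T} \<Longrightarrow> dN (f t) = t"
proof -
  have fM: "f t \<in> topspace M" if "t \<in> {0..T}" for t using f(1) that by (simp add: lip_def)
  have fd: "rd (f s) (f t) \<le> \<bar>s - t\<bar>" if "s \<in> {0..T}" "t \<in> {0..T}" for s t using f(1) that by (simp add: lip_def)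
  show d: "dN (f t) = t" if t: "t \<in> {0..T}" for t
  proof -
    have m: "0 \<in> {0..T}" "T \<in> {0..T}" using t by auto
    have "dN (f t) \<le> t" using dN_le[OF fM[OF t] f(2)] fd[OF t m(1)] t by simp
    moreover have "T \<le> (T - t) + dN (f t)" using dN_triangle[OF fM[OF m(2)] fM[OF t]] fd[OF m(2) t] T t by simp
    ultimately show ?thesis by simp
  qed
  show "isopath {0..T} f" unfolding isopath_def
  proof (intro conjI ballI fM)
    fix s t assume s: "s \<in> {0..T}" and t: "t \<in> {0..T}"
    have "s - t \<le> rd (f s) (f t)" "t - s \<le> rd (f t) (f s)"
      using dN_triangle[OF fM[OF s] fM[OF t]] dN_triangle[OF fM[OF t] fM[OF s]] d s t by simp_all
    then show "rd (f s) (f t) = \<bar>s - t\<bar>" using fd[OF s t] rd_commute[of "f s" "f t"] by linarith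
  qed
qed

text \<open>From right to left this is the regularity of minimal paths. From left to right, unit
  speed makes the path 1-Lipschitz, and the distance \<open>T\<close> of its end point makes it
  isometric.\<close>

lemma N_segment_iff:
  "N_segment M UNIV \<A> g N T f \<longleftrightarrow> T > 0 \<and> isopath {0..T} f \<and> f 0 \<in> N \<and> (\<forall>t\<in>{0..T}. dN (f t) = t)"
proof
  assume "T > 0 \<and> isopath {0..T} f \<and> f 0 \<in> N \<and> (\<forall>t\<in>{0..T}. dN (f t) = t)"
  then show "N_segment M UNIV \<A> g N T f"
    unfolding N_segment_def using isopath_geodesic[of T f] by (simp add: dN_def)
next
  assume "N_segment M UNIV \<A> g N T f"
  then have T: "T > 0" and sm: "smooth_curve M \<A> 0 T f" and sp: "\<And>t. t \<in> {0..T} \<Longrightarrow> speed \<A> g {0..T} f t = 1"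
    and f: "f 0 \<in> N" "\<And>t. t \<in> {0..T} \<Longrightarrow> dN (f t) = t"
    unfolding N_segment_def geodesic_def dN_def by auto
  have PS: "PS 0 T f" by (rule smooth_curve_imp_PS[OF sm]) (use T in simp)
  have le: "rd (f s) (f t) \<le> t - s" if st: "0 \<le> s" "s \<le> t" "t \<le> T" for s t
  proof -
    have "integral {s..t} (spd f) = integral {s..t} (\<lambda>_. 1)"
    proof (rule integral_spike[of "{s, t}"])
      fix x assume x: "x \<in> {s..t} - {s, t}"
      then have "0 < x" "x < T" using st by auto
      then show "1 = spd f x" using speed_eq_spd[of 0 x T f] sp[of x] by simp
    qed simp
    then have "len s t f = t - s" using st by (simp add: curve_length_eq)
    moreover have "joined (f s) (f t) (len s t f)" unfolding joined_def using PS_restrict[OF PS st] by blast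
    ultimately show ?thesis using rd_le by metis
  qed
  have "lip {0..T} f" unfolding lip_def
  proof (intro conjI ballI)
    show "f s \<in> topspace M" if "s \<in> {0..T}" for s by (rule PS_in_topspace[OF PS that])
    fix s t assume s: "s \<in> {0..T}" and t: "t \<in> {0..T}"
    show "rd (f s) (f t) \<le> \<bar>s - t\<bar>"
      using le[of s t] le[of t s] s t rd_commute[of "f s" "f t"] by (cases "s \<le> t") auto
  qed
  moreover have "dN (f T) = T" using f(2) T by simp
  ultimately show "T > 0 \<and> isopath {0..T} f \<and> f 0 \<in> N \<and> (\<forall>t\<in>{0..T}. dN (f t) = t)"
    using T f lip_imp_isopath(1) by blast
qed

text \<open>Minimal paths from \<open>N\<close> to \<open>z\<close> and from \<open>z\<close> to
  \<open>x\<close> are joined. By hypothesis the total length is \<open>dN x\<close>, so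
  \<open>lip_imp_isopath\<close> applies to the joined path.\<close>

lemma segment_through:
  assumes x: "x \<in> topspace M" and z: "z \<in> topspace M" and xz: "dN z + rd z x = dN x"
  obtains k where "isopath {0..dN x} k" "k 0 \<in> N" "k (dN x) = x" "k (dN z) = z" "\<And>t. t \<in> {0..dN x} \<Longrightarrow> dN (k t) = t"
proof (rule dN_attained[OF z])
  fix y assume y: "y \<in> N" "dN z = rd z y"
  have yM: "y \<in> topspace M" using y N_sub by blast
  let ?c = "dN z"
  have c: "rd y z = ?c" using y rd_commute by simp
  obtain f where f: "f 0 = y" "f ?c = z" "isopath {0..?c} f" by (rule ex_isopath[OF yM z]) (use c that in auto)
  obtain h where h: "h 0 = z" "h (rd z x) = x" "isopath {0..rd z x} h" by (rule ex_isopath[OF z x]) (rule that)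
  define k where "k = (\<lambda>t. if t \<le> ?c then f t else h (t - ?c))"
  have c0: "0 \<le> ?c" "?c \<le> dN x" using dN_nonneg[OF z] rd_nonneg[of z x] xz by linarith+
  have "lip {?c..dN x} (\<lambda>t. h (t - ?c))"
    by (rule lip_reparam[OF isopath_imp_lip[OF h(3)]]) (use xz in auto)
  then have lip: "lip {0..dN x} k" unfolding k_def
    by (rule lip_join[OF isopath_imp_lip[OF f(3)] _ _ c0]) (simp add: f h)
  have k: "k 0 = y" "k ?c = z" using c0 f by (auto simp: k_def)
  have kx: "k (dN x) = x"
  proof (cases "dN x \<le> ?c")
    case True
    then have "rd z x = 0" using xz rd_nonneg[of z x] by linarith
    then have "z = x" by (rule rd_zero[OF z x])
    then show ?thesis using f(2) by (simp add: k_def)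
  next
    case False
    have "dN x - ?c = rd z x" using xz by simp
    then show ?thesis using False h(2) by (simp add: k_def)
  qed
  have k0: "k 0 \<in> N" and kT: "dN (k (dN x)) = dN x" using k y kx by auto
  show thesis
    by (rule that[OF lip_imp_isopath(1)[OF lip k0 kT] k0 kx k(2) lip_imp_isopath(2)[OF lip k0 kT]])
qed

abbreviation "Cut \<equiv> cut_locus M UNIV \<A> g N"

lemma Cut_sub: "Cut \<subseteq> topspace M"
proof
  fix x assume "x \<in> Cut"
  then obtain f T where "x = f T" "N_segment M UNIV \<A> g N T f" unfolding cut_locus_def by blast
  then show "x \<in> topspace M" unfolding N_segment_iff isopath_def by auto
qed

text \<open>The equation \<open>dN z + rd z x = dN x\<close> expresses that \<open>z\<close> lies on
  a minimal path from \<open>N\<close> to \<open>x\<close>. Uniqueness of the path is stated in this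
  pointwise form because \<open>deformation\<close> works with conditions given by continuous
  functions. If \<open>dN x = 0\<close>, both points are \<open>x\<close>.\<close>

lemma unique_between:
  assumes x: "x \<in> topspace M" "x \<notin> Cut"
    and z: "z \<in> topspace M" "dN z + rd z x = dN x" and w: "w \<in> topspace M" "dN w + rd w x = dN x"
    and zw: "dN z = dN w"
  shows "z = w"
proof (cases "dN x = 0")
  case True
  then have "rd z x = 0" "rd w x = 0" using z w rd_nonneg[of z x] rd_nonneg[of w x] dN_nonneg[of z] dN_nonneg[of w] by linarith+
  then show ?thesis using rd_zero z(1) w(1) x(1) by blast
next
  case False
  then have T: "dN x > 0" using dN_nonneg[OF x(1)] by simp
  obtain k where k: "isopath {0..dN x} k" "k 0 \<in> N" "k (dN x) = x" "k (dN z) = z" "\<And>t. t \<in> {0..dN x} \<Longrightarrow> dN (k t) = t"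
    by (rule segment_through[OF x(1) z]) (rule that)
  obtain l where l: "isopath {0..dN x} l" "l 0 \<in> N" "l (dN x) = x" "l (dN w) = w" "\<And>t. t \<in> {0..dN x} \<Longrightarrow> dN (l t) = t"
    by (rule segment_through[OF x(1) w]) (rule that)
  have seg: "N_segment M UNIV \<A> g N (dN x) k" unfolding N_segment_iff using T k by blast
  have "\<exists>t1>dN x. \<exists>k'. N_segment M UNIV \<A> g N t1 k' \<and> (\<forall>t\<in>{0..dN x}. k' t = k t)"
  proof (rule ccontr)
    assume n: "\<not> ?thesis"
    have "\<exists>\<gamma> t0. x = \<gamma> t0 \<and> N_segment M UNIV \<A> g N t0 \<gamma> \<and>
       \<not> (\<exists>t1>t0. \<exists>k'. N_segment M UNIV \<A> g N t1 k' \<and> (\<forall>t\<in>{0..t0}. k' t = \<gamma> t))"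
      by (intro exI[of _ k] exI[of _ "dN x"] conjI k(3)[symmetric] seg n)
    then show False using x(2) unfolding cut_locus_def by (elim notE) (rule CollectI)
  qed
  then obtain t1 k' where t1: "t1 > dN x" "N_segment M UNIV \<A> g N t1 k'" and k': "\<And>t. t \<in> {0..dN x} \<Longrightarrow> k' t = k t"
    by blast
  have k'i: "isopath {0..t1} k'" "k' 0 \<in> N" "\<And>t. t \<in> {0..t1} \<Longrightarrow> dN (k' t) = t" using t1(2) unfolding N_segment_iff by auto
  \<comment> \<open>The end of this joined path has distance \<open>t1\<close> from
    \<open>N\<close>, so the path is isometric; it agrees with \<open>k'\<close> from
    \<open>dN x\<close> on, and non-branching carries the agreement back to the start.\<close>
  define m where "m = (\<lambda>t. if t \<le> dN x then l t else k' t)"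
  have lip1: "lip {dN x..t1} k'" using isopath_imp_lip[OF k'i(1)] T by (auto simp: lip_def)
  have lip: "lip {0..t1} m" unfolding m_def
    by (rule lip_join[OF isopath_imp_lip[OF l(1)] lip1]) (use T t1(1) l(3) k(3) k' in auto)
  have m: "m 0 \<in> N" "dN (m t1) = t1" using T t1(1) l(2) k'i(3) by (auto simp: m_def)
  have eq: "m t = k' t" if "t \<in> {dN x..t1}" for t
    using that l(3) k(3) k'[of "dN x"] T by (cases "t = dN x") (auto simp: m_def)
  have mk: "m t = k' t" if "t \<in> {0..t1}" for t
    by (rule isopath_nonbranching[OF lip_imp_isopath(1)[OF lip m] k'i(1) less_imp_le[OF T] t1(1) eq that])
  have zr: "dN z \<in> {0..dN x}"
    unfolding atLeastAtMost_iff using z(2) dN_nonneg[OF z(1)] rd_nonneg[of z x] by linarith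
  have "l (dN z) = k (dN z)" using mk[of "dN z"] k'[OF zr] t1(1) zr by (simp add: m_def)
  then show ?thesis unfolding k(4) unfolding zw l(4) by (rule sym)
qed

lemma ex_between_N:
  assumes x: "x \<in> topspace M" and t: "0 \<le> t" "t \<le> dN x"
  obtains z where "z \<in> topspace M" "dN z = t" "dN z + rd z x = dN x"
proof -
  have "dN x + rd x x = dN x" using x by (simp add: rd_self)
  then obtain k where k: "isopath {0..dN x} k" "k 0 \<in> N" "k (dN x) = x" "\<And>t. t \<in> {0..dN x} \<Longrightarrow> dN (k t) = t"
    by (rule segment_through[OF x x]) (rule that)
  have "k t \<in> topspace M" "dN (k t) = t" "rd (k t) (k (dN x)) = \<bar>t - dN x\<bar>" using k(1,4) t by (auto simp: isopath_def)
  then show thesis using that[of "k t"] k(3) t by simp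
qed

lemma deformation:
  obtains \<rho> where "homotopic_with (\<lambda>_. True) (subtopology M (topspace M - Cut)) M (\<lambda>x. x) \<rho>"
    "\<rho> ` (topspace M - Cut) \<subseteq> N"
proof -
  let ?Y = "subtopology M (topspace M - Cut)"
  let ?P = "prod_topology (top_of_set {0..1::real}) ?Y"
  \<comment> \<open>\<open>\<Gamma> ((t, x), z)\<close> says that \<open>z\<close> lies on a minimal
    path from \<open>N\<close> to \<open>x\<close>, at the fraction \<open>1 - t\<close> of its
    length. So time 0 gives \<open>x\<close> and time 1 a point of \<open>N\<close>; the choice made
    by \<open>SOME\<close> below is forced by \<open>unique_between\<close>.\<close>
  define \<Gamma> where "\<Gamma> = (\<lambda>q::(real \<times> 'a) \<times> 'a. dN (snd q) + rd (snd q) (snd (fst q)) = dN (snd (fst q)) \<and> dN (snd q) = (1 - fst (fst q)) * dN (snd (fst q)))"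
  define H where "H = (\<lambda>q::real \<times> 'a. SOME z. z \<in> topspace M \<and> \<Gamma> (q, z))"
  have P: "topspace ?P = {0..1} \<times> (topspace M - Cut)" by auto
  have H: "H q \<in> topspace M \<and> \<Gamma> (q, H q)" if "q \<in> topspace ?P" for q
    unfolding H_def
  proof (rule someI_ex)
    have q: "snd q \<in> topspace M" "0 \<le> fst q" "fst q \<le> 1" using that unfolding P by auto
    then have "0 \<le> (1 - fst q) * dN (snd q)" "(1 - fst q) * dN (snd q) \<le> dN (snd q)"
      using dN_nonneg[OF q(1)] by (auto simp: mult_left_le_one_le)
    then show "\<exists>z. z \<in> topspace M \<and> \<Gamma> (q, z)"
      by (rule ex_between_N[OF q(1)]) (auto simp: \<Gamma>_def)
  qed
  have uniq: "z = H q" if "q \<in> topspace ?P" "z \<in> topspace M" "\<Gamma> (q, z)" for q z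
    by (rule unique_between[of "snd q"]) (use H[OF that(1)] that in \<open>auto simp: \<Gamma>_def\<close>)
  let ?Q = "prod_topology ?P M"
  have cont: "continuous_map ?P M H"
    unfolding continuous_map_closedin
  proof (intro conjI ballI allI impI)
    show "H \<in> topspace ?P \<rightarrow> topspace M" using H by blast
    fix Z assume Z: "closedin M Z"
    have c1: "continuous_map ?Q M (\<lambda>q. snd q)" "continuous_map ?Q ?P fst" by (simp_all add: continuous_map_fst continuous_map_snd)
    have c2: "continuous_map ?Q M (\<lambda>q. snd (fst q))"
      using continuous_map_compose[OF c1(2) continuous_map_snd] by (simp add: o_def continuous_map_in_subtopology)
    have c3: "continuous_map ?Q euclideanreal (\<lambda>q. fst (fst q))"
      using continuous_map_compose[OF c1(2) continuous_map_fst] by (simp add: o_def continuous_map_in_subtopology)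
    have d1: "continuous_map ?Q euclideanreal (\<lambda>q. dN (snd q))" "continuous_map ?Q euclideanreal (\<lambda>q. dN (snd (fst q)))"
      using continuous_map_compose[OF c1(1) dN_continuous] continuous_map_compose[OF c2 dN_continuous] by (simp_all add: o_def)
    \<comment> \<open>The part of the graph over \<open>Z\<close>. The projection along the compact
      factor \<open>M\<close> is a closed map and sends it to the preimage of \<open>Z\<close> under
      \<open>H\<close>.\<close>
    let ?G = "{q \<in> topspace ?Q. dN (snd q) + rd (snd q) (snd (fst q)) - dN (snd (fst q)) \<in> {0}} \<inter>
       {q \<in> topspace ?Q. dN (snd q) - (1 - fst (fst q)) * dN (snd (fst q)) \<in> {0}} \<inter> {q \<in> topspace ?Q. snd q \<in> Z}"
    have "closedin ?Q ?G"
      by (intro closedin_Int closedin_continuous_map_preimage[where Y = euclideanreal] closedin_continuous_map_preimage[OF c1(1) Z]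
          continuous_map_diff continuous_map_add continuous_map_real_mult d1 continuous_map_rd c1(1) c2 c3) auto
    then have "closedin ?P (fst ` ?G)" using closed_map_fst[OF cpt] unfolding closed_map_def by blast
    moreover have "fst ` ?G = {q \<in> topspace ?P. H q \<in> Z}"
    proof (intro equalityI subsetI)
      fix q assume "q \<in> fst ` ?G"
      then obtain z where z: "q \<in> topspace ?P" "z \<in> topspace M" "\<Gamma> (q, z)" "z \<in> Z" by (auto simp: \<Gamma>_def)
      then show "q \<in> {q \<in> topspace ?P. H q \<in> Z}" using uniq[OF z(1-3)] by auto
    next
      fix q assume "q \<in> {q \<in> topspace ?P. H q \<in> Z}"
      then have "(q, H q) \<in> ?G" using H[of q] by (auto simp: \<Gamma>_def)
      then show "q \<in> fst ` ?G" by force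
    qed
    ultimately show "closedin ?P {q \<in> topspace ?P. H q \<in> Z}" by simp
  qed
  have "homotopic_with (\<lambda>_. True) ?Y M (\<lambda>x. x) (\<lambda>x. H (1, x))"
  proof (subst homotopic_with, simp, intro exI[of _ H] conjI cont ballI)
    fix x assume x: "x \<in> topspace ?Y"
    then have xM: "x \<in> topspace M" by auto
    have "\<Gamma> ((0, x), x)" by (simp add: \<Gamma>_def rd_self)
    then show "H (0, x) = x" using uniq[of "(0, x)" x] x by auto
  qed auto
  moreover have "H (1, x) \<in> N" if "x \<in> topspace M - Cut" for x
    using H[of "(1, x)"] that by (intro dN_zero) (auto simp: \<Gamma>_def)
  ultimately show thesis using that by blast
qed

end

section \<open>Categorical subsets\<close>

context compact_riemannian
begin

text \<open>The part of \<open>f\<close> with values in the box is extended by Tietze's theorem, one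
  coordinate at a time with values in an open interval, which is why cells are boxes. The result is
  pasted with \<open>f\<close> on \<open>B\<close>; it is defined on a whole neighbourhood
  \<open>Q\<close> of \<open>A\<close>.\<close>

lemma extend_over_cell:
  fixes X :: "'b topology"
  assumes X: "normal_space X" and B: "closedin X B" and f: "continuous_map (subtopology X B) M f"
    and C: "(U, \<phi>) \<in> \<A>" and box: "box a b \<subseteq> \<phi> ` U" "box a b \<noteq> {}"
    and A: "closedin X A" "A \<subseteq> B" "\<And>x. x \<in> A \<Longrightarrow> f x \<in> U \<and> \<phi> (f x) \<in> box a b"
  obtains B' Q f' where "closedin X B'" "B \<subseteq> B'" "openin X Q" "A \<subseteq> Q" "Q \<subseteq> B'"
    "continuous_map (subtopology X B') M f'" "\<And>x. x \<in> B \<Longrightarrow> f' x = f x"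
proof -
  let ?cell = "{x \<in> U. \<phi> x \<in> box a b}"
  have BX: "B \<subseteq> topspace X" using closedin_subset[OF B] .
  have "openin (subtopology X B) {x \<in> topspace (subtopology X B). f x \<in> ?cell}"
    by (rule openin_continuous_map_preimage[OF f chart_preimage_open[OF C open_box]])
  \<comment> \<open>\<open>O'\<close> is open in all of \<open>X\<close>. Normality puts the closure
    of some open \<open>Q\<close> between \<open>A\<close> and \<open>O'\<close>, so that
    \<open>?D\<close>, the overlap of this closure with \<open>B\<close>, is mapped into the
    cell.\<close>
  then obtain O' where O': "openin X O'" "{x \<in> topspace (subtopology X B). f x \<in> ?cell} = O' \<inter> B"
    unfolding openin_subtopology by blast
  have "A \<subseteq> O'" using A(2,3) BX O'(2) by auto
  then obtain Q where Q: "openin X Q" "A \<subseteq> Q" "X closure_of Q \<subseteq> O'"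
    using X A(1) O'(1) unfolding normal_space_alt by metis
  let ?cQ = "X closure_of Q"
  let ?D = "?cQ \<inter> B"
  have D: "closedin X ?D" by (rule closedin_Int[OF closedin_closure_of B])
  have fD: "f x \<in> U" "\<phi> (f x) \<in> box a b" if "x \<in> ?D" for x
  proof -
    have "x \<in> {x \<in> topspace (subtopology X B). f x \<in> ?cell}" using that Q(3) unfolding O'(2) by blast
    then show "f x \<in> U" "\<phi> (f x) \<in> box a b" by auto
  qed
  have "continuous_map (subtopology X ?D) (subtopology M U) f"
    by (intro continuous_map_into_subtopology continuous_map_from_subtopology_mono[OF f]) (use fD in auto)
  then have "continuous_map (subtopology X ?D) euclidean (\<phi> \<circ> f)"
    by (rule continuous_map_compose[OF _ chart_continuous[OF C]])
  then have c: "continuous_map (subtopology X ?D) euclideanreal (\<lambda>x. \<phi> (f x) \<bullet> e)" for e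
    by (auto simp: continuous_map_atin o_def intro: tendsto_inner)
  define P where "P = (\<lambda>e k. continuous_map X euclideanreal k \<and> k ` topspace X \<subseteq> {a \<bullet> e<..<b \<bullet> e} \<and> (\<forall>x\<in>?D. k x = \<phi> (f x) \<bullet> e))"
  have ex: "\<exists>k. P e k"
    if e: "e \<in> Basis" for e
  proof (rule Tietze_extension_realinterval[OF X D _ _ c[of e]])
    show "is_interval {a \<bullet> e<..<b \<bullet> e}" by (rule is_interval_oo)
    show "{a \<bullet> e<..<b \<bullet> e} \<noteq> {}" using box(2) e by (auto simp: box_eq_empty not_le)
    show "(\<lambda>x. \<phi> (f x) \<bullet> e) ` ?D \<subseteq> {a \<bullet> e<..<b \<bullet> e}" using fD(2) e by (auto simp: mem_box)
    fix k assume "continuous_map X euclideanreal k" "k ` topspace X \<subseteq> {a \<bullet> e<..<b \<bullet> e}" "\<And>x. x \<in> ?D \<Longrightarrow> k x = \<phi> (f x) \<bullet> e"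
    then show ?thesis unfolding P_def by (intro exI[of _ k] conjI ballI)
  qed
  define k where "k = (\<lambda>e. SOME k. P e k)"
  have "P e (k e)" if "e \<in> Basis" for e unfolding k_def by (rule someI_ex[OF ex[OF that]])
  then have k: "\<And>e. e \<in> Basis \<Longrightarrow> continuous_map X euclideanreal (k e)"
      "\<And>e x. e \<in> Basis \<Longrightarrow> x \<in> topspace X \<Longrightarrow> k e x \<in> {a \<bullet> e<..<b \<bullet> e}"
      "\<And>e x. e \<in> Basis \<Longrightarrow> x \<in> ?D \<Longrightarrow> k e x = \<phi> (f x) \<bullet> e"
    unfolding P_def by blast+
  define h where "h = (\<lambda>x. \<Sum>e\<in>Basis. k e x *\<^sub>R e)"
  have hc: "continuous_map X euclidean h"
    unfolding h_def continuous_map_atin limitin_canonical_iff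
    by (intro ballI tendsto_sum tendsto_scaleR tendsto_const) (use k(1) in \<open>auto simp: continuous_map_atin\<close>)
  have hbox: "h x \<in> box a b" if "x \<in> topspace X" for x
    unfolding mem_box using k(2)[OF _ that] by (auto simp: h_def inner_sum_left_Basis)
  have hD: "h x = \<phi> (f x)" if "x \<in> ?D" for x
    unfolding h_def using k(3)[OF _ that] by (simp add: euclidean_representation)
  define f' where "f' = (\<lambda>x. if x \<in> B then f x else inv_into U \<phi> (h x))"
  have eq: "f x = inv_into U \<phi> (h x)" if "x \<in> ?D" for x
    using fD(1)[OF that] hD[OF that] C by simp
  have "continuous_map X (top_of_set (\<phi> ` U)) h"
    by (rule continuous_map_into_subtopology[OF hc]) (use hbox box(1) in blast)
  from continuous_map_compose[OF this chart_inv_continuous[OF C]]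
  have gc: "continuous_map X M (\<lambda>x. inv_into U \<phi> (h x))"
    by (simp add: o_def continuous_map_in_subtopology)
  let ?Y = "subtopology X (B \<union> ?cQ)"
  have "continuous_map ?Y M f'"
  proof (rule pasting_lemma_closed[where I = "UNIV::bool set" and T = "\<lambda>i. if i then B else ?cQ" and f = "\<lambda>i. if i then f else (\<lambda>x. inv_into U \<phi> (h x))"])
    fix i :: bool
    have "closedin ?Y S" if "closedin X S" "S \<subseteq> B \<union> ?cQ" for S
      using closedin_subset_topspace[OF that] by simp
    then show "closedin ?Y (if i then B else ?cQ)" using B by auto
    show "continuous_map (subtopology ?Y (if i then B else ?cQ)) M (if i then f else (\<lambda>x. inv_into U \<phi> (h x)))"
      using continuous_map_from_subtopology_mono[OF f, of "(B \<union> ?cQ) \<inter> B"] continuous_map_from_subtopology[OF gc]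
      by (simp add: subtopology_subtopology)
  next
    fix i j x assume "x \<in> topspace ?Y \<inter> (if i then B else ?cQ) \<inter> (if j then B else ?cQ)"
    then show "(if i then f else (\<lambda>x. inv_into U \<phi> (h x))) x = (if j then f else (\<lambda>x. inv_into U \<phi> (h x))) x"
      using eq[of x] by (auto split: if_splits)
  next
    fix x assume "x \<in> topspace ?Y"
    then show "\<exists>j. j \<in> UNIV \<and> x \<in> (if j then B else ?cQ) \<and> f' x = (if j then f else (\<lambda>x. inv_into U \<phi> (h x))) x"
      by (intro exI[of _ "x \<in> B"]) (auto simp: f'_def)
  qed simp
  moreover have "closedin X (B \<union> ?cQ)" by (rule closedin_Un[OF B closedin_closure_of])
  moreover have "Q \<subseteq> B \<union> ?cQ" using closure_of_subset[OF openin_subset[OF Q(1)]] by blast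
  ultimately show thesis using Q(1,2) by (intro that[of "B \<union> ?cQ" Q f']) (auto simp: f'_def)
qed

text \<open>The copy of a compact smaller box is closed in all of \<open>M\<close>, not just in the
  chart domain, and leaves room inside the open box.\<close>

lemma ex_cell:
  assumes p: "p \<in> topspace M"
  obtains U \<phi> a b K C where "(U, \<phi>) \<in> \<A>" "box a b \<subseteq> \<phi> ` U" "box a b \<noteq> {}" "closedin M K"
    "K \<subseteq> {x \<in> U. \<phi> x \<in> box a b}" "openin M C" "p \<in> C" "C \<subseteq> K"
proof -
  obtain U \<phi> where C: "(U, \<phi>) \<in> \<A>" "p \<in> U" by (rule chart_cover[OF p])
  have pU: "\<phi> p \<in> \<phi> ` U" using C(2) by blast
  obtain a b where ab: "cbox a b \<subseteq> \<phi> ` U" "\<phi> p \<in> box a b" by (rule open_contains_cbox[OF is_chartD(2)[OF C(1)] pU])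
  obtain c d where cd: "cbox c d \<subseteq> box a b" "\<phi> p \<in> box c d" by (rule open_contains_cbox[OF open_box ab(2)])
  have abU: "box a b \<subseteq> \<phi> ` U" using ab(1) box_subset_cbox by blast
  let ?K = "inv_into U \<phi> ` cbox c d"
  have "continuous_map (top_of_set (\<phi> ` U)) M (inv_into U \<phi>)"
    using chart_inv_continuous[OF C(1)] by (simp add: continuous_map_in_subtopology)
  moreover have "compactin (top_of_set (\<phi> ` U)) (cbox c d)"
    using cd(1) abU by (simp add: compactin_subtopology)
  ultimately have "compactin M ?K" by (rule image_compactin[rotated])
  then have K: "closedin M ?K" by (rule compactin_imp_closedin[OF Hausdorff])
  have KU: "?K \<subseteq> {x \<in> U. \<phi> x \<in> box a b}"
  proof
    fix x assume "x \<in> ?K"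
    then obtain y where y: "y \<in> cbox c d" "x = inv_into U \<phi> y" by blast
    then have "y \<in> \<phi> ` U" "y \<in> box a b" using cd(1) abU by auto
    then show "x \<in> {x \<in> U. \<phi> x \<in> box a b}" using y(2) by (simp add: inv_into_into f_inv_into_f)
  qed
  have CK: "{x \<in> U. \<phi> x \<in> box c d} \<subseteq> ?K"
  proof
    fix x assume "x \<in> {x \<in> U. \<phi> x \<in> box c d}"
    then have "x = inv_into U \<phi> (\<phi> x)" "\<phi> x \<in> cbox c d" using C(1) box_subset_cbox by auto
    then show "x \<in> ?K" by blast
  qed
  show thesis
    by (rule that[OF C(1) abU _ K KU chart_preimage_open[OF C(1) open_box] _ CK]) (use ab(2) cd(2) C(2) in auto)
qed

text \<open>The closed set selects the points to be treated in one extension step, the surrounding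
  open box is the target of that extension.\<close>

definition cell :: "'a set \<Rightarrow> bool" where
  "cell K \<longleftrightarrow> closedin M K \<and> (\<exists>U \<phi> a b. (U, \<phi>) \<in> \<A> \<and> box a b \<subseteq> \<phi> ` U \<and> box a b \<noteq> {} \<and> K \<subseteq> {x \<in> U. \<phi> x \<in> box a b})"

lemma finite_cell_cover:
  obtains \<F> where "finite \<F>" "\<And>K. K \<in> \<F> \<Longrightarrow> cell K" "topspace M \<subseteq> \<Union>\<F>"
proof -
  let ?\<U> = "{C. openin M C \<and> (\<exists>K. cell K \<and> C \<subseteq> K)}"
  have "topspace M \<subseteq> \<Union>?\<U>"
  proof
    fix p assume p: "p \<in> topspace M"
    show "p \<in> \<Union>?\<U>"
    proof (rule ex_cell[OF p])
      fix U \<phi> a b K C assume *: "(U, \<phi>) \<in> \<A>" "box a b \<subseteq> \<phi> ` U" "box a b \<noteq> {}" "closedin M K"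
        "K \<subseteq> {x \<in> U. \<phi> x \<in> box a b}" and C: "openin M C" "p \<in> C" "C \<subseteq> K"
      have "cell K" unfolding cell_def using *
        by (intro conjI exI[of _ U] exI[of _ \<phi>] exI[of _ a] exI[of _ b])
      then have "C \<in> ?\<U>" using C(1,3) by (intro CollectI conjI exI[of _ K])
      then show ?thesis using C(2) by (rule UnionI)
    qed
  qed
  then obtain \<C> where \<C>: "finite \<C>" "\<C> \<subseteq> ?\<U>" "topspace M \<subseteq> \<Union>\<C>"
    using cpt[unfolded compact_space_alt, rule_format, of ?\<U>] by blast
  have "\<forall>C\<in>\<C>. \<exists>K. cell K \<and> C \<subseteq> K" using \<C>(2) by blast
  then obtain k where k: "\<And>C. C \<in> \<C> \<Longrightarrow> cell (k C) \<and> C \<subseteq> k C" by metis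
  show thesis
  proof (rule that[of "k ` \<C>"])
    show "topspace M \<subseteq> \<Union>(k ` \<C>)" using \<C>(3) k by blast
  qed (use \<C>(1) k in auto)
qed

text \<open>\<open>M\<close> is an absolute neighbourhood extensor for normal spaces.\<close>

lemma neighbourhood_extension:
  fixes X :: "'b topology"
  assumes X: "normal_space X" and A: "closedin X A" and f: "continuous_map (subtopology X A) M f"
  obtains V f' where "openin X V" "A \<subseteq> V" "continuous_map (subtopology X V) M f'" "\<And>x. x \<in> A \<Longrightarrow> f' x = f x"
proof (rule finite_cell_cover)
  fix \<F> assume \<F>: "finite \<F>" "\<And>K. K \<in> \<F> \<Longrightarrow> cell K" "topspace M \<subseteq> \<Union>\<F>"
  have AX: "A \<subseteq> topspace X" using closedin_subset[OF A] .
  \<comment> \<open>After the cells in \<open>\<F>\<close> have been treated, \<open>f'\<close>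
    lives on the closed set \<open>B\<close>, and \<open>V\<close> is an open part of
    \<open>B\<close> containing every point of \<open>A\<close> that is sent into one of these
    cells. The next step starts from a closed domain whereas the final domain has to be open; hence
    both sets are carried along.\<close>
  have "\<exists>B V f'. closedin X B \<and> A \<subseteq> B \<and> openin X V \<and> V \<subseteq> B \<and> continuous_map (subtopology X B) M f' \<and>
    (\<forall>x\<in>A. f' x = f x \<and> (f x \<in> \<Union>\<F> \<longrightarrow> x \<in> V))"
    using \<F>(1,2)
  proof (induction \<F> rule: finite_induct)
    case empty
    show ?case using A f by (intro exI[of _ A] exI[of _ "{}"] exI[of _ f]) auto
  next
    case (insert K \<F>)
    obtain B V f' where B: "closedin X B" "A \<subseteq> B" "openin X V" "V \<subseteq> B" "continuous_map (subtopology X B) M f'"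
      and f': "\<And>x. x \<in> A \<Longrightarrow> f' x = f x" "\<And>x. x \<in> A \<Longrightarrow> f x \<in> \<Union>\<F> \<Longrightarrow> x \<in> V"
      using insert.IH insert.prems by auto
    have "cell K" using insert.prems by blast
    then obtain U \<phi> a b where K: "closedin M K" "(U, \<phi>) \<in> \<A>" "box a b \<subseteq> \<phi> ` U" "box a b \<noteq> {}" "K \<subseteq> {x \<in> U. \<phi> x \<in> box a b}"
      unfolding cell_def by blast
    let ?A = "{x \<in> topspace (subtopology X A). f x \<in> K}"
    have "closedin (subtopology X A) ?A" by (rule closedin_continuous_map_preimage[OF f K(1)])
    then have A': "closedin X ?A" using A by (rule closedin_trans_full)
    have AB: "?A \<subseteq> B" using B(2) by auto
    have cellA: "f' x \<in> U \<and> \<phi> (f' x) \<in> box a b" if "x \<in> ?A" for x using that K(5) f'(1) by auto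
    show ?case
    proof (rule extend_over_cell[OF X B(1,5) K(2,3,4) A' AB cellA], assumption)
      fix B' Q f'' assume B': "closedin X B'" "B \<subseteq> B'" "openin X Q" "?A \<subseteq> Q" "Q \<subseteq> B'"
        "continuous_map (subtopology X B') M f''" "\<And>x. x \<in> B \<Longrightarrow> f'' x = f' x"
      have "\<forall>x\<in>A. f'' x = f x \<and> (f x \<in> \<Union>(insert K \<F>) \<longrightarrow> x \<in> V \<union> Q)"
        using B'(4,7) B(2) f' AX by auto
      then show ?case using B' B by (intro exI[of _ B'] exI[of _ "V \<union> Q"] exI[of _ f'']) auto
    qed
  qed
  then obtain B V f' where B: "A \<subseteq> B" "openin X V" "V \<subseteq> B" "continuous_map (subtopology X B) M f'"
    and f': "\<And>x. x \<in> A \<Longrightarrow> f' x = f x \<and> (f x \<in> \<Union>\<F> \<longrightarrow> x \<in> V)" by auto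
  have "f x \<in> topspace M" if "x \<in> A" for x using f AX that unfolding continuous_map_def by auto
  then have "A \<subseteq> V" using f' \<F>(3) by blast
  then show thesis using that[OF B(2) _ continuous_map_from_subtopology_mono[OF B(4,3)]] f' by blast
qed


text \<open>The function is half the distance of \<open>(x, 0)\<close> from the complement of
  \<open>O'\<close>, measured by \<open>rd x y + t\<close> and capped at 1. The infimum is
  1-Lipschitz in \<open>x\<close>, and halving puts \<open>(x, s x)\<close> closer to
  \<open>(x, 0)\<close> than the complement.\<close>

lemma open_collar:
  assumes O': "openin (prod_topology M (top_of_set {0..1::real})) O'"
  obtains s where "continuous_map M euclideanreal s" "\<And>x. x \<in> topspace M \<Longrightarrow> (x, 0) \<in> O' \<Longrightarrow> 0 < s x"
    "\<And>x. x \<in> topspace M \<Longrightarrow> 0 < s x \<Longrightarrow> s x \<le> 1 \<and> (x, s x) \<in> O'"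
proof -
  define S where "S = (\<lambda>x. insert 1 {rd x y + t | y t. y \<in> topspace M \<and> 0 \<le> t \<and> t \<le> 1 \<and> (y, t) \<notin> O'})"
  have bdd: "bdd_below (S x)" for x
    by (rule bdd_belowI[of _ 0]) (use rd_nonneg in \<open>auto simp: S_def intro: add_nonneg_nonneg\<close>)
  have ne: "S x \<noteq> {}" for x by (simp add: S_def)
  have S1: "Inf (S x) \<le> 1" for x by (rule cInf_lower[OF _ bdd]) (simp add: S_def)
  have "Inf (S x) \<le> rd x z + Inf (S z)" if x: "x \<in> topspace M" and z: "z \<in> topspace M" for x z
  proof -
    have "Inf (S x) - rd x z \<le> Inf (S z)"
    proof (rule cInf_greatest[OF ne])
      fix l assume "l \<in> S z"
      then consider "l = 1" | y t where "l = rd z y + t" "y \<in> topspace M" "0 \<le> t" "t \<le> 1" "(y, t) \<notin> O'" by (auto simp: S_def)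
      then show "Inf (S x) - rd x z \<le> l"
      proof cases
        case 1 then show ?thesis using S1[of x] rd_nonneg[of x z] by linarith
      next
        case 2
        then have "Inf (S x) \<le> rd x y + t" by (intro cInf_lower[OF _ bdd]) (auto simp: S_def)
        then show ?thesis using rd_triangle[OF x z 2(2)] 2(1) by linarith
      qed
    qed
    then show ?thesis by simp
  qed
  then have "continuous_map M euclideanreal (\<lambda>x. Inf (S x))" by (rule nonexpansive_continuous)
  then have c: "continuous_map M euclideanreal (\<lambda>x. Inf (S x) * (1 / 2))"
    by (rule continuous_map_real_mult) simp
  show thesis
  proof (rule that[OF c])
    fix x assume x: "x \<in> topspace M" "(x, 0) \<in> O'"
    obtain A B where AB: "openin M A" "openin (top_of_set {0..1::real}) B" "x \<in> A" "0 \<in> B" "A \<times> B \<subseteq> O'"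
      using O'[unfolded openin_prod_topology_alt, rule_format, OF x(2)] by (elim exE conjE) (rule that)
    have "openin mtopology A" using AB(1) by (simp only: mtopology_eq)
    then obtain e where e: "e > 0" "mball x e \<subseteq> A" using AB(3) unfolding openin_mtopology by blast
    obtain d where d: "d > 0" "ball 0 d \<inter> {0..1} \<subseteq> B" using AB(2,4) unfolding openin_contains_ball by blast
    have "min 1 (min e d) \<le> Inf (S x)"
    proof (rule cInf_greatest[OF ne])
      fix l assume "l \<in> S x"
      then consider "l = 1" | y t where "l = rd x y + t" "y \<in> topspace M" "0 \<le> t" "t \<le> 1" "(y, t) \<notin> O'" by (auto simp: S_def)
      then show "min 1 (min e d) \<le> l"
      proof cases
        case 2
        have "\<not> (rd x y < e \<and> t < d)"
        proof
          assume "rd x y < e \<and> t < d"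
          then have "y \<in> A" "t \<in> B" using e(2) d(2) 2(2-4) x(1) by auto
          then show False using AB(5) 2(5) by blast
        qed
        then show ?thesis using 2(1,3) rd_nonneg[of x y] by linarith
      qed simp
    qed
    then show "0 < Inf (S x) * (1 / 2)" using e(1) d(1) by linarith
  next
    fix x assume x: "x \<in> topspace M" and pos: "0 < Inf (S x) * (1 / 2)"
    let ?t = "Inf (S x) * (1 / 2)"
    have t: "0 \<le> ?t" "?t \<le> 1" using pos S1[of x] by linarith+
    have "(x, ?t) \<in> O'"
    proof (rule ccontr)
      assume "(x, ?t) \<notin> O'"
      then have "rd x x + ?t \<in> S x" using x t unfolding S_def by blast
      then have "Inf (S x) \<le> rd x x + ?t" by (rule cInf_lower[OF _ bdd])
      then show False using pos rd_self[of x] by linarith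
    qed
    then show "?t \<le> 1 \<and> (x, ?t) \<in> O'" using t by simp
  qed
qed

text \<open>Covers pulled back to the complement of the cut locus are not known to be open in
  \<open>M\<close>, so the notion is kept free of openness; \<open>categorical_thicken\<close>
  restores it.\<close>

definition categorical :: "'a set \<Rightarrow> bool" where
  "categorical V \<longleftrightarrow> V \<subseteq> topspace M \<and>
     (\<exists>c\<in>topspace M. homotopic_with (\<lambda>_. True) (subtopology M V) M (\<lambda>x. x) (\<lambda>_. c))"

text \<open>A contraction of \<open>V\<close> is extended over a neighbourhood of \<open>V \<times> {0}\<close> in
  \<open>V \<times> {0} \<union> M \<times> (0,1]\<close>, and the extension is restricted to the graph of a positive function.\<close>

lemma categorical_thicken:
  assumes V: "categorical V"
  obtains W where "openin M W" "V \<subseteq> W" "categorical W"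
proof -
  obtain c where VM: "V \<subseteq> topspace M" and c: "c \<in> topspace M"
    and hom: "homotopic_with (\<lambda>_. True) (subtopology M V) M (\<lambda>x. x) (\<lambda>_. c)"
    using V unfolding categorical_def by blast
  let ?I = "top_of_set {0..1::real}"
  obtain H where H: "continuous_map (prod_topology ?I (subtopology M V)) M H" "\<And>x. H (0, x) = x" "\<And>x. H (1, x) = c"
    using hom unfolding homotopic_with_def by blast
  \<comment> \<open>Level 0 keeps only the points over \<open>V\<close>. The copy of
    \<open>V\<close> at level 0 is therefore closed in \<open>Y\<close>, whatever the set
    \<open>V\<close> is, and \<open>neighbourhood_extension\<close> starts from a closed
    set.\<close>
  define Y where "Y = {q::'a \<times> real. snd q = 0 \<longrightarrow> fst q \<in> V}"
  let ?Y = "subtopology (prod_topology M ?I) Y"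
  let ?X = "prod_topology ?I ?Y"
  have tX: "q \<in> topspace ?X \<longleftrightarrow> fst q \<in> {0..1} \<and> fst (snd q) \<in> topspace M \<and> snd (snd q) \<in> {0..1} \<and> (snd (snd q) = 0 \<longrightarrow> fst (snd q) \<in> V)" for q
    by (cases q) (auto simp: Y_def)
  have mI: "metrizable_space ?I" by (rule metrizable_space_subtopology[OF metrizable_space_euclidean])
  have "metrizable_space M" using metrizable_space_mtopology unfolding mtopology_eq .
  then have "metrizable_space ?Y"
    using mI by (intro metrizable_space_subtopology) (simp add: metrizable_space_prod_topology)
  then have "metrizable_space ?X" using mI by (simp add: metrizable_space_prod_topology)
  then have X: "normal_space ?X" by (rule metrizable_imp_normal_space)
  have p1: "continuous_map ?X euclideanreal fst"
    using continuous_map_fst[of ?I ?Y] by (simp add: continuous_map_in_subtopology)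
  have pY: "continuous_map ?X (prod_topology M ?I) snd"
    using continuous_map_snd[of ?I ?Y] by (simp add: continuous_map_in_subtopology)
  have p2: "continuous_map ?X M (\<lambda>q. fst (snd q))"
    using continuous_map_compose[OF pY continuous_map_fst] by (simp add: o_def)
  have p3: "continuous_map ?X euclideanreal (\<lambda>q. snd (snd q))"
    using continuous_map_compose[OF pY continuous_map_snd] by (simp add: o_def continuous_map_in_subtopology)
  \<comment> \<open>The map to be extended is the contraction \<open>H\<close> on level 0, the
    projection to \<open>M\<close> at time 0 and the constant \<open>c\<close> at time 1. Both ends
    are prescribed over all of \<open>Y\<close>, so that the extension is again a homotopy from the
    identity to \<open>c\<close>.\<close>
  define T where "T = (\<lambda>i::nat. if i = 0 then {q \<in> topspace ?X. snd (snd q) \<in> {0}} else if i = 1 then {q \<in> topspace ?X. fst q \<in> {0}}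
      else {q \<in> topspace ?X. fst q \<in> {1}})"
  have T: "q \<in> T 0 \<longleftrightarrow> snd (snd q) = 0" "q \<in> T 1 \<longleftrightarrow> fst q = 0" "q \<in> T 2 \<longleftrightarrow> fst q = 1" if "q \<in> topspace ?X" for q
    using that unfolding T_def by (simp_all del: topspace_prod_topology topspace_subtopology)
  define f where "f = (\<lambda>(i::nat) (q::real \<times> 'a \<times> real). if i = 0 then H (fst q, fst (snd q)) else if i = 1 then fst (snd q) else c)"
  define f0 where "f0 = (\<lambda>q. if snd (snd q) = 0 then f 0 q else if fst q = 0 then f 1 q else f 2 q)"
  let ?A = "T 0 \<union> T 1 \<union> T 2"
  have cl: "closedin ?X {q \<in> topspace ?X. snd (snd q) \<in> {0}}" "closedin ?X {q \<in> topspace ?X. fst q \<in> {z}}" for z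
    by (rule closedin_continuous_map_preimage[OF p3] closedin_continuous_map_preimage[OF p1], simp)+
  have Tcl: "closedin ?X (T i)" for i
    unfolding T_def by (cases "i = 0"; cases "i = 1") (simp_all only: simp_thms if_True if_False cl)
  then have A: "closedin ?X ?A" by (intro closedin_Un)
  have "continuous_map (subtopology ?X (T 0)) (prod_topology ?I (subtopology M V)) (\<lambda>q. (fst q, fst (snd q)))"
    unfolding continuous_map_pairwise o_def fst_conv snd_conv
    by (intro conjI continuous_map_into_subtopology continuous_map_from_subtopology[OF p1] continuous_map_from_subtopology[OF p2])
       (auto simp: T_def Y_def)
  from continuous_map_compose[OF this H(1)]
  have fc: "continuous_map (subtopology ?X (T i)) M (f i)" for i
    using continuous_map_from_subtopology[OF p2, of "T 1"] c by (auto simp: f_def T_def o_def)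
  have "continuous_map (subtopology ?X ?A) M f0"
  proof (rule pasting_lemma_closed[where I = "{0,1,2}" and T = T and f = f])
    fix i :: nat assume i: "i \<in> {0,1,2}"
    then have Ti: "T i \<subseteq> ?A" by auto
    then show "closedin (subtopology ?X ?A) (T i)" using Tcl by (rule closedin_subset_topspace[rotated])
    have "?A \<inter> T i = T i" using Ti by blast
    then show "continuous_map (subtopology (subtopology ?X ?A) (T i)) M (f i)" using fc by (simp add: subtopology_subtopology)
  next
    fix i j :: nat and q assume "i \<in> {0,1,2}" "j \<in> {0,1,2}" "q \<in> topspace (subtopology ?X ?A) \<inter> T i \<inter> T j"
    then show "f i q = f j q" using H(2,3) by (auto simp: f_def T_def)
  next
    fix q assume "q \<in> topspace (subtopology ?X ?A)"
    then have "q \<in> ?A" by simp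
    then have d: "q \<in> T 0 \<or> q \<in> T 1 \<or> q \<in> T 2" and q: "q \<in> topspace ?X" using closedin_subset[OF A] by blast+
    show "\<exists>j. j \<in> {0,1,2} \<and> q \<in> T j \<and> f0 q = f j q"
    proof (cases "snd (snd q) = 0")
      case True
      then show ?thesis using T(1)[OF q] by (intro exI[of _ 0]) (simp add: f0_def)
    next
      case False
      then have n: "q \<in> T 1 \<or> q \<in> T 2" using T(1)[OF q] d by blast
      show ?thesis
      proof (cases "fst q = 0")
        case True
        then show ?thesis using T(2)[OF q] False by (intro exI[of _ 1]) (simp add: f0_def)
      next
        case False
        then have "q \<in> T 2" using n T(2)[OF q] by blast
        then show ?thesis using False \<open>snd (snd q) \<noteq> 0\<close> by (intro exI[of _ 2]) (simp add: f0_def)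
      qed
    qed
  qed simp
  then obtain G F where G: "openin ?X G" "?A \<subseteq> G" "continuous_map (subtopology ?X G) M F" "\<And>q. q \<in> ?A \<Longrightarrow> F q = f0 q"
    by (rule neighbourhood_extension[OF X A]) (rule that)
  \<comment> \<open>The points of \<open>Y\<close> near which the extension exists for all times in
    \<open>{0..1}\<close>. The union makes this an open set, and the tube lemma shows that it
    contains level 0 over \<open>V\<close>.\<close>
  define \<T> where "\<T> = \<Union>{B. openin ?Y B \<and> {0..1} \<times> B \<subseteq> G}"
  have "openin ?Y \<T>" unfolding \<T>_def by (rule openin_Union) blast
  then obtain O' where O': "openin (prod_topology M ?I) O'" "\<T> = O' \<inter> Y" unfolding openin_subtopology by blast
  have \<T>G: "(r, y) \<in> G" if "r \<in> {0..1}" "y \<in> \<T>" for r y using that unfolding \<T>_def by blast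
  have V0: "(x, 0) \<in> O'" if x: "x \<in> V" for x
  proof -
    have xY: "(x, 0) \<in> topspace ?Y" using x VM by (auto simp: Y_def)
    have "{0..1} \<times> {(x, 0)} \<subseteq> T 0" using x VM tX by (auto simp: T_def Y_def)
    then have sub: "{0..1} \<times> {(x, 0)} \<subseteq> G" using G(2) by blast
    have "compactin ?I {0..1}" by (simp add: compactin_subtopology)
    from tube_lemma_left[OF G(1) this xY sub]
    obtain A' B where "{0..1} \<subseteq> A'" "openin ?Y B" "(x, 0) \<in> B" "A' \<times> B \<subseteq> G" by blast
    then have "(x, 0) \<in> \<T>" unfolding \<T>_def by blast
    then show ?thesis using O'(2) by blast
  qed
  obtain s where s: "continuous_map M euclideanreal s" "\<And>x. x \<in> topspace M \<Longrightarrow> (x, 0) \<in> O' \<Longrightarrow> 0 < s x"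
    "\<And>x. x \<in> topspace M \<Longrightarrow> 0 < s x \<Longrightarrow> s x \<le> 1 \<and> (x, s x) \<in> O'"
    by (rule open_collar[OF O'(1)]) (rule that)
  \<comment> \<open>Over \<open>W\<close> the graph of \<open>s\<close> runs above level 0, hence
    inside \<open>Y\<close>, and through the region where the extension exists for all
    times.\<close>
  define W where "W = {x \<in> topspace M. s x \<in> {0<..}}"
  have W: "openin M W" unfolding W_def by (rule openin_continuous_map_preimage[OF s(1)]) simp
  have WG: "(r, x, s x) \<in> G" "(r, x, s x) \<in> topspace ?X" if "r \<in> {0..1}" "x \<in> W" for r x
  proof -
    have x: "x \<in> topspace M" "0 < s x" using that(2) by (auto simp: W_def)
    then have "(x, s x) \<in> \<T>" using s(3)[OF x] unfolding O'(2) by (auto simp: Y_def)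
    then show "(r, x, s x) \<in> G" using \<T>G that(1) by blast
    then show "(r, x, s x) \<in> topspace ?X" using openin_subset[OF G(1)] by blast
  qed
  let ?P = "prod_topology ?I (subtopology M W)"
  have q2: "continuous_map ?P M snd"
    using continuous_map_snd[of ?I "subtopology M W"] by (simp add: continuous_map_in_subtopology)
  have q3: "continuous_map ?P euclideanreal (\<lambda>q. s (snd q))"
    using continuous_map_compose[OF q2 s(1)] by (simp add: o_def)
  have sW: "0 < s x" "s x \<le> 1" if "x \<in> W" for x using that s(3) by (auto simp: W_def)
  have "continuous_map ?P (prod_topology M ?I) (\<lambda>q. (snd q, s (snd q)))"
    unfolding continuous_map_pairwise o_def fst_conv snd_conv
    by (intro conjI q2 continuous_map_into_subtopology q3) (use sW in \<open>auto simp: less_imp_le\<close>)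
  then have "continuous_map ?P ?Y (\<lambda>q. (snd q, s (snd q)))"
    by (rule continuous_map_into_subtopology) (auto simp: Y_def dest: sW(1))
  then have "continuous_map ?P ?X (\<lambda>q. (fst q, snd q, s (snd q)))"
    by (subst continuous_map_pairwise) (simp add: o_def continuous_map_fst)
  then have "continuous_map ?P (subtopology ?X G) (\<lambda>q. (fst q, snd q, s (snd q)))"
    by (rule continuous_map_into_subtopology) (use WG(1) in auto)
  from continuous_map_compose[OF this G(3)]
  have K: "continuous_map ?P M (\<lambda>q. F (fst q, snd q, s (snd q)))" by (simp add: o_def)
  have "homotopic_with (\<lambda>_. True) (subtopology M W) M (\<lambda>x. x) (\<lambda>_. c)"
  proof (subst homotopic_with, simp, intro exI[of _ "\<lambda>q. F (fst q, snd q, s (snd q))"] conjI K ballI)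
    fix x assume "x \<in> topspace (subtopology M W)"
    then have x: "x \<in> W" "s x \<noteq> 0" by (auto simp: W_def)
    have t: "(0, x, s x) \<in> topspace ?X" "(1, x, s x) \<in> topspace ?X" by (rule WG(2)[OF _ x(1)], simp)+
    have "(0, x, s x) \<in> T 1" "(1, x, s x) \<in> T 2" unfolding T(2)[OF t(1)] T(3)[OF t(2)] by simp_all
    then have "F (0, x, s x) = f0 (0, x, s x)" "F (1, x, s x) = f0 (1, x, s x)" using G(4) by blast+
    then show "F (fst (0, x), snd (0, x), s (snd (0, x))) = x" "F (fst (1, x), snd (1, x), s (snd (1, x))) = c"
      using x(2) by (simp_all add: f0_def f_def)
  qed auto
  then have "categorical W" unfolding categorical_def using c W openin_subset by blast
  moreover have "V \<subseteq> W" using VM s(2) V0 by (auto simp: W_def)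
  ultimately show thesis using that W by blast
qed


section \<open>From categorical covers to the inequality\<close>

lemma Inf_enat_mem:
  assumes "Inf S = enat k" shows "enat k \<in> S"
proof -
  have "S \<noteq> {}" using assms by (auto simp: Inf_enat_def)
  then obtain m where "m \<in> S" by blast
  then have "(LEAST m. m \<in> S) \<in> S" by (rule LeastI)
  then show ?thesis using assms \<open>S \<noteq> {}\<close> by (simp add: Inf_enat_def)
qed

text \<open>Categorical sets of any kind will do, because \<open>categorical_thicken\<close>
  replaces each of them by an open one that contains it.\<close>

lemma ls_cat_le_categorical_cover:
  assumes U: "\<And>j. j \<le> k \<Longrightarrow> categorical (U j)" and cover: "topspace M \<subseteq> (\<Union>j\<le>k. U j)"
  shows "ls_cat M (topspace M) \<le> enat k"
proof -
  have "\<exists>W. openin M W \<and> U j \<subseteq> W \<and> categorical W" if "j \<le> k" for j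
    by (rule categorical_thicken[OF U[OF that]]) blast
  then obtain W where W: "\<And>j. j \<le> k \<Longrightarrow> openin M (W j) \<and> U j \<subseteq> W j \<and> categorical (W j)" by metis
  have "(\<Union>j\<le>k. W j) = topspace M" using W cover openin_subset[of M] by fastforce
  moreover have "openin (subtopology M (topspace M)) (W j)" if "j \<le> k" for j using W[OF that] by simp
  ultimately have "enat k \<in> enat ` {k. \<exists>U. (\<Union>j\<le>k. U j) = topspace M \<and>
      (\<forall>j\<le>k. openin (subtopology M (topspace M)) (U j) \<and>
         (\<exists>c\<in>topspace M. homotopic_with (\<lambda>_. True) (subtopology M (U j)) M (\<lambda>x. x) (\<lambda>_. c)))}"
    using W unfolding categorical_def by (intro imageI CollectI exI[of _ W]) blast
  then show ?thesis unfolding ls_cat_def by (rule Inf_lower)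
qed

lemma ls_cat_imp_categorical_cover:
  assumes k: "ls_cat M A = enat k" and A: "A \<subseteq> topspace M"
  obtains U where "(\<Union>j\<le>k. U j) = A" "\<And>j. j \<le> k \<Longrightarrow> categorical (U j)"
proof -
  let ?S = "enat ` {k. \<exists>U. (\<Union>j\<le>k. U j) = A \<and>
      (\<forall>j\<le>k. openin (subtopology M A) (U j) \<and>
         (\<exists>c\<in>topspace M. homotopic_with (\<lambda>_. True) (subtopology M (U j)) M (\<lambda>x. x) (\<lambda>_. c)))}"
  have "enat k \<in> ?S" by (rule Inf_enat_mem) (use k in \<open>simp only: ls_cat_def\<close>)
  then obtain U where U: "(\<Union>j\<le>k. U j) = A" "\<And>j. j \<le> k \<Longrightarrow>
      (\<exists>c\<in>topspace M. homotopic_with (\<lambda>_. True) (subtopology M (U j)) M (\<lambda>x. x) (\<lambda>_. c))" by auto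
  have "categorical (U j)" if "j \<le> k" for j unfolding categorical_def using U that A by blast
  then show thesis using that U(1) by blast
qed

end

context distance_to_closed
begin

text \<open>On the preimage the inclusion is homotopic in \<open>M\<close> to \<rho>, whose values
  lie in \<open>U\<close> and are therefore contracted to a point by the homotopy of
  \<open>U\<close>.\<close>

lemma categorical_pullback:
  assumes hom: "homotopic_with (\<lambda>_. True) (subtopology M (topspace M - Cut)) M (\<lambda>x. x) \<rho>" and U: "categorical U"
  shows "categorical {x \<in> topspace M - Cut. \<rho> x \<in> U}"
proof -
  let ?P = "{x \<in> topspace M - Cut. \<rho> x \<in> U}"
  obtain c where c: "c \<in> topspace M" "homotopic_with (\<lambda>_. True) (subtopology M U) M (\<lambda>x. x) (\<lambda>_. c)"
    using U unfolding categorical_def by blast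
  have "continuous_map (subtopology M ?P) (subtopology M (topspace M - Cut)) (\<lambda>x. x)"
    by (auto simp: continuous_map_in_subtopology)
  from homotopic_with_compose_continuous_map_right[OF hom this, of "\<lambda>_. True"]
  have 1: "homotopic_with (\<lambda>_. True) (subtopology M ?P) M (\<lambda>x. x) \<rho>" by (simp add: o_def)
  have "continuous_map (subtopology M ?P) M \<rho>" using homotopic_with_imp_continuous_maps[OF 1] by blast
  then have "continuous_map (subtopology M ?P) (subtopology M U) \<rho>"
    by (rule continuous_map_into_subtopology) auto
  from homotopic_with_compose_continuous_map_right[OF c(2) this, of "\<lambda>_. True"]
  have "homotopic_with (\<lambda>_. True) (subtopology M ?P) M \<rho> (\<lambda>_. c)" by (simp add: o_def)
  with 1 have "homotopic_with (\<lambda>_. True) (subtopology M ?P) M (\<lambda>x. x) (\<lambda>_. c)" by (rule homotopic_with_trans)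
  then show ?thesis unfolding categorical_def using c(1) by blast
qed

lemma ls_cat_bound: "ls_cat M (topspace M) \<le> ls_cat M N + ls_cat M Cut + 1"
proof (cases "ls_cat M N"; cases "ls_cat M Cut")
  fix k l assume k: "ls_cat M N = enat k" and l: "ls_cat M Cut = enat l"
  obtain U where U: "(\<Union>j\<le>k. U j) = N" "\<And>j. j \<le> k \<Longrightarrow> categorical (U j)"
    by (rule ls_cat_imp_categorical_cover[OF k N_sub]) (rule that)
  obtain V where V: "(\<Union>j\<le>l. V j) = Cut" "\<And>j. j \<le> l \<Longrightarrow> categorical (V j)"
    by (rule ls_cat_imp_categorical_cover[OF l Cut_sub]) (rule that)
  obtain \<rho> where \<rho>: "homotopic_with (\<lambda>_. True) (subtopology M (topspace M - Cut)) M (\<lambda>x. x) \<rho>" "\<rho> ` (topspace M - Cut) \<subseteq> N"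
    by (rule deformation) (rule that)
  \<comment> \<open>The indices \<open>j \<le> k\<close> carry the \<open>k + 1\<close> sets pulled
    back from \<open>N\<close>; the shift by \<open>Suc k\<close> appends the \<open>l + 1\<close>
    sets covering \<open>Cut\<close>. Altogether there are \<open>k + l + 2\<close> sets, which is
    the normalized value \<open>k + l + 1\<close>.\<close>
  define W where "W = (\<lambda>j. if j \<le> k then {x \<in> topspace M - Cut. \<rho> x \<in> U j} else V (j - Suc k))"
  have "ls_cat M (topspace M) \<le> enat (k + l + 1)"
  proof (rule ls_cat_le_categorical_cover)
    show "categorical (W j)" if "j \<le> k + l + 1" for j
      using categorical_pullback[OF \<rho>(1) U(2)] V(2)[of "j - Suc k"] that by (simp add: W_def)
    show "topspace M \<subseteq> (\<Union>j\<le>k + l + 1. W j)"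
    proof
      fix x assume x: "x \<in> topspace M"
      show "x \<in> (\<Union>j\<le>k + l + 1. W j)"
      proof (cases "x \<in> Cut")
        case True
        then obtain j where "j \<le> l" "x \<in> V j" using V(1) by blast
        then show ?thesis by (intro UN_I[of "Suc k + j"]) (auto simp: W_def)
      next
        case False
        then have "\<rho> x \<in> N" using \<rho>(2) x by blast
        then obtain j where "j \<le> k" "\<rho> x \<in> U j" using U(1) by blast
        then show ?thesis using x False by (intro UN_I[of j]) (auto simp: W_def)
      qed
    qed
  qed
  then show ?thesis by (simp add: k l one_enat_def)
qed auto

end

text \<open>Chart images lie in \<open>{0}\<close> and charts are injective, so all points are open;
  a connected space of this kind is a single point.\<close>

lemma ls_cat_zero_dimensional:
  assumes mfd: "analytic_manifold M {0} \<A>" and pc: "path_connected_space M" and ne: "topspace M \<noteq> {}"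
  shows "ls_cat M (topspace M) = 0"
proof -
  have single: "openin M {x}" if x: "x \<in> topspace M" for x
  proof -
    obtain U \<phi> where U: "(U, \<phi>) \<in> \<A>" "x \<in> U" using mfd x unfolding analytic_manifold_def by blast
    then have "is_chart M {0} (U, \<phi>)" using mfd unfolding analytic_manifold_def by blast
    then have o: "openin M U" and op: "openin (top_of_set {0}) (\<phi> ` U)" and hom: "homeomorphic_map (subtopology M U) (top_of_set (\<phi> ` U)) \<phi>"
      unfolding is_chart_def by auto
    have sub: "\<phi> ` U \<subseteq> {0}" using openin_imp_subset[OF op] .
    have "inj_on \<phi> (topspace (subtopology M U))" by (rule homeomorphic_imp_injective_map[OF hom])
    then have "inj_on \<phi> U" using openin_subset[OF o] by (simp add: Int_absorb1)
    then have "y = x" if y: "y \<in> U" for y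
    proof (rule inj_onD)
      have "\<phi> x \<in> {0}" "\<phi> y \<in> {0}" using sub U(2) y by blast+
      then show "\<phi> y = \<phi> x" by simp
    qed (use U(2) y in auto)
    then have "U = {x}" using U(2) by blast
    then show ?thesis using o by simp
  qed
  obtain p where p: "p \<in> topspace M" using ne by blast
  have "topspace M = {p}"
  proof (rule ccontr)
    assume n: "topspace M \<noteq> {p}"
    have "openin M (\<Union>x\<in>topspace M - {p}. {x})" using single by blast
    then have "openin M (topspace M - {p})" by simp
    moreover have "topspace M - {p} \<noteq> {}" "topspace M \<subseteq> {p} \<union> (topspace M - {p})" using n p by blast+
    moreover have "connected_space M" using pc by (rule path_connected_imp_connected_space)
    ultimately show False using single[OF p] unfolding connected_space_def by blast
  qed
  have "homotopic_with (\<lambda>_. True) (subtopology M (topspace M)) M (\<lambda>x. x) (\<lambda>_. p)"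
    by (rule homotopic_with_equal) (use \<open>topspace M = {p}\<close> in auto)
  then have "0 \<in> enat ` {k. \<exists>U. (\<Union>j\<le>k. U j) = topspace M \<and>
      (\<forall>j\<le>k. openin (subtopology M (topspace M)) (U j) \<and>
         (\<exists>c\<in>topspace M. homotopic_with (\<lambda>_. True) (subtopology M (U j)) M (\<lambda>x. x) (\<lambda>_. c)))}"
    using p by (intro image_eqI[of _ _ 0] CollectI exI[of _ "\<lambda>_. topspace M"]) (auto simp: zero_enat_def)
  then have "ls_cat M (topspace M) \<le> 0" unfolding ls_cat_def by (rule Inf_lower)
  then show ?thesis by simp
qed

theorem corollary5p9:
  fixes M :: "'a topology" and E :: "'e::euclidean_space set"
    and \<A> :: "('a, 'e) chart set" and g :: "('a, 'e) metric" and N :: "'a set"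
  assumes "analytic_manifold M E \<A>"
    and "analytic_riemannian_metric E \<A> g"
    and "compact_space M" and "path_connected_space M"
    and "analytic_submanifold M E \<A> N"
    and "closedin M N" and "path_connectedin M N" and "N \<noteq> {}"
  shows "ls_cat M (topspace M) \<le> ls_cat M N + ls_cat M (cut_locus M E \<A> g N) + 1"
proof (cases "E = UNIV")
  case True
  interpret distance_to_closed M \<A> g N
    by unfold_locales (use assms True in auto)
  show ?thesis using ls_cat_bound unfolding True .
next
  case False
  then have "E = {0}" using assms(1) unfolding analytic_manifold_def by blast
  moreover have "topspace M \<noteq> {}" using closedin_subset[OF assms(6)] assms(8) by blast
  ultimately have "ls_cat M (topspace M) = 0"
    using ls_cat_zero_dimensional assms(1,4) by blast
  then show ?thesis by simp
qed

end
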